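(* Let $T>0$ and $Q_T=(0,1)\times(0,T]$. Let $\sigma:\mathbb{R}\to\mathbb{R}$ be a $C^1$, nonmonotone function with $\sigma(u)\to\pm\infty$ as $u\to\pm\infty$, such that $W(u)=\int_0^u\sigma(\tau)\,d\tau$ satisfies, for some $p>1$ and constants $c,C>0$, $$c|u|^p-C\le W(u)\le C(|u|^p+1),\qquad |\sigma(u)|\le C(1+|u|^{p-1}).$$ Let $(u^\varepsilon,v^\varepsilon)$, with total stress $S^\varepsilon=\sigma(u^\varepsilon)+v^\varepsilon_x$, be a family of solutions of $$\partial_t u=\partial_x v,\qquad \partial_t v=\partial_x(\sigma(u)+v_x),\qquad 0\le x\le 1,\ t>0,$$ with boundary conditions $S^\varepsilon(0,t)=S^\varepsilon(1,t)=0$ and initial data $u^\varepsilon(x,0)=u^\varepsilon_0(x)$, $v^\varepsilon(x,0)=v_0^\varepsilon(x)$ satisfying, uniformly in $\varepsilon$, $\|u_0^\varepsilon\|_{L^\infty}\le C$ and $\|v_0^\varepsilon\|_{W^{1,\infty}}\le C$. Set $M:=\sqrt{\mathcal E(0)}$, where $\mathcal E(0)=\mathcal E^\varepsilon(0)=\int_0^1\tfrac12(v_0^\varepsilon)^2+W(u_0^\varepsilon)\,dx$ is the initial energy, and $$B(u,M)=\max_{s\in[0,1],\,|A|\le M}\big|\sigma'(u+(1-s)A)\big|\,|A|,$$ and assume $$\lim_{u\to+\infty}\big(\sigma(u)-B(u,M)\big)=+\infty,\qquad \lim_{u\to-\infty}\big(\sigma(u)+B(u,M)\big)=-\infty.$$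 Let $(v,u,S)$ and $F$ be defined as the limits, along a subsequence, $$u^\varepsilon\rightharpoonup u \text{ weak-}\ast\text{ in }L^\infty(Q_T),\quad v^\varepsilon\to v\text{ in }L^2(Q_T),\quad S^\varepsilon\to S\text{ a.e. in }Q_T,\quad \mathbf 1_{u^\varepsilon<\xi}\rightharpoonup F(t,x,\xi)\text{ weak-}\ast\text{ in }L^\infty(Q_T\times\mathbb{R}).$$ Then: (a) $F$ is connected to the Young measure $\nu_{t,x}$ of $\{u^\varepsilon\}$ via $$F(t,x,\xi)=\int_{(-\infty,\xi]}d\nu_{t,x}(\lambda).$$ (b) $(F,v)$ satisfies, for $(x,t)\in Q_T$, $\xi\in\mathbb{R}$, the system $$\begin{cases}\partial_tF+\partial_\xi\Big(\big(v_x+\overline{\sigma(u)}-\sigma(\xi)\big)F\Big)+\sigma'(\xi)F=0,\\ \partial_tv=\partial_{xx}v+\partial_x\big(\overline{\sigma(u)}\big),\\ S=\overline{\sigma(u)}+v_x=\int\sigma(\xi)\,dF_{t,x}(\xi)+v_x,\end{cases}$$ with $S(0,t)=S(1,t)=0$ for $0<t<T$, and initial data $v(0,x)=v_0(x)=\text{s-lim}\,v_0^\varepsilon(x)$, $F(0,x,\xi)=\text{wk-}\ast\lim \mathbf 1_{u_0^\varepsilon(x)<\xi}$. (c) As an alternative, $(F,S)$ can be determined via the system, for $(x,t)\in Q_T$, $\xi\in\mathbb{R}$, $$\begin{cases}\partial_tF+\partial_\xi\Big(\big(S-\sigma(\xi)\big)F\Big)+\sigma'(\xi)F=0,\\ \partial_tS=\partial_{xx}S+\int\sigma'(\xi)\,(S-\sigma(\xi))\,dF_{t,x}(\xi),\end{cases}$$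 with $S(0,t)=S(1,t)=0$ for $0<t<T$, and initial data $S(0,x)=S_0(x)=\text{wk-lim}\big(\sigma(u_0^\varepsilon(x))+\partial_xv_0^\varepsilon\big)$, $F(0,x,\xi)=\text{wk-}\ast\lim\mathbf 1_{u_0^\varepsilon(x)<\xi}$.
   Context: Solutions satisfy the energy bound $\int_0^1\big(\tfrac12(v^\varepsilon)^2+W(u^\varepsilon)\big)(x,t)\,dx+\int_0^t\int_0^1(v_x^\varepsilon)^2\le\mathcal E^\varepsilon(0)\le C$. The Young measure $\nu_{t,x}$ of $\{u^\varepsilon\}$ is the parametrized family of probability measures on $\mathbb{R}$ such that, along the subsequence, $\beta(u^\varepsilon)\rightharpoonup\int\beta(\lambda)\,d\nu_{t,x}(\lambda)$ weak-$\ast$ in $L^\infty(Q_T)$ for every continuous $\beta$. For continuous $f$, $\overline{f(u)}$ denotes the weak-$\ast$ limit of $f(u^\varepsilon)$, and $dF_{t,x}(\xi)$ denotes integration against the Young measure, whose distribution function is the right-continuous representative of $F(t,x,\cdot)$; thus $\overline{f(u)}=\int f(\xi)\,dF_{t,x}(\xi)$. $\mathbf 1_{u^\varepsilon<\xi}$ is the function of $(t,x,\xi)$ equal to 1 if $u^\varepsilon(t,x)<\xi$ and 0 otherwise. The equations for $F$ are understood in the sense of distributions. Here s-lim, wk-lim and wk-$\ast$ lim denote strong, weak and weak-$\ast$ limits as $\varepsilon\to0$ along the subsequence. *)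

theory Defs
  imports "HOL-Probability.Probability"
begin

text \<open>
  Space-time points are pairs \<open>(t, x)\<close>, kinetic points are triples \<open>(t, x, \<xi>)\<close>.
  Elements of Lebesgue and Sobolev spaces are represented by Borel functions; all statements about
  them are up to null sets of the Lebesgue measure \<^const>\<open>lborel\<close>.
\<close>

definition QT :: "real \<Rightarrow> (real \<times> real) set"
  where "QT T = {0<..T} \<times> {0<..<1}"


subsection \<open>Lebesgue spaces and their modes of convergence\<close>

definition Linf_le :: "'a::euclidean_space set \<Rightarrow> real \<Rightarrow> ('a \<Rightarrow> real) \<Rightarrow> bool"
  where "Linf_le Q K f \<longleftrightarrow>
    set_borel_measurable lborel Q f \<and> (AE p in lborel. p \<in> Q \<longrightarrow> \<bar>f p\<bar> \<le> K)"

definition Linf :: "'a::euclidean_space set \<Rightarrow> ('a \<Rightarrow> real) set"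
  where "Linf Q = {f. \<exists>K. Linf_le Q K f}"

definition L2 :: "'a::euclidean_space set \<Rightarrow> ('a \<Rightarrow> real) set"
  where "L2 Q = {f. set_borel_measurable lborel Q f \<and> set_integrable lborel Q (\<lambda>p. (f p)\<^sup>2)}"

definition Linf_weakstar_lim ::
    "'a::euclidean_space set \<Rightarrow> (nat \<Rightarrow> 'a \<Rightarrow> real) \<Rightarrow> ('a \<Rightarrow> real) \<Rightarrow> bool"
  where "Linf_weakstar_lim Q f g \<longleftrightarrow>
    (\<forall>n. f n \<in> Linf Q) \<and> g \<in> Linf Q \<and>
    (\<forall>h. set_integrable lborel Q h \<longrightarrow>
      (\<lambda>n. LINT p:Q|lborel. f n p * h p) \<longlonglongrightarrow> (LINT p:Q|lborel. g p * h p))"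

definition L2_lim ::
    "'a::euclidean_space set \<Rightarrow> (nat \<Rightarrow> 'a \<Rightarrow> real) \<Rightarrow> ('a \<Rightarrow> real) \<Rightarrow> bool"
  where "L2_lim Q f g \<longleftrightarrow>
    (\<forall>n. f n \<in> L2 Q) \<and> g \<in> L2 Q \<and>
    (\<lambda>n. LINT p:Q|lborel. (f n p - g p)\<^sup>2) \<longlonglongrightarrow> 0"

definition L2_weak_lim ::
    "'a::euclidean_space set \<Rightarrow> (nat \<Rightarrow> 'a \<Rightarrow> real) \<Rightarrow> ('a \<Rightarrow> real) \<Rightarrow> bool"
  where "L2_weak_lim Q f g \<longleftrightarrow>
    (\<forall>n. f n \<in> L2 Q) \<and> g \<in> L2 Q \<and>
    (\<forall>h \<in> L2 Q.
      (\<lambda>n. LINT p:Q|lborel. f n p * h p) \<longlonglongrightarrow> (LINT p:Q|lborel. g p * h p))"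


subsection \<open>Spatial derivatives and boundary values\<close>

text \<open>
  Weak derivative of a function of one variable on \<open>(0, 1)\<close>: \<open>f\<close> is almost everywhere equal to an
  absolutely continuous function with derivative \<open>g\<close>, that is, \<open>f \<in> W\<^sup>1\<^sup>,\<^sup>1(0, 1)\<close> and \<open>f' = g\<close>.
\<close>

definition has_ac_deriv :: "(real \<Rightarrow> real) \<Rightarrow> (real \<Rightarrow> real) \<Rightarrow> bool"
  where "has_ac_deriv f g \<longleftrightarrow>
    set_integrable lborel {0<..<1} g \<and>
    (\<exists>c. AE x in lborel. x \<in> {0<..<1} \<longrightarrow> f x = c + (LBINT y=0..x. g y))"

definition has_x_deriv ::
    "real set \<Rightarrow> (real \<times> real \<Rightarrow> real) \<Rightarrow> (real \<times> real \<Rightarrow> real) \<Rightarrow> bool"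
  where "has_x_deriv J f g \<longleftrightarrow>
    (AE t in lborel. t \<in> J \<longrightarrow> has_ac_deriv (\<lambda>x. f (t, x)) (\<lambda>x. g (t, x)))"

text \<open>
  \<open>f(t, 0) = f(t, 1) = 0\<close> for \<open>t \<in> J\<close>. Since \<open>f\<close> is only determined almost everywhere, the boundary
  values are those of a representative that is continuous on \<open>[0, 1]\<close> at each time (traces).
\<close>

definition vanishes_at_ends :: "real set \<Rightarrow> (real \<times> real \<Rightarrow> real) \<Rightarrow> bool"
  where "vanishes_at_ends J f \<longleftrightarrow>
    (\<exists>g. (AE p in lborel. p \<in> J \<times> {0<..<1} \<longrightarrow> f p = g p) \<and>
         (\<forall>t\<in>J. continuous_on {0..1} (\<lambda>x. g (t, x)) \<and> g (t, 0) = 0 \<and> g (t, 1) = 0))"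


subsection \<open>The viscoelastic system\<close>

definition Wpot :: "(real \<Rightarrow> real) \<Rightarrow> real \<Rightarrow> real"
  where "Wpot \<sigma> u = (LBINT \<tau>=0..u. \<sigma> \<tau>)"

definition energy :: "(real \<Rightarrow> real) \<Rightarrow> (real \<Rightarrow> real) \<Rightarrow> (real \<Rightarrow> real) \<Rightarrow> real"
  where "energy \<sigma> u v = (LINT x:{0<..<1}|lborel. (v x)\<^sup>2 / 2 + Wpot \<sigma> (u x))"

text \<open>For \<open>M \<ge> 0\<close> the supremum is a maximum, since \<open>\<sigma>'\<close> is continuous and the index set is compact.\<close>

definition Bmax :: "(real \<Rightarrow> real) \<Rightarrow> real \<Rightarrow> real \<Rightarrow> real"
  where "Bmax \<sigma>' u M = (SUP (s, A) \<in> {0..1} \<times> {A. \<bar>A\<bar> \<le> M}. \<bar>\<sigma>' (u + (1 - s) * A)\<bar> * \<bar>A\<bar>)"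

definition stress ::
    "(real \<Rightarrow> real) \<Rightarrow> (real \<times> real \<Rightarrow> real) \<Rightarrow> (real \<times> real \<Rightarrow> real) \<Rightarrow> real \<times> real \<Rightarrow> real"
  where "stress \<sigma> u vx p = \<sigma> (u p) + vx p"

text \<open>
  Solutions of \<open>u\<^sub>t = v\<^sub>x\<close>, \<open>v\<^sub>t = S\<^sub>x\<close>, \<open>S = \<sigma>(u) + v\<^sub>x\<close> for \<open>t > 0\<close>, \<open>0 < x < 1\<close>, with
  \<open>S(t, 0) = S(t, 1) = 0\<close> and data \<open>u0\<close>, \<open>v0\<close>. For bounded \<open>u0\<close> and Lipschitz \<open>v0\<close> the strain \<open>u\<close> is in
  general discontinuous in \<open>x\<close>, so the derivatives \<open>v\<^sub>x\<close> and \<open>S\<^sub>x\<close> are weak ones, locally square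
  integrable in time. For almost every \<open>x\<close> the functions \<open>u\<close> and \<open>v\<close> are then absolutely continuous
  in \<open>t\<close>, and the two equations with their initial conditions are stated in time-integrated form.
  The argument \<open>vx\<close> is the weak derivative of \<open>v\<close>.
\<close>

definition kv_solution ::
    "(real \<Rightarrow> real) \<Rightarrow> (real \<Rightarrow> real) \<Rightarrow> (real \<Rightarrow> real) \<Rightarrow> (real \<times> real \<Rightarrow> real) \<Rightarrow>
     (real \<times> real \<Rightarrow> real) \<Rightarrow> (real \<times> real \<Rightarrow> real) \<Rightarrow> bool"
  where "kv_solution \<sigma> u0 v0 u v vx \<longleftrightarrow>
    set_borel_measurable lborel ({0<..} \<times> {0<..<1}) u \<and>
    set_borel_measurable lborel ({0<..} \<times> {0<..<1}) v \<and>
    has_x_deriv {0<..} v vx \<and> (\<forall>T>0. vx \<in> L2 (QT T)) \<and>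
    (AE x in lborel. x \<in> {0<..<1} \<longrightarrow>
      (\<forall>t\<ge>0. u (t, x) = u0 x + (LBINT s=0..t. vx (s, x)))) \<and>
    (\<exists>Sx. has_x_deriv {0<..} (stress \<sigma> u vx) Sx \<and> (\<forall>T>0. Sx \<in> L2 (QT T)) \<and>
      (AE x in lborel. x \<in> {0<..<1} \<longrightarrow>
        (\<forall>t\<ge>0. v (t, x) = v0 x + (LBINT s=0..t. Sx (s, x))))) \<and>
    vanishes_at_ends {0<..} (stress \<sigma> u vx)"

definition energy_bound ::
    "(real \<Rightarrow> real) \<Rightarrow> (real \<Rightarrow> real) \<Rightarrow> (real \<Rightarrow> real) \<Rightarrow> (real \<times> real \<Rightarrow> real) \<Rightarrow>
     (real \<times> real \<Rightarrow> real) \<Rightarrow> (real \<times> real \<Rightarrow> real) \<Rightarrow> bool"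
  where "energy_bound \<sigma> u0 v0 u v vx \<longleftrightarrow>
    (\<forall>t>0. set_integrable lborel {0<..<1} (\<lambda>x. (v (t, x))\<^sup>2 / 2 + Wpot \<sigma> (u (t, x))) \<and>
      energy \<sigma> (\<lambda>x. u (t, x)) (\<lambda>x. v (t, x)) + (LINT p:QT t|lborel. (vx p)\<^sup>2)
        \<le> energy \<sigma> u0 v0)"


subsection \<open>Young measures\<close>

definition young_measure ::
    "'a::euclidean_space set \<Rightarrow> (nat \<Rightarrow> 'a \<Rightarrow> real) \<Rightarrow> ('a \<Rightarrow> real measure) \<Rightarrow> bool"
  where "young_measure Q u \<nu> \<longleftrightarrow>
    \<nu> \<in> measurable (restrict_space borel Q) (prob_algebra borel) \<and>
    (\<forall>\<beta>. continuous_on UNIV \<beta> \<longrightarrow>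
      (AE p in lborel. p \<in> Q \<longrightarrow> integrable (\<nu> p) \<beta>) \<and>
      Linf_weakstar_lim Q (\<lambda>n p. \<beta> (u n p)) (\<lambda>p. \<integral>y. \<beta> y \<partial>\<nu> p))"


subsection \<open>Equations in the sense of distributions\<close>

definition dir_deriv :: "'a::euclidean_space \<Rightarrow> ('a \<Rightarrow> real) \<Rightarrow> 'a \<Rightarrow> real"
  where "dir_deriv e \<phi> p = frechet_derivative \<phi> (at p) e"

primrec C_k :: "nat \<Rightarrow> ('a::euclidean_space \<Rightarrow> real) \<Rightarrow> bool"
  where
    "C_k 0 \<phi> = continuous_on UNIV \<phi>"
  | "C_k (Suc k) \<phi> = ((\<forall>p. \<phi> differentiable (at p)) \<and> (\<forall>e. C_k k (dir_deriv e \<phi>)))"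

definition test_functions :: "'a::euclidean_space set \<Rightarrow> ('a \<Rightarrow> real) set"
  where "test_functions U =
    {\<phi>. (\<forall>k. C_k k \<phi>) \<and> compact (closure {p. \<phi> p \<noteq> 0}) \<and> closure {p. \<phi> p \<noteq> 0} \<subseteq> U}"

text \<open>
  Both equations below are tested with functions that need not vanish at \<open>t = 0\<close>, so that they
  include the initial condition.

  \<open>F\<^sub>t + ((a(t, x) - \<sigma>(\<xi>)) F)\<^sub>\<xi> + \<sigma>'(\<xi>) F = 0\<close> and \<open>F(0, x, \<xi>) = F0(x, \<xi>)\<close>:
\<close>

definition kinetic_eq ::
    "real \<Rightarrow> (real \<Rightarrow> real) \<Rightarrow> (real \<Rightarrow> real) \<Rightarrow> (real \<times> real \<Rightarrow> real) \<Rightarrow>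
     (real \<times> real \<times> real \<Rightarrow> real) \<Rightarrow> (real \<times> real \<Rightarrow> real) \<Rightarrow> bool"
  where "kinetic_eq T \<sigma> \<sigma>' a F F0 \<longleftrightarrow>
    (\<forall>\<phi> \<in> test_functions ({..<T} \<times> {0<..<1} \<times> UNIV).
      let Q = {0<..<T} \<times> {0<..<1} \<times> UNIV;
          I = (\<lambda>(t, x, \<xi>).
                F (t, x, \<xi>) * dir_deriv (1, 0, 0) \<phi> (t, x, \<xi>)
                + (a (t, x) - \<sigma> \<xi>) * F (t, x, \<xi>) * dir_deriv (0, 0, 1) \<phi> (t, x, \<xi>)
                - \<sigma>' \<xi> * F (t, x, \<xi>) * \<phi> (t, x, \<xi>))
      in set_integrable lborel Q I \<and>
         (LINT p:Q|lborel. I p)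
         + (LINT q:{0<..<1} \<times> UNIV|lborel. F0 q * \<phi> (0, fst q, snd q)) = 0)"

text \<open>\<open>w\<^sub>t = w\<^sub>x\<^sub>x + a\<^sub>x + b\<close> and \<open>w(0, x) = w0(x)\<close>:\<close>

definition heat_eq ::
    "real \<Rightarrow> (real \<times> real \<Rightarrow> real) \<Rightarrow> (real \<times> real \<Rightarrow> real) \<Rightarrow> (real \<times> real \<Rightarrow> real) \<Rightarrow>
     (real \<Rightarrow> real) \<Rightarrow> bool"
  where "heat_eq T w a b w0 \<longleftrightarrow>
    (\<forall>\<phi> \<in> test_functions ({..<T} \<times> {0<..<1}).
      let Q = {0<..<T} \<times> {0<..<1};
          I = (\<lambda>p. w p * dir_deriv (1, 0) \<phi> p
                + w p * dir_deriv (0, 1) (dir_deriv (0, 1) \<phi>) p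
                - a p * dir_deriv (0, 1) \<phi> p
                + b p * \<phi> p)
      in set_integrable lborel Q I \<and>
         (LINT p:Q|lborel. I p) + (LINT x:{0<..<1}|lborel. w0 x * \<phi> (0, x)) = 0)"

end

theory Submission
  imports Defs
begin

text \<open>
  Testing the weak-\<open>*\<close> convergence of \<open>\<beta>(u\<^sub>n)\<close> with rapidly growing \<open>\<beta>\<close> bounds \<open>u\<^sub>n\<close> uniformly, and the
  energy estimate bounds \<open>\<partial>\<^sub>x v\<^sub>n\<close> in \<open>L\<^sup>2\<close>. Hence \<open>S\<^sub>n\<close> is bounded in \<open>L\<^sup>2\<close> and converges strongly in \<open>L\<^sup>1\<close>, and
  \<open>\<partial>\<^sub>x v\<^sub>n\<close> converges weakly to \<open>S\<close> minus the weak limit of \<open>\<sigma>(u\<^sub>n)\<close>.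

  For almost every \<open>x\<close> the strain solves \<open>\<partial>\<^sub>t u\<^sub>n = S\<^sub>n - \<sigma>(u\<^sub>n)\<close>, so that the chain rule for
  \<open>\<integral>\<^sub>u\<^sup>\<infinity> \<phi>(t, x, \<xi>) d\<xi>\<close> at \<open>u = u\<^sub>n(t, x)\<close> gives the kinetic equation for the indicator of \<open>u\<^sub>n < \<xi>\<close>. It is
  linear in the indicator, and its only product of two converging factors involves \<open>S\<^sub>n\<close>, which
  converges strongly. Likewise \<open>\<partial>\<^sub>t \<sigma>(u\<^sub>n) = \<sigma>'(u\<^sub>n) (S\<^sub>n - \<sigma>(u\<^sub>n))\<close> turns the equation for \<open>v\<^sub>n\<close>, tested with
  \<open>\<partial>\<^sub>x \<phi>\<close>, into the heat equation for \<open>S\<^sub>n\<close>, whose source is linear in \<open>S\<^sub>n\<close>.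

  The initial traces converge because \<open>\<partial>\<^sub>x v\<^sub>n\<close> is small in \<open>L\<^sup>1\<close> over short times, uniformly in \<open>n\<close>. The boundary
  values of \<open>S\<close> come from a bound on \<open>\<integral>\<integral> t (\<partial>\<^sub>x S\<^sub>n)\<^sup>2\<close>, derived with Steklov averages in time: for almost
  every \<open>t\<close> some subsequence of \<open>S\<^sub>n(t, \<cdot>)\<close> is bounded in \<open>H\<^sup>1\<^sub>0\<close>, hence equi-Hoelder.
\<close>

text \<open>All limits must hold along the given sequence, so the initial data may not be treated by
  extracting a further subsequence: their convergence has to come out of that of the evolving
  quantities. For \<open>v0\<close> this is done by testing the equation for \<open>v\<close>, for
  the initial indicators by comparing them with averages over short times, and for the initial
  stress by writing \<sigma>(u0) linearly in the indicator.

  The bound on the \<open>x\<close>-derivative of the stress comes from multiplying the stress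
  equation by \<open>t S\<close>. The weight removes the boundary term at \<open>t = 0\<close>, and
  the contribution of \<sigma>(u) is controlled because \<sigma> is Lipschitz on the bounded range
  of \<open>u\<close>. As the \<open>x\<close>-derivative of \<open>v\<close> need not have a time
  derivative that is a function, the product is formed for averages over \<open>(t, t + h]\<close>,
  with constants independent of \<open>h\<close>.

  Statements for almost every \<open>x\<close> and all \<open>t\<close> (the strain) alternate with
  statements for almost every \<open>t\<close> (the stress in \<open>x\<close>). Extending
  everything by zero to Borel functions on the whole plane lets Fubini pass between the two.\<close>

abbreviation (input) ind :: "'a set \<Rightarrow> 'a \<Rightarrow> real"
  where "ind \<equiv> indicator"

abbreviation (input) L1 :: "('a::euclidean_space \<Rightarrow> real) \<Rightarrow> bool"
  where "L1 \<equiv> integrable lborel"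

abbreviation (input) BM :: "('a::topological_space \<Rightarrow> 'b::topological_space) set"
  where "BM \<equiv> borel_measurable borel"

abbreviation (input) dt :: "(real \<times> real \<Rightarrow> real) \<Rightarrow> real \<times> real \<Rightarrow> real"
  where "dt \<equiv> dir_deriv (1, 0)"

abbreviation (input) dx :: "(real \<times> real \<Rightarrow> real) \<Rightarrow> real \<times> real \<Rightarrow> real"
  where "dx \<equiv> dir_deriv (0, 1)"

lemmas LINT_cong = Bochner_Integration.integral_cong[OF refl]
  and LINT_add = Bochner_Integration.integral_add and LINT_diff = Bochner_Integration.integral_diff
  and LINT_nonneg = Bochner_Integration.integral_nonneg
  and L1_bound = Bochner_Integration.integrable_bound
  and L1_add = Bochner_Integration.integrable_add and L1_diff = Bochner_Integration.integrable_diff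

section \<open>Bounded multipliers, square-integrable functions and convergence by
  approximation\<close>

lemma integrable_mult_bounded:
  fixes f g :: "'a::euclidean_space \<Rightarrow> real"
  assumes "L1 f" "g \<in> BM" "AE x in lborel. \<bar>g x\<bar> \<le> B"
  shows "L1 (\<lambda>x. f x * g x)"
proof (rule L1_bound[where f="\<lambda>x. B * f x"])
  show "AE x in lborel. norm (f x * g x) \<le> norm (B * f x)"
    using assms(3)
  proof eventually_elim
    case (elim x)
    then have "\<bar>f x\<bar> * \<bar>g x\<bar> \<le> \<bar>f x\<bar> * B" by (intro mult_left_mono) auto
    moreover have "0 \<le> B" using elim by simp
    ultimately show ?case by (simp add: abs_mult mult.commute)
  qed
qed (use assms in auto)

lemma integral_mult_bounded:
  fixes f g :: "'a::euclidean_space \<Rightarrow> real"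
  assumes f: "L1 f" and g: "g \<in> BM" "AE x in lborel. \<bar>g x\<bar> \<le> B"
  shows "\<bar>LBINT x. f x * g x\<bar> \<le> B * (LBINT x. \<bar>f x\<bar>)"
proof -
  have "(LBINT x. \<bar>f x * g x\<bar>) \<le> (LBINT x. B * \<bar>f x\<bar>)"
  proof (rule integral_mono_AE)
    show "AE x in lborel. \<bar>f x * g x\<bar> \<le> B * \<bar>f x\<bar>"
      using g(2) by eventually_elim (simp add: abs_mult mult.commute[of B] mult_left_mono)
  qed (use f integrable_mult_bounded[OF f g] in auto)
  also have "\<dots> = B * (LBINT x. \<bar>f x\<bar>)" by simp
  finally show ?thesis by (rule order_trans[OF integral_abs_bound])
qed

lemma integrable_square_add:
  fixes f g :: "'a::euclidean_space \<Rightarrow> real"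
  assumes "f \<in> BM" "g \<in> BM" "L1 (\<lambda>p. (f p)\<^sup>2)" "L1 (\<lambda>p. (g p)\<^sup>2)"
  shows "L1 (\<lambda>p. (f p + g p)\<^sup>2)" and "L1 (\<lambda>p. (f p - g p)\<^sup>2)"
proof -
  have "L1 (\<lambda>p. 2 * (f p)\<^sup>2 + 2 * (g p)\<^sup>2)" using assms(3,4) by simp
  note bound = L1_bound[OF this]
  have "norm ((f p + g p)\<^sup>2) \<le> norm (2 * (f p)\<^sup>2 + 2 * (g p)\<^sup>2)" "norm ((f p - g p)\<^sup>2) \<le> norm (2 * (f p)\<^sup>2 + 2 * (g p)\<^sup>2)" for p
    using sum_squares_bound[of "f p" "g p"] sum_squares_bound[of "f p" "- g p"] by (simp_all add: power2_sum power2_diff)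
  note le = this[THEN AE_I2]
  show "L1 (\<lambda>p. (f p + g p)\<^sup>2)" by (rule bound[OF _ le(1)]) (use assms(1,2) in simp)
  show "L1 (\<lambda>p. (f p - g p)\<^sup>2)" by (rule bound[OF _ le(2)]) (use assms(1,2) in simp)
qed

text \<open>On a set of finite measure, \<open>\<bar>f\<bar> \<le> 1 + f\<^sup>2\<close> takes the
  place of the Cauchy-Schwarz inequality.\<close>

lemma integrable_of_square:
  fixes f :: "'a::euclidean_space \<Rightarrow> real"
  assumes A: "L1 (ind A)" and fm: "f \<in> BM" and z: "\<And>p. p \<notin> A \<Longrightarrow> f p = 0" and f2: "L1 (\<lambda>p. (f p)\<^sup>2)"
  shows "L1 f"
proof (rule L1_bound[where f="\<lambda>p. ind A p + (f p)\<^sup>2"])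
  show "AE p in lborel. norm (f p) \<le> norm (ind A p + (f p)\<^sup>2)"
  proof (rule AE_I2)
    fix p
    have "\<bar>f p\<bar> \<le> 1 + (f p)\<^sup>2" using sum_squares_bound[of 1 "\<bar>f p\<bar>"] by simp
    then show "norm (f p) \<le> norm (ind A p + (f p)\<^sup>2)" using z[of p] by (cases "p \<in> A") auto
  qed
qed (use A f2 fm in auto)

lemma integrable_01: "L1 (\<lambda>x::real. K * ind {0..1} x)"
  by (intro integrable_mult_right integrable_real_indicator) (auto simp: emeasure_lborel_Icc_eq)

lemma integrable_bounded_01:
  fixes f :: "real \<Rightarrow> real"
  assumes "f \<in> BM" "AE x in lborel. \<bar>f x\<bar> \<le> K" "\<And>x. x \<notin> {0<..<1} \<Longrightarrow> f x = 0"
  shows "L1 f" and "(LBINT x. \<bar>f x\<bar>) \<le> K"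
proof -
  have le: "AE x in lborel. \<bar>f x\<bar> \<le> K * ind {0..1} x"
    using assms(2)
  proof eventually_elim
    case (elim x)
    then show ?case using assms(3)[of x] by (cases "x \<in> {0<..<1}") (auto simp: indicator_def)
  qed
  then have "AE x in lborel. norm (f x) \<le> norm (K * ind {0..1} x)" by eventually_elim auto
  then show i: "L1 f" using assms(1) by (intro L1_bound[OF integrable_01]) auto
  have "(LBINT x. \<bar>f x\<bar>) \<le> (LINT x::real|lborel. K * ind {0..1} x)"
    using i le by (intro integral_mono_AE integrable_01) auto
  then show "(LBINT x. \<bar>f x\<bar>) \<le> K" by simp
qed

lemma QT_facts:
  shows QT_iff: "(t, x) \<in> QT T \<longleftrightarrow> 0 < t \<and> t \<le> T \<and> 0 < x \<and> x < 1"
    and QT_sets: "QT T \<in> sets borel" and QT_finite: "emeasure lborel (QT T) < \<infinity>"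
proof -
  show "(t, x) \<in> QT T \<longleftrightarrow> 0 < t \<and> t \<le> T \<and> 0 < x \<and> x < 1" by (auto simp: QT_def)
  have "{0<..T} \<times> {0<..<1::real} \<in> sets (borel \<Otimes>\<^sub>M borel)" by (intro pair_measureI) auto
  then show "QT T \<in> sets borel" by (simp only: QT_def borel_prod)
  have "QT T \<subseteq> cbox (0, 0) (T, 1)" by (auto simp: QT_def)
  then have "emeasure lborel (QT T) \<le> emeasure lborel (cbox (0, 0) (T, 1 :: real))" by (rule emeasure_mono) simp
  also have "emeasure lborel (cbox (0, 0) (T, 1 :: real)) < \<infinity>" using emeasure_lborel_cbox_finite by blast
  finally show "emeasure lborel (QT T) < \<infinity>" .
qed

text \<open>Serves where only averages of a sequence are known to converge: if such averages stay
  within any prescribed error of it, uniformly in the index, the sequence itself is Cauchy.\<close>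

lemma Cauchy_by_approximation:
  fixes X :: "nat \<Rightarrow> real"
  assumes "\<And>e. e > 0 \<Longrightarrow> \<exists>Z. convergent Z \<and> (\<forall>n. \<bar>X n - Z n\<bar> \<le> e)"
  shows "convergent X"
proof (rule Cauchy_convergent, rule CauchyI)
  fix e :: real assume e: "e > 0"
  then obtain Z where Z: "convergent Z" "\<And>n. \<bar>X n - Z n\<bar> \<le> e / 4" using assms[of "e / 4"] by auto
  have "\<exists>N. \<forall>m\<ge>N. \<forall>n\<ge>N. norm (Z m - Z n) < e / 4"
    using CauchyD[OF convergent_Cauchy[OF Z(1)], of "e / 4"] e by simp
  then obtain N where N: "\<And>m n. m \<ge> N \<Longrightarrow> n \<ge> N \<Longrightarrow> \<bar>Z m - Z n\<bar> < e / 4" by auto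
  show "\<exists>M. \<forall>m\<ge>M. \<forall>n\<ge>M. norm (X m - X n) < e"
  proof (intro exI allI impI)
    fix m n assume "m \<ge> N" "n \<ge> N"
    then show "norm (X m - X n) < e" using N[of m n] Z(2)[of m] Z(2)[of n] unfolding real_norm_def by linarith
  qed
qed

lemma tendsto_zero_by_approximation:
  fixes X :: "nat \<Rightarrow> real"
  assumes X: "\<And>n. 0 \<le> X n" and approx: "\<And>e. e > 0 \<Longrightarrow> \<exists>Y. Y \<longlonglongrightarrow> 0 \<and> (\<forall>n. X n \<le> Y n + e)"
  shows "X \<longlonglongrightarrow> 0"
proof (rule LIMSEQ_I)
  fix e :: real assume "e > 0"
  then obtain Y where Y: "Y \<longlonglongrightarrow> 0" "\<And>n. X n \<le> Y n + e / 2" using approx[of "e / 2"] by auto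
  have "eventually (\<lambda>n. Y n < e / 2) sequentially" using order_tendstoD(2)[OF Y(1), of "e / 2"] \<open>e > 0\<close> by simp
  then obtain N where "\<And>n. n \<ge> N \<Longrightarrow> Y n < e / 2" by (auto simp: eventually_sequentially)
  then have "norm (X n - 0) < e" if "n \<ge> N" for n using Y(2)[of n] X[of n] that by fastforce
  then show "\<exists>N. \<forall>n\<ge>N. norm (X n - 0) < e" by blast
qed

subsection \<open>Weak-\<open>*\<close> limits of bounded sequences\<close>

text \<open>Reduces a claim about all integrable test functions to indicators of boxes. Boxes are an
  intersection-stable generator of the Borel sets, and the rule \<open>lim\<close> covers the
  countable unions and monotone limits of the Dynkin argument.\<close>

lemma L1_induct [consumes 1, case_names box scale add lim]:
  fixes f :: "'a::euclidean_space \<Rightarrow> real"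
  assumes f: "L1 f"
    and box: "\<And>a b. P (ind (box a b))"
    and scale: "\<And>f c. L1 f \<Longrightarrow> P f \<Longrightarrow> P (\<lambda>x. c * f x)"
    and add: "\<And>f g. L1 f \<Longrightarrow> P f \<Longrightarrow> L1 g \<Longrightarrow> P g \<Longrightarrow> P (\<lambda>x. f x + g x)"
    and lim: "\<And>f s. (\<And>i. L1 (s i)) \<Longrightarrow> (\<And>i. P (s i)) \<Longrightarrow> L1 f \<Longrightarrow>
        (\<lambda>i::nat. LBINT x. \<bar>s i x - f x\<bar>) \<longlonglongrightarrow> 0 \<Longrightarrow> P f"
  shows "P f"
proof -
  \<comment> \<open>Every limit below is pointwise and dominated, which yields the
    \<open>L^1\<close> convergence that \<open>lim\<close> asks for.\<close>
  have dom: "P g" if s: "\<And>i. L1 (s i)" "\<And>i. P (s i)" and g: "L1 g"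
      and h: "L1 h"
      and c: "\<And>x. (\<lambda>i::nat. s i x) \<longlonglongrightarrow> g x" and b: "\<And>i x. \<bar>s i x\<bar> \<le> h x" for s g and h :: "'a \<Rightarrow> real"
  proof (rule lim[OF s g])
    have "(\<lambda>i. LBINT x. \<bar>s i x - g x\<bar>) \<longlonglongrightarrow> (LBINT x. \<bar>g x - g x\<bar> :: real)"
    proof (rule integral_dominated_convergence[where w="\<lambda>x. h x + \<bar>g x\<bar>"])
      show "L1 (\<lambda>x. h x + \<bar>g x\<bar>)" using g h by auto
      show "AE x in lborel. norm \<bar>s i x - g x\<bar> \<le> h x + \<bar>g x\<bar>" for i
      proof (rule AE_I2)
        fix x show "norm \<bar>s i x - g x\<bar> \<le> h x + \<bar>g x\<bar>" using b[of i x] by simp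
      qed
      show "AE x in lborel. (\<lambda>i. \<bar>s i x - g x\<bar>) \<longlonglongrightarrow> \<bar>g x - g x\<bar>"
        by (intro AE_I2 tendsto_intros c)
    qed (use s g in auto)
    then show "(\<lambda>i. LBINT x. \<bar>s i x - g x\<bar>) \<longlonglongrightarrow> 0" by simp
  qed
  \<comment> \<open>Complements may have infinite measure, so the Dynkin argument runs inside a
    bounded box \<open>B N\<close>; letting \<open>N\<close> grow removes the cut at the
    end.\<close>
  define B where "B N = box (- real N *\<^sub>R One :: 'a) (real N *\<^sub>R One)" for N
  have Bint: "L1 (ind (A \<inter> B N) :: 'a \<Rightarrow> real)" if "A \<in> sets borel" for A N
  proof -
    have "emeasure lborel (A \<inter> B N) \<le> emeasure lborel (B N)"
      by (intro emeasure_mono) (auto simp: B_def)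
    also have "\<dots> < \<infinity>" by (auto simp: B_def emeasure_lborel_box_finite)
    finally show ?thesis using that by (intro integrable_real_indicator) (auto simp: B_def)
  qed
  have bb: "P (ind (box a b \<inter> box c d))" for a b c d
    using box by (simp add: box_Int_box)
  have PB: "P (ind (A \<inter> B N))" if A: "A \<in> sets borel" for A N
  proof -
    have sg: "A \<in> sigma_sets UNIV (range (\<lambda>(a, b). box a b))"
      using A by (simp add: borel_eq_box)
    have st: "Int_stable (range (\<lambda>(a, b). box a b :: 'a set))"
    proof (rule Int_stableI, safe)
      fix a b c d :: 'a
      show "box a b \<inter> box c d \<in> range (\<lambda>(a, b). box a b)"
        unfolding box_Int_box by (auto intro!: image_eqI[where x="(_,_)"])
    qed
    show ?thesis
    proof (induction rule: sigma_sets_induct_disjoint[OF st subset_Pow_Union[THEN subset_trans] sg])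
      case 1
      then show ?case by simp
    next
      case (2 A)
      then show ?case unfolding B_def using bb by auto
    next
      case 3
      show ?case using scale[OF Bint[of "{}" 0] , of 0] bb[of 0 0 0 0] box[of 0 0] by (simp)
    next
      case (4 A)
      then have A: "A \<in> sets borel" by (simp add: borel_eq_box)
      have "P (\<lambda>x. ind (UNIV \<inter> B N) x + (-1) * ind (A \<inter> B N) x)"
        by (intro add scale Bint A 4 integrable_mult_right) (use box B_def in auto)
      also have "(\<lambda>x. ind (UNIV \<inter> B N) x + (-1) * ind (A \<inter> B N) x) = (ind ((UNIV - A) \<inter> B N) :: 'a \<Rightarrow> real)"
        by (auto simp: indicator_def)
      finally show ?case .
    next
      case (5 A)
      then have A: "A i \<in> sets borel" for i by (auto simp add: borel_eq_box)
      have fin: "P (ind ((\<Union>i<n. A i) \<inter> B N))" for n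
      proof (induction n)
        case 0
        have "ind ((\<Union>i<0. A i) \<inter> B N) = (ind (box 0 0) :: 'a \<Rightarrow> real)" by simp
        then show ?case using box by metis
      next
        case (Suc n)
        have "P (\<lambda>x. ind ((\<Union>i<n. A i) \<inter> B N) x + ind (A n \<inter> B N) x)"
          by (intro add Bint Suc 5 A) (use A in auto)
        moreover have "(\<lambda>x. ind ((\<Union>i<n. A i) \<inter> B N) x + ind (A n \<inter> B N) x) =
            (ind ((\<Union>i<Suc n. A i) \<inter> B N) :: 'a \<Rightarrow> real)"
        proof
          fix x
          have "x \<in> A n \<Longrightarrow> x \<notin> A i" if "i < n" for i
            using 5(1) that unfolding disjoint_family_on_def by (metis UNIV_I disjoint_iff less_irrefl)
          then show "ind ((\<Union>i<n. A i) \<inter> B N) x + ind (A n \<inter> B N) x =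
            (ind ((\<Union>i<Suc n. A i) \<inter> B N) x :: real)"
            by (auto simp: indicator_def less_Suc_eq)
        qed
        ultimately show ?case by simp
      qed
      show ?case
      proof (rule dom[where s="\<lambda>n. ind ((\<Union>i<n. A i) \<inter> B N)"])
        show "(\<lambda>n. ind ((\<Union>i<n. A i) \<inter> B N) x) \<longlonglongrightarrow> (ind ((\<Union> (range A)) \<inter> B N) x :: real)" for x
        proof -
          have "(\<lambda>n. ind (\<Union>i<n. A i \<inter> B N) x) \<longlonglongrightarrow> (ind (\<Union>i. A i \<inter> B N) x :: real)"
            by (rule LIMSEQ_indicator_UN)
          then show ?thesis by (simp add: Int_UN_distrib2 Int_commute)
        qed
        show "L1 (ind (UNIV \<inter> B N) :: 'a \<Rightarrow> real)" by (intro Bint) auto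
        show "L1 (ind ((\<Union>i<n. A i) \<inter> B N) :: 'a \<Rightarrow> real)" for n
          by (intro Bint) (use A in auto)
        show "L1 (ind (\<Union> (range A) \<inter> B N) :: 'a \<Rightarrow> real)"
          by (intro Bint) (use A in auto)
        show "\<bar>ind ((\<Union>i<n. A i) \<inter> B N) x :: real\<bar> \<le> ind (UNIV \<inter> B N) x" for n x
          by (auto simp: indicator_def)
      qed (rule fin)
    qed
  qed
  from f show "P f"
  proof (induction rule: integrable_induct)
    case (base A c)
    have "P (ind A)"
    proof (rule dom[where s="\<lambda>N. ind (A \<inter> B N)" and h="ind A"])
      show "(\<lambda>N. ind (A \<inter> B N) x) \<longlonglongrightarrow> (ind A x :: real)" for x
      proof -
        obtain N0 where N0: "x \<in> B N0"
        proof -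
          obtain n where n: "norm x < real n" using reals_Archimedean2 by blast
          have "x \<in> B n" unfolding B_def mem_box
          proof
            fix i :: 'a assume i: "i \<in> Basis"
            have "\<bar>x \<bullet> i\<bar> \<le> norm x" using i by (rule Basis_le_norm)
            then show "- real n *\<^sub>R One \<bullet> i < x \<bullet> i \<and> x \<bullet> i < real n *\<^sub>R One \<bullet> i" using n i by (auto simp add: inner_sum_left_Basis)
          qed
          then show ?thesis using that by blast
        qed
        have "eventually (\<lambda>N. x \<in> B N) sequentially"
          unfolding eventually_sequentially
        proof (intro exI allI impI)
          fix n assume n: "N0 \<le> n"
          show "x \<in> B n" using N0 n unfolding B_def mem_box
            by (force simp: inner_sum_left_Basis)
        qed
        then show ?thesis by (intro tendsto_eventually) (auto elim!: eventually_mono simp: indicator_def)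
      qed
      show "L1 (ind A :: 'a \<Rightarrow> real)"
        using base by (intro integrable_real_indicator) auto
      then show "L1 (ind A :: 'a \<Rightarrow> real)" .
      show "\<bar>ind (A \<inter> B N) x :: real\<bar> \<le> ind A x" for N x
        by (auto simp: indicator_def)
    qed (use base PB Bint in auto)
    then have "P (\<lambda>x. c * ind A x)" using base by (intro scale) (auto intro!: integrable_real_indicator)
    then show ?case by (simp add: mult.commute)
  next
    case (add f g) then show ?case using assms(4) by blast
  next
    case (lim f s)
    show ?case
      by (rule dom[of s f "\<lambda>x. 2 * \<bar>f x\<bar>"]) (use lim in auto)
  qed
qed

text \<open>Convergence on boxes spreads to all integrable functions by density and the common bound
  \<open>K\<close>, for the full sequence. The limit functional \<Lambda> is then bounded on
  \<open>L^1\<close>; that it is integration against a bounded function is obtained from the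
  Radon-Nikodym theorem.\<close>

lemma weakstar_bounded_limit:
  fixes f :: "nat \<Rightarrow> 'a::euclidean_space \<Rightarrow> real"
  assumes m: "\<And>n. f n \<in> BM" and K: "\<And>n. AE x in lborel. \<bar>f n x\<bar> \<le> K"
    and conv: "\<And>a b. convergent (\<lambda>n. LBINT x. f n x * ind (box a b) x)"
  obtains g where "g \<in> BM" "\<And>x. \<bar>g x\<bar> \<le> K"
    "\<And>h. L1 h \<Longrightarrow> (\<lambda>n. LBINT x. f n x * h x) \<longlonglongrightarrow> (LBINT x. g x * h x)"
proof -
  have [measurable]: "f n \<in> BM" for n by (rule m)
  have K0: "K \<ge> 0"
  proof (rule ccontr)
    assume "\<not> K \<ge> 0"
    then have "AE x::'a in lborel. False" using K[of 0] by (auto elim!: eventually_mono)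
    then have "emeasure lborel (UNIV :: 'a set) = 0" by (simp add: AE_iff_null null_sets_def)
    then show False by simp
  qed
  have int: "L1 (\<lambda>x. f n x * h x)" if "L1 h" for n h
    using integrable_mult_bounded[OF that m[of n] K[of n]] by (simp add: mult.commute)
  have bd: "\<bar>LBINT x. f n x * h x\<bar> \<le> K * (LBINT x. \<bar>h x\<bar>)" if "L1 h" for n h
    using integral_mult_bounded[OF that m[of n] K[of n]] by (simp add: mult.commute)
  have close: "\<bar>(LBINT x. f n x * s x) - (LBINT x. f n x * h x)\<bar> \<le> K * (LBINT x. \<bar>s x - h x\<bar>)"
    if s: "L1 s" and h: "L1 h" for n s h
  proof -
    have "(LBINT x. f n x * s x) - (LBINT x. f n x * h x) = (LBINT x. f n x * (s x - h x))"
      using int[OF s] int[OF h] by (simp add: right_diff_distrib)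
    then show ?thesis using bd[of "\<lambda>x. s x - h x" n] s h by simp
  qed
  have convh: "convergent (\<lambda>n. LBINT x. f n x * h x)" if "L1 h" for h
    using that
  proof (induction rule: L1_induct)
    case (box a b) then show ?case by (rule conv)
  next
    case (scale h c)
    then show ?case
      using convergent_mult_const_iff[of c "\<lambda>n. LBINT x. f n x * h x"]
      by (cases "c = 0") (auto simp: mult.left_commute convergent_const)
  next
    case (add f g)
    then show ?case using int by (simp add: distrib_left convergent_add)
  next
    case (lim h s)
    show ?case
    proof (rule Cauchy_by_approximation)
      fix e :: real assume e: "e > 0"
      have "(\<lambda>i. K * (LBINT x. \<bar>s i x - h x\<bar>)) \<longlonglongrightarrow> K * 0" by (intro tendsto_intros lim.hyps)
      then have "eventually (\<lambda>i. K * (LBINT x. \<bar>s i x - h x\<bar>) < e) sequentially"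
        using e by (intro order_tendstoD(2)) auto
      then obtain i where i: "K * (LBINT x. \<bar>s i x - h x\<bar>) < e" by (auto simp: eventually_sequentially)
      have "\<bar>(LBINT x. f n x * h x) - (LBINT x. f n x * s i x)\<bar> \<le> e" for n
        using close[OF lim.hyps(1)[of i] lim.hyps(2), of n] i by linarith
      with lim.IH[of i] show "\<exists>Z. convergent Z \<and> (\<forall>n. \<bar>(LBINT x. f n x * h x) - Z n\<bar> \<le> e)" by blast
    qed
  qed
  define \<Lambda> where "\<Lambda> h = lim (\<lambda>n. LBINT x. f n x * h x)" for h
  have \<Lambda>: "(\<lambda>n. LBINT x. f n x * h x) \<longlonglongrightarrow> \<Lambda> h" if "L1 h" for h
    using convh[OF that] unfolding \<Lambda>_def by (simp add: convergent_LIMSEQ_iff)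
  have \<Lambda>bd: "\<bar>\<Lambda> h\<bar> \<le> K * (LBINT x. \<bar>h x\<bar>)" if h: "L1 h" for h
    by (rule LIMSEQ_le_const2[OF tendsto_rabs[OF \<Lambda>[OF h]]]) (use bd[OF h] in auto)
  have \<Lambda>add: "\<Lambda> (\<lambda>x. h x + k x) = \<Lambda> h + \<Lambda> k" if h: "L1 h" and k: "L1 k" for h k
  proof (rule LIMSEQ_unique[OF \<Lambda>])
    show "(\<lambda>n. LBINT x. f n x * (h x + k x)) \<longlonglongrightarrow> \<Lambda> h + \<Lambda> k"
      using tendsto_add[OF \<Lambda>[OF h] \<Lambda>[OF k]] int[OF h] int[OF k] by (simp add: distrib_left)
  qed (use h k in auto)
  have \<Lambda>scale: "\<Lambda> (\<lambda>x. c * h x) = c * \<Lambda> h" if h: "L1 h" for h c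
  proof (rule LIMSEQ_unique[OF \<Lambda>])
    show "(\<lambda>n. LBINT x. f n x * (c * h x)) \<longlonglongrightarrow> c * \<Lambda> h"
      using tendsto_mult_left[OF \<Lambda>[OF h], of c] by (simp add: mult.left_commute)
  qed (use h in auto)
  have \<Lambda>close: "\<bar>\<Lambda> s - \<Lambda> h\<bar> \<le> K * (LBINT x. \<bar>s x - h x\<bar>)" if s: "L1 s" and h: "L1 h" for s h
    using \<Lambda>add[OF s, of "\<lambda>x. -1 * h x"] \<Lambda>scale[OF h, of "-1"] \<Lambda>bd[of "\<lambda>x. s x + -1 * h x"] s h by simp
  \<comment> \<open>A positive integrable weight turns Lebesgue measure into a finite measure
    \<open>M\<close>, so that \<Lambda> can be evaluated on every Borel set \<open>A\<close> through
    \<open>\<rho> x * ind A x\<close>.\<close>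
  obtain \<rho> :: "'a \<Rightarrow> real" where \<rho>m[measurable]: "\<rho> \<in> borel_measurable lborel" and \<rho>0: "\<And>x. \<rho> x > 0" and \<rho>i: "L1 \<rho>"
    using sigma_finite_measure.obtain_positive_integrable_function[OF sigma_finite_lborel] by metis
  define M where "M = density lborel (\<lambda>x. ennreal (\<rho> x))"
  have [simp]: "sets M = sets borel" "space M = UNIV" by (simp_all add: M_def)
  have iM: "integrable M k \<longleftrightarrow> L1 (\<lambda>x. \<rho> x * k x)" and IM: "(\<integral>x. k x \<partial>M) = (LBINT x. \<rho> x * k x)"
    if "k \<in> BM" for k :: "'a \<Rightarrow> real"
    using that \<rho>0 by (simp_all add: M_def integrable_density integral_density less_imp_le)
  interpret M: finite_measure M
  proof
    have "emeasure M UNIV = (\<integral>\<^sup>+x. ennreal (\<rho> x) \<partial>lborel)" by (simp add: M_def emeasure_density)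
    also have "\<dots> < \<infinity>" using \<rho>i \<rho>0 by (subst nn_integral_eq_integral) (auto simp: less_imp_le)
    finally show "emeasure M (space M) \<noteq> \<infinity>" by simp
  qed
  have \<rho>A: "L1 (\<lambda>x. \<rho> x * ind A x)" "(LBINT x. \<rho> x * ind A x) = measure M A" if "A \<in> sets borel" for A
    using iM[of "ind A"] IM[of "ind A"] that by (simp_all add: integrable_real_indicator M.emeasure_finite less_top[symmetric])
  \<comment> \<open>The set function given by \<Lambda> is signed. As it is bounded by
    \<open>K\<close> times \<open>M\<close>, adding \<open>K * measure M A\<close> makes it
    nonnegative, at the price of the upper bound \<open>2 * K * measure M A\<close>.\<close>
  define m where "m A = \<Lambda> (\<lambda>x. \<rho> x * ind A x) + K * measure M A" for A
  have mb: "0 \<le> m A" "m A \<le> 2 * K * measure M A" if A: "A \<in> sets borel" for A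
  proof -
    have "\<bar>\<rho> x * ind A x\<bar> = \<rho> x * ind A x" for x using \<rho>0[of x] by (simp add: abs_mult)
    with \<Lambda>bd[OF \<rho>A(1)[OF A]] \<rho>A(2)[OF A] show "0 \<le> m A" "m A \<le> 2 * K * measure M A"
      unfolding m_def by auto
  qed
  have madd: "m (A \<union> B) = m A + m B" if "A \<in> sets borel" "B \<in> sets borel" "A \<inter> B = {}" for A B
  proof -
    have "(\<lambda>x. \<rho> x * ind (A \<union> B) x) = (\<lambda>x. \<rho> x * ind A x + \<rho> x * ind B x)"
      using that by (auto simp: indicator_def fun_eq_iff)
    then show ?thesis
      unfolding m_def using that \<rho>A(1) M.finite_measure_Union[of A B] by (simp add: \<Lambda>add algebra_simps)
  qed
  define N where "N = measure_of UNIV (sets borel) (\<lambda>A::'a set. ennreal (m A))"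
  \<comment> \<open>Finite additivity is linearity of \<Lambda>; the bound by a multiple of
    \<open>M\<close> gives continuity at the empty set, and the two together give countable
    additivity.\<close>
  have ca: "countably_additive (sets borel) (\<lambda>A::'a set. ennreal (m A))"
  proof (rule sets.empty_continuous_imp_countably_additive)
    show "positive (sets borel) (\<lambda>A. ennreal (m A))"
      using mb[of "{}"] by (auto simp: positive_def)
    show "additive (sets borel) (\<lambda>A. ennreal (m A))"
      using madd mb by (auto simp: additive_def ennreal_plus)
    fix A :: "nat \<Rightarrow> 'a set" assume A: "range A \<subseteq> sets borel" "decseq A" "(\<Inter>i. A i) = {}"
    have "(\<lambda>i. 2 * K * measure M (A i)) \<longlonglongrightarrow> 0"
      using tendsto_mult_left[OF M.finite_Lim_measure_decseq[of A], of "2 * K"] A by simp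
    note sandwich = tendsto_sandwich[OF _ _ tendsto_const this]
    have "(\<lambda>i. m (A i)) \<longlonglongrightarrow> 0"
      by (rule sandwich) (use mb A(1) in \<open>auto intro!: always_eventually\<close>)
    then show "(\<lambda>i. ennreal (m (A i))) \<longlonglongrightarrow> 0" using tendsto_ennrealI[of _ 0] by simp
  qed auto
  have setsN[simp]: "sets N = sets borel" unfolding N_def using sets.sets_measure_of_eq[of borel] by simp
  have emN: "emeasure N A = ennreal (m A)" if "A \<in> sets borel" for A
    unfolding N_def
    by (rule emeasure_measure_of_sigma)
       (use that ca mb[of "{}"] sets.sigma_algebra_axioms[of "borel :: 'a measure"] in \<open>simp_all add: positive_def\<close>)
  have ac: "absolutely_continuous M N"
    unfolding absolutely_continuous_def
  proof
    fix A :: "'a set" assume A: "A \<in> null_sets M"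
    then have "A \<in> sets borel" "measure M A = 0" using null_setsD2[OF A] by (auto simp: measure_eq_0_null_sets)
    then show "A \<in> null_sets N" using mb[of A] by (auto simp: null_sets_def emN)
  qed
  obtain \<phi> where \<phi>[measurable]: "\<phi> \<in> borel_measurable M" and dN: "density M \<phi> = N"
    using M.Radon_Nikodym[OF ac] by auto
  have nnA: "(\<integral>\<^sup>+x. \<phi> x * indicator A x \<partial>M) = ennreal (m A)" if "A \<in> sets borel" for A
    using emN[OF that] that unfolding dN[symmetric] by (simp add: emeasure_density)
  have "AE x in M. \<phi> x \<noteq> \<infinity>"
    by (rule nn_integral_PInf_AE) (use nnA[of UNIV] in auto)
  then have \<phi>e: "AE x in M. \<phi> x = ennreal (enn2real (\<phi> x))"
    by eventually_elim (simp add: less_top)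
  define G where "G x = enn2real (\<phi> x)" for x
  have G0: "0 \<le> G x" for x by (simp add: G_def)
  have "G \<in> borel_measurable M" unfolding G_def by measurable
  then have [measurable]: "G \<in> BM" by (simp add: M_def)
  have hG: "has_bochner_integral M (\<lambda>x. ind A x * G x) (m A)" if A: "A \<in> sets borel" for A
  proof (rule has_bochner_integral_nn_integral)
    show "(\<integral>\<^sup>+x. ennreal (ind A x * G x) \<partial>M) = ennreal (m A)"
      unfolding nnA[OF A, symmetric]
      by (rule nn_integral_cong_AE) (use \<phi>e in \<open>eventually_elim, simp add: G_def indicator_def\<close>)
    show "(\<lambda>x. ind A x * G x) \<in> borel_measurable M" using A by (simp add: M_def)
  qed (use A mb[OF A] G0 in auto)
  have Gi: "integrable M G" using hG[of UNIV] by (auto simp: has_bochner_integral_iff)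
  have Ai: "integrable M (\<lambda>x. c * ind A x)" "(\<integral>x. c * ind A x \<partial>M) = c * measure M A" if "A \<in> sets borel" for A c
    using that by (auto simp: M.emeasure_finite less_top[symmetric])
  have GK: "AE x in M. 0 \<le> 2 * K - G x"
  proof (rule M.density_nonneg)
    fix A assume "A \<in> sets M"
    then have A: "A \<in> sets borel" by simp
    have "(\<integral>x\<in>A. 2 * K - G x \<partial>M) = (\<integral>x. 2 * K * ind A x - ind A x * G x \<partial>M)"
      unfolding set_lebesgue_integral_def by (intro LINT_cong) (simp add: algebra_simps)
    also have "\<dots> = 2 * K * measure M A - m A"
      using hG[OF A] Ai[OF A] by (subst LINT_diff) (simp_all add: has_bochner_integral_iff)
    finally show "0 \<le> (\<integral>x\<in>A. 2 * K - G x \<partial>M)" using mb[OF A] by simp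
  qed (use Gi in auto)
  \<comment> \<open>Undoing the shift: \<open>G - K\<close> lies in \<open>[-K, K]\<close> almost
    everywhere, and the truncation makes the bound hold everywhere.\<close>
  define g where "g x = max (- K) (min K (G x - K))" for x
  have gm [measurable]: "g \<in> BM" unfolding g_def by measurable
  have gK: "\<bar>g x\<bar> \<le> K" for x unfolding g_def using K0 by auto
  have gG: "AE x in M. g x = G x - K"
    using GK
  proof eventually_elim
    case (elim x)
    then show ?case using G0[of x] by (auto simp: g_def min_def max_def)
  qed
  have gint: "L1 (\<lambda>x. g x * h x)" if "L1 h" for h
    using integrable_mult_bounded[OF that, of g K] gK by (simp add: mult.commute)
  \<comment> \<open>Every integrable \<open>h\<close> is \<rho> times the
    \<open>M\<close>-integrable function \<open>h / \<rho>\<close>, so the representation is proved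
    in this form, by induction over \<open>M\<close>-integrable \<open>k\<close>.\<close>
  have main: "\<Lambda> (\<lambda>x. \<rho> x * k x) = (LBINT x. g x * (\<rho> x * k x))" if "integrable M k" for k
    using that
  proof (induction rule: integrable_induct)
    case (base A c)
    then have A: "A \<in> sets borel" by simp
    have "(LBINT x. g x * (\<rho> x * (ind A x * c))) = (\<integral>x. g x * (ind A x * c) \<partial>M)"
      using A by (subst IM) (simp_all add: mult.left_commute)
    also have "\<dots> = (\<integral>x. c * (ind A x * G x - K * ind A x) \<partial>M)"
    proof (rule integral_cong_AE)
      show "AE x in M. g x * (ind A x * c) = c * (ind A x * G x - K * ind A x)"
        using gG
      proof eventually_elim
        case (elim x)
        show ?case unfolding elim by (simp add: algebra_simps)
      qed
    qed (use A in \<open>simp_all add: M_def\<close>)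
    also have "\<dots> = c * (m A - K * measure M A)"
      using hG[OF A] Ai[OF A] by (simp add: has_bochner_integral_iff)
    also have "\<dots> = \<Lambda> (\<lambda>x. c * (\<rho> x * ind A x))" using \<Lambda>scale[OF \<rho>A(1)[OF A]] by (simp add: m_def)
    finally show ?case by (simp add: mult_ac)
  next
    case (add k l)
    then have "L1 (\<lambda>x. \<rho> x * k x)" "L1 (\<lambda>x. \<rho> x * l x)"
      using iM[of k] iM[of l] borel_measurable_integrable[OF add.hyps(1)] borel_measurable_integrable[OF add.hyps(2)] by (simp_all add: M_def)
    then show ?case using add gint by (simp add: distrib_left \<Lambda>add)
  next
    case (lim k s)
    have km: "k \<in> BM" "s i \<in> BM" for i
      using borel_measurable_integrable[OF lim.hyps(4)] borel_measurable_integrable[OF lim.hyps(1)[of i]] by (simp_all add: M_def)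
    then have k: "L1 (\<lambda>x. \<rho> x * k x)" and s: "L1 (\<lambda>x. \<rho> x * s i x)" for i
      using lim.hyps(1)[of i] lim.hyps(4) iM[of k] iM[of "s i"] by simp_all
    have L: "(\<lambda>i. LBINT x. \<bar>\<rho> x * s i x - \<rho> x * k x\<bar>) \<longlonglongrightarrow> (LBINT x. \<bar>\<rho> x * k x - \<rho> x * k x\<bar>)"
    proof (rule integral_dominated_convergence[where w="\<lambda>x. 3 * \<bar>\<rho> x * k x\<bar>"])
      show "AE x in lborel. (\<lambda>i. \<bar>\<rho> x * s i x - \<rho> x * k x\<bar>) \<longlonglongrightarrow> \<bar>\<rho> x * k x - \<rho> x * k x\<bar>"
        using lim.hyps(2) by (intro AE_I2 tendsto_intros) auto
      show "AE x in lborel. norm \<bar>\<rho> x * s i x - \<rho> x * k x\<bar> \<le> 3 * \<bar>\<rho> x * k x\<bar>" for i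
      proof (rule AE_I2)
        fix x
        have "\<bar>s i x - k x\<bar> \<le> 3 * \<bar>k x\<bar>" using lim.hyps(3)[of x i] by auto
        then have "\<rho> x * \<bar>s i x - k x\<bar> \<le> \<rho> x * (3 * \<bar>k x\<bar>)" using \<rho>0[of x] by (intro mult_left_mono) auto
        then show "norm \<bar>\<rho> x * s i x - \<rho> x * k x\<bar> \<le> 3 * \<bar>\<rho> x * k x\<bar>"
          using \<rho>0[of x] by (simp add: abs_mult right_diff_distrib[symmetric])
      qed
    qed (use k s in auto)
    then have L0: "(\<lambda>i. K * (LBINT x. \<bar>\<rho> x * s i x - \<rho> x * k x\<bar>)) \<longlonglongrightarrow> 0"
      using tendsto_mult_left[of _ 0 sequentially K] by simp
    have close0: "(\<lambda>i. \<Phi> i - \<Phi>0) \<longlonglongrightarrow> 0"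
      if "\<And>i. \<bar>\<Phi> i - \<Phi>0\<bar> \<le> K * (LBINT x. \<bar>\<rho> x * s i x - \<rho> x * k x\<bar>)" for \<Phi> and \<Phi>0 :: real
      by (rule tendsto_rabs_zero_cancel, rule tendsto_sandwich[OF _ _ tendsto_const L0]) (use that in auto)
    have a: "(\<lambda>i. \<Lambda> (\<lambda>x. \<rho> x * s i x)) \<longlonglongrightarrow> \<Lambda> (\<lambda>x. \<rho> x * k x)"
      by (rule LIM_zero_cancel, rule close0) (rule \<Lambda>close[OF s k])
    have b: "(\<lambda>i. LBINT x. g x * (\<rho> x * s i x)) \<longlonglongrightarrow> (LBINT x. g x * (\<rho> x * k x))"
    proof (rule LIM_zero_cancel, rule close0)
      fix i
      have "L1 (\<lambda>x. \<rho> x * s i x - \<rho> x * k x)" using s k by auto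
      from integral_mult_bounded[OF this gm AE_I2[OF gK]]
      show "\<bar>(LBINT x. g x * (\<rho> x * s i x)) - (LBINT x. g x * (\<rho> x * k x))\<bar> \<le> K * (LBINT x. \<bar>\<rho> x * s i x - \<rho> x * k x\<bar>)"
        using gint[OF s] gint[OF k] by (simp add: right_diff_distrib mult.commute[of _ "g _"])
    qed
    show ?case using LIMSEQ_unique[OF a] b lim.IH by simp
  qed
  show ?thesis
  proof (rule that[of g])
    fix h :: "'a \<Rightarrow> real" assume h: "L1 h"
    have e: "\<rho> x * (h x / \<rho> x) = h x" for x using less_imp_neq[OF \<rho>0[of x]] by simp
    have "(\<lambda>x. h x / \<rho> x) \<in> BM" using borel_measurable_integrable[OF h] \<rho>m by simp
    from iM[OF this] have "integrable M (\<lambda>x. h x / \<rho> x)" using h by (simp only: e)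
    from main[OF this] have "\<Lambda> h = (LBINT x. g x * h x)" by (simp only: e)
    with \<Lambda>[OF h] show "(\<lambda>n. LBINT x. f n x * h x) \<longlonglongrightarrow> (LBINT x. g x * h x)" by simp
  qed (use gm gK in auto)
qed

subsection \<open>Primitives of integrable functions\<close>

text \<open>The integral runs over the whole line with an indicator, which suits Fubini. For
  negative \<open>t\<close> the interval is empty, so the primitive is 0 there and is continuous on
  all of the line.\<close>

definition prim :: "(real \<Rightarrow> real) \<Rightarrow> real \<Rightarrow> real"
  where "prim g t = (LBINT s. ind {0..t} s * g s)"

lemma integrable_ind_mult:
  fixes g :: "'a::euclidean_space \<Rightarrow> real"
  assumes "L1 g" "A \<in> sets borel"
  shows "L1 (\<lambda>s. ind A s * g s)"
  using integrable_mult_indicator[of A lborel g] assms by simp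

lemma prim_0 [simp]: "prim g 0 = 0"
proof -
  have "AE s in lborel. ind {0..0::real} s * g s = 0"
    using AE_lborel_singleton[of 0] by eventually_elim auto
  then show ?thesis unfolding prim_def by (rule integral_eq_zero_AE)
qed

lemma prim_diff:
  assumes g: "L1 g" and "0 \<le> s" "s \<le> t"
  shows "prim g t - prim g s = (LBINT r. ind {s<..t} r * g r)"
proof -
  have "prim g t - prim g s = (LBINT r. ind {0..t} r * g r - ind {0..s} r * g r)"
    unfolding prim_def using g by (subst LINT_diff) (auto intro!: integrable_ind_mult)
  also have "\<dots> = (LBINT r. ind {s<..t} r * g r)"
    using assms by (intro Bochner_Integration.integral_cong) (auto simp: indicator_def)
  finally show ?thesis .
qed

lemma prim_mono:
  assumes g: "L1 g" and "0 \<le> s" "s \<le> t" "\<And>r. 0 \<le> g r"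
  shows "prim g s \<le> prim g t"
proof -
  have "0 \<le> prim g t - prim g s" unfolding prim_diff[OF assms(1-3)]
    by (intro LINT_nonneg) (use assms in auto)
  then show ?thesis by simp
qed

lemma prim_diff_bound:
  assumes g: "L1 g" and "0 \<le> s" "s \<le> t"
  shows "\<bar>prim g t - prim g s\<bar> \<le> prim (\<lambda>r. \<bar>g r\<bar>) t - prim (\<lambda>r. \<bar>g r\<bar>) s"
proof -
  have "\<bar>prim g t - prim g s\<bar> \<le> (LBINT r. \<bar>ind {s<..t} r * g r\<bar>)"
    unfolding prim_diff[OF assms] by (rule integral_abs_bound)
  also have "\<dots> = (LBINT r. ind {s<..t} r * \<bar>g r\<bar>)"
    by (intro Bochner_Integration.integral_cong) (auto simp: abs_mult)
  also have "\<dots> = prim (\<lambda>r. \<bar>g r\<bar>) t - prim (\<lambda>r. \<bar>g r\<bar>) s"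
    using assms by (subst prim_diff) auto
  finally show ?thesis .
qed

lemma isCont_prim:
  assumes g: "L1 g"
  shows "isCont (prim g) t"
  unfolding continuous_at_sequentially comp_def
proof (intro allI impI)
  fix X assume X: "X \<longlonglongrightarrow> t"
  show "(\<lambda>n. prim g (X n)) \<longlonglongrightarrow> prim g t"
    unfolding prim_def
  proof (rule integral_dominated_convergence[where w="\<lambda>s. \<bar>g s\<bar>"])
    show "AE s in lborel. (\<lambda>n. ind {0..X n} s * g s) \<longlonglongrightarrow> ind {0..t} s * g s"
      using AE_lborel_singleton[of t]
    proof eventually_elim
      case (elim s)
      have "eventually (\<lambda>n. ind {0..X n} s = (ind {0..t} s :: real)) sequentially"
      proof (cases "s < t")
        case True
        from order_tendstoD(1)[OF X this] show ?thesis
          by eventually_elim (use True in \<open>auto simp: indicator_def\<close>)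
      next
        case False
        then have "t < s" using elim by auto
        from order_tendstoD(2)[OF X this] show ?thesis
          by eventually_elim (use False elim in \<open>auto simp: indicator_def\<close>)
      qed
      then show ?case by (intro tendsto_mult_right tendsto_eventually)
    qed
    show "AE s in lborel. norm (ind {0..X n} s * g s) \<le> \<bar>g s\<bar>" for n
      by (auto simp: indicator_def)
  qed (use g in auto)
qed

lemma continuous_on_prim:
  assumes "L1 g"
  shows "continuous_on S (prim g)"
  using isCont_prim[OF assms] by (auto intro: continuous_at_imp_continuous_on)

lemma prim_minus:
  assumes "L1 f" "L1 g"
  shows "prim (\<lambda>s. f s - g s) t = prim f t - prim g t"
  unfolding prim_def using assms by (simp add: right_diff_distrib integrable_ind_mult)

lemma prim_cmult: "prim (\<lambda>s. c * f s) t = c * prim f t"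
  unfolding prim_def by (simp add: mult.left_commute)

lemma prim_abs_bound:
  assumes g: "L1 g"
  shows "\<bar>prim g t\<bar> \<le> (LBINT s. \<bar>g s\<bar>)"
proof -
  have "\<bar>prim g t\<bar> \<le> (LBINT s. \<bar>ind {0..t} s * g s\<bar>)"
    unfolding prim_def by (rule integral_abs_bound)
  also have "\<dots> \<le> (LBINT s. \<bar>g s\<bar>)"
  proof (intro integral_mono integrable_abs integrable_ind_mult g)
    show "\<bar>ind {0..t} s * g s\<bar> \<le> \<bar>g s\<bar>" for s by (simp add: indicator_def)
  qed simp
  finally show ?thesis .
qed

lemma integrable_pair_mult:
  fixes f g :: "real \<Rightarrow> real"
  assumes f: "L1 f" and g: "L1 g"
  shows "integrable (lborel \<Otimes>\<^sub>M lborel) (\<lambda>(x, y). f x * g y)"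
proof (rule lborel_pair.Fubini_integrable)
  show "(\<lambda>(x, y). f x * g y) \<in> borel_measurable (lborel \<Otimes>\<^sub>M lborel)"
    using f g by measurable
  show "L1 (\<lambda>x. LBINT y. norm (case (x, y) of (x, y) \<Rightarrow> f x * g y))"
    using f by (simp add: abs_mult)
  show "AE x in lborel. L1 (\<lambda>y. case (x, y) of (x, y) \<Rightarrow> f x * g y)"
    using g by simp
qed

lemma integrable_prim_mult:
  assumes h: "L1 h" and k: "L1 k"
  shows "L1 (\<lambda>y. ind {0..a} y * (prim h y * k y))"
proof -
  have "prim h \<in> BM" by (intro borel_measurable_continuous_onI continuous_on_prim h)
  from integrable_mult_bounded[OF k this AE_I2[OF prim_abs_bound[OF h]]]
  show ?thesis by (intro integrable_ind_mult) (simp_all add: mult.commute)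
qed

text \<open>The product rule for absolutely continuous functions, read off from Fubini: the square
  \<open>[0, a] x [0, a]\<close> is cut along the diagonal, and each triangle contributes one of the
  two terms.\<close>

lemma prim_mult_prim:
  assumes f: "L1 f" and g: "L1 g"
  shows "prim f a * prim g a = (LBINT y. ind {0..a} y * (prim f y * g y + f y * prim g y))"
proof -
  let ?i = "ind {0..a} :: real \<Rightarrow> real"
  have fi: "L1 (\<lambda>x. ?i x * f x)" and gi: "L1 (\<lambda>x. ?i x * g x)"
    using f g by (auto intro: integrable_ind_mult)
  define H where "H = (\<lambda>(x, y). (?i x * f x) * (?i y * g y))"
  have H: "integrable (lborel \<Otimes>\<^sub>M lborel) H"
    unfolding H_def by (rule integrable_pair_mult[OF fi gi])
  have S: "{p :: real \<times> real. fst p \<le> snd p} \<in> sets (lborel \<Otimes>\<^sub>M lborel)"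
    by (simp only: lborel_prod sets_lborel) (intro borel_closed closed_Collect_le continuous_intros)
  have H1: "integrable (lborel \<Otimes>\<^sub>M lborel) (\<lambda>(x, y). ind {p. fst p \<le> snd p} (x, y) * H (x, y))"
    using integrable_mult_indicator[OF S H] by (simp add: case_prod_beta')
  have H2: "integrable (lborel \<Otimes>\<^sub>M lborel) (\<lambda>(x, y). H (x, y) - ind {p. fst p \<le> snd p} (x, y) * H (x, y))"
    using L1_diff[OF H H1] by (simp add: case_prod_beta')
  have "prim f a * prim g a = integral\<^sup>L (lborel \<Otimes>\<^sub>M lborel) H"
    using H unfolding H_def by (subst lborel_pair.integral_fst[symmetric]) (auto simp: prim_def)
  also have "\<dots> = (LINT (x, y)|(lborel \<Otimes>\<^sub>M lborel). ind {p. fst p \<le> snd p} (x, y) * H (x, y))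
      + (LINT (x, y)|(lborel \<Otimes>\<^sub>M lborel). H (x, y) - ind {p. fst p \<le> snd p} (x, y) * H (x, y))"
    using H1 H2 by (subst LINT_add[symmetric]) (auto simp: case_prod_beta')
  also have "(LINT (x, y)|(lborel \<Otimes>\<^sub>M lborel). ind {p. fst p \<le> snd p} (x, y) * H (x, y))
      = (LBINT y. ?i y * (prim f y * g y))"
    using H1
  proof (subst lborel_pair.integral_snd[symmetric], assumption, intro LINT_cong)
    fix y :: real
    have "(LBINT x. ind {p. fst p \<le> snd p} (x, y) * H (x, y)) = (LBINT x. (?i y * g y) * (ind {0..y} x * f x))"
      unfolding H_def by (intro LINT_cong) (auto simp: indicator_def)
    then show "(LBINT x. ind {p. fst p \<le> snd p} (x, y) * H (x, y)) = ?i y * (prim f y * g y)"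
      by (simp add: prim_def)
  qed
  also have "(LINT (x, y)|(lborel \<Otimes>\<^sub>M lborel). H (x, y) - ind {p. fst p \<le> snd p} (x, y) * H (x, y))
      = (LBINT x. ?i x * (f x * prim g x))"
    using H2
  proof (subst lborel_pair.integral_fst[symmetric], assumption, intro LINT_cong)
    fix x :: real
    have "(LBINT y. H (x, y) - ind {p. fst p \<le> snd p} (x, y) * H (x, y)) = (LBINT y. (?i x * f x) * (ind {0..x} y * g y))"
    proof (rule integral_cong_AE)
      show "AE y in lborel. H (x, y) - ind {p. fst p \<le> snd p} (x, y) * H (x, y) = (?i x * f x) * (ind {0..x} y * g y)"
        using AE_lborel_singleton[of x] unfolding H_def by eventually_elim (auto simp: indicator_def)
      have [measurable]: "H \<in> borel_measurable (lborel \<Otimes>\<^sub>M lborel)" using H by auto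
      show "(\<lambda>y. H (x, y) - ind {p. fst p \<le> snd p} (x, y) * H (x, y)) \<in> borel_measurable lborel"
        unfolding H_def using g by (auto simp: indicator_def)
    qed (use g in auto)
    then show "(LBINT y. H (x, y) - ind {p. fst p \<le> snd p} (x, y) * H (x, y)) = ?i x * (f x * prim g x)"
      by (simp add: prim_def)
  qed
  also have "(LBINT y. ?i y * (prim f y * g y)) + (LBINT x. ?i x * (f x * prim g x)) =
     (LBINT y. ?i y * (prim f y * g y) + ?i y * (f y * prim g y))"
  proof (rule LINT_add[symmetric])
    show "L1 (\<lambda>y. ?i y * (prim f y * g y))" by (rule integrable_prim_mult[OF f g])
    show "L1 (\<lambda>y. ?i y * (f y * prim g y))" using integrable_prim_mult[OF g f] by (simp add: mult.commute)
  qed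
  finally show ?thesis by (simp add: distrib_left)
qed

text \<open>Each increment of \<open>t \<mapsto> G t (u t) - \<integral>k\<close> over a short interval is at most \<open>e\<close> times the
  increment of \<open>t \<mapsto> t + \<integral>\<bar>w\<bar>\<close>; summing over a partition shows that the former is constant.\<close>

lemma ac_chain_rule:
  fixes G Gt Gl :: "real \<Rightarrow> real \<Rightarrow> real"
  assumes a: "a \<ge> 0" and w: "L1 w"
    and Gt: "\<And>t x. ((\<lambda>t. G t x) has_real_derivative Gt t x) (at t)"
    and Gl: "\<And>t x. (G t has_real_derivative Gl t x) (at x)"
    and cGt: "continuous_on UNIV (\<lambda>(t, x). Gt t x)" and cGl: "continuous_on UNIV (\<lambda>(t, x). Gl t x)"
    and u: "\<And>t. u t = c + prim w t"
  shows "L1 (\<lambda>t. ind {0..a} t * (Gt t (u t) + Gl t (u t) * w t))"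
    and "G a (u a) - G 0 c = (LBINT t. ind {0..a} t * (Gt t (u t) + Gl t (u t) * w t))"
proof -
  have cu: "continuous_on S u" for S
    unfolding u[abs_def] by (intro continuous_intros continuous_on_prim w)
  have cGtu: "continuous_on S (\<lambda>t. Gt t (u t))" and cGlu: "continuous_on S (\<lambda>t. Gl t (u t))" for S
  proof -
    have "continuous_on S (\<lambda>t. (t, u t))" by (intro continuous_intros cu)
    from continuous_on_compose2[OF cGt this] continuous_on_compose2[OF cGl this]
    show "continuous_on S (\<lambda>t. Gt t (u t))" "continuous_on S (\<lambda>t. Gl t (u t))" by auto
  qed
  have bdd: "\<exists>K. \<forall>t\<in>{0..a}. \<bar>f t\<bar> \<le> K" if "continuous_on {0..a} f" for f :: "real \<Rightarrow> real"
    using compact_imp_bounded[OF compact_continuous_image[OF that compact_Icc]] by (auto simp: bounded_iff)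
  obtain K1 where K1: "\<And>t. t \<in> {0..a} \<Longrightarrow> \<bar>Gt t (u t)\<bar> \<le> K1" using bdd[OF cGtu] by blast
  obtain K2 where K2: "\<And>t. t \<in> {0..a} \<Longrightarrow> \<bar>Gl t (u t)\<bar> \<le> K2" using bdd[OF cGlu] by blast
  obtain R where R: "\<And>t. t \<in> {0..a} \<Longrightarrow> \<bar>u t\<bar> \<le> R" using bdd[OF cu] by blast
  have m1: "(\<lambda>t. Gt t (u t)) \<in> BM" "(\<lambda>t. Gl t (u t)) \<in> BM"
    by (intro borel_measurable_continuous_onI cGtu cGlu)+
  define k where "k t = ind {0..a} t * (Gt t (u t) + Gl t (u t) * w t)" for t
  have ki: "L1 k"
  proof (rule L1_bound[where f="\<lambda>t. ind {0..a} t * K1 + K2 * \<bar>w t\<bar>"])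
    show "AE t in lborel. norm (k t) \<le> norm (ind {0..a} t * K1 + K2 * \<bar>w t\<bar>)"
    proof (rule AE_I2)
      fix t
      show "norm (k t) \<le> norm (ind {0..a} t * K1 + K2 * \<bar>w t\<bar>)"
      proof (cases "t \<in> {0..a}")
        case True
        have "\<bar>Gt t (u t) + Gl t (u t) * w t\<bar> \<le> \<bar>Gt t (u t)\<bar> + \<bar>Gl t (u t)\<bar> * \<bar>w t\<bar>"
          by (metis abs_mult abs_triangle_ineq)
        also have "\<dots> \<le> K1 + K2 * \<bar>w t\<bar>"
          using K1[OF True] K2[OF True] by (intro add_mono mult_right_mono) auto
        finally show ?thesis using True by (simp add: k_def)
      qed (simp add: k_def)
    qed
    have "L1 (\<lambda>t. ind {0..a} t :: real)"
      by (rule integrable_real_indicator) (auto simp: emeasure_lborel_Icc_eq)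
    then show "L1 (\<lambda>t. ind {0..a} t * K1 + K2 * \<bar>w t\<bar>)"
      using w by (intro L1_add integrable_mult_left integrable_mult_right integrable_abs)
    show "k \<in> borel_measurable lborel" unfolding k_def[abs_def] using m1 w by simp
  qed
  then show "L1 (\<lambda>t. ind {0..a} t * (Gt t (u t) + Gl t (u t) * w t))"
    by (simp add: k_def[abs_def])
  define D where "D t = G t (u t) - prim k t" for t
  define A where "A t = t + prim (\<lambda>r. \<bar>w r\<bar>) t" for t
  have small: "\<bar>D a - D 0\<bar> \<le> e * (A a - A 0)" if e: "e > 0" for e
  proof -
    let ?C = "{0..a} \<times> {-R..R}"
    have "compact ?C" by (intro compact_Times compact_Icc)
    then have "uniformly_continuous_on ?C (\<lambda>(t, x). Gt t x)" "uniformly_continuous_on ?C (\<lambda>(t, x). Gl t x)"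
      using cGt cGl by (auto intro!: compact_uniformly_continuous intro: continuous_on_subset)
    then obtain d1 d2 where d: "d1 > 0" "d2 > 0"
      "\<And>p q. p \<in> ?C \<Longrightarrow> q \<in> ?C \<Longrightarrow> dist q p < d1 \<Longrightarrow> dist (case q of (t, x) \<Rightarrow> Gt t x) (case p of (t, x) \<Rightarrow> Gt t x) < e"
      "\<And>p q. p \<in> ?C \<Longrightarrow> q \<in> ?C \<Longrightarrow> dist q p < d2 \<Longrightarrow> dist (case q of (t, x) \<Rightarrow> Gl t x) (case p of (t, x) \<Rightarrow> Gl t x) < e"
      using e unfolding uniformly_continuous_on_def by metis
    define d where "d = min d1 d2"
    have dpos: "d > 0" using d by (simp add: d_def)
    have dd: "dist (t, x) (t', x') < d" if "\<bar>t - t'\<bar> < d / 2" "\<bar>x - x'\<bar> < d / 2" for t t' x x' :: real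
    proof -
      have "dist (t, x) (t', x') \<le> \<bar>t - t'\<bar> + \<bar>x - x'\<bar>"
        unfolding dist_prod_def by (simp add: dist_real_def sqrt_sum_squares_le_sum_abs[THEN order_trans])
      then show ?thesis using that by simp
    qed
    have "uniformly_continuous_on {0..a} u" by (intro compact_uniformly_continuous cu compact_Icc)
    then obtain h1 where h1: "h1 > 0" "\<And>s t. s \<in> {0..a} \<Longrightarrow> t \<in> {0..a} \<Longrightarrow> \<bar>t - s\<bar> < h1 \<Longrightarrow> \<bar>u t - u s\<bar> < d / 2"
      using dpos unfolding uniformly_continuous_on_def dist_real_def by (metis half_gt_zero)
    define \<eta> where "\<eta> = min h1 (d / 2)"
    have \<eta>: "\<eta> > 0" using h1 dpos by (simp add: \<eta>_def)
    \<comment> \<open>The increment is taken first in the time argument at the fixed value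
      \<open>u t\<close>, then in the space argument at the fixed time \<open>s\<close>. The mean
      value theorem produces derivatives at intermediate points, and uniform continuity on the
      rectangle replaces these by \<open>(r, u r)\<close> for each \<open>r\<close> in between, at a
      cost of \<open>e\<close> each.\<close>
    have loc: "\<bar>D t - D s\<bar> \<le> e * (A t - A s)" if st: "0 \<le> s" "s \<le> t" "t \<le> a" "t - s < \<eta>" for s t
    proof (cases "s = t")
      case False
      then have lt: "s < t" using st by simp
      obtain z where z: "s < z" "z < t" "G t (u t) - G s (u t) = (t - s) * Gt z (u t)"
        using MVT2[OF lt, of "\<lambda>t'. G t' (u t)" "\<lambda>t'. Gt t' (u t)"] Gt by blast
      obtain y where y: "y \<in> {min (u s) (u t)..max (u s) (u t)}" "G s (u t) - G s (u s) = (u t - u s) * Gl s y"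
      proof (cases "u s" "u t" rule: linorder_cases)
        case less
        from MVT2[OF this, of "G s" "Gl s"] Gl obtain y where "u s < y" "y < u t" "G s (u t) - G s (u s) = (u t - u s) * Gl s y" by blast
        then show ?thesis using that[of y] by auto
      next
        case equal then show ?thesis using that[of "u s"] by auto
      next
        case greater
        from MVT2[OF this, of "G s" "Gl s"] Gl obtain y where "u t < y" "y < u s" "G s (u s) - G s (u t) = (u s - u t) * Gl s y" by blast
        then show ?thesis using that[of y] by (auto simp: algebra_simps)
      qed
      let ?j = "ind {s<..t} :: real \<Rightarrow> real"
      have us: "u t - u s = (LBINT r. ?j r * w r)" using prim_diff[OF w st(1,2)] by (simp add: u)
      have ks: "prim k t - prim k s = (LBINT r. ?j r * k r)" using prim_diff[OF ki st(1,2)] .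
      have ji: "L1 ?j" by (rule integrable_real_indicator) (use st in auto)
      have jt: "(LBINT r. ?j r) = t - s" using st by simp
      have jw: "L1 (\<lambda>r. ?j r * w r)" and jk: "L1 (\<lambda>r. ?j r * k r)" and jw': "L1 (\<lambda>r. ?j r * \<bar>w r\<bar>)"
        using w ki by (auto intro!: integrable_ind_mult)
      have "D t - D s = (G t (u t) - G s (u t)) + (G s (u t) - G s (u s)) - (prim k t - prim k s)"
        by (simp add: D_def)
      also have "\<dots> = (t - s) * Gt z (u t) + (u t - u s) * Gl s y - (prim k t - prim k s)"
        using y z by simp
      also have "\<dots> = (LBINT r. ?j r * Gt z (u t) + (?j r * w r) * Gl s y - ?j r * k r)"
        unfolding us ks using ji jw jk st by simp
      finally have "\<bar>D t - D s\<bar> = \<bar>LBINT r. ?j r * Gt z (u t) + (?j r * w r) * Gl s y - ?j r * k r\<bar>" by simp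
      also have "\<dots> \<le> (LBINT r. \<bar>?j r * Gt z (u t) + (?j r * w r) * Gl s y - ?j r * k r\<bar>)"
        by (rule integral_abs_bound)
      also have "\<dots> \<le> (LBINT r. e * ?j r + e * (?j r * \<bar>w r\<bar>))"
      proof (rule integral_mono)
        show "L1 (\<lambda>r. \<bar>?j r * Gt z (u t) + ?j r * w r * Gl s y - ?j r * k r\<bar>)"
          by (intro integrable_abs L1_diff L1_add integrable_mult_left jk jw ji)
        show "L1 (\<lambda>r. e * ?j r + e * (?j r * \<bar>w r\<bar>))" using ji jw' by auto
        fix r
        show "\<bar>?j r * Gt z (u t) + ?j r * w r * Gl s y - ?j r * k r\<bar> \<le> e * ?j r + e * (?j r * \<bar>w r\<bar>)"
        proof (cases "r \<in> {s<..t}")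
          case True
          have \<eta>d: "\<eta> \<le> h1" "\<eta> \<le> d / 2" by (auto simp: \<eta>_def)
          have ust: "\<bar>u t - u r\<bar> < d / 2" "\<bar>u s - u r\<bar> < d / 2"
            using h1(2)[of r t] h1(2)[of r s] st True \<eta>d by auto
          have urd: "\<bar>y - u r\<bar> < d / 2"
          proof (cases "u s \<le> u t")
            case True
            then have "u s \<le> y" "y \<le> u t" using y(1) by auto
            then show ?thesis using ust by linarith
          next
            case False
            then have "u t \<le> y" "y \<le> u s" using y(1) by auto
            then show ?thesis using ust by linarith
          qed
          have yR: "\<bar>y\<bar> \<le> R" using y(1) R[of s] R[of t] st by (auto simp: min_def max_def split: if_splits)
          have zr: "\<bar>z - r\<bar> < d / 2" "\<bar>s - r\<bar> < d / 2"
          proof -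
            have "s < r" "r \<le> t" using True by auto
            then show "\<bar>z - r\<bar> < d / 2" "\<bar>s - r\<bar> < d / 2" using z st \<eta>d by linarith+
          qed
          have 1: "\<bar>Gt z (u t) - Gt r (u r)\<bar> < e"
            using d(3)[of "(r, u r)" "(z, u t)"] dd[OF zr(1) ust(1)] R[of r] R[of t] z st True
            by (auto simp: d_def dist_real_def abs_le_iff)
          have 2: "\<bar>Gl s y - Gl r (u r)\<bar> < e"
            using d(4)[of "(r, u r)" "(s, y)"] dd[OF zr(2) urd] R[of r] yR st True
            by (auto simp: d_def dist_real_def abs_le_iff)
          have "\<bar>Gt z (u t) + w r * Gl s y - k r\<bar> = \<bar>(Gt z (u t) - Gt r (u r)) + (Gl s y - Gl r (u r)) * w r\<bar>"
            using True st by (simp add: k_def algebra_simps)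
          also have "\<dots> \<le> \<bar>Gt z (u t) - Gt r (u r)\<bar> + \<bar>Gl s y - Gl r (u r)\<bar> * \<bar>w r\<bar>"
            by (metis abs_mult abs_triangle_ineq)
          also have "\<dots> \<le> e + e * \<bar>w r\<bar>" using 1 2 by (intro add_mono mult_right_mono) auto
          finally show ?thesis using True by simp
        qed simp
      qed
      also have "\<dots> = e * (t - s) + e * (LBINT r. ?j r * \<bar>w r\<bar>)"
        using ji jw' jt by simp
      also have "\<dots> = e * (A t - A s)"
        using prim_diff[OF integrable_abs[OF w] st(1,2)] by (simp add: A_def algebra_simps)
      finally show ?thesis .
    qed simp
    obtain N :: nat where N: "a / real N < \<eta>" "N > 0"
    proof -
      obtain n where "a / \<eta> < real n" using reals_Archimedean2 by blast
      moreover have "0 \<le> a / \<eta>" using a \<eta> by simp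
      ultimately have n: "0 < real n" "a / \<eta> < real n" by linarith+
      then have "a / real n < \<eta>" using \<eta> by (simp add: field_simps)
      then show ?thesis using that[of n] n by simp
    qed
    have "\<bar>D (real i * a / N) - D 0\<bar> \<le> e * (A (real i * a / N) - A 0)" if "i \<le> N" for i
      using that
    proof (induction i)
      case (Suc i)
      let ?s = "real i * a / N" and ?t = "real (Suc i) * a / N"
      have "?t - ?s = a / N" by (simp add: field_simps add_divide_distrib)
      moreover have "0 \<le> ?s" using a by simp
      moreover have "?s \<le> ?t" using a by (intro divide_right_mono mult_right_mono) auto
      moreover have "?t \<le> a"
      proof -
        have "real (Suc i) * a \<le> real N * a" using Suc.prems a by (intro mult_right_mono) auto
        then show ?thesis using N by (simp add: field_simps)
      qed
      ultimately have "\<bar>D ?t - D ?s\<bar> \<le> e * (A ?t - A ?s)" using N by (intro loc) auto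
      then show ?case using Suc by (simp add: algebra_simps abs_le_iff)
    qed simp
    from this[of N] N show ?thesis by simp
  qed
  have "D a = D 0"
  proof (rule ccontr)
    assume ne: "D a \<noteq> D 0"
    have A0: "0 \<le> A a - A 0"
      using prim_mono[OF integrable_abs[OF w], of 0 a] a by (simp add: A_def)
    \<comment> \<open>Chosen so that the bound \<open>small\<close> is at most half of the supposed
      difference; the summand 1 keeps the denominator positive when
      \<open>A a = A 0\<close>.\<close>
    define e where "e = \<bar>D a - D 0\<bar> / (2 * (A a - A 0 + 1))"
    have e: "e > 0" using ne A0 by (simp add: e_def)
    have "e * (A a - A 0) \<le> e * (A a - A 0 + 1)" using e by (intro mult_left_mono) auto
    also have "\<dots> = \<bar>D a - D 0\<bar> / 2" using A0 by (simp add: e_def field_simps)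
    finally have "e * (A a - A 0) \<le> \<bar>D a - D 0\<bar> / 2" .
    moreover have "\<bar>D a - D 0\<bar> > 0" using ne by simp
    ultimately show False using order_trans[OF small[OF e]] by fastforce
  qed
  then have "G a (u a) - G 0 c = prim k a" by (simp add: D_def u)
  also have "\<dots> = (LBINT t. ind {0..a} t * (Gt t (u t) + Gl t (u t) * w t))"
    unfolding prim_def k_def by (intro Bochner_Integration.integral_cong) (auto simp: indicator_def)
  finally show "G a (u a) - G 0 c = (LBINT t. ind {0..a} t * (Gt t (u t) + Gl t (u t) * w t))" .
qed

subsection \<open>Integration over products\<close>

lemma Fubini_fst:
  fixes f :: "'a::euclidean_space \<times> 'b::euclidean_space \<Rightarrow> real"
  assumes "L1 f"
  shows "(LBINT p. f p) = (LBINT x. LBINT y. f (x, y))"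
    and "AE x in lborel. L1 (\<lambda>y. f (x, y))"
    and "L1 (\<lambda>x. LBINT y. f (x, y))"
proof -
  have f: "integrable (lborel \<Otimes>\<^sub>M lborel) f" using assms by (simp add: lborel_prod)
  show "(LBINT p. f p) = (LBINT x. LBINT y. f (x, y))"
    using lborel_pair.integral_fst'[OF f] by (simp add: lborel_prod)
  show "AE x in lborel. L1 (\<lambda>y. f (x, y))"
    using lborel_pair.AE_integrable_fst'[OF f] .
  show "L1 (\<lambda>x. LBINT y. f (x, y))"
    using lborel_pair.integrable_fst'[OF f] .
qed

lemma Fubini_snd:
  fixes f :: "'a::euclidean_space \<times> 'b::euclidean_space \<Rightarrow> real"
  assumes "L1 f"
  shows "(LBINT p. f p) = (LBINT y. LBINT x. f (x, y))"
    and "AE y in lborel. L1 (\<lambda>x. f (x, y))"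
    and "L1 (\<lambda>y. LBINT x. f (x, y))"
proof -
  have f: "integrable (lborel \<Otimes>\<^sub>M lborel) (\<lambda>(x, y). f (x, y))" using assms by (simp add: lborel_prod)
  show "(LBINT p. f p) = (LBINT y. LBINT x. f (x, y))"
    using lborel_pair.integral_snd[OF f] by (simp add: lborel_prod)
  show "AE y in lborel. L1 (\<lambda>x. f (x, y))"
    using lborel_pair.AE_integrable_snd[OF f] .
  show "L1 (\<lambda>y. LBINT x. f (x, y))"
    using lborel_pair.integrable_snd[OF f] .
qed

lemma integrable_swap:
  fixes f :: "'a::euclidean_space \<times> 'b::euclidean_space \<Rightarrow> real"
  shows "L1 (\<lambda>p. f (snd p, fst p)) \<longleftrightarrow> L1 f"
  using lborel_pair.integrable_product_swap_iff[of f] by (simp add: lborel_prod case_prod_beta')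

lemma integral_swap:
  fixes f :: "'a::euclidean_space \<times> 'b::euclidean_space \<Rightarrow> real"
  assumes "L1 f"
  shows "(LBINT x. LBINT y. f (x, y)) = (LBINT y. LBINT x. f (x, y))"
  using Fubini_fst(1)[OF assms] Fubini_snd(1)[OF assms] by simp

lemma integrable_pairI_fst:
  fixes f :: "'a::euclidean_space \<times> 'b::euclidean_space \<Rightarrow> real"
  assumes "f \<in> BM"
    and "AE x in lborel. L1 (\<lambda>y. f (x, y))"
    and "L1 (\<lambda>x. LBINT y. \<bar>f (x, y)\<bar>)"
  shows "L1 f"
proof -
  have "f \<in> borel_measurable (lborel \<Otimes>\<^sub>M lborel)" using assms(1) by (simp add: lborel_prod)
  then have "integrable (lborel \<Otimes>\<^sub>M lborel) f"
    by (rule lborel_pair.Fubini_integrable) (use assms in auto)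
  then show ?thesis by (simp add: lborel_prod)
qed

lemma integrable_pairI_snd:
  fixes f :: "'a::euclidean_space \<times> 'b::euclidean_space \<Rightarrow> real"
  assumes "f \<in> BM"
    and "AE y in lborel. L1 (\<lambda>x. f (x, y))"
    and "L1 (\<lambda>y. LBINT x. \<bar>f (x, y)\<bar>)"
  shows "L1 f"
proof -
  have "(\<lambda>p. f (snd p, fst p)) \<in> BM"
    by (rule measurable_compose[OF _ assms(1)]) (simp add: borel_prod[symmetric])
  then have "L1 (\<lambda>p. f (snd p, fst p))"
    by (rule integrable_pairI_fst) (use assms in auto)
  then show ?thesis by (simp add: integrable_swap)
qed

lemma AE_fst:
  fixes P :: "'a::euclidean_space \<times> 'b::euclidean_space \<Rightarrow> bool"
  assumes "AE p in lborel. P p"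
  shows "AE x in lborel. AE y in lborel. P (x, y)"
  by (rule lborel_pair.AE_pair) (use assms in \<open>simp only: lborel_prod\<close>)

lemma AE_snd:
  fixes P :: "'a::euclidean_space \<times> 'b::euclidean_space \<Rightarrow> bool"
  assumes "AE p in lborel. P p"
  shows "AE y in lborel. AE x in lborel. P (x, y)"
proof -
  \<comment> \<open>The order of the two almost-everywhere quantifiers can be exchanged for a
    measurable condition. \<open>P\<close> need not be one, so it is replaced by the complement of a
    Borel null set.\<close>
  obtain N where N: "{p \<in> space lborel. \<not> P p} \<subseteq> N" "N \<in> null_sets lborel"
    using assms by (auto elim!: AE_E simp: null_sets_def)
  have "AE p in lborel. p \<notin> N" using AE_not_in[OF N(2)] .
  then have a: "AE x in lborel. AE y in lborel. (x, y) \<notin> N" by (rule AE_fst)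
  have "- N \<in> sets borel" using N(2) by auto
  then have "{p \<in> space (lborel \<Otimes>\<^sub>M lborel). (fst p, snd p) \<notin> N} \<in> sets (lborel \<Otimes>\<^sub>M lborel)"
    unfolding lborel_prod by (simp add: Compl_eq)
  with a have "AE y in lborel. AE x in lborel. (x, y) \<notin> N"
    using lborel_pair.AE_commute[of "\<lambda>x y. (x, y) \<notin> N"] by simp
  moreover have "P p" if "p \<notin> N" for p using N(1) that by auto
  ultimately show ?thesis by (auto elim!: eventually_mono)
qed

lemma AE_pairI_fst:
  fixes P :: "'a::euclidean_space \<times> 'b::euclidean_space \<Rightarrow> bool"
  assumes "{p. P p} \<in> sets borel" "AE x in lborel. AE y in lborel. P (x, y)"
  shows "AE p in lborel. P p"
proof -
  have "AE p in lborel \<Otimes>\<^sub>M lborel. P p"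
    by (rule lborel_pair.AE_pair_measure) (use assms in \<open>simp_all only: lborel_prod space_lborel sets_lborel, simp_all\<close>)
  then show ?thesis by (simp only: lborel_prod)
qed

lemma AE_pairI_snd:
  fixes P :: "'a::euclidean_space \<times> 'b::euclidean_space \<Rightarrow> bool"
  assumes P: "{p. P p} \<in> sets borel" and "AE y in lborel. AE x in lborel. P (x, y)"
  shows "AE p in lborel. P p"
proof (rule AE_pairI_fst[OF P])
  have "{p \<in> space (lborel \<Otimes>\<^sub>M lborel). P (fst p, snd p)} \<in> sets (lborel \<Otimes>\<^sub>M lborel)"
    unfolding lborel_prod using P by simp
  then show "AE x in lborel. AE y in lborel. P (x, y)"
    using lborel_pair.AE_commute[of "\<lambda>x y. P (x, y)"] assms(2) by simp
qed

lemma measurable_section: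
  fixes f :: "'a::euclidean_space \<times> 'b::euclidean_space \<Rightarrow> 'c::topological_space"
  assumes "f \<in> BM"
  shows "(\<lambda>y. f (x, y)) \<in> BM" "(\<lambda>x. f (x, y)) \<in> BM"
proof -
  have "(\<lambda>y. (x, y)) \<in> BM" "(\<lambda>x. (x, y)) \<in> BM"
    by (intro borel_measurable_continuous_onI continuous_intros)+
  then show "(\<lambda>y. f (x, y)) \<in> BM" "(\<lambda>x. f (x, y)) \<in> BM"
    using assms by (auto intro: measurable_compose)
qed

lemma measurable_integral_param:
  fixes f :: "'a::euclidean_space \<times> 'b::euclidean_space \<Rightarrow> real"
  assumes "f \<in> BM"
  shows "(\<lambda>x. LBINT y. f (x, y)) \<in> BM"
proof -
  have "case_prod (\<lambda>x y. f (x, y)) \<in> borel_measurable (borel \<Otimes>\<^sub>M lborel)"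
    using assms by (simp add: borel_prod measurable_cong_sets[OF sets_pair_measure_cong[OF refl sets_lborel] refl])
  then show ?thesis by (rule lborel.borel_measurable_lebesgue_integral)
qed

lemma measurable_indicator_Icc [measurable (raw)]:
  fixes f g h :: "'a \<Rightarrow> real"
  assumes [measurable]: "f \<in> borel_measurable M" "g \<in> borel_measurable M" "h \<in> borel_measurable M"
  shows "(\<lambda>p. ind {f p..g p} (h p) :: real) \<in> borel_measurable M"
    and "(\<lambda>p. ind {f p<..g p} (h p) :: real) \<in> borel_measurable M"
    and "(\<lambda>p. ind {f p<..<g p} (h p) :: real) \<in> borel_measurable M"
    and "(\<lambda>p. ind {f p..<g p} (h p) :: real) \<in> borel_measurable M"
proof -
  have "(\<lambda>p. if f p \<le> h p \<and> h p \<le> g p then 1 else 0 :: real) \<in> borel_measurable M"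
    "(\<lambda>p. if f p < h p \<and> h p \<le> g p then 1 else 0 :: real) \<in> borel_measurable M"
    "(\<lambda>p. if f p < h p \<and> h p < g p then 1 else 0 :: real) \<in> borel_measurable M"
    "(\<lambda>p. if f p \<le> h p \<and> h p < g p then 1 else 0 :: real) \<in> borel_measurable M"
    by measurable
  then show "(\<lambda>p. ind {f p..g p} (h p) :: real) \<in> borel_measurable M"
    "(\<lambda>p. ind {f p<..g p} (h p) :: real) \<in> borel_measurable M"
    "(\<lambda>p. ind {f p<..<g p} (h p) :: real) \<in> borel_measurable M"
    "(\<lambda>p. ind {f p..<g p} (h p) :: real) \<in> borel_measurable M"
    by (simp_all add: indicator_def of_bool_def)
qed

lemma measurable_comp_pair:
  fixes f :: "'a::euclidean_space \<times> 'b::euclidean_space \<Rightarrow> 'c::topological_space"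
  assumes "f \<in> BM" "g \<in> borel_measurable M" "h \<in> borel_measurable M"
  shows "(\<lambda>p. f (g p, h p)) \<in> borel_measurable M"
  by (rule measurable_compose[OF _ assms(1)]) (use assms in \<open>simp add: borel_prod[symmetric]\<close>)

lemma measurable_proj [measurable, simp]:
  "(fst :: 'a::euclidean_space \<times> 'b::euclidean_space \<Rightarrow> 'a) \<in> BM"
  "(snd :: 'a::euclidean_space \<times> 'b::euclidean_space \<Rightarrow> 'b) \<in> BM"
  by (simp_all add: borel_prod[symmetric])

lemma integrable_prod_of_squares:
  fixes f g :: "'a::euclidean_space \<Rightarrow> real"
  assumes "f \<in> BM" "g \<in> BM"
    and "L1 (\<lambda>p. (f p)\<^sup>2)" "L1 (\<lambda>p. (g p)\<^sup>2)"
  shows "L1 (\<lambda>p. f p * g p)"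
proof (rule L1_bound[where f="\<lambda>p. (f p)\<^sup>2 + (g p)\<^sup>2"])
  show "AE p in lborel. norm (f p * g p) \<le> norm ((f p)\<^sup>2 + (g p)\<^sup>2)"
  proof (rule AE_I2)
    fix p
    have "2 * \<bar>f p\<bar> * \<bar>g p\<bar> \<le> \<bar>f p\<bar>\<^sup>2 + \<bar>g p\<bar>\<^sup>2" by (rule sum_squares_bound)
    moreover have "0 \<le> \<bar>f p\<bar> * \<bar>g p\<bar>" by simp
    ultimately have "\<bar>f p\<bar> * \<bar>g p\<bar> \<le> (f p)\<^sup>2 + (g p)\<^sup>2" by (simp only: mult.assoc power2_abs)
    then show "norm (f p * g p) \<le> norm ((f p)\<^sup>2 + (g p)\<^sup>2)" by (simp add: abs_mult)
  qed
qed (use assms in auto)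

subsection \<open>Steklov averages\<close>

text \<open>The average looks forward in time: for \<open>t\<close> in \<open>[0, T - h]\<close> it
  only sees times in \<open>(0, T]\<close>, where the equations hold.\<close>

definition stek :: "real \<Rightarrow> (real \<Rightarrow> real) \<Rightarrow> real \<Rightarrow> real"
  where "stek h f t = (LBINT s. ind {t<..t + h} s * f s) / h"

lemma stek_eq_prim:
  assumes "L1 f" "0 \<le> t" "0 \<le> h"
  shows "stek h f t = (prim f (t + h) - prim f t) / h"
  unfolding stek_def using assms by (subst prim_diff) auto

lemma stek_diff:
  assumes "L1 f" "L1 g"
  shows "stek h (\<lambda>s. f s - g s) t = stek h f t - stek h g t"
  unfolding stek_def using assms by (simp add: right_diff_distrib integrable_ind_mult diff_divide_distrib)

lemma stek_add:
  assumes "L1 f" "L1 g"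
  shows "stek h (\<lambda>s. f s + g s) t = stek h f t + stek h g t"
  unfolding stek_def using assms by (simp add: distrib_left integrable_ind_mult add_divide_distrib)

lemma stek_cmult: "stek h (\<lambda>s. c * f s) t = c * stek h f t"
  unfolding stek_def by (simp add: mult.left_commute)

text \<open>After exchanging the integrals, each \<open>s\<close> is counted for the
  \<open>t\<close> in \<open>[s - h, s)\<close>, an interval of length \<open>h\<close>; the factor
  cancels and averaging is a contraction in \<open>L^1\<close>.\<close>

lemma integrable_stek:
  assumes f: "L1 f" and h: "h > 0"
  shows "L1 (stek h f)" and "(LBINT t. \<bar>stek h f t\<bar>) \<le> (LBINT t. \<bar>f t\<bar>)"
proof -
  define H where "H = (\<lambda>p :: real \<times> real. ind {fst p<..fst p + h} (snd p) * f (snd p))"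
  have fm [measurable]: "f \<in> BM" using f by simp
  have eq: "ind {t<..t + h} s = (ind {s - h..<s} t :: real)" for s t by (auto simp: indicator_def)
  have Hm: "H \<in> BM" unfolding H_def
    by (intro borel_measurable_times measurable_indicator_Icc measurable_compose[OF _ fm]) auto
  have Hi: "L1 H"
  proof (rule integrable_pairI_snd[OF Hm])
    have "L1 (\<lambda>x. ind {s - h..<s} x :: real)" for s
      using h by (intro integrable_real_indicator) auto
    then show "AE s in lborel. L1 (\<lambda>x. H (x, s))" by (simp add: H_def eq)
    have "(LBINT t. \<bar>H (t, s)\<bar>) = h * \<bar>f s\<bar>" for s
      using h by (simp add: H_def eq abs_mult)
    then show "L1 (\<lambda>s. LBINT t. \<bar>H (t, s)\<bar>)" using f by simp
  qed
  have st: "stek h f t = (LBINT s. H (t, s)) / h" for t by (simp add: stek_def H_def)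
  show si: "L1 (stek h f)"
    unfolding st[abs_def] using Fubini_fst(3)[OF Hi] by simp
  have Ha: "L1 (\<lambda>p. \<bar>H p\<bar>)" using Hi by simp
  have "(LBINT t. \<bar>stek h f t\<bar>) \<le> (LBINT t. (LBINT s. \<bar>H (t, s)\<bar>) / h)"
  proof (rule integral_mono)
    show "L1 (\<lambda>t. (LBINT s. \<bar>H (t, s)\<bar>) / h)" using Fubini_fst(3)[OF Ha] by simp
    show "\<bar>stek h f t\<bar> \<le> (LBINT s. \<bar>H (t, s)\<bar>) / h" for t
      unfolding st using h by (simp add: divide_right_mono integral_abs_bound)
  qed (use si in auto)
  also have "\<dots> = (LBINT t. LBINT s. \<bar>H (t, s)\<bar>) / h" by simp
  also have "(LBINT t. LBINT s. \<bar>H (t, s)\<bar>) = (LBINT s. LBINT t. \<bar>H (t, s)\<bar>)"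
    using integral_swap[OF Ha] by simp
  also have "\<dots> / h = (LBINT s. \<bar>f s\<bar>)"
    using h by (simp add: H_def eq abs_mult)
  finally show "(LBINT t. \<bar>stek h f t\<bar>) \<le> (LBINT t. \<bar>f t\<bar>)" .
qed

text \<open>Density argument: for the indicator of an interval the average is eventually exact at
  every point other than the endpoints, and the contraction property carries the claim to
  \<open>L^1\<close> limits. The step sequence \<open>H\<close> is quantified inside the claim so
  that the induction predicate depends on \<open>f\<close> alone.\<close>

lemma stek_L1_limit:
  assumes f: "L1 f"
  shows "\<forall>H. (\<forall>k::nat. H k > 0) \<longrightarrow> H \<longlonglongrightarrow> 0 \<longrightarrow> (\<lambda>k. LBINT t. \<bar>stek (H k) f t - f t\<bar>) \<longlonglongrightarrow> 0"
  using f
proof (induction rule: L1_induct)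
  case (box a b)
  show ?case
  proof (intro allI impI)
    fix H :: "nat \<Rightarrow> real" assume H0: "\<forall>k. H k > 0" and H: "H \<longlonglongrightarrow> 0"
    \<comment> \<open>A common bound on the steps confines all averages to
      \<open>[a - M, b]\<close>, which gives one integrable majorant.\<close>
    obtain M where M: "\<And>k. H k \<le> M"
      using convergent_imp_Bseq[OF convergentI[OF H]] unfolding Bseq_def by (auto simp: abs_le_iff)
    let ?f = "ind (box a b) :: real \<Rightarrow> real"
    have bf: "?f = ind {a<..<b}" by (simp add: box_real)
    have fi: "L1 ?f" unfolding bf by (cases "a < b") (auto intro!: integrable_real_indicator)
    have zero: "stek h ?f t = 0" if "{t<..t + h} \<inter> {a<..<b} = {}" for h t
    proof -
      have "(LBINT s. ind {t<..t + h} s * ?f s) = (LINT s::real|lborel. (0::real))"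
        using that by (intro Bochner_Integration.integral_cong) (auto simp: bf indicator_def)
      then show ?thesis by (simp add: stek_def)
    qed
    have one: "stek h ?f t = 1" if "{t<..t + h} \<subseteq> {a<..<b}" "h > 0" for h t
    proof -
      have "(LBINT s. ind {t<..t + h} s * ?f s) = (LINT s::real|lborel. ind {t<..t + h} s)"
        using that by (intro Bochner_Integration.integral_cong) (auto simp: bf indicator_def)
      then show ?thesis using that by (simp add: stek_def)
    qed
    have bd: "\<bar>stek h ?f t\<bar> \<le> 1" if "h > 0" for h t
    proof -
      have "L1 (ind {t<..t + h} :: real \<Rightarrow> real)" using that by (intro integrable_real_indicator) auto
      from integral_mult_bounded[OF this, of ?f 1] show ?thesis using that by (simp add: stek_def)
    qed
    have "(\<lambda>k. LBINT t. \<bar>stek (H k) ?f t - ?f t\<bar>) \<longlonglongrightarrow> (LINT t::real|lborel. (0::real))"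
    proof (rule integral_dominated_convergence[where w="\<lambda>t. 2 * ind {a - M..b} t"])
      have "L1 (ind {a - M..b} :: real \<Rightarrow> real)"
        by (intro integrable_real_indicator) (auto simp: emeasure_lborel_Icc_eq)
      then show "L1 (\<lambda>t. 2 * ind {a - M..b} t :: real)" by simp
      show "AE t in lborel. norm \<bar>stek (H k) ?f t - ?f t\<bar> \<le> 2 * ind {a - M..b} t" for k
      proof (rule AE_I2)
        fix t
        show "norm \<bar>stek (H k) ?f t - ?f t\<bar> \<le> 2 * ind {a - M..b} t"
        proof (cases "t \<in> {a - M..b}")
          case True
          have "\<bar>stek (H k) ?f t - ?f t\<bar> \<le> 1 + 1"
            using bd[of "H k" t] H0 by (intro order_trans[OF abs_triangle_ineq4] add_mono) (auto simp: indicator_def)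
          then show ?thesis using True by simp
        next
          case False
          have M0: "M > 0" using M[of k] H0 by (meson less_le_trans)
          have "{t<..t + H k} \<inter> {a<..<b} = {}" using False M[of k] by (auto simp: not_le)
          then show ?thesis using zero False M0 by (auto simp: bf indicator_def)
        qed
      qed
      show "AE t in lborel. (\<lambda>k. \<bar>stek (H k) ?f t - ?f t\<bar>) \<longlonglongrightarrow> 0"
        using AE_lborel_singleton[of a] AE_lborel_singleton[of b]
      proof eventually_elim
        case (elim t)
        have "eventually (\<lambda>k. stek (H k) ?f t = ?f t) sequentially"
        proof -
          consider "t < a" | "a < t" "t < b" | "b < t" | "a < t" "b \<le> a" using elim by linarith
          then show ?thesis
          proof cases
            case 1
            then have "eventually (\<lambda>k. H k < a - t) sequentially" using order_tendstoD(2)[OF H, of "a - t"] by simp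
            then show ?thesis
            proof eventually_elim
              case (elim k)
              then have "stek (H k) ?f t = 0" by (intro zero) auto
              then show ?case using 1 by (simp add: bf)
            qed
          next
            case 2
            then have "eventually (\<lambda>k. H k < b - t) sequentially" using order_tendstoD(2)[OF H, of "b - t"] by simp
            then show ?thesis
            proof eventually_elim
              case (elim k)
              then have "stek (H k) ?f t = 1" using H0 2 by (intro one) auto
              then show ?case using 2 by (simp add: bf)
            qed
          next
            case 3
            have "stek (H k) ?f t = 0" for k using 3 by (intro zero) auto
            then show ?thesis using 3 by (simp add: bf)
          next
            case 4
            have "stek (H k) ?f t = 0" for k using 4 by (intro zero) auto
            then show ?thesis using 4 by (simp add: bf)
          qed
        qed
        then have "eventually (\<lambda>k. \<bar>stek (H k) ?f t - ?f t\<bar> = 0) sequentially" by eventually_elim simp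
        then show ?case by (rule tendsto_eventually)
      qed
      show "(\<lambda>t. \<bar>stek (H k) ?f t - ?f t\<bar>) \<in> borel_measurable lborel" for k
        using integrable_stek(1)[OF fi, of "H k"] H0 fi by auto
    qed auto
    then show "(\<lambda>k. LBINT t. \<bar>stek (H k) ?f t - ?f t\<bar>) \<longlonglongrightarrow> 0" by simp
  qed
next
  case (scale f c)
  have "(LBINT t. \<bar>stek h (\<lambda>s. c * f s) t - c * f t\<bar>) = \<bar>c\<bar> * (LBINT t. \<bar>stek h f t - f t\<bar>)" for h
    by (simp add: stek_cmult right_diff_distrib[symmetric] abs_mult)
  then show ?case using scale by (auto intro: tendsto_mult_right_zero)
next
  case (add f g)
  show ?case
  proof (intro allI impI)
    fix H :: "nat \<Rightarrow> real" assume H0: "\<forall>k. H k > 0" and H: "H \<longlonglongrightarrow> 0"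
    have i: "L1 (\<lambda>t. \<bar>stek (H k) f t - f t\<bar>)" "L1 (\<lambda>t. \<bar>stek (H k) g t - g t\<bar>)" for k
      using integrable_stek(1) H0 add.hyps by auto
    have lim: "(\<lambda>k. (LBINT t. \<bar>stek (H k) f t - f t\<bar>) + (LBINT t. \<bar>stek (H k) g t - g t\<bar>)) \<longlonglongrightarrow> 0 + 0"
      using add.IH H0 H by (intro tendsto_add) auto
    show "(\<lambda>k. LBINT t. \<bar>stek (H k) (\<lambda>t. f t + g t) t - (f t + g t)\<bar>) \<longlonglongrightarrow> 0"
    proof (rule tendsto_sandwich[OF _ _ tendsto_const])
      show "eventually (\<lambda>k. (LBINT t. \<bar>stek (H k) (\<lambda>t. f t + g t) t - (f t + g t)\<bar>)
          \<le> (LBINT t. \<bar>stek (H k) f t - f t\<bar>) + (LBINT t. \<bar>stek (H k) g t - g t\<bar>)) sequentially"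
      proof (intro always_eventually allI)
        fix k
        have "(LBINT t. \<bar>stek (H k) (\<lambda>t. f t + g t) t - (f t + g t)\<bar>) \<le>
            (LBINT t. \<bar>stek (H k) f t - f t\<bar> + \<bar>stek (H k) g t - g t\<bar>)"
          using i[of k] integrable_stek(1) H0 add.hyps
          by (intro integral_mono) (auto simp: stek_add)
        then show "(LBINT t. \<bar>stek (H k) (\<lambda>t. f t + g t) t - (f t + g t)\<bar>)
          \<le> (LBINT t. \<bar>stek (H k) f t - f t\<bar>) + (LBINT t. \<bar>stek (H k) g t - g t\<bar>)"
          using i[of k] by simp
      qed
    qed (use lim in auto)
  qed
next
  case (lim f s)
  show ?case
  proof (intro allI impI)
    fix H :: "nat \<Rightarrow> real" assume H0: "\<forall>k. H k > 0" and H: "H \<longlonglongrightarrow> 0"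
    have bound: "(LBINT t. \<bar>stek (H k) f t - f t\<bar>) \<le>
       2 * (LBINT t. \<bar>s i t - f t\<bar>) + (LBINT t. \<bar>stek (H k) (s i) t - s i t\<bar>)" for i k
    proof -
      have fsi: "L1 (\<lambda>t. f t - s i t)" using lim.hyps by auto
      have "(LBINT t. \<bar>stek (H k) f t - f t\<bar>) \<le>
         (LBINT t. \<bar>stek (H k) (\<lambda>t. f t - s i t) t\<bar> + \<bar>stek (H k) (s i) t - s i t\<bar> + \<bar>s i t - f t\<bar>)"
        using integrable_stek(1) H0 lim.hyps fsi by (intro integral_mono) (auto simp: stek_diff)
      also have "\<dots> = (LBINT t. \<bar>stek (H k) (\<lambda>t. f t - s i t) t\<bar>) + (LBINT t. \<bar>stek (H k) (s i) t - s i t\<bar>)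
          + (LBINT t. \<bar>s i t - f t\<bar>)"
        using integrable_stek(1) H0 lim.hyps fsi by (subst LINT_add; (subst LINT_add)?) auto
      also have "(LBINT t. \<bar>stek (H k) (\<lambda>t. f t - s i t) t\<bar>) \<le> (LBINT t. \<bar>f t - s i t\<bar>)"
        using integrable_stek(2)[OF fsi] H0 by auto
      also have "(LBINT t. \<bar>f t - s i t\<bar>) = (LBINT t. \<bar>s i t - f t\<bar>)" by (simp add: abs_minus_commute)
      finally show ?thesis by simp
    qed
    show "(\<lambda>k. LBINT t. \<bar>stek (H k) f t - f t\<bar>) \<longlonglongrightarrow> 0"
    proof (rule tendsto_zero_by_approximation)
      fix e :: real assume e: "e > 0"
      have "eventually (\<lambda>i. (LBINT t. \<bar>s i t - f t\<bar>) < e / 2) sequentially"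
        using order_tendstoD(2)[OF lim.hyps(3), of "e / 2"] e by simp
      then obtain i where i: "(LBINT t. \<bar>s i t - f t\<bar>) < e / 2" by (auto simp: eventually_sequentially)
      have "(\<lambda>k. LBINT t. \<bar>stek (H k) (s i) t - s i t\<bar>) \<longlonglongrightarrow> 0" using lim.IH H0 H by blast
      moreover have "(LBINT t. \<bar>stek (H k) f t - f t\<bar>) \<le> (LBINT t. \<bar>stek (H k) (s i) t - s i t\<bar>) + e" for k
        using bound[of k i] i by linarith
      ultimately show "\<exists>Y. Y \<longlonglongrightarrow> 0 \<and> (\<forall>k. (LBINT t. \<bar>stek (H k) f t - f t\<bar>) \<le> Y k + e)" by blast
    qed simp
  qed
qed

text \<open>Jensen's inequality for the square, from the nonnegativity of the variance of
  \<open>f\<close> over \<open>(t, t + h]\<close>.\<close>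

lemma stek_square_le:
  assumes f: "L1 f" and f2: "L1 (\<lambda>s. (f s)\<^sup>2)" and h: "h > 0"
  shows "(stek h f t)\<^sup>2 \<le> stek h (\<lambda>s. (f s)\<^sup>2) t"
proof -
  let ?i = "ind {t<..t + h} :: real \<Rightarrow> real"
  let ?m = "stek h f t"
  have i: "L1 ?i" using h by (intro integrable_real_indicator) auto
  have fi: "L1 (\<lambda>s. ?i s * f s)" "L1 (\<lambda>s. ?i s * (f s)\<^sup>2)"
    using f f2 by (auto intro: integrable_ind_mult)
  have m: "(LBINT s. ?i s * f s) = h * ?m" using h by (simp add: stek_def)
  have m2: "(LBINT s. ?i s * (f s)\<^sup>2) = h * stek h (\<lambda>s. (f s)\<^sup>2) t" using h by (simp add: stek_def)
  have "0 \<le> (LBINT s. ?i s * (f s - ?m)\<^sup>2)" by (intro LINT_nonneg) auto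
  also have "\<dots> = (LBINT s. ?i s * (f s)\<^sup>2 - (2 * ?m) * (?i s * f s) + ?m\<^sup>2 * ?i s)"
    by (intro Bochner_Integration.integral_cong) (auto simp: power2_eq_square algebra_simps)
  also have "\<dots> = h * stek h (\<lambda>s. (f s)\<^sup>2) t - (2 * ?m) * (h * ?m) + ?m\<^sup>2 * h"
    using i fi h by (simp add: m m2)
  also have "\<dots> = h * (stek h (\<lambda>s. (f s)\<^sup>2) t - ?m\<^sup>2)" by (simp add: power2_eq_square algebra_simps)
  finally show ?thesis using h by (simp add: zero_le_mult_iff)
qed

lemma stek_nonneg: "(\<And>s. 0 \<le> f s) \<Longrightarrow> h > 0 \<Longrightarrow> 0 \<le> stek h f t"
  unfolding stek_def by (intro divide_nonneg_pos LINT_nonneg) auto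

text \<open>Averages are taken in time only, with \<open>x\<close> as a parameter: the
  one-dimensional limit holds for almost every \<open>x\<close>, and the contraction property
  supplies the majorant for dominated convergence in \<open>x\<close>.\<close>

lemma stek_L1_limit2:
  fixes f :: "real \<times> real \<Rightarrow> real"
  assumes f: "L1 f" and fm: "f \<in> BM"
    and H: "\<And>k. H k > 0" "H \<longlonglongrightarrow> (0 :: real)"
  shows "\<And>k. L1 (\<lambda>p. stek (H k) (\<lambda>s. f (s, snd p)) (fst p))"
    and "(\<lambda>k. LBINT p. \<bar>stek (H k) (\<lambda>s. f (s, snd p)) (fst p) - f p\<bar>) \<longlonglongrightarrow> 0"
proof -
  have sm: "(\<lambda>p. stek h (\<lambda>s. f (s, snd p)) (fst p)) \<in> BM" for h
  proof -
    have "(\<lambda>q. ind {fst (fst q)<..fst (fst q) + h} (snd q) * f (snd q, snd (fst q))) \<in> borel_measurable (borel :: ((real \<times> real) \<times> real) measure)"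
      by (intro borel_measurable_times measurable_indicator_Icc measurable_comp_pair[OF fm] borel_measurable_add measurable_const
          measurable_compose[OF measurable_proj(1)] measurable_proj) auto
    from measurable_integral_param[OF this]
    show ?thesis unfolding stek_def by simp
  qed
  have fx: "AE x in lborel. L1 (\<lambda>t. f (t, x))" using Fubini_snd(2)[OF f] .
  have fa: "L1 (\<lambda>p. \<bar>f p\<bar>)" using f by simp
  show i: "L1 (\<lambda>p. stek (H k) (\<lambda>s. f (s, snd p)) (fst p))" for k
  proof (rule integrable_pairI_snd[OF sm])
    show "AE x in lborel. L1 (\<lambda>t. stek (H k) (\<lambda>s. f (s, snd (t, x))) (fst (t, x)))"
      using fx by eventually_elim (use integrable_stek(1)[OF _ H(1)] in auto)
    show "L1 (\<lambda>x. LBINT t. \<bar>stek (H k) (\<lambda>s. f (s, snd (t, x))) (fst (t, x))\<bar>)"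
    proof (rule L1_bound[OF Fubini_snd(3)[OF fa]])
      have "(\<lambda>p. \<bar>stek (H k) (\<lambda>s. f (s, fst p)) (snd p)\<bar>) \<in> borel_measurable (borel :: (real \<times> real) measure)"
        using measurable_comp_pair[OF sm[of "H k"], of snd borel fst] by simp
      from measurable_integral_param[OF this]
      show "(\<lambda>x. LBINT t. \<bar>stek (H k) (\<lambda>s. f (s, snd (t, x))) (fst (t, x))\<bar>) \<in> borel_measurable lborel" by simp
      show "AE x in lborel. norm (LBINT t. \<bar>stek (H k) (\<lambda>s. f (s, snd (t, x))) (fst (t, x))\<bar>) \<le> norm (LBINT t. \<bar>f (t, x)\<bar>)"
        using fx by eventually_elim (use integrable_stek(2)[OF _ H(1)] in auto)
    qed
  qed
  have d: "L1 (\<lambda>p. \<bar>stek (H k) (\<lambda>s. f (s, snd p)) (fst p) - f p\<bar>)" for k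
    using i[of k] f by auto
  have eq: "(LBINT p. \<bar>stek (H k) (\<lambda>s. f (s, snd p)) (fst p) - f p\<bar>) =
      (LBINT x. LBINT t. \<bar>stek (H k) (\<lambda>s. f (s, x)) t - f (t, x)\<bar>)" for k
    using Fubini_snd(1)[OF d[of k]] by simp
  have "(\<lambda>k. LBINT x. LBINT t. \<bar>stek (H k) (\<lambda>s. f (s, x)) t - f (t, x)\<bar>) \<longlonglongrightarrow> (LINT x::real|lborel. (0::real))"
  proof (rule integral_dominated_convergence[where w="\<lambda>x. 2 * (LBINT t. \<bar>f (t, x)\<bar>)"])
    show "L1 (\<lambda>x. 2 * (LBINT t. \<bar>f (t, x)\<bar>))" using Fubini_snd(3)[OF fa] by simp
    show "AE x in lborel. (\<lambda>k. LBINT t. \<bar>stek (H k) (\<lambda>s. f (s, x)) t - f (t, x)\<bar>) \<longlonglongrightarrow> 0"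
      using fx by eventually_elim (use stek_L1_limit H in blast)
    show "AE x in lborel. norm (LBINT t. \<bar>stek (H k) (\<lambda>s. f (s, x)) t - f (t, x)\<bar>) \<le> 2 * (LBINT t. \<bar>f (t, x)\<bar>)" for k
      using fx
    proof eventually_elim
      case (elim x)
      note st = integrable_stek[OF elim H(1)[of k]]
      have "(LBINT t. \<bar>stek (H k) (\<lambda>s. f (s, x)) t - f (t, x)\<bar>) \<le> (LBINT t. \<bar>stek (H k) (\<lambda>s. f (s, x)) t\<bar> + \<bar>f (t, x)\<bar>)"
        using st(1) elim by (intro integral_mono) auto
      also have "\<dots> \<le> 2 * (LBINT t. \<bar>f (t, x)\<bar>)" using st elim by simp
      finally show ?case by simp
    qed
    show "(\<lambda>x. LBINT t. \<bar>stek (H k) (\<lambda>s. f (s, x)) t - f (t, x)\<bar>) \<in> borel_measurable lborel" for k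
      using Fubini_snd(3)[OF d[of k]] by simp
  qed auto
  then show "(\<lambda>k. LBINT p. \<bar>stek (H k) (\<lambda>s. f (s, snd p)) (fst p) - f p\<bar>) \<longlonglongrightarrow> 0"
    unfolding eq by simp
qed

lemma stek_L2_bound:
  fixes f :: "real \<times> real \<Rightarrow> real"
  assumes f: "L1 f" and fm: "f \<in> BM" and f2: "L1 (\<lambda>p. (f p)\<^sup>2)"
    and h: "h > 0"
  shows "L1 (\<lambda>p. (stek h (\<lambda>s. f (s, snd p)) (fst p))\<^sup>2)"
    and "(LBINT p. (stek h (\<lambda>s. f (s, snd p)) (fst p))\<^sup>2) \<le> (LBINT p. (f p)\<^sup>2)"
proof -
  have f2m: "(\<lambda>p. (f p)\<^sup>2) \<in> BM" using fm by simp
  \<comment> \<open>The sequence starts with \<open>h\<close> itself at \<open>k = 0\<close>; it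
    only serves to quote integrability of the averages for this single step.\<close>
  have hs: "h / real (Suc k) > 0" "(\<lambda>k. h / real (Suc k)) \<longlonglongrightarrow> 0" for k
    using h LIMSEQ_inverse_real_of_nat[THEN tendsto_mult_left, of h] by (auto simp: divide_inverse)
  have i1: "L1 (\<lambda>p. stek h (\<lambda>s. f (s, snd p)) (fst p))"
    using stek_L1_limit2(1)[OF f fm hs, of 0] by simp
  have i2: "L1 (\<lambda>p. stek h (\<lambda>s. (f (s, snd p))\<^sup>2) (fst p))"
    using stek_L1_limit2(1)[OF f2 f2m hs, of 0] by simp
  have le: "AE x in lborel. \<forall>t. (stek h (\<lambda>s. f (s, x)) t)\<^sup>2 \<le> stek h (\<lambda>s. (f (s, x))\<^sup>2) t"
    using Fubini_snd(2)[OF f] Fubini_snd(2)[OF f2]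
    by eventually_elim (use stek_square_le h in auto)
  have le2: "AE p in lborel. (stek h (\<lambda>s. f (s, snd p)) (fst p))\<^sup>2 \<le> stek h (\<lambda>s. (f (s, snd p))\<^sup>2) (fst p)"
  proof (rule AE_pairI_snd)
    have "(\<lambda>p. (stek h (\<lambda>s. f (s, snd p)) (fst p))\<^sup>2) \<in> BM" "(\<lambda>p. stek h (\<lambda>s. (f (s, snd p))\<^sup>2) (fst p)) \<in> BM"
      using i1 i2 by auto
    then show "{p. (stek h (\<lambda>s. f (s, snd p)) (fst p))\<^sup>2 \<le> stek h (\<lambda>s. (f (s, snd p))\<^sup>2) (fst p)} \<in> sets borel"
      by measurable
    show "AE x in lborel. AE t in lborel. (stek h (\<lambda>s. f (s, snd (t, x))) (fst (t, x)))\<^sup>2 \<le> stek h (\<lambda>s. (f (s, snd (t, x)))\<^sup>2) (fst (t, x))"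
      using le by eventually_elim auto
  qed
  show i3: "L1 (\<lambda>p. (stek h (\<lambda>s. f (s, snd p)) (fst p))\<^sup>2)"
    by (rule L1_bound[OF i2]) (use i1 le2 in \<open>auto elim!: eventually_mono\<close>)
  have "(LBINT p. (stek h (\<lambda>s. f (s, snd p)) (fst p))\<^sup>2) \<le> (LBINT p. stek h (\<lambda>s. (f (s, snd p))\<^sup>2) (fst p))"
    by (rule integral_mono_AE[OF i3 i2 le2])
  also have "\<dots> = (LBINT x. LBINT t. stek h (\<lambda>s. (f (s, x))\<^sup>2) t)"
    using Fubini_snd(1)[OF i2] by simp
  also have "\<dots> \<le> (LBINT x. LBINT t. (f (t, x))\<^sup>2)"
  proof (rule integral_mono_AE)
    show "L1 (\<lambda>x. LBINT t. stek h (\<lambda>s. (f (s, x))\<^sup>2) t)" using Fubini_snd(3)[OF i2] by simp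
    show "L1 (\<lambda>x. LBINT t. (f (t, x))\<^sup>2)" using Fubini_snd(3)[OF f2] by simp
    show "AE x in lborel. (LBINT t. stek h (\<lambda>s. (f (s, x))\<^sup>2) t) \<le> (LBINT t. (f (t, x))\<^sup>2)"
      using Fubini_snd(2)[OF f2]
    proof eventually_elim
      case (elim x)
      have "(LBINT t. stek h (\<lambda>s. (f (s, x))\<^sup>2) t) = (LBINT t. \<bar>stek h (\<lambda>s. (f (s, x))\<^sup>2) t\<bar>)"
        using h by (simp add: stek_nonneg)
      also have "\<dots> \<le> (LBINT t. \<bar>(f (t, x))\<^sup>2\<bar>)" using integrable_stek(2)[OF elim h] .
      finally show ?case by simp
    qed
  qed
  also have "\<dots> = (LBINT p. (f p)\<^sup>2)" using Fubini_snd(1)[OF f2] by simp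
  finally show "(LBINT p. (stek h (\<lambda>s. f (s, snd p)) (fst p))\<^sup>2) \<le> (LBINT p. (f p)\<^sup>2)" .
qed

section \<open>Parameter integrals and Fubini on triples\<close>

lemma measurable_prim_fst:
  fixes f :: "real \<times> real \<Rightarrow> real"
  assumes fm: "f \<in> BM"
  shows "(\<lambda>p. prim (\<lambda>s. f (s, snd p)) (fst p)) \<in> BM"
    and "(\<lambda>p. prim (\<lambda>y. f (fst p, y)) (snd p)) \<in> BM"
proof -
  have "(\<lambda>q. ind {0..fst (fst q)} (snd q) * f (snd q, snd (fst q))) \<in> borel_measurable (borel :: ((real \<times> real) \<times> real) measure)"
    by (intro borel_measurable_times measurable_indicator_Icc measurable_comp_pair[OF fm] borel_measurable_add measurable_const
        measurable_compose[OF measurable_proj(1)] measurable_proj) auto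
  from measurable_integral_param[OF this]
  show "(\<lambda>p. prim (\<lambda>s. f (s, snd p)) (fst p)) \<in> BM" unfolding prim_def by simp
  have "(\<lambda>q. ind {0..snd (fst q)} (snd q) * f (fst (fst q), snd q)) \<in> borel_measurable (borel :: ((real \<times> real) \<times> real) measure)"
    by (intro borel_measurable_times measurable_indicator_Icc measurable_comp_pair[OF fm] borel_measurable_add measurable_const
        measurable_compose[OF measurable_proj(1)] measurable_proj) auto
  from measurable_integral_param[OF this]
  show "(\<lambda>p. prim (\<lambda>y. f (fst p, y)) (snd p)) \<in> BM" unfolding prim_def by simp
qed

text \<open>Triples are nested to the right, whereas the kinetic variable has to be integrated out
  with \<open>(t, x)\<close> held fixed. Regrouping preserves Lebesgue measure because it preserves
  the volume of boxes.\<close>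

lemma lborel_assoc:
  "distr (lborel :: ((real \<times> real) \<times> real) measure) borel (\<lambda>q. (fst (fst q), snd (fst q), snd q)) = lborel"
proof (rule lborel_eqI[symmetric])
  let ?r = "\<lambda>q :: (real \<times> real) \<times> real. (fst (fst q), snd (fst q), snd q)"
  have m: "?r \<in> BM" by (intro borel_measurable_continuous_onI continuous_intros)
  fix l u :: "real \<times> real \<times> real"
  assume lu: "\<And>b. b \<in> Basis \<Longrightarrow> l \<bullet> b \<le> u \<bullet> b"
  obtain l1 l2 l3 u1 u2 u3 where lue: "l = (l1, l2, l3)" "u = (u1, u2, u3)" by (metis prod.exhaust)
  have "l1 \<le> u1" "l2 \<le> u2" "l3 \<le> u3"
    using lu[of "(1, 0, 0)"] lu[of "(0, 1, 0)"] lu[of "(0, 0, 1)"] by (auto simp: lue Basis_prod_def zero_prod_def)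
  have "emeasure (distr lborel borel ?r) (box l u) = emeasure lborel (?r -` box l u)"
    using m by (subst emeasure_distr) auto
  also have "?r -` box l u = box ((l1, l2), l3) ((u1, u2), u3)"
    by (auto simp: lue box_def Basis_prod_def)
  also have "emeasure lborel \<dots> = ennreal (\<Prod>b\<in>Basis. (u - l) \<bullet> b)"
    using \<open>l1 \<le> u1\<close> \<open>l2 \<le> u2\<close> \<open>l3 \<le> u3\<close>
    by (subst emeasure_lborel_box) (auto simp: lue Basis_prod_def prod.union_disjoint sum_prod image_Un prod.reindex inj_on_def mult.assoc)
  finally show "emeasure (distr lborel borel ?r) (box l u) = ennreal (\<Prod>b\<in>Basis. (u - l) \<bullet> b)" .
qed simp

lemma integrable3_iff:
  fixes f :: "real \<times> real \<times> real \<Rightarrow> real"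
  assumes "f \<in> BM"
  shows "L1 (\<lambda>q. f (fst (fst q), snd (fst q), snd q)) \<longleftrightarrow> L1 f"
proof -
  have m: "(\<lambda>q :: (real \<times> real) \<times> real. (fst (fst q), snd (fst q), snd q)) \<in> measurable lborel borel"
    by (subst measurable_cong_sets[OF sets_lborel refl], intro borel_measurable_continuous_onI continuous_intros)
  show ?thesis
    using integrable_distr_eq[OF m, of f] assms by (simp add: lborel_assoc)
qed

lemma Fubini3:
  fixes f :: "real \<times> real \<times> real \<Rightarrow> real"
  assumes f: "L1 f"
  shows "(LBINT q. f q) = (LBINT p. LBINT \<xi>. f (fst p, snd p, \<xi>))"
    and "AE p in lborel. L1 (\<lambda>\<xi>. f (fst p, snd p, \<xi>))"
    and "L1 (\<lambda>p. LBINT \<xi>. f (fst p, snd p, \<xi>))"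
proof -
  have fm: "f \<in> BM" using f by simp
  have m: "(\<lambda>q :: (real \<times> real) \<times> real. (fst (fst q), snd (fst q), snd q)) \<in> measurable lborel borel"
    by (subst measurable_cong_sets[OF sets_lborel refl], intro borel_measurable_continuous_onI continuous_intros)
  have i: "L1 (\<lambda>q. f (fst (fst q), snd (fst q), snd q))"
    using f integrable3_iff[OF fm] by simp
  have "(LBINT q. f q) = (LBINT q. f (fst (fst q), snd (fst q), snd q))"
    using integral_distr[OF m, of f] fm by (simp add: lborel_assoc)
  also have "\<dots> = (LBINT p. LBINT \<xi>. f (fst p, snd p, \<xi>))"
    using Fubini_fst(1)[OF i] by simp
  finally show "(LBINT q. f q) = (LBINT p. LBINT \<xi>. f (fst p, snd p, \<xi>))" .
  show "AE p in lborel. L1 (\<lambda>\<xi>. f (fst p, snd p, \<xi>))"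
    using Fubini_fst(2)[OF i] by simp
  show "L1 (\<lambda>p. LBINT \<xi>. f (fst p, snd p, \<xi>))"
    using Fubini_fst(3)[OF i] by simp
qed

lemma integrable3I:
  fixes f :: "real \<times> real \<times> real \<Rightarrow> real"
  assumes fm: "f \<in> BM"
    and "AE p in lborel. L1 (\<lambda>\<xi>. f (fst p, snd p, \<xi>))"
    and "L1 (\<lambda>p. LBINT \<xi>. \<bar>f (fst p, snd p, \<xi>)\<bar>)"
  shows "L1 f"
proof -
  have "(\<lambda>q :: (real \<times> real) \<times> real. (fst (fst q), snd (fst q), snd q)) \<in> BM"
    by (intro borel_measurable_continuous_onI continuous_intros)
  from measurable_compose[OF this fm]
  have "L1 (\<lambda>q. f (fst (fst q), snd (fst q), snd q))"
    by (rule integrable_pairI_fst) (use assms in auto)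
  then show ?thesis using integrable3_iff[OF fm] by simp
qed

section \<open>Test functions\<close>

text \<open>Off the support the function vanishes in a neighbourhood, so the derivative vanishes too
  and the support does not grow. Hence derivatives of test functions inherit boundedness, compact
  support and vanishing near the lateral boundary.\<close>

lemma test_functions_dir_deriv:
  assumes "\<phi> \<in> test_functions U"
  shows "dir_deriv e \<phi> \<in> test_functions U"
proof -
  have C: "\<And>k. C_k k \<phi>" and K: "compact (closure {p. \<phi> p \<noteq> 0})" "closure {p. \<phi> p \<noteq> 0} \<subseteq> U"
    using assms by (auto simp: test_functions_def)
  have Ck: "C_k k (dir_deriv e \<phi>)" for k using C[of "Suc k"] by simp
  have sub: "{p. dir_deriv e \<phi> p \<noteq> 0} \<subseteq> closure {p. \<phi> p \<noteq> 0}"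
  proof (intro subsetI CollectI)
    fix p assume "p \<in> {p. dir_deriv e \<phi> p \<noteq> 0}"
    then have p: "dir_deriv e \<phi> p \<noteq> 0" by simp
    show "p \<in> closure {p. \<phi> p \<noteq> 0}"
    proof (rule ccontr)
      assume n: "p \<notin> closure {p. \<phi> p \<noteq> 0}"
      have "(\<phi> has_derivative (\<lambda>_. 0)) (at p)"
      proof (rule has_derivative_transform_within_open[OF has_derivative_const open_Compl[OF closed_closure]])
        show "p \<in> - closure {p. \<phi> p \<noteq> 0}" using n by simp
        show "0 = \<phi> q" if "q \<in> - closure {p. \<phi> p \<noteq> 0}" for q
          using that closure_subset[of "{p. \<phi> p \<noteq> 0}"] by auto
      qed
      then have "frechet_derivative \<phi> (at p) = (\<lambda>_. 0)" by (rule frechet_derivative_at[symmetric])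
      then show False using p by (simp add: dir_deriv_def)
    qed
  qed
  have cl: "closure {p. dir_deriv e \<phi> p \<noteq> 0} \<subseteq> closure {p. \<phi> p \<noteq> 0}"
    by (rule closure_minimal[OF sub closed_closure])
  have "compact (closure {p. \<phi> p \<noteq> 0} \<inter> closure {p. dir_deriv e \<phi> p \<noteq> 0})"
    by (rule compact_Int_closed[OF K(1) closed_closure])
  with cl have "compact (closure {p. dir_deriv e \<phi> p \<noteq> 0})"
    by (simp only: Int_absorb1)
  then show ?thesis unfolding test_functions_def using Ck order_trans[OF cl K(2)] by blast
qed

lemma test_functions_continuous:
  assumes "\<phi> \<in> test_functions U"
  shows "continuous_on S \<phi>"
proof -
  have "C_k 0 \<phi>" using assms unfolding test_functions_def by blast
  then show ?thesis by (auto intro: continuous_on_subset)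
qed

lemma test_functions_measurable:
  assumes "\<phi> \<in> test_functions U"
  shows "\<phi> \<in> BM"
  by (intro borel_measurable_continuous_onI test_functions_continuous[OF assms])

lemma test_functions_support:
  assumes "\<phi> \<in> test_functions U"
  obtains K where "compact K" "K \<subseteq> U" "\<And>p. p \<notin> K \<Longrightarrow> \<phi> p = 0"
  using assms closure_subset[of "{p. \<phi> p \<noteq> 0}"]
  by (intro that[of "closure {p. \<phi> p \<noteq> 0}"]) (auto simp: test_functions_def)

lemma test_functions_outside:
  assumes "\<phi> \<in> test_functions U" "p \<notin> U"
  shows "\<phi> p = 0"
  by (rule test_functions_support[OF assms(1)]) (use assms(2) in blast)

lemma test_functions_bounded:
  assumes "\<phi> \<in> test_functions U"
  obtains B where "B \<ge> 0" "\<And>p. \<bar>\<phi> p\<bar> \<le> B"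
proof -
  obtain K where K: "compact K" "K \<subseteq> U" "\<And>p. p \<notin> K \<Longrightarrow> \<phi> p = 0"
    using test_functions_support[OF assms] by metis
  have "bounded (\<phi> ` K)"
    by (intro compact_imp_bounded compact_continuous_image test_functions_continuous[OF assms] K)
  then obtain B where B: "\<And>p. p \<in> K \<Longrightarrow> \<bar>\<phi> p\<bar> \<le> B" by (auto simp: bounded_iff)
  show ?thesis
  proof (rule that[of "max B 0"])
    show "\<bar>\<phi> p\<bar> \<le> max B 0" for p using B[of p] K(3)[of p] by (cases "p \<in> K") auto
  qed simp
qed

lemma test_functions_bounded_support:
  assumes "\<phi> \<in> test_functions U"
  obtains B where "B > 0" "\<And>p. norm p \<ge> B \<Longrightarrow> \<phi> p = 0"
proof -
  obtain K where K: "compact K" "K \<subseteq> U" "\<And>p. p \<notin> K \<Longrightarrow> \<phi> p = 0"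
    using test_functions_support[OF assms] by metis
  obtain B where B: "\<And>p. p \<in> K \<Longrightarrow> norm p \<le> B" using compact_imp_bounded[OF K(1)] by (auto simp: bounded_iff)
  show ?thesis
  proof (rule that[of "max B 0 + 1"])
    show "\<phi> p = 0" if "norm p \<ge> max B 0 + 1" for p using that B[of p] K(3)[of p] by fastforce
  qed simp
qed

lemma test_functions_line:
  assumes "\<phi> \<in> test_functions U"
  shows "((\<lambda>s. \<phi> (p + s *\<^sub>R e)) has_real_derivative dir_deriv e \<phi> (p + s *\<^sub>R e)) (at s)"
proof -
  have "C_k (Suc 0) \<phi>" using assms unfolding test_functions_def by blast
  then have "\<phi> differentiable (at (p + s *\<^sub>R e))" by simp
  then have d: "(\<phi> has_derivative frechet_derivative \<phi> (at (p + s *\<^sub>R e))) (at (p + s *\<^sub>R e))"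
    using frechet_derivative_works by blast
  have l: "((\<lambda>s. p + s *\<^sub>R e) has_derivative (\<lambda>h. h *\<^sub>R e)) (at s)"
    by (auto intro!: derivative_eq_intros)
  have "((\<lambda>s. \<phi> (p + s *\<^sub>R e)) has_derivative (\<lambda>h. frechet_derivative \<phi> (at (p + s *\<^sub>R e)) (h *\<^sub>R e))) (at s)"
    using has_derivative_compose[OF l d] .
  moreover have "(\<lambda>h. frechet_derivative \<phi> (at (p + s *\<^sub>R e)) (h *\<^sub>R e)) = (*) (dir_deriv e \<phi> (p + s *\<^sub>R e))"
    using linear_cmul[OF has_derivative_linear[OF d]] by (auto simp: dir_deriv_def fun_eq_iff)
  ultimately show ?thesis by (simp add: has_field_derivative_def)
qed

lemma test_functions_partial2:
  fixes \<phi> :: "real \<times> real \<Rightarrow> real"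
  assumes "\<phi> \<in> test_functions U"
  shows "((\<lambda>t. \<phi> (t, x)) has_real_derivative dt \<phi> (t, x)) (at t)"
    and "((\<lambda>x. \<phi> (t, x)) has_real_derivative dx \<phi> (t, x)) (at x)"
  using test_functions_line[OF assms, of "(0, x)" "(1, 0)" t] test_functions_line[OF assms, of "(t, 0)" "(0, 1)" x]
  by simp_all

lemma test_functions_partial3:
  fixes \<phi> :: "real \<times> real \<times> real \<Rightarrow> real"
  assumes "\<phi> \<in> test_functions U"
  shows "((\<lambda>t. \<phi> (t, x, y)) has_real_derivative dir_deriv (1, 0, 0) \<phi> (t, x, y)) (at t)"
    and "((\<lambda>y. \<phi> (t, x, y)) has_real_derivative dir_deriv (0, 0, 1) \<phi> (t, x, y)) (at y)"
  using test_functions_line[OF assms, of "(0, x, y)" "(1, 0, 0)" t] test_functions_line[OF assms, of "(t, x, 0)" "(0, 0, 1)" y]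
  by simp_all

section \<open>Absolutely continuous functions of one variable and the chain rule along strain
  paths\<close>

lemma prim_FTC:
  assumes "\<And>s. (f has_real_derivative f' s) (at s)" "continuous_on UNIV f'" "0 \<le> t"
  shows "prim f' t = f t - f 0"
proof -
  have "(LBINT s. f' s * ind {0..t} s) = f t - f 0"
    using assms by (intro integral_FTC_Icc_real) (auto simp: continuous_on_eq_continuous_at)
  then show ?thesis by (simp add: prim_def mult.commute)
qed

text \<open>Integration by parts with free constants: applied in time \<open>p\<close> and
  \<open>c\<close> are initial values, applied in space they are values at the left end.\<close>

lemma ac_ibp:
  assumes f: "L1 f" and g: "L1 g"
  shows "(LBINT y. ind {0..a} y * ((p + prim f y) * g y + f y * (c + prim g y)))
    = (p + prim f a) * (c + prim g a) - p * c"
proof -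
  have i: "L1 (\<lambda>y. ind {0..a} y * (prim f y * g y))" "L1 (\<lambda>y. ind {0..a} y * (f y * prim g y))"
    "L1 (\<lambda>y. ind {0..a} y * f y)" "L1 (\<lambda>y. ind {0..a} y * g y)"
    using integrable_prim_mult[OF f g] integrable_prim_mult[OF g f, of a] integrable_ind_mult[OF f, of "{0..a}"] integrable_ind_mult[OF g, of "{0..a}"]
    by (simp_all add: mult.commute[of "prim g _" "f _"])
  have "(LBINT y. ind {0..a} y * ((p + prim f y) * g y + f y * (c + prim g y))) =
      (LBINT y. (ind {0..a} y * (prim f y * g y) + ind {0..a} y * (f y * prim g y))
        + (p * (ind {0..a} y * g y) + c * (ind {0..a} y * f y)))"
    by (intro LINT_cong) (simp add: algebra_simps)
  also have "\<dots> = (LBINT y. ind {0..a} y * (prim f y * g y) + ind {0..a} y * (f y * prim g y))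
     + (p * prim g a + c * prim f a)"
    using i by (simp add: prim_def)
  also have "(LBINT y. ind {0..a} y * (prim f y * g y) + ind {0..a} y * (f y * prim g y)) = prim f a * prim g a"
    unfolding prim_mult_prim[OF f g] by (simp add: distrib_left)
  finally show ?thesis by (simp add: algebra_simps)
qed

text \<open>A point of the open interval violating a closed condition would have a whole ball of
  violations, which has positive measure; the endpoints follow by closure. Turns almost-everywhere
  facts about continuous functions into pointwise ones, in particular at 0 and at the ends.\<close>

lemma AE_closed_interval:
  fixes P :: "real \<Rightarrow> bool"
  assumes cl: "closed {t. P t}" and ae: "AE t in lborel. t \<in> {a<..<b} \<longrightarrow> P t" and t: "t \<in> {a..b}" "a < b"
  shows "P t"
proof -
  have "{a<..<b} \<subseteq> {t. P t}"
  proof (rule ccontr)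
    assume "\<not> {a<..<b} \<subseteq> {t. P t}"
    then obtain x where x: "x \<in> {a<..<b} - {t. P t}" by blast
    have "open ({a<..<b} - {t. P t})" by (intro open_Diff cl) simp
    then obtain e where e: "e > 0" "ball x e \<subseteq> {a<..<b} - {t. P t}" using x by (meson openE)
    have "AE t in lborel. t \<notin> ball x e"
      using ae by eventually_elim (use e in blast)
    then have "emeasure lborel (ball x e) = 0"
      using AE_iff_null_sets[of "ball x e" lborel] by (auto dest: null_setsD1)
    moreover have "emeasure lborel (ball x e) = ennreal (2 * e)"
      using e by (simp add: ball_eq_greaterThanLessThan)
    ultimately show False using e by simp
  qed
  then have "closure {a<..<b} \<subseteq> {t. P t}" using cl by (rule closure_minimal)
  then show ?thesis using t by auto
qed

text \<open>Bridge to the gauge integral, in which differentiation under the integral sign is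
  carried out.\<close>

lemma HK_eq_prim:
  assumes "continuous_on UNIV f"
  shows "integral {0..t} f = prim f t"
proof -
  have c: "continuous_on {0..t} f" using assms continuous_on_subset by blast
  have "set_integrable lborel {0..t} f" by (rule borel_integrable_atLeastAtMost') (rule c)
  from set_borel_integral_eq_integral(2)[OF this] show ?thesis
    by (simp add: prim_def set_lebesgue_integral_def)
qed

lemma integrable_ind_bounded:
  fixes f :: "'a::euclidean_space \<Rightarrow> real"
  assumes "A \<in> sets borel" "emeasure lborel A < \<infinity>" "f \<in> BM" "\<And>x. x \<in> A \<Longrightarrow> \<bar>f x\<bar> \<le> B"
  shows "L1 (\<lambda>x. ind A x * f x)"
proof (rule L1_bound[where f="\<lambda>x. B * ind A x"])
  have "L1 (ind A :: 'a \<Rightarrow> real)" using assms by (intro integrable_real_indicator) auto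
  then show "L1 (\<lambda>x. B * ind A x :: real)" by simp
  show "AE x in lborel. norm (ind A x * f x) \<le> norm (B * ind A x)"
    using assms(4) by (intro AE_I2) (fastforce simp: indicator_def)
qed (use assms in auto)

text \<open>The chain rule is applied to \<open>G t l = \<integral>\<^sub>l\<^sup>\<infinity> \<psi> t \<xi> d\<xi>\<close>, written as an integral over a fixed interval.\<close>

lemma kinetic_characteristic:
  fixes \<psi> \<psi>t \<psi>x :: "real \<Rightarrow> real \<Rightarrow> real"
  assumes a: "a > 0" and w: "L1 w" and u: "\<And>t. u t = c + prim w t"
    and uR: "\<And>t. t \<in> {0..a} \<Longrightarrow> \<bar>u t\<bar> \<le> R"
    and d: "\<And>t y. ((\<lambda>t. \<psi> t y) has_real_derivative \<psi>t t y) (at t)"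
      "\<And>t y. (\<psi> t has_real_derivative \<psi>x t y) (at y)"
    and cont: "continuous_on UNIV (\<lambda>(t, y). \<psi> t y)" "continuous_on UNIV (\<lambda>(t, y). \<psi>t t y)" "continuous_on UNIV (\<lambda>(t, y). \<psi>x t y)"
    and supp: "\<And>t y. \<bar>y\<bar> \<ge> B \<Longrightarrow> \<psi> t y = 0" "\<And>t y. \<bar>y\<bar> \<ge> B \<Longrightarrow> \<psi>t t y = 0"
    and fin: "\<And>y. \<psi> a y = 0"
  shows "(LBINT t. ind {0..a} t * ((LBINT y. ind {u t<..} y * \<psi>t t y) - \<psi> t (u t) * w t))
    = - (LBINT y. ind {c<..} y * \<psi> 0 y)"
proof -
  \<comment> \<open>For \<open>\<bar>l\<bar> \<le> R\<close> the interval \<open>[l, l + L]\<close>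
    reaches past the support bound \<open>B\<close>, so the integral over this fixed length is the
    full tail above \<open>l\<close>.\<close>
  define L where "L = max R 0 + max B 0"
  have L: "L \<ge> 0" "L \<ge> R + B" by (auto simp: L_def)
  have tail: "integral {0..L} (\<lambda>\<eta>. f (l + \<eta>)) = (LBINT y. ind {l<..} y * f y)"
    if f: "continuous_on UNIV f" and z: "\<And>y. \<bar>y\<bar> \<ge> B \<Longrightarrow> f y = 0" and l: "\<bar>l\<bar> \<le> R" for f :: "real \<Rightarrow> real" and l
  proof -
    have "continuous_on UNIV (\<lambda>\<eta>. f (l + \<eta>))"
      by (intro continuous_on_compose2[OF f] continuous_intros) auto
    then have "integral {0..L} (\<lambda>\<eta>. f (l + \<eta>)) = prim (\<lambda>\<eta>. f (l + \<eta>)) L" by (rule HK_eq_prim)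
    also have "\<dots> = (LBINT \<eta>. ind {l<..} (l + \<eta>) * f (l + \<eta>))"
      unfolding prim_def
    proof (rule integral_cong_AE)
      have fm: "f \<in> BM" by (rule borel_measurable_continuous_onI[OF f])
      then show "(\<lambda>\<eta>. ind {0..L} \<eta> * f (l + \<eta>)) \<in> borel_measurable lborel"
        "(\<lambda>\<eta>. ind {l<..} (l + \<eta>) * f (l + \<eta>)) \<in> borel_measurable lborel"
        by measurable
      show "AE \<eta> in lborel. ind {0..L} \<eta> * f (l + \<eta>) = ind {l<..} (l + \<eta>) * f (l + \<eta>)"
        using AE_lborel_singleton[of 0]
      proof eventually_elim
        case (elim \<eta>)
        have "f (l + \<eta>) = 0" if "\<eta> > L"
        proof -
          have "l + \<eta> \<ge> B" using that l L unfolding L_def by linarith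
          then show ?thesis using z[of "l + \<eta>"] by linarith
        qed
        then show ?case using elim L by (cases "\<eta> > L") (auto simp: indicator_def)
      qed
    qed
    also have "\<dots> = (LBINT y. ind {l<..} y * f y)"
      using lborel_integral_real_affine[of 1 "\<lambda>y. ind {l<..} y * f y" l] by simp
    finally show ?thesis .
  qed
  have csec: "continuous_on UNIV (h t)" if "continuous_on UNIV (\<lambda>(t, y). h t y)" for h :: "real \<Rightarrow> real \<Rightarrow> real" and t
  proof -
    have "continuous_on UNIV (\<lambda>y :: real. (t, y))" by (intro continuous_intros)
    from continuous_on_compose2[OF that this] show ?thesis by simp
  qed
  have cshift: "continuous_on S (\<lambda>q. h (fst (fst q)) (snd (fst q) + snd q))" if "continuous_on UNIV (\<lambda>(t, y). h t y)" for h :: "real \<Rightarrow> real \<Rightarrow> real" and S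
  proof -
    have "continuous_on S (\<lambda>q. (fst (fst q), snd (fst q) + snd q))" by (intro continuous_intros)
    from continuous_on_compose2[OF that this] show ?thesis by simp
  qed
  define G where "G t l = integral (cbox 0 L) (\<lambda>\<eta>. \<psi> t (l + \<eta>))" for t l
  define Gt where "Gt t l = integral (cbox 0 L) (\<lambda>\<eta>. \<psi>t t (l + \<eta>))" for t l
  define Gl where "Gl t l = integral (cbox 0 L) (\<lambda>\<eta>. \<psi>x t (l + \<eta>))" for t l
  have int: "(\<lambda>\<eta>. \<psi> t (l + \<eta>)) integrable_on cbox 0 L" for t l
    by (intro integrable_continuous continuous_on_compose2[OF csec[OF cont(1)]] continuous_intros) auto
  have 1: "((\<lambda>t. G t l) has_real_derivative Gt t l) (at t)" for t l
    unfolding G_def Gt_def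
  proof (rule leibniz_rule_field_derivative[where U=UNIV])
    have "continuous_on (UNIV \<times> cbox 0 L) ((\<lambda>q. \<psi>t (fst (fst q)) (snd (fst q) + snd q)) \<circ> (\<lambda>(t, \<eta>). ((t, l), \<eta>)))"
      by (intro continuous_on_compose cshift[OF cont(2)]) (auto intro!: continuous_intros simp: case_prod_beta')
    then show "continuous_on (UNIV \<times> cbox 0 L) (\<lambda>(t, \<eta>). \<psi>t t (l + \<eta>))"
      by (simp add: comp_def case_prod_beta')
  qed (use d int in auto)
  have 2: "(G t has_real_derivative Gl t l) (at l)" for t l
    unfolding G_def[abs_def] Gl_def
  proof (rule leibniz_rule_field_derivative[where U=UNIV])
    have "continuous_on (UNIV \<times> cbox 0 L) ((\<lambda>q. \<psi>x (fst (fst q)) (snd (fst q) + snd q)) \<circ> (\<lambda>(l, \<eta>). ((t, l), \<eta>)))"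
      by (intro continuous_on_compose cshift[OF cont(3)]) (auto intro!: continuous_intros simp: case_prod_beta')
    then show "continuous_on (UNIV \<times> cbox 0 L) (\<lambda>(l, \<eta>). \<psi>x t (l + \<eta>))"
      by (simp add: comp_def case_prod_beta')
    show "((\<lambda>l. \<psi> t (l + \<eta>)) has_real_derivative \<psi>x t (l + \<eta>)) (at l within UNIV)" for l \<eta>
      using DERIV_shift[of "\<psi> t" "\<psi>x t (l + \<eta>)" l \<eta>] d(2) by simp
  qed (use int in auto)
  have c1: "continuous_on UNIV (\<lambda>(t, l). Gt t l)" and c2: "continuous_on UNIV (\<lambda>(t, l). Gl t l)"
  proof -
    have "continuous_on UNIV (\<lambda>p. integral (cbox 0 L) (\<lambda>\<eta>. h (fst p) (snd p + \<eta>)))" if "continuous_on UNIV (\<lambda>(t, y). h t y)" for h :: "real \<Rightarrow> real \<Rightarrow> real"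
      by (rule integral_continuous_on_param) (use cshift[OF that, of "UNIV \<times> cbox 0 L"] in \<open>simp add: case_prod_beta'\<close>)
    from this[OF cont(2)] this[OF cont(3)] show "continuous_on UNIV (\<lambda>(t, l). Gt t l)" "continuous_on UNIV (\<lambda>(t, l). Gl t l)"
      by (simp_all add: Gt_def Gl_def case_prod_beta')
  qed
  have "G a (u a) - G 0 c = (LBINT t. ind {0..a} t * (Gt t (u t) + Gl t (u t) * w t))"
    by (rule ac_chain_rule(2)[OF _ w 1 2 c1 c2 u]) (use a in simp)
  moreover have "G a (u a) = 0" by (simp add: G_def fin)
  moreover have "G 0 c = (LBINT y. ind {c<..} y * \<psi> 0 y)"
    unfolding G_def using tail[OF csec[OF cont(1)] supp(1)] uR[of 0] a by (simp add: u)
  moreover have "(LBINT t. ind {0..a} t * (Gt t (u t) + Gl t (u t) * w t)) =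
      (LBINT t. ind {0..a} t * ((LBINT y. ind {u t<..} y * \<psi>t t y) - \<psi> t (u t) * w t))"
  proof (intro LINT_cong)
    fix t
    show "ind {0..a} t * (Gt t (u t) + Gl t (u t) * w t) = ind {0..a} t * ((LBINT y. ind {u t<..} y * \<psi>t t y) - \<psi> t (u t) * w t)"
    proof (cases "t \<in> {0..a}")
      case True
      have "Gt t (u t) = (LBINT y. ind {u t<..} y * \<psi>t t y)"
        unfolding Gt_def using tail[OF csec[OF cont(2)] supp(2) uR[OF True]] by simp
      \<comment> \<open>Moving the lower limit of a tail integral: the derivative integrates back to
        minus the integrand at that limit, the upper end lying outside the support.\<close>
      moreover have "Gl t (u t) = - \<psi> t (u t)"
      proof -
        have "((\<lambda>\<eta>. \<psi>x t (u t + \<eta>)) has_integral \<psi> t (u t + L) - \<psi> t (u t + 0)) {0..L}"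
        proof (rule fundamental_theorem_of_calculus[OF L(1)])
          fix \<eta>
          have "((\<lambda>\<eta>. \<psi> t (u t + \<eta>)) has_real_derivative \<psi>x t (u t + \<eta>)) (at \<eta>)"
            using DERIV_shift[of "\<psi> t" "\<psi>x t (\<eta> + u t)" \<eta> "u t"] d(2) by (simp add: add.commute)
          then show "((\<lambda>\<eta>. \<psi> t (u t + \<eta>)) has_vector_derivative \<psi>x t (u t + \<eta>)) (at \<eta> within {0..L})"
            by (auto simp: has_real_derivative_iff_has_vector_derivative[symmetric] intro: has_field_derivative_at_within)
        qed
        moreover have "\<psi> t (u t + L) = 0"
        proof (rule supp(1))
          show "\<bar>u t + L\<bar> \<ge> B" using uR[OF True] unfolding L_def by linarith
        qed
        ultimately show ?thesis unfolding Gl_def by (simp add: integral_unique)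
      qed
      ultimately show ?thesis by simp
    qed simp
  qed
  ultimately show ?thesis by simp
qed

text \<open>The equation for \<open>v\<close> is tested with \<open>dx \<phi>\<close>, whose time
  derivative should appear as \<open>dx (dt \<phi>)\<close> so that it matches the integration by
  parts in \<open>x\<close>. Differentiating \<phi>(t, x) - \<phi>(0, x), written as a time
  integral, under the integral sign gives exactly this order.\<close>

lemma mixed_partial_prim:
  fixes \<phi> :: "real \<times> real \<Rightarrow> real"
  assumes \<phi>: "\<phi> \<in> test_functions U" and t: "t \<ge> 0"
  shows "dx \<phi> (t, x) = dx \<phi> (0, x) + prim (\<lambda>s. dx (dt \<phi>) (s, x)) t"
proof -
  let ?t = "dt \<phi>" let ?xt = "dx ?t"
  note \<phi>t = test_functions_dir_deriv[OF \<phi>, of "(1, 0)"]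
  note \<phi>xt = test_functions_dir_deriv[OF \<phi>t, of "(0, 1)"]
  have sec: "continuous_on UNIV (\<lambda>s. \<psi> (s, x))" if "\<psi> \<in> test_functions U" for \<psi> x
    by (rule continuous_on_compose2[OF test_functions_continuous[OF that, of UNIV]]) (auto intro!: continuous_intros)
  have "\<phi> (t, x) - \<phi> (0, x) = integral (cbox 0 t) (\<lambda>s. ?t (s, x))" for x
    using prim_FTC[OF test_functions_partial2(1)[OF \<phi>] sec[OF \<phi>t] t] HK_eq_prim[OF sec[OF \<phi>t]] by simp
  moreover have "((\<lambda>x. integral (cbox 0 t) (\<lambda>s. ?t (s, x))) has_real_derivative integral (cbox 0 t) (\<lambda>s. ?xt (s, x))) (at x within UNIV)"
  proof (rule leibniz_rule_field_derivative)
    show "continuous_on (UNIV \<times> cbox 0 t) (\<lambda>(x, s). ?xt (s, x))"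
      unfolding case_prod_beta'
      by (rule continuous_on_compose2[OF test_functions_continuous[OF \<phi>xt, of UNIV]]) (auto intro!: continuous_intros)
    show "(\<lambda>s. ?t (s, x)) integrable_on cbox 0 t" for x
      by (intro integrable_continuous continuous_on_subset[OF sec[OF \<phi>t]]) auto
  qed (use test_functions_partial2(2)[OF \<phi>t] in auto)
  ultimately have "((\<lambda>x. \<phi> (t, x) - \<phi> (0, x)) has_real_derivative integral (cbox 0 t) (\<lambda>s. ?xt (s, x))) (at x)"
    by simp
  moreover have "((\<lambda>x. \<phi> (t, x) - \<phi> (0, x)) has_real_derivative (dx \<phi> (t, x) - dx \<phi> (0, x))) (at x)"
    by (intro DERIV_diff test_functions_partial2(2)[OF \<phi>])
  ultimately have "integral (cbox 0 t) (\<lambda>s. ?xt (s, x)) = dx \<phi> (t, x) - dx \<phi> (0, x)"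
    by (rule DERIV_unique)
  then show ?thesis using HK_eq_prim[OF sec[OF \<phi>xt]] by simp
qed

subsection \<open>Solutions on a finite time strip\<close>

text \<open>
  The solution is cut off to zero outside \<open>QT T\<close>; \<open>w\<close> is \<open>\<partial>\<^sub>x v\<close>, \<open>s\<close> is the stress and \<open>g\<close> is \<open>\<partial>\<^sub>x s\<close>. The
  boundary condition \<open>s = 0\<close> at both ends is contained in \<open>s_x\<close>.
\<close>

locale kv_strip =
  fixes T R :: real and \<sigma> \<sigma>' :: "real \<Rightarrow> real" and u0 v0 :: "real \<Rightarrow> real"
    and u v w s g :: "real \<times> real \<Rightarrow> real"
  assumes T: "T > 0" and R: "R \<ge> 0"
    and \<sigma>: "\<And>\<xi>. (\<sigma> has_real_derivative \<sigma>' \<xi>) (at \<xi>)" and \<sigma>': "continuous_on UNIV \<sigma>'"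
    and meas [measurable]: "u \<in> BM" "v \<in> BM" "w \<in> BM"
      "s \<in> BM" "g \<in> BM" "u0 \<in> BM" "v0 \<in> BM"
    and zero: "\<And>p. p \<notin> QT T \<Longrightarrow> u p = 0 \<and> v p = 0 \<and> w p = 0 \<and> s p = 0 \<and> g p = 0"
    and zero0: "\<And>x. x \<notin> {0<..<1} \<Longrightarrow> u0 x = 0 \<and> v0 x = 0"
    and sq: "L1 (\<lambda>p. (v p)\<^sup>2)" "L1 (\<lambda>p. (w p)\<^sup>2)" "L1 (\<lambda>p. (g p)\<^sup>2)"
    and v0i: "L1 v0"
    and s_eq: "\<And>p. p \<in> QT T \<Longrightarrow> s p = \<sigma> (u p) + w p"
    and u_eq: "AE x in lborel. x \<in> {0<..<1} \<longrightarrow> (\<forall>t\<in>{0<..T}. u (t, x) = u0 x + prim (\<lambda>r. w (r, x)) t)"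
    and v_eq: "AE x in lborel. x \<in> {0<..<1} \<longrightarrow> (\<forall>t\<in>{0<..T}. v (t, x) = v0 x + prim (\<lambda>r. g (r, x)) t)"
    and v_x: "AE t in lborel. t \<in> {0<..T} \<longrightarrow> (\<exists>c. AE x in lborel. x \<in> {0<..<1} \<longrightarrow> v (t, x) = c + prim (\<lambda>y. w (t, y)) x)"
    and s_x: "AE t in lborel. t \<in> {0<..T} \<longrightarrow>
        (AE x in lborel. x \<in> {0<..<1} \<longrightarrow> s (t, x) = prim (\<lambda>y. g (t, y)) x) \<and> prim (\<lambda>y. g (t, y)) 1 = 0"
    and u_bound: "AE p in lborel. \<bar>u p\<bar> \<le> R"
begin

abbreviation Q where "Q \<equiv> QT T"

lemma Q_iff: "(t, x) \<in> Q \<longleftrightarrow> 0 < t \<and> t \<le> T \<and> 0 < x \<and> x < 1"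
  by (rule QT_iff)

lemma Q_sets [measurable]: "Q \<in> sets borel"
  by (rule QT_sets)

lemma Q_int: "L1 (ind Q :: real \<times> real \<Rightarrow> real)"
  using QT_finite by (intro integrable_real_indicator) auto

lemma ints: "L1 v" "L1 w" "L1 g"
  using zero sq by (auto intro!: integrable_of_square[OF Q_int])

lemma \<sigma>_cont: "continuous_on UNIV \<sigma>" "\<sigma> \<in> BM" "\<sigma>' \<in> BM"
proof -
  show c: "continuous_on UNIV \<sigma>"
    using \<sigma> by (meson DERIV_isCont continuous_at_imp_continuous_on)
  show "\<sigma> \<in> BM" "\<sigma>' \<in> BM"
    by (intro borel_measurable_continuous_onI c \<sigma>')+
qed

lemma bounded_on_R:
  fixes f :: "real \<Rightarrow> real"
  assumes "continuous_on UNIV f"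
  obtains B where "B \<ge> 0" "\<And>y. \<bar>y\<bar> \<le> R \<Longrightarrow> \<bar>f y\<bar> \<le> B"
proof -
  have "compact (f ` {-R..R})" by (intro compact_continuous_image continuous_on_subset[OF assms]) auto
  then obtain B where B: "\<And>y. y \<in> {-R..R} \<Longrightarrow> \<bar>f y\<bar> \<le> B" using compact_imp_bounded by (fastforce simp: bounded_iff)
  show ?thesis
    by (rule that[of "max B 0"]) (use B in \<open>auto simp: abs_le_iff le_max_iff_disj\<close>)
qed

lemma integrable_comp_u:
  fixes f :: "real \<Rightarrow> real"
  assumes f: "continuous_on UNIV f" and h: "L1 h"
  shows "L1 (\<lambda>p. h p * f (u p))"
proof -
  obtain B where B: "\<And>y. \<bar>y\<bar> \<le> R \<Longrightarrow> \<bar>f y\<bar> \<le> B" using bounded_on_R[OF f] by blast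
  have "f \<in> BM" by (rule borel_measurable_continuous_onI[OF f])
  then show ?thesis
    by (intro integrable_mult_bounded[where B=B] h) (use u_bound B in \<open>auto elim!: eventually_mono intro: measurable_compose[OF meas(1)]\<close>)
qed

text \<open>The indicator accounts for the points outside \<open>Q\<close>: there \<open>u\<close>
  is set to 0 while \<open>\<sigma> 0\<close> may be nonzero.\<close>

lemma s_split: "s p = ind Q p * \<sigma> (u p) + w p"
  using s_eq[of p] zero[of p] by (cases "p \<in> Q") auto

lemma s_sq: "L1 (\<lambda>p. (s p)\<^sup>2)"
proof -
  have "L1 (\<lambda>p. ind Q p * (\<sigma> (u p))\<^sup>2)"
    by (rule integrable_comp_u[where f="\<lambda>y. (\<sigma> y)\<^sup>2"]) (auto intro!: continuous_intros \<sigma>_cont Q_int)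
  moreover have "(\<lambda>p. (ind Q p * \<sigma> (u p))\<^sup>2) = (\<lambda>p. ind Q p * (\<sigma> (u p))\<^sup>2)" by (simp add: fun_eq_iff indicator_def)
  moreover have "(\<lambda>p. ind Q p * \<sigma> (u p)) \<in> BM" using \<sigma>_cont(2) by simp
  ultimately show ?thesis unfolding s_split by (intro integrable_square_add(1) meas sq) simp_all
qed

lemma s_int: "L1 s"
  using zero s_sq by (auto intro!: integrable_of_square[OF Q_int])

lemma good_x:
  "AE x in lborel. L1 (\<lambda>r. w (r, x)) \<and> L1 (\<lambda>r. g (r, x)) \<and> L1 (\<lambda>r. s (r, x))
     \<and> L1 (\<lambda>r. v (r, x))"
  using Fubini_snd(2)[OF ints(2)] Fubini_snd(2)[OF ints(3)] Fubini_snd(2)[OF s_int] Fubini_snd(2)[OF ints(1)]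
  by eventually_elim auto

lemma good_t:
  "AE t in lborel. L1 (\<lambda>y. w (t, y)) \<and> L1 (\<lambda>y. g (t, y)) \<and> L1 (\<lambda>y. s (t, y))
     \<and> L1 (\<lambda>y. v (t, y))"
  using Fubini_fst(2)[OF ints(2)] Fubini_fst(2)[OF ints(3)] Fubini_fst(2)[OF s_int] Fubini_fst(2)[OF ints(1)]
  by eventually_elim auto

text \<open>For almost every \<open>x\<close> the path is continuous in time, so the essential bound
  holds for all times, including 0. The chain rule along the path needs this, and it gives the bound
  on the initial strain.\<close>

lemma u_path_bound:
  "AE x in lborel. x \<in> {0<..<1} \<longrightarrow> (\<forall>t\<in>{0..T}. \<bar>u0 x + prim (\<lambda>r. w (r, x)) t\<bar> \<le> R)"
  using u_eq good_x AE_snd[OF u_bound]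
proof eventually_elim
  case (elim x)
  show ?case
  proof (intro impI ballI)
    fix t assume x: "x \<in> {0<..<1}" and t: "t \<in> {0..T}"
    show "\<bar>u0 x + prim (\<lambda>r. w (r, x)) t\<bar> \<le> R"
    proof (rule AE_closed_interval[where a=0 and b=T and P="\<lambda>t. \<bar>u0 x + prim (\<lambda>r. w (r, x)) t\<bar> \<le> R"])
      show "closed {t. \<bar>u0 x + prim (\<lambda>r. w (r, x)) t\<bar> \<le> R}"
        by (intro closed_Collect_le continuous_intros continuous_on_prim) (use elim in auto)
      show "AE t in lborel. t \<in> {0<..<T} \<longrightarrow> \<bar>u0 x + prim (\<lambda>r. w (r, x)) t\<bar> \<le> R"
        using elim(3)
      proof eventually_elim
        case (elim t)
        then show ?case using \<open>x \<in> {0<..<1} \<longrightarrow> (\<forall>t\<in>{0<..T}. u (t, x) = u0 x + prim (\<lambda>r. w (r, x)) t)\<close> x by auto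
      qed
    qed (use t T in auto)
  qed
qed

lemma u0_bound: "AE x in lborel. \<bar>u0 x\<bar> \<le> R"
  using u_path_bound
proof eventually_elim
  case (elim x)
  then show ?case using zero0[of x] R T by (cases "x \<in> {0<..<1}") (auto dest: bspec[of _ _ 0])
qed

text \<open>The triple \<phi>, \<phi>t, \<phi>x is linked only through primitives, so that besides
  smooth test functions a time ramp times the primitive of a bounded function is allowed. The
  boundary terms in \<open>x\<close> vanish through the stress and not through \<phi>.\<close>

lemma weak_v:
  fixes \<phi> \<phi>t \<phi>x :: "real \<times> real \<Rightarrow> real"
  assumes m: "\<phi> \<in> BM" "\<phi>t \<in> BM" "\<phi>x \<in> BM"
    and b: "\<And>p. \<bar>\<phi> p\<bar> \<le> B" "\<And>p. \<bar>\<phi>t p\<bar> \<le> B" "\<And>p. \<bar>\<phi>x p\<bar> \<le> B"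
    and i: "\<And>x. L1 (\<lambda>r. \<phi>t (r, x))" "\<And>t. L1 (\<lambda>y. \<phi>x (t, y))"
    and dt: "\<And>t x. t \<in> {0..T} \<Longrightarrow> \<phi> (t, x) = \<phi> (0, x) + prim (\<lambda>r. \<phi>t (r, x)) t"
    and dx: "\<And>t x. x \<in> {0..1} \<Longrightarrow> \<phi> (t, x) = \<phi> (t, 0) + prim (\<lambda>y. \<phi>x (t, y)) x"
    and fin: "\<And>x. \<phi> (T, x) = 0"
  shows "(LBINT p. v p * \<phi>t p - s p * \<phi>x p) + (LBINT x. v0 x * \<phi> (0, x)) = 0"
proof -
  have vi: "L1 (\<lambda>p. v p * \<phi>t p)" "L1 (\<lambda>p. s p * \<phi>x p)" "L1 (\<lambda>p. g p * \<phi> p)"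
    using ints s_int m b by (auto intro!: integrable_mult_bounded[where B=B])
  \<comment> \<open>Two integrations by parts, in time for fixed \<open>x\<close> and in space for
    fixed \<open>t\<close>. Both contain the product of \<open>g\<close> and \<phi>, which cancels
    in the difference.\<close>
  have "(LBINT p. v p * \<phi>t p + g p * \<phi> p) = (LBINT x. LBINT t. v (t, x) * \<phi>t (t, x) + g (t, x) * \<phi> (t, x))"
    using vi by (intro Fubini_snd(1)) auto
  also have "\<dots> = (LBINT x. - (v0 x * \<phi> (0, x)))"
  proof (rule integral_cong_AE)
    have "L1 (\<lambda>p. v p * \<phi>t p + g p * \<phi> p)" using vi by auto
    from Fubini_snd(3)[OF this] show "(\<lambda>x. LBINT t. v (t, x) * \<phi>t (t, x) + g (t, x) * \<phi> (t, x)) \<in> borel_measurable lborel"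
      by simp
    show "(\<lambda>x. - (v0 x * \<phi> (0, x))) \<in> borel_measurable lborel"
      using measurable_section(1)[OF m(1)] by simp
    show "AE x in lborel. (LBINT t. v (t, x) * \<phi>t (t, x) + g (t, x) * \<phi> (t, x)) = - (v0 x * \<phi> (0, x))"
      using v_eq good_x
    proof eventually_elim
      case (elim x)
      show ?case
      proof (cases "x \<in> {0<..<1}")
        case True
        let ?f = "\<lambda>r. \<phi>t (r, x)" and ?g = "\<lambda>r. g (r, x)"
        have gi: "L1 ?g" using elim by simp
        have "(LBINT t. v (t, x) * \<phi>t (t, x) + g (t, x) * \<phi> (t, x)) =
            (LBINT t. ind {0..T} t * ((\<phi> (0, x) + prim ?f t) * ?g t + ?f t * (v0 x + prim ?g t)))"
        proof (rule integral_cong_AE)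
          show "AE t in lborel. v (t, x) * \<phi>t (t, x) + g (t, x) * \<phi> (t, x) =
              ind {0..T} t * ((\<phi> (0, x) + prim ?f t) * ?g t + ?f t * (v0 x + prim ?g t))"
            using AE_lborel_singleton[of 0]
          proof eventually_elim
            fix t :: real assume t: "t \<noteq> 0"
            show "v (t, x) * \<phi>t (t, x) + g (t, x) * \<phi> (t, x) =
              ind {0..T} t * ((\<phi> (0, x) + prim ?f t) * ?g t + ?f t * (v0 x + prim ?g t))"
            proof (cases "t \<in> {0..T}")
              case True': True
              then have "v (t, x) = v0 x + prim ?g t" using elim True t by auto
              then show ?thesis using True' dt[OF True', of x] by (simp add: mult.commute)
            next
              case False
              then have "(t, x) \<notin> Q" by (auto simp: Q_iff)
              then show ?thesis using False zero[of "(t, x)"] by simp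
            qed
          qed
          show "(\<lambda>t. v (t, x) * \<phi>t (t, x) + g (t, x) * \<phi> (t, x)) \<in> borel_measurable lborel"
            using measurable_section(2)[OF meas(2)] measurable_section(2)[OF meas(5)] measurable_section(2)[OF m(1)] measurable_section(2)[OF m(2)]
            by simp
          have "prim ?f \<in> BM" "prim ?g \<in> BM"
            using gi i by (auto intro!: borel_measurable_continuous_onI continuous_on_prim)
          then show "(\<lambda>t. ind {0..T} t * ((\<phi> (0, x) + prim ?f t) * ?g t + ?f t * (v0 x + prim ?g t))) \<in> borel_measurable lborel"
            using gi i(1)[of x] by simp
        qed
        also have "\<dots> = (\<phi> (0, x) + prim ?f T) * (v0 x + prim ?g T) - \<phi> (0, x) * v0 x"
          by (rule ac_ibp[OF i(1) gi])
        also have "\<phi> (0, x) + prim ?f T = 0" using dt[of T x] fin[of x] T by simp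
        finally show ?thesis by simp
      next
        case False
        then have "(t, x) \<notin> Q" for t by (auto simp: Q_iff)
        then show ?thesis using zero zero0[OF False] by simp
      qed
    qed
  qed
  finally have 1: "(LBINT p. v p * \<phi>t p + g p * \<phi> p) + (LBINT x. v0 x * \<phi> (0, x)) = 0" by simp
  have "(LBINT p. g p * \<phi> p + s p * \<phi>x p) = (LBINT t. LBINT x. g (t, x) * \<phi> (t, x) + s (t, x) * \<phi>x (t, x))"
    using vi by (intro Fubini_fst(1)) auto
  also have "\<dots> = (LINT t::real|lborel. (0::real))"
  proof (rule integral_cong_AE)
    have "L1 (\<lambda>p. g p * \<phi> p + s p * \<phi>x p)" using vi by auto
    from Fubini_fst(3)[OF this] show "(\<lambda>t. LBINT x. g (t, x) * \<phi> (t, x) + s (t, x) * \<phi>x (t, x)) \<in> borel_measurable lborel"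
      by simp
    show "AE t in lborel. (LBINT x. g (t, x) * \<phi> (t, x) + s (t, x) * \<phi>x (t, x)) = 0"
      using s_x good_t
    proof eventually_elim
      case (elim t)
      show ?case
      proof (cases "t \<in> {0<..T}")
        case True
        let ?f = "\<lambda>y. \<phi>x (t, y)" and ?g = "\<lambda>y. g (t, y)"
        have gi: "L1 ?g" using elim by simp
        have s: "AE x in lborel. x \<in> {0<..<1} \<longrightarrow> s (t, x) = prim ?g x" and g1: "prim ?g 1 = 0"
          using elim True by auto
        have "(LBINT x. g (t, x) * \<phi> (t, x) + s (t, x) * \<phi>x (t, x)) =
            (LBINT x. ind {0..1} x * ((\<phi> (t, 0) + prim ?f x) * ?g x + ?f x * (0 + prim ?g x)))"
        proof (rule integral_cong_AE)
          show "AE x in lborel. g (t, x) * \<phi> (t, x) + s (t, x) * \<phi>x (t, x) =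
              ind {0..1} x * ((\<phi> (t, 0) + prim ?f x) * ?g x + ?f x * (0 + prim ?g x))"
            using s AE_lborel_singleton[of 0] AE_lborel_singleton[of 1]
          proof eventually_elim
            case (elim x)
            show ?case
            proof (cases "x \<in> {0..1}")
              case True
              then have "s (t, x) = prim ?g x" using elim by auto
              then show ?thesis using True dx[OF True, of t] by (simp add: mult.commute)
            next
              case False
              then have "(t, x) \<notin> Q" by (auto simp: Q_iff)
              then show ?thesis using False zero[of "(t, x)"] by simp
            qed
          qed
          show "(\<lambda>x. g (t, x) * \<phi> (t, x) + s (t, x) * \<phi>x (t, x)) \<in> borel_measurable lborel"
            using measurable_section(1)[OF meas(4)] measurable_section(1)[OF meas(5)] measurable_section(1)[OF m(1)] measurable_section(1)[OF m(3)]
            by simp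
          have "prim ?f \<in> BM" "prim ?g \<in> BM"
            using gi i by (auto intro!: borel_measurable_continuous_onI continuous_on_prim)
          then show "(\<lambda>x. ind {0..1} x * ((\<phi> (t, 0) + prim ?f x) * ?g x + ?f x * (0 + prim ?g x))) \<in> borel_measurable lborel"
            using gi i(2)[of t] by simp
        qed
        also have "\<dots> = (\<phi> (t, 0) + prim ?f 1) * (0 + prim ?g 1) - \<phi> (t, 0) * 0"
          by (rule ac_ibp[OF i(2) gi])
        finally show ?thesis using g1 by simp
      next
        case False
        then have "(t, x) \<notin> Q" for x by (auto simp: Q_iff)
        then show ?thesis using zero by simp
      qed
    qed
  qed simp
  finally have 2: "(LBINT p. g p * \<phi> p + s p * \<phi>x p) = 0" by simp
  from 1 2 vi show ?thesis by simp
qed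

text \<open>A quantitative initial trace: the right-hand side is small for small \<open>t\<close>,
  and uniformly so along a sequence whose \<open>w\<close> is bounded in \<open>L^2\<close>.\<close>

lemma u_initial_L1:
  assumes t: "t \<in> {0<..T}"
  shows "L1 (\<lambda>x. u (t, x) - u0 x)"
    and "(LBINT x. \<bar>u (t, x) - u0 x\<bar>) \<le> (LBINT p. ind {0..t} (fst p) * \<bar>w p\<bar>)"
proof -
  have m: "(\<lambda>p. ind {0..t} (fst p) * \<bar>w p\<bar>) \<in> borel_measurable (borel :: (real \<times> real) measure)"
    by (intro borel_measurable_times measurable_indicator_Icc) auto
  have wi: "L1 (\<lambda>p. ind {0..t} (fst p) * \<bar>w p\<bar>)"
    by (rule L1_bound[OF ints(2)]) (use m in \<open>auto simp: indicator_def\<close>)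
  have le: "AE x in lborel. \<bar>u (t, x) - u0 x\<bar> \<le> (LBINT r. ind {0..t} r * \<bar>w (r, x)\<bar>)"
    using u_eq good_x
  proof eventually_elim
    case (elim x)
    show ?case
    proof (cases "x \<in> {0<..<1}")
      case True
      have "\<bar>u (t, x) - u0 x\<bar> = \<bar>prim (\<lambda>r. w (r, x)) t - prim (\<lambda>r. w (r, x)) 0\<bar>" using elim True t by simp
      also have "\<dots> \<le> prim (\<lambda>r. \<bar>w (r, x)\<bar>) t - prim (\<lambda>r. \<bar>w (r, x)\<bar>) 0"
        by (rule prim_diff_bound) (use elim t in auto)
      also have "\<dots> = prim (\<lambda>r. \<bar>w (r, x)\<bar>) t" by simp
      finally show ?thesis by (simp only: prim_def)
    next
      case False
      then have "(t, x) \<notin> Q" by (auto simp: Q_iff)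
      then show ?thesis using zero[of "(t, x)"] zero0[OF False] by simp
    qed
  qed
  have i2: "L1 (\<lambda>x. LBINT r. ind {0..t} r * \<bar>w (r, x)\<bar>)"
    using Fubini_snd(3)[OF wi] by simp
  show i1: "L1 (\<lambda>x. u (t, x) - u0 x)"
    by (rule L1_bound[OF i2])
      (use le measurable_section(1)[OF meas(1)] in \<open>auto elim!: eventually_mono\<close>)
  have "(LBINT x. \<bar>u (t, x) - u0 x\<bar>) \<le> (LBINT x. LBINT r. ind {0..t} r * \<bar>w (r, x)\<bar>)"
    using i1 i2 le by (intro integral_mono_AE) auto
  also have "\<dots> = (LBINT p. ind {0..t} (fst p) * \<bar>w p\<bar>)"
    using Fubini_snd(1)[OF wi] by simp
  finally show "(LBINT x. \<bar>u (t, x) - u0 x\<bar>) \<le> (LBINT p. ind {0..t} (fst p) * \<bar>w p\<bar>)" .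
qed

end

section \<open>Time shifts and the averaged stress\<close>

lemma AE_shift:
  fixes c :: "'a::euclidean_space"
  assumes "AE t in lborel. P t"
  shows "AE t in lborel. P (t + c)"
proof -
  have m: "(+) c \<in> measurable lborel borel" by simp
  have "AE t in lborel. P (c + t)"
    by (rule AE_distrD[OF m]) (subst lborel_distr_plus, rule assms)
  then show ?thesis by (simp add: add.commute)
qed

lemma integrable_shift:
  fixes c :: "'a::euclidean_space" and f :: "'a \<Rightarrow> real"
  assumes "L1 f"
  shows "L1 (\<lambda>t. f (t + c))"
proof -
  have "integrable (distr lborel borel ((+) c)) f" using assms by (simp add: lborel_distr_plus)
  then have "L1 (\<lambda>t. f (c + t))"
    by (subst (asm) integrable_distr_eq) (use assms in auto)
  then show ?thesis by (simp add: add.commute)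
qed

lemma prim_shift:
  assumes f: "L1 f" and "0 \<le> t" "0 \<le> h"
  shows "prim (\<lambda>r. f (r + h)) t = prim f (t + h) - prim f h"
proof -
  have "prim f (t + h) - prim f h = (LBINT r. ind {h<..t + h} r * f r)"
    using assms by (intro prim_diff) auto
  also have "\<dots> = (LBINT r. ind {h<..t + h} (h + r) * f (h + r))"
    using lborel_integral_real_affine[of 1 "\<lambda>r. ind {h<..t + h} r * f r" h] by simp
  also have "\<dots> = prim (\<lambda>r. f (r + h)) t"
    unfolding prim_def
  proof (rule integral_cong_AE)
    show "AE r in lborel. ind {h<..t + h} (h + r) * f (h + r) = ind {0..t} r * f (r + h)"
      using AE_lborel_singleton[of 0] by eventually_elim (auto simp: indicator_def add.commute)
    have "f \<in> BM" using f by simp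
    then show "(\<lambda>r. ind {h<..t + h} (h + r) * f (h + r)) \<in> borel_measurable lborel"
      "(\<lambda>r. ind {0..t} r * f (r + h)) \<in> borel_measurable lborel"
      by measurable
  qed
  finally show ?thesis by simp
qed

context kv_strip
begin

lemma s_prim_AE: "AE p in lborel. p \<in> Q \<longrightarrow> s p = prim (\<lambda>y. g (fst p, y)) (snd p)"
proof (rule AE_pairI_fst)
  have "(\<lambda>p. prim (\<lambda>y. g (fst p, y)) (snd p)) \<in> BM" by (rule measurable_prim_fst(2)[OF meas(5)])
  then show "{p. p \<in> Q \<longrightarrow> s p = prim (\<lambda>y. g (fst p, y)) (snd p)} \<in> sets borel" by measurable
  show "AE t in lborel. AE x in lborel. (t, x) \<in> Q \<longrightarrow> s (t, x) = prim (\<lambda>y. g (fst (t, x), y)) (snd (t, x))"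
    using s_x
  proof eventually_elim
    case (elim t)
    show ?case
    proof (cases "t \<in> {0<..T}")
      case True
      with elim have "AE x in lborel. x \<in> {0<..<1} \<longrightarrow> s (t, x) = prim (\<lambda>y. g (t, y)) x" by simp
      then show ?thesis by eventually_elim (auto simp: Q_iff)
    qed (auto simp: Q_iff)
  qed
qed

text \<open>Averaging in time commutes with taking primitives in \<open>x\<close>, so the averaged
  stress keeps the averaged \<open>g\<close> as its derivative and still vanishes at both ends. The
  exceptional set of \<open>x\<close> is the same for all \<open>t\<close>.\<close>

lemma stek_s_eq_prim:
  assumes h: "0 < h"
  shows "AE x in lborel. x \<in> {0<..<1} \<longrightarrow> (\<forall>t\<in>{0..T - h}.
      stek h (\<lambda>r. s (r, x)) t = prim (\<lambda>y. stek h (\<lambda>r. g (r, y)) t) x)"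
    and "AE t in lborel. t \<in> {0..T - h} \<longrightarrow> prim (\<lambda>y. stek h (\<lambda>r. g (r, y)) t) 1 = 0"
proof -
  \<comment> \<open>Sections that are not integrable have integral 0, so both iterated integrals are
    defined throughout and the exchange holds for every \<open>t\<close> and
    \<open>x\<close>.\<close>
  have swap: "prim (\<lambda>y. stek h (\<lambda>r. g (r, y)) t) x = (LBINT r. ind {t<..t + h} r * prim (\<lambda>y. g (r, y)) x) / h" for t x
  proof -
    define H where "H p = ind {t<..t + h} (fst p) * (ind {0..x} (snd p) * g p)" for p
    have "L1 H"
      unfolding H_def
      by (rule L1_bound[OF ints(3)])
        (auto simp: indicator_def intro!: borel_measurable_times measurable_indicator_Icc)
    from integral_swap[OF this] have "(LBINT r. LBINT y. H (r, y)) = (LBINT y. LBINT r. H (r, y))" .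
    moreover have "(LBINT y. H (r, y)) = ind {t<..t + h} r * prim (\<lambda>y. g (r, y)) x" for r
      by (simp add: H_def prim_def)
    moreover have "(LBINT r. H (r, y)) = ind {0..x} y * (LBINT r. ind {t<..t + h} r * g (r, y))" for y
      unfolding integral_mult_right_zero[symmetric] by (intro Bochner_Integration.integral_cong) (simp_all add: H_def)
    ultimately have "(LBINT r. ind {t<..t + h} r * prim (\<lambda>y. g (r, y)) x) =
      (LBINT y. ind {0..x} y * (LBINT r. ind {t<..t + h} r * g (r, y)))" by simp
    then show ?thesis by (simp add: prim_def stek_def)
  qed
  have gm: "(\<lambda>r. prim (\<lambda>y. g (r, y)) x) \<in> BM" for x
    using measurable_section(2)[OF measurable_prim_fst(2)[OF meas(5)], of x] by simp
  show "AE x in lborel. x \<in> {0<..<1} \<longrightarrow> (\<forall>t\<in>{0..T - h}.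
      stek h (\<lambda>r. s (r, x)) t = prim (\<lambda>y. stek h (\<lambda>r. g (r, y)) t) x)"
    using AE_snd[OF s_prim_AE]
  proof eventually_elim
    case (elim x)
    show ?case
    proof (intro impI ballI)
      fix t assume x: "x \<in> {0<..<1}" and t: "t \<in> {0..T - h}"
      have "(LBINT r. ind {t<..t + h} r * s (r, x)) = (LBINT r. ind {t<..t + h} r * prim (\<lambda>y. g (r, y)) x)"
      proof (rule integral_cong_AE)
        show "AE r in lborel. ind {t<..t + h} r * s (r, x) = ind {t<..t + h} r * prim (\<lambda>y. g (r, y)) x"
          using elim by eventually_elim (use x t in \<open>auto simp: Q_iff indicator_def\<close>)
        show "(\<lambda>r. ind {t<..t + h} r * s (r, x)) \<in> borel_measurable lborel"
          using measurable_section(2)[OF meas(4)] by simp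
        show "(\<lambda>r. ind {t<..t + h} r * prim (\<lambda>y. g (r, y)) x) \<in> borel_measurable lborel"
          using gm by simp
      qed
      then show "stek h (\<lambda>r. s (r, x)) t = prim (\<lambda>y. stek h (\<lambda>r. g (r, y)) t) x"
        unfolding swap by (simp add: stek_def)
    qed
  qed
  show "AE t in lborel. t \<in> {0..T - h} \<longrightarrow> prim (\<lambda>y. stek h (\<lambda>r. g (r, y)) t) 1 = 0"
  proof (rule AE_I2, rule impI)
    fix t assume t: "t \<in> {0..T - h}"
    have "AE r in lborel. ind {t<..t + h} r * prim (\<lambda>y. g (r, y)) 1 = 0"
      using s_x by eventually_elim (use t in \<open>auto simp: indicator_def\<close>)
    then have "(LBINT r. ind {t<..t + h} r * prim (\<lambda>y. g (r, y)) 1) = 0" by (rule integral_eq_zero_AE)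
    then show "prim (\<lambda>y. stek h (\<lambda>r. g (r, y)) t) 1 = 0" unfolding swap by simp
  qed
qed

text \<open>The time derivative of the average \<open>stek h\<close> of \<open>f\<close>.\<close>

definition dq :: "real \<Rightarrow> (real \<times> real \<Rightarrow> real) \<Rightarrow> real \<times> real \<Rightarrow> real"
  where "dq h f p = (f (fst p + h, snd p) - f p) / h"

lemma dq_measurable: "f \<in> BM \<Longrightarrow> dq h f \<in> BM"
  unfolding dq_def[abs_def]
  by (intro borel_measurable_divide borel_measurable_diff measurable_comp_pair[of f] borel_measurable_add) auto

lemma dq_square:
  assumes fm: "f \<in> BM" and f: "L1 (\<lambda>p. (f p)\<^sup>2)" and h: "h > 0"
  shows "L1 (\<lambda>p. (dq h f p)\<^sup>2)"
proof -
  have "(\<lambda>p. f (p + (h, 0))) \<in> BM"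
    by (rule measurable_compose[OF _ fm]) (intro borel_measurable_continuous_onI continuous_intros)
  then have "L1 (\<lambda>p. (f (p + (h, 0)) - f p)\<^sup>2)"
    using integrable_shift[OF f, of "(h, 0)"] by (intro integrable_square_add(2) fm f)
  then have "L1 (\<lambda>p. (f (p + (h, 0)) - f p)\<^sup>2 / h\<^sup>2)" by simp
  moreover have "(\<lambda>p. (dq h f p)\<^sup>2) = (\<lambda>p. (f (p + (h, 0)) - f p)\<^sup>2 / h\<^sup>2)"
    by (auto simp: fun_eq_iff dq_def power_divide)
  ultimately show ?thesis by simp
qed

lemma stek_weighted_energy:
  assumes h: "0 < h"
  shows "AE x in lborel. - (LBINT t. ind {0..T - h} t * (t * stek h (\<lambda>r. s (r, x)) t * dq h s (t, x)))
     \<le> (LBINT t. (stek h (\<lambda>r. s (r, x)) t)\<^sup>2) / 2"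
proof (cases "h < T")
  case True
  have P2: "AE x in lborel. L1 (\<lambda>t. (stek h (\<lambda>r. s (r, x)) t)\<^sup>2)"
    using Fubini_snd(2)[OF stek_L2_bound(1)[OF s_int meas(4) s_sq h]] by simp
  show ?thesis
    using good_x P2
  proof eventually_elim
    case (elim x)
    then have si: "L1 (\<lambda>r. s (r, x))" by simp
    let ?P = "stek h (\<lambda>r. s (r, x))"
    let ?d = "\<lambda>t. dq h s (t, x)"
    have di: "L1 ?d" unfolding dq_def using integrable_shift[OF si, of h] si by simp
    have P: "?P t = ?P 0 + prim ?d t" if "t \<ge> 0" for t
    proof -
      have "prim ?d t = prim (\<lambda>r. (1 / h) * (s (r + h, x) - s (r, x))) t" by (simp add: dq_def)
      also have "\<dots> = (prim (\<lambda>r. s (r + h, x)) t - prim (\<lambda>r. s (r, x)) t) / h"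
        unfolding prim_cmult using integrable_shift[OF si, of h] si by (simp add: prim_minus)
      also have "prim (\<lambda>r. s (r + h, x)) t = prim (\<lambda>r. s (r, x)) (t + h) - prim (\<lambda>r. s (r, x)) h"
        using prim_shift[OF si that, of h] h by simp
      finally show ?thesis using stek_eq_prim[OF si that] stek_eq_prim[OF si, of 0 h] h by (simp add: diff_divide_distrib)
    qed
    \<comment> \<open>The chain rule is stated for a path given by one formula on the whole line;
      \<open>U\<close> coincides with the average for \<open>t \<ge> 0\<close>.\<close>
    define U where "U t = ?P 0 + prim ?d t" for t
    let ?G = "\<lambda>t l :: real. t * l\<^sup>2 / 2" and ?Gt = "\<lambda>t l :: real. l\<^sup>2 / 2" and ?Gl = "\<lambda>t l :: real. t * l"
    have ch: "L1 (\<lambda>t. ind {0..T - h} t * (?Gt t (U t) + ?Gl t (U t) * ?d t))"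
      "?G (T - h) (U (T - h)) - ?G 0 (?P 0) = (LBINT t. ind {0..T - h} t * (?Gt t (U t) + ?Gl t (U t) * ?d t))"
    proof -
      have a: "0 \<le> T - h" using True by simp
      have Gt: "((\<lambda>t. t * x\<^sup>2 / 2) has_real_derivative x\<^sup>2 / 2) (at t)" for t x :: real
        by (auto intro!: derivative_eq_intros)
      have Gl: "((\<lambda>l. t * l\<^sup>2 / 2) has_real_derivative t * x) (at x)" for t x :: real
        by (auto intro!: derivative_eq_intros)
      have c: "continuous_on UNIV (\<lambda>(t :: real, x :: real). x\<^sup>2 / 2)" "continuous_on UNIV (\<lambda>(t :: real, x). t * x)"
        unfolding case_prod_beta' by (intro continuous_intros; simp)+
      show "L1 (\<lambda>t. ind {0..T - h} t * (?Gt t (U t) + ?Gl t (U t) * ?d t))"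
        by (rule ac_chain_rule(1)[OF a di Gt Gl c U_def])
      show "?G (T - h) (U (T - h)) - ?G 0 (?P 0) = (LBINT t. ind {0..T - h} t * (?Gt t (U t) + ?Gl t (U t) * ?d t))"
        by (rule ac_chain_rule(2)[OF a di Gt Gl c U_def])
    qed
    have Pi: "L1 (\<lambda>t. ind {0..T - h} t * ((?P t)\<^sup>2 / 2))"
      using elim by (intro integrable_ind_mult) auto
    have e: "ind {0..T - h} t * (?Gt t (U t) + ?Gl t (U t) * ?d t) =
       ind {0..T - h} t * ((?P t)\<^sup>2 / 2) + ind {0..T - h} t * (t * ?P t * ?d t)" for t
      using P[of t] by (auto simp: U_def indicator_def)
    have Ki: "L1 (\<lambda>t. ind {0..T - h} t * (t * ?P t * ?d t))"
      using L1_diff[OF ch(1) Pi] unfolding e by simp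
    have "0 \<le> ?G (T - h) (U (T - h)) - ?G 0 (?P 0)" using True by simp
    also have "\<dots> = (LBINT t. ind {0..T - h} t * ((?P t)\<^sup>2 / 2)) + (LBINT t. ind {0..T - h} t * (t * ?P t * ?d t))"
      unfolding ch(2) e using Pi Ki by simp
    finally have "- (LBINT t. ind {0..T - h} t * (t * ?P t * ?d t)) \<le> (LBINT t. ind {0..T - h} t * ((?P t)\<^sup>2 / 2))"
      by simp
    also have "\<dots> \<le> (LBINT t. (?P t)\<^sup>2 / 2)"
      by (rule integral_mono[OF Pi]) (use elim in \<open>auto simp: indicator_def\<close>)
    finally show ?case by simp
  qed
next
  case False
  \<comment> \<open>For \<open>h \<ge> T\<close> the interval is empty or reduces to the point 0,
    where the weight vanishes.\<close>
  have "(LBINT t. ind {0..T - h} t * (t * stek h (\<lambda>r. s (r, x)) t * dq h s (t, x))) = 0" for x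
  proof (rule integral_eq_zero_AE)
    show "AE t in lborel. ind {0..T - h} t * (t * stek h (\<lambda>r. s (r, x)) t * dq h s (t, x)) = 0"
      using False by (intro AE_I2) (auto simp: indicator_def)
  qed
  then show ?thesis by (auto intro!: AE_I2 LINT_nonneg)
qed

text \<open>Let \<open>P\<close> be the averaged stress and \<open>q\<close> its
  \<open>x\<close>-derivative. By the equation for \<open>v\<close>, \<open>q\<close> is also the
  difference quotient of \<open>v\<close>, with \<open>x\<close>-derivative \<open>dq h w\<close>.
  Integrating \<open>(P q)\<close> differentiated in \<open>x\<close> over \<open>(0, 1)\<close>
  leaves nothing, because \<open>P\<close> vanishes at both ends.\<close>

lemma stek_dissipation:
  assumes h: "0 < h"
  shows "AE t in lborel. t \<in> {0<..<T - h} \<longrightarrow>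
    (LBINT x. ind {0<..<1} x * (stek h (\<lambda>r. s (r, x)) t * dq h w (t, x) + (stek h (\<lambda>r. g (r, x)) t)\<^sup>2)) = 0"
proof -
  have qi: "L1 (\<lambda>p. stek h (\<lambda>r. g (r, snd p)) (fst p))"
  proof -
    have hs: "h / real (Suc k) > 0" "(\<lambda>k. h / real (Suc k)) \<longlonglongrightarrow> 0" for k
      using h LIMSEQ_inverse_real_of_nat[THEN tendsto_mult_left, of h] by (auto simp: divide_inverse)
    show ?thesis using stek_L1_limit2(1)[OF ints(3) meas(5) hs, of 0] by simp
  qed
  have qm: "(\<lambda>p. stek h (\<lambda>r. g (r, snd p)) (fst p)) \<in> BM"
    and Pm: "(\<lambda>p. stek h (\<lambda>r. s (r, snd p)) (fst p)) \<in> BM"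
  proof -
    have hs: "h / real (Suc k) > 0" "(\<lambda>k. h / real (Suc k)) \<longlonglongrightarrow> 0" for k
      using h LIMSEQ_inverse_real_of_nat[THEN tendsto_mult_left, of h] by (auto simp: divide_inverse)
    show "(\<lambda>p. stek h (\<lambda>r. g (r, snd p)) (fst p)) \<in> BM" using qi by simp
    show "(\<lambda>p. stek h (\<lambda>r. s (r, snd p)) (fst p)) \<in> BM"
      using borel_measurable_integrable[OF stek_L1_limit2(1)[OF s_int meas(4) hs, of 0]] by simp
  qed
  have qv: "AE x in lborel. x \<in> {0<..<1} \<longrightarrow> (\<forall>t\<in>{0<..<T - h}. stek h (\<lambda>r. g (r, x)) t = (v (t + h, x) - v (t, x)) / h)"
    using v_eq good_x
  proof eventually_elim
    case (elim x)
    then show ?case using h by (auto simp: stek_eq_prim)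
  qed
  show ?thesis
    using v_x AE_shift[OF v_x, of h] good_t AE_shift[OF good_t, of h] Fubini_fst(2)[OF qi] stek_s_eq_prim(2)[OF h]
  proof eventually_elim
    case (elim t)
    show ?case
    proof
      assume t: "t \<in> {0<..<T - h}"
      let ?q = "\<lambda>y. stek h (\<lambda>r. g (r, y)) t" and ?d = "\<lambda>x. dq h w (t, x)"
      have q: "L1 ?q" using elim by simp
      have d: "L1 ?d" using elim by (simp add: dq_def)
      have q1: "prim ?q 1 = 0" using elim(6) t by simp
      obtain c1 where c1: "AE x in lborel. x \<in> {0<..<1} \<longrightarrow> v (t, x) = c1 + prim (\<lambda>y. w (t, y)) x"
        using elim(1) t h by auto
      obtain c2 where c2: "AE x in lborel. x \<in> {0<..<1} \<longrightarrow> v (t + h, x) = c2 + prim (\<lambda>y. w (t + h, y)) x"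
        using elim(2) t h by auto
      have pd: "prim ?d x = (prim (\<lambda>y. w (t + h, y)) x - prim (\<lambda>y. w (t, y)) x) / h" for x
      proof -
        have "prim ?d x = prim (\<lambda>y. (1 / h) * (w (t + h, y) - w (t, y))) x" by (simp add: dq_def)
        also have "\<dots> = (prim (\<lambda>y. w (t + h, y)) x - prim (\<lambda>y. w (t, y)) x) / h"
          unfolding prim_cmult using elim by (simp add: prim_minus)
        finally show ?thesis .
      qed
      define c where "c = (c2 - c1) / h"
      have "(LBINT x. ind {0<..<1} x * (stek h (\<lambda>r. s (r, x)) t * ?d x + (?q x)\<^sup>2)) =
          (LBINT x. ind {0..1} x * ((0 + prim ?q x) * ?d x + ?q x * (c + prim ?d x)))"
      proof (rule integral_cong_AE)
        show "AE x in lborel. ind {0<..<1} x * (stek h (\<lambda>r. s (r, x)) t * ?d x + (?q x)\<^sup>2) =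
          ind {0..1} x * ((0 + prim ?q x) * ?d x + ?q x * (c + prim ?d x))"
          using stek_s_eq_prim(1)[OF h] c1 c2 qv AE_lborel_singleton[of 0] AE_lborel_singleton[of 1]
        proof eventually_elim
          case (elim x)
          show ?case
          proof (cases "x \<in> {0<..<1}")
            case True
            have "stek h (\<lambda>r. s (r, x)) t = prim ?q x" using elim True t by auto
            moreover have "?q x = c + prim ?d x"
              using elim True t h by (simp add: pd c_def diff_divide_distrib add_divide_distrib)
            ultimately show ?thesis using True by (simp add: power2_eq_square)
          next
            case False
            then have "x \<notin> {0..1}" using elim by auto
            then show ?thesis using False by simp
          qed
        qed
        have sm: "?q \<in> BM" "?d \<in> BM" "(\<lambda>x. stek h (\<lambda>r. s (r, x)) t) \<in> BM"
          using q d measurable_section(1)[OF Pm, of t] by simp_all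
        then show "(\<lambda>x. ind {0<..<1} x * (stek h (\<lambda>r. s (r, x)) t * ?d x + (?q x)\<^sup>2)) \<in> borel_measurable lborel"
          by simp
        have "prim ?q \<in> BM" "prim ?d \<in> BM"
          using q d by (auto intro!: borel_measurable_continuous_onI continuous_on_prim)
        with sm show "(\<lambda>x. ind {0..1} x * ((0 + prim ?q x) * ?d x + ?q x * (c + prim ?d x))) \<in> borel_measurable lborel"
          by simp
      qed
      also have "\<dots> = (0 + prim ?q 1) * (c + prim ?d 1) - 0 * c" by (rule ac_ibp[OF q d])
      finally show "(LBINT x. ind {0<..<1} x * (stek h (\<lambda>r. s (r, x)) t * ?d x + (?q x)\<^sup>2)) = 0"
        using q1 by simp
    qed
  qed
qed

end

section \<open>The weighted bound on the space derivative of the stress\<close>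

context kv_strip
begin

text \<open>The first term comes from differentiating the weight \<open>t\<close>. The second comes
  from Young's inequality applied to \<open>T * L\<close> times the product of the averages of
  \<open>s\<close> and of \<open>\<bar>w\<bar>\<close>, where \<open>L\<close> bounds \<sigma>' on
  \<open>[-R, R]\<close>.\<close>

definition dissip :: "real \<Rightarrow> real"
  where "dissip L = (LBINT p. (s p)\<^sup>2) / 2 + T * L / 2 * ((LBINT p. (s p)\<^sup>2) + (LBINT p. (w p)\<^sup>2))"

lemma \<sigma>_lipschitz:
  assumes L: "\<And>y. \<bar>y\<bar> \<le> R \<Longrightarrow> \<bar>\<sigma>' y\<bar> \<le> L" and a: "\<bar>a\<bar> \<le> R" and b: "\<bar>b\<bar> \<le> R"
  shows "\<bar>\<sigma> a - \<sigma> b\<bar> \<le> L * \<bar>a - b\<bar>"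
proof -
  have "norm (\<sigma> a - \<sigma> b) \<le> L * norm (a - b)"
    by (rule field_differentiable_bound[where S="{-R..R}" and f'=\<sigma>'])
      (use L a b \<sigma> in \<open>auto intro: has_field_derivative_at_within\<close>)
  then show ?thesis by simp
qed

text \<open>\<open>stek_weighted_energy\<close> involves \<open>dq h s\<close> and
  \<open>stek_dissipation\<close> involves \<open>dq h w\<close>. They differ by the difference
  quotient of \<sigma>(u), which the Lipschitz bound makes a harmless lower-order term. The final
  constant is free of \<open>h\<close>.\<close>

lemma stek_dissipation_bound:
  assumes h: "0 < h" and L: "\<And>y. \<bar>y\<bar> \<le> R \<Longrightarrow> \<bar>\<sigma>' y\<bar> \<le> L" "L \<ge> 0"
  shows "L1 (\<lambda>p. ind ({0<..<T - h} \<times> {0<..<1}) p * (fst p * (stek h (\<lambda>r. g (r, snd p)) (fst p))\<^sup>2))"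
    and "(LBINT p. ind ({0<..<T - h} \<times> {0<..<1}) p * (fst p * (stek h (\<lambda>r. g (r, snd p)) (fst p))\<^sup>2)) \<le> dissip L"
proof -
  define A where "A = {0<..<T - h} \<times> {0<..<1::real}"
  have A[measurable]: "A \<in> sets borel"
  proof -
    have "A \<in> sets (borel \<Otimes>\<^sub>M borel)" unfolding A_def by (intro pair_measureI) auto
    then show ?thesis by (simp only: borel_prod)
  qed
  define P where "P p = stek h (\<lambda>r. s (r, snd p)) (fst p)" for p
  define q where "q p = stek h (\<lambda>r. g (r, snd p)) (fst p)" for p
  \<comment> \<open>Controls the strain increments: \<open>u\<close> changes over
    \<open>(t, t + h]\<close> by at most \<open>h\<close> times this average.\<close>
  define Y where "Y p = stek h (\<lambda>r. \<bar>w (r, snd p)\<bar>) (fst p)" for p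
  have wa: "L1 (\<lambda>p. \<bar>w p\<bar>)" "(\<lambda>p. \<bar>w p\<bar>) \<in> BM" "L1 (\<lambda>p. \<bar>w p\<bar>\<^sup>2)"
    using ints sq by auto
  have hs: "h / real (Suc k) > 0" "(\<lambda>k. h / real (Suc k)) \<longlonglongrightarrow> 0" for k
    using h LIMSEQ_inverse_real_of_nat[THEN tendsto_mult_left, of h] by (auto simp: divide_inverse)
  have [measurable]: "P \<in> BM" "q \<in> BM" "Y \<in> BM"
    using borel_measurable_integrable[OF stek_L1_limit2(1)[OF s_int meas(4) hs, of 0]]
      borel_measurable_integrable[OF stek_L1_limit2(1)[OF ints(3) meas(5) hs, of 0]]
      borel_measurable_integrable[OF stek_L1_limit2(1)[OF wa(1,2) hs, of 0]]
    by (simp_all add: P_def[abs_def] q_def[abs_def] Y_def[abs_def])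
  have P2: "L1 (\<lambda>p. (P p)\<^sup>2)" "(LBINT p. (P p)\<^sup>2) \<le> (LBINT p. (s p)\<^sup>2)"
    using stek_L2_bound[OF s_int meas(4) s_sq h] by (simp_all add: P_def)
  have q2: "L1 (\<lambda>p. (q p)\<^sup>2)"
    using stek_L2_bound[OF ints(3) meas(5) sq(3) h] by (simp_all add: q_def)
  have Y2: "L1 (\<lambda>p. (Y p)\<^sup>2)" "(LBINT p. (Y p)\<^sup>2) \<le> (LBINT p. (w p)\<^sup>2)"
    using stek_L2_bound[OF wa h] by (simp_all add: Y_def)
  have [measurable]: "dq h s \<in> BM" "dq h w \<in> BM"
    by (intro dq_measurable meas)+
  have Ps: "L1 (\<lambda>p. P p * dq h s p)" and Pw: "L1 (\<lambda>p. P p * dq h w p)"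
    using dq_square[OF meas(4) s_sq h] dq_square[OF meas(3) sq(2) h] P2 by (auto intro!: integrable_prod_of_squares)
  have tb: "AE p in lborel. \<bar>ind A p * fst p\<bar> \<le> T"
    using h T by (intro AE_I2) (auto simp: A_def indicator_def)
  have tm: "(\<lambda>p. ind A p * fst p) \<in> BM" by measurable
  have i1: "L1 (\<lambda>p. (P p * dq h s p) * (ind A p * fst p))"
    and i2: "L1 (\<lambda>p. (P p * dq h w p + (q p)\<^sup>2) * (ind A p * fst p))"
    and i3: "L1 (\<lambda>p. (q p)\<^sup>2 * (ind A p * fst p))"
    using Ps Pw q2 by (auto intro!: integrable_mult_bounded[OF _ tm tb])
  have i4: "L1 (\<lambda>p. (P p * dq h w p + (q p)\<^sup>2) * (ind A p * fst p) - (P p * dq h s p) * (ind A p * fst p)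
       + T * L / 2 * ((P p)\<^sup>2 + (Y p)\<^sup>2))"
    using i1 i2 P2 Y2 by (intro L1_add L1_diff integrable_mult_right)
  have F1: "- (LBINT p. (P p * dq h s p) * (ind A p * fst p)) \<le> (LBINT p. (P p)\<^sup>2) / 2"
  proof -
    have "- (LBINT p. (P p * dq h s p) * (ind A p * fst p)) =
        (LBINT x. - (LBINT t. (P (t, x) * dq h s (t, x)) * (ind A (t, x) * t)))"
      using Fubini_snd(1)[OF i1] by simp
    also have "\<dots> \<le> (LBINT x. (LBINT t. (P (t, x))\<^sup>2) / 2)"
    proof (rule integral_mono_AE)
      show "L1 (\<lambda>x. - (LBINT t. (P (t, x) * dq h s (t, x)) * (ind A (t, x) * t)))"
        using Fubini_snd(3)[OF i1] by simp
      show "L1 (\<lambda>x. (LBINT t. (P (t, x))\<^sup>2) / 2)" using Fubini_snd(3)[OF P2(1)] by simp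
      show "AE x in lborel. - (LBINT t. (P (t, x) * dq h s (t, x)) * (ind A (t, x) * t)) \<le> (LBINT t. (P (t, x))\<^sup>2) / 2"
        using stek_weighted_energy[OF h]
      proof eventually_elim
        case (elim x)
        show ?case
        proof (cases "x \<in> {0<..<1}")
          case True
          have "(LBINT t. (P (t, x) * dq h s (t, x)) * (ind A (t, x) * t)) =
             (LBINT t. ind {0..T - h} t * (t * stek h (\<lambda>r. s (r, x)) t * dq h s (t, x)))"
          proof (rule integral_cong_AE)
            show "AE t in lborel. (P (t, x) * dq h s (t, x)) * (ind A (t, x) * t) =
               ind {0..T - h} t * (t * stek h (\<lambda>r. s (r, x)) t * dq h s (t, x))"
              using AE_lborel_singleton[of "T - h"] AE_lborel_singleton[of 0]
              by eventually_elim (use True in \<open>auto simp: A_def P_def indicator_def\<close>)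
            show "(\<lambda>t. (P (t, x) * dq h s (t, x)) * (ind A (t, x) * t)) \<in> borel_measurable lborel"
            proof -
              have "(\<lambda>p. (P p * dq h s p) * (ind A p * fst p)) \<in> BM" by measurable
              from measurable_section(2)[OF this, of x] show ?thesis by simp
            qed
            have a: "(\<lambda>t. P (t, x)) \<in> BM" "(\<lambda>t. dq h s (t, x)) \<in> BM"
              by (intro measurable_section; measurable)+
            then have "(\<lambda>t. stek h (\<lambda>r. s (r, x)) t) \<in> BM" by (simp add: P_def)
            with a show "(\<lambda>t. ind {0..T - h} t * (t * stek h (\<lambda>r. s (r, x)) t * dq h s (t, x))) \<in> borel_measurable lborel"
              by simp
          qed
          then show ?thesis using elim by (simp add: P_def)
        next
          case False
          then have "ind A (t, x) = (0 :: real)" for t by (auto simp: A_def)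
          then show ?thesis by (simp add: LINT_nonneg)
        qed
      qed
    qed
    also have "\<dots> = (LBINT p. (P p)\<^sup>2) / 2" using Fubini_snd(1)[OF P2(1)] by simp
    finally show ?thesis .
  qed
  have F2: "(LBINT p. (P p * dq h w p + (q p)\<^sup>2) * (ind A p * fst p)) = 0"
  proof -
    have "(LBINT p. (P p * dq h w p + (q p)\<^sup>2) * (ind A p * fst p)) =
      (LBINT t. LBINT x. (P (t, x) * dq h w (t, x) + (q (t, x))\<^sup>2) * (ind A (t, x) * t))"
      using Fubini_fst(1)[OF i2] by simp
    also have "\<dots> = 0"
    proof (rule integral_eq_zero_AE)
      show "AE t in lborel. (LBINT x. (P (t, x) * dq h w (t, x) + (q (t, x))\<^sup>2) * (ind A (t, x) * t)) = 0"
        using stek_dissipation[OF h]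
      proof eventually_elim
        case (elim t)
        show ?case
        proof (cases "t \<in> {0<..<T - h}")
          case True
          have "(LBINT x. (P (t, x) * dq h w (t, x) + (q (t, x))\<^sup>2) * (ind A (t, x) * t)) =
             t * (LBINT x. ind {0<..<1} x * (stek h (\<lambda>r. s (r, x)) t * dq h w (t, x) + (stek h (\<lambda>r. g (r, x)) t)\<^sup>2))"
            unfolding integral_mult_right_zero[symmetric] using True
            by (intro LINT_cong) (auto simp: A_def P_def q_def indicator_def)
          then show ?thesis using elim True by simp
        next
          case False
          then have "ind A (t, x) = (0 :: real)" for x by (auto simp: A_def)
          then show ?thesis by simp
        qed
      qed
    qed
    finally show ?thesis .
  qed
  \<comment> \<open>With \<open>d\<close> the difference quotient of \<sigma>(u),
    \<open>dq h s\<close> is \<open>d + dq h w\<close>, so the left side equals the first two terms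
    on the right plus \<open>P * d * t\<close>. This last product is at most
    \<open>T * L * \<bar>P\<bar> * Y\<close> and is split by Young's inequality.\<close>
  have "AE p in lborel. (q p)\<^sup>2 * (ind A p * fst p) \<le>
      (P p * dq h w p + (q p)\<^sup>2) * (ind A p * fst p) - (P p * dq h s p) * (ind A p * fst p)
       + T * L / 2 * ((P p)\<^sup>2 + (Y p)\<^sup>2)"
  proof (rule AE_pairI_snd)
    show "{p. (q p)\<^sup>2 * (ind A p * fst p) \<le>
      (P p * dq h w p + (q p)\<^sup>2) * (ind A p * fst p) - (P p * dq h s p) * (ind A p * fst p)
       + T * L / 2 * ((P p)\<^sup>2 + (Y p)\<^sup>2)} \<in> sets borel"
      using borel_measurable_le[OF borel_measurable_integrable[OF i3] borel_measurable_integrable[OF i4]]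
      by (simp only: space_lborel space_borel sets_lborel UNIV_I simp_thms)
    show "AE x in lborel. AE t in lborel. (q (t, x))\<^sup>2 * (ind A (t, x) * fst (t, x)) \<le>
      (P (t, x) * dq h w (t, x) + (q (t, x))\<^sup>2) * (ind A (t, x) * fst (t, x)) - (P (t, x) * dq h s (t, x)) * (ind A (t, x) * fst (t, x))
       + T * L / 2 * ((P (t, x))\<^sup>2 + (Y (t, x))\<^sup>2)"
      using u_eq u_path_bound good_x
    proof eventually_elim
      case (elim x)
      have "(q (t, x))\<^sup>2 * (ind A (t, x) * t) \<le>
        (P (t, x) * dq h w (t, x) + (q (t, x))\<^sup>2) * (ind A (t, x) * t) - (P (t, x) * dq h s (t, x)) * (ind A (t, x) * t)
         + T * L / 2 * ((P (t, x))\<^sup>2 + (Y (t, x))\<^sup>2)" for t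
      proof (cases "(t, x) \<in> A")
        case False
        then show ?thesis using T L by simp
      next
        case True
        then have t: "0 < t" "t < T - h" and x: "x \<in> {0<..<1}" by (auto simp: A_def)
        have Qs: "(t, x) \<in> Q" "(t + h, x) \<in> Q" using t x h by (auto simp: Q_iff)
        have ub: "\<bar>u (t, x)\<bar> \<le> R" "\<bar>u (t + h, x)\<bar> \<le> R"
          using elim x t h by (auto simp: Ball_def)
        have wi: "L1 (\<lambda>r. w (r, x))" using elim by simp
        have du: "\<bar>u (t + h, x) - u (t, x)\<bar> \<le> h * Y (t, x)"
        proof -
          have "\<bar>u (t + h, x) - u (t, x)\<bar> = \<bar>prim (\<lambda>r. w (r, x)) (t + h) - prim (\<lambda>r. w (r, x)) t\<bar>"
            using elim x t h by auto
          also have "\<dots> \<le> prim (\<lambda>r. \<bar>w (r, x)\<bar>) (t + h) - prim (\<lambda>r. \<bar>w (r, x)\<bar>) t"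
            using t h by (intro prim_diff_bound[OF wi]) auto
          also have "\<dots> = h * Y (t, x)"
            unfolding Y_def using stek_eq_prim[of "\<lambda>r. \<bar>w (r, x)\<bar>" t h] wi t h by simp
          finally show ?thesis .
        qed
        define d where "d = (\<sigma> (u (t + h, x)) - \<sigma> (u (t, x))) / h"
        have d: "\<bar>d\<bar> \<le> L * Y (t, x)"
        proof -
          have "\<bar>\<sigma> (u (t + h, x)) - \<sigma> (u (t, x))\<bar> \<le> L * (h * Y (t, x))"
            using \<sigma>_lipschitz[OF L(1) ub(2) ub(1)] mult_left_mono[OF du L(2)] by linarith
          then show ?thesis using h by (simp add: d_def abs_divide field_simps)
        qed
        have ds: "dq h s (t, x) = d + dq h w (t, x)"
          using s_eq[OF Qs(1)] s_eq[OF Qs(2)] h by (simp add: dq_def d_def field_simps)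
        have Y0: "0 \<le> Y (t, x)" unfolding Y_def using h by (intro stek_nonneg) auto
        have "P (t, x) * d * t \<le> \<bar>P (t, x)\<bar> * \<bar>d\<bar> * t"
          using t by (intro mult_right_mono) (auto simp: abs_mult[symmetric])
        also have "\<dots> \<le> \<bar>P (t, x)\<bar> * (L * Y (t, x)) * T"
          using d t h L Y0 by (intro mult_mono mult_left_mono) auto
        also have "\<dots> = T * L / 2 * (2 * \<bar>P (t, x)\<bar> * Y (t, x))" by simp
        also have "\<dots> \<le> T * L / 2 * (\<bar>P (t, x)\<bar>\<^sup>2 + (Y (t, x))\<^sup>2)"
          using T L by (intro mult_left_mono sum_squares_bound) auto
        finally have "P (t, x) * d * t \<le> T * L / 2 * ((P (t, x))\<^sup>2 + (Y (t, x))\<^sup>2)" by simp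
        moreover have "(q (t, x))\<^sup>2 * t = (P (t, x) * dq h w (t, x) + (q (t, x))\<^sup>2) * t - P (t, x) * dq h s (t, x) * t + P (t, x) * d * t"
          unfolding ds by (simp add: algebra_simps)
        ultimately show ?thesis using True by simp
      qed
      then show ?case by simp
    qed
  qed
  then have "(LBINT p. (q p)\<^sup>2 * (ind A p * fst p)) \<le>
      (LBINT p. (P p * dq h w p + (q p)\<^sup>2) * (ind A p * fst p) - (P p * dq h s p) * (ind A p * fst p)
       + T * L / 2 * ((P p)\<^sup>2 + (Y p)\<^sup>2))"
    by (intro integral_mono_AE i3 i4)
  also have "\<dots> = (LBINT p. (P p * dq h w p + (q p)\<^sup>2) * (ind A p * fst p)) - (LBINT p. (P p * dq h s p) * (ind A p * fst p))
       + T * L / 2 * ((LBINT p. (P p)\<^sup>2) + (LBINT p. (Y p)\<^sup>2))"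
    using i1 i2 P2 Y2 by simp
  finally have "(LBINT p. (q p)\<^sup>2 * (ind A p * fst p)) \<le>
      (LBINT p. (P p * dq h w p + (q p)\<^sup>2) * (ind A p * fst p)) - (LBINT p. (P p * dq h s p) * (ind A p * fst p))
       + T * L / 2 * ((LBINT p. (P p)\<^sup>2) + (LBINT p. (Y p)\<^sup>2))" .
  moreover have "T * L / 2 * ((LBINT p. (P p)\<^sup>2) + (LBINT p. (Y p)\<^sup>2)) \<le> T * L / 2 * ((LBINT p. (s p)\<^sup>2) + (LBINT p. (w p)\<^sup>2))"
    using P2 Y2 T L by (intro mult_left_mono add_mono) auto
  ultimately have "(LBINT p. (q p)\<^sup>2 * (ind A p * fst p)) \<le> dissip L"
    using P2 F1 F2 unfolding dissip_def by linarith
  then show "(LBINT p. ind ({0<..<T - h} \<times> {0<..<1}) p * (fst p * (stek h (\<lambda>r. g (r, snd p)) (fst p))\<^sup>2)) \<le> dissip L"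
    by (simp add: A_def q_def mult_ac)
  show "L1 (\<lambda>p. ind ({0<..<T - h} \<times> {0<..<1}) p * (fst p * (stek h (\<lambda>r. g (r, snd p)) (fst p))\<^sup>2))"
    using i3 by (simp add: A_def q_def mult_ac)
qed

text \<open>Fatou's lemma as the averaging step tends to 0, along a subsequence on which the
  averages of \<open>g\<close> converge almost everywhere; the bound survives since it does not
  depend on the step.\<close>

lemma weighted_dissipation:
  assumes L: "\<And>y. \<bar>y\<bar> \<le> R \<Longrightarrow> \<bar>\<sigma>' y\<bar> \<le> L" "L \<ge> 0"
  shows "L1 (\<lambda>p. fst p * (g p)\<^sup>2)" and "(LBINT p. fst p * (g p)\<^sup>2) \<le> dissip L"
proof -
  define H where "H k = inverse (real (Suc k))" for k
  have H: "\<And>k. H k > 0" "H \<longlonglongrightarrow> 0" unfolding H_def using LIMSEQ_inverse_real_of_nat by auto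
  define q where "q k p = stek (H k) (\<lambda>r. g (r, snd p)) (fst p)" for k p
  have qi: "L1 (q k)" for k
    using stek_L1_limit2(1)[OF ints(3) meas(5) H] by (simp add: q_def[abs_def])
  have d: "L1 (\<lambda>p. q k p - g p)" for k using qi ints by auto
  have "\<exists>r::nat \<Rightarrow> nat. strict_mono r \<and> (AE p in lborel. (\<lambda>n. q (r n) p - g p) \<longlonglongrightarrow> 0)"
    by (rule tendsto_L1_AE_subseq[OF d]) (use stek_L1_limit2(2)[OF ints(3) meas(5) H] in \<open>simp add: q_def\<close>)
  then obtain r :: "nat \<Rightarrow> nat" where r: "strict_mono r" and lim: "AE p in lborel. (\<lambda>n. q (r n) p - g p) \<longlonglongrightarrow> 0" by blast
  define A where "A k = {0<..<T - H k} \<times> {0<..<1::real}" for k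
  have Am: "A k \<in> sets borel" for k
  proof -
    have "A k \<in> sets (borel \<Otimes>\<^sub>M borel)" unfolding A_def by (intro pair_measureI) auto
    then show ?thesis by (simp only: borel_prod)
  qed
  have Hr: "(\<lambda>n. H (r n)) \<longlonglongrightarrow> 0" using LIMSEQ_subseq_LIMSEQ[OF H(2) r] by (simp add: comp_def)
  have tT: "AE p in lborel. fst (p :: real \<times> real) \<noteq> T"
  proof (rule AE_pairI_fst)
    show "{p :: real \<times> real. fst p \<noteq> T} \<in> sets borel" by measurable
    show "AE t in lborel. AE x::real in lborel. fst (t, x) \<noteq> T" using AE_lborel_singleton[of T] by eventually_elim auto
  qed
  have cv: "AE p in lborel. (\<lambda>n. ind (A (r n)) p * (fst p * (q (r n) p)\<^sup>2)) \<longlonglongrightarrow> fst p * (g p)\<^sup>2"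
    using lim tT
  proof eventually_elim
    case (elim p)
    obtain t x where p: "p = (t, x)" by (cases p)
    have qg: "(\<lambda>n. q (r n) p) \<longlonglongrightarrow> g p" using elim(1) LIM_zero_iff by blast
    show ?case
    proof (cases "p \<in> Q")
      case True
      then have tx: "0 < t" "t < T" "0 < x" "x < 1" using elim(2) by (auto simp: p Q_iff)
      have "eventually (\<lambda>n. H (r n) < T - t) sequentially" using order_tendstoD(2)[OF Hr, of "T - t"] tx by simp
      then have "eventually (\<lambda>n. fst p * (q (r n) p)\<^sup>2 = ind (A (r n)) p * (fst p * (q (r n) p)\<^sup>2)) sequentially"
        by eventually_elim (use tx in \<open>auto simp: A_def p indicator_def\<close>)
      moreover have "(\<lambda>n. fst p * (q (r n) p)\<^sup>2) \<longlonglongrightarrow> fst p * (g p)\<^sup>2" by (intro tendsto_intros qg)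
      ultimately show ?thesis by (rule Lim_transform_eventually[rotated])
    next
      case False
      have "p \<notin> A k" for k using False H(1)[of k] by (auto simp: A_def p Q_iff)
      then show ?thesis using zero[OF False] by simp
    qed
  qed
  have nn: "0 \<le> ind (A k) p * (fst p * (q k p)\<^sup>2)" for k p by (auto simp: A_def indicator_def)
  have b: "(\<integral>\<^sup>+p. ennreal (ind (A k) p * (fst p * (q k p)\<^sup>2)) \<partial>lborel) \<le> ennreal (dissip L)" for k
    using stek_dissipation_bound[OF H(1) L, of k] nn
    by (subst nn_integral_eq_integral) (auto simp: A_def q_def intro!: ennreal_leI)
  have gm: "(\<lambda>p. fst p * (g p)\<^sup>2) \<in> BM" by measurable
  have "(\<integral>\<^sup>+p. ennreal (fst p * (g p)\<^sup>2) \<partial>lborel) = (\<integral>\<^sup>+p. liminf (\<lambda>n. ennreal (ind (A (r n)) p * (fst p * (q (r n) p)\<^sup>2))) \<partial>lborel)"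
  proof (rule nn_integral_cong_AE)
    show "AE p in lborel. ennreal (fst p * (g p)\<^sup>2) = liminf (\<lambda>n. ennreal (ind (A (r n)) p * (fst p * (q (r n) p)\<^sup>2)))"
      using cv by eventually_elim (auto intro!: lim_imp_Liminf[symmetric] tendsto_ennrealI)
  qed
  also have "\<dots> \<le> liminf (\<lambda>n. \<integral>\<^sup>+p. ennreal (ind (A (r n)) p * (fst p * (q (r n) p)\<^sup>2)) \<partial>lborel)"
    using Am qi by (intro nn_integral_liminf) auto
  also have "\<dots> \<le> ennreal (dissip L)"
    using Liminf_mono[of "\<lambda>n. \<integral>\<^sup>+p. ennreal (ind (A (r n)) p * (fst p * (q (r n) p)\<^sup>2)) \<partial>lborel" "\<lambda>_. ennreal (dissip L)" sequentially] b
    by (simp add: Liminf_const)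
  finally have le: "(\<integral>\<^sup>+p. ennreal (fst p * (g p)\<^sup>2) \<partial>lborel) \<le> ennreal (dissip L)" .
  have pos: "0 \<le> fst p * (g p)\<^sup>2" for p
    using zero[of p] by (cases p, cases "p \<in> Q") (auto simp: Q_iff)
  show i: "L1 (\<lambda>p. fst p * (g p)\<^sup>2)"
    unfolding integrable_iff_bounded using le gm pos by (auto intro: le_less_trans)
  have "dissip L \<ge> 0" unfolding dissip_def using T L by (intro add_nonneg_nonneg mult_nonneg_nonneg divide_nonneg_pos) auto
  then show "(LBINT p. fst p * (g p)\<^sup>2) \<le> dissip L"
    using le nn_integral_eq_integral[OF i] pos by simp
qed

end

section \<open>Kinetic and heat identities for a single solution\<close>

lemma measurable_indicator_greaterThan [measurable (raw)]:
  fixes f h :: "'a \<Rightarrow> real"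
  assumes [measurable]: "f \<in> borel_measurable M" "h \<in> borel_measurable M"
  shows "(\<lambda>p. ind {f p<..} (h p) :: real) \<in> borel_measurable M"
proof -
  have "(\<lambda>p. if f p < h p then 1 else 0 :: real) \<in> borel_measurable M" by measurable
  then show ?thesis by (simp add: indicator_def of_bool_def)
qed

lemma continuous_test_section3:
  fixes \<phi> :: "real \<times> real \<times> real \<Rightarrow> real"
  assumes "\<phi> \<in> test_functions U"
  shows "continuous_on UNIV (\<lambda>(t, y). \<phi> (t, x, y))"
  unfolding case_prod_beta'
  by (rule continuous_on_compose2[OF test_functions_continuous[OF assms, of UNIV]]) (auto intro!: continuous_intros)

lemma test_tail_measurable:
  fixes \<phi> :: "real \<times> real \<times> real \<Rightarrow> real"
  assumes \<phi>: "\<phi> \<in> test_functions U" and [measurable]: "f \<in> borel_measurable M" "a \<in> borel_measurable M" "b \<in> borel_measurable M"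
  shows "(\<lambda>p. LBINT \<xi>. ind {f p<..} \<xi> * \<phi> (a p, b p, \<xi>)) \<in> borel_measurable M"
proof -
  have "(\<lambda>q. (\<lambda>(t, x, \<xi>). \<phi> (t, x, \<xi>)) (a (fst q), b (fst q), snd q)) \<in> borel_measurable (M \<Otimes>\<^sub>M lborel)"
  proof (rule measurable_compose[of "\<lambda>q. (a (fst q), b (fst q), snd q)" _ borel])
    show "(\<lambda>q. (a (fst q), b (fst q), snd q)) \<in> borel_measurable (M \<Otimes>\<^sub>M lborel)"
      by (simp add: borel_prod[symmetric])
    show "(\<lambda>(t, x, \<xi>). \<phi> (t, x, \<xi>)) \<in> BM"
      using test_functions_measurable[OF \<phi>] by simp
  qed
  then have "(\<lambda>(p, \<xi>). ind {f p<..} \<xi> * \<phi> (a p, b p, \<xi>)) \<in> borel_measurable (M \<Otimes>\<^sub>M lborel)"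
    unfolding case_prod_beta' by (intro borel_measurable_times measurable_indicator_greaterThan) auto
  then show ?thesis by (rule lborel.borel_measurable_lebesgue_integral)
qed

lemma test_tail_bounded:
  fixes \<phi> :: "real \<times> real \<times> real \<Rightarrow> real"
  assumes \<phi>: "\<phi> \<in> test_functions U"
  obtains C where "\<And>t x l. \<bar>LBINT \<xi>. ind {l<..} \<xi> * \<phi> (t, x, \<xi>)\<bar> \<le> C"
    "\<And>t x l. L1 (\<lambda>\<xi>. ind {l<..} \<xi> * \<phi> (t, x, \<xi>))" "C \<ge> 0"
proof -
  obtain K where K: "\<And>p. \<bar>\<phi> p\<bar> \<le> K" "K \<ge> 0" using test_functions_bounded[OF \<phi>] by metis
  obtain B where B: "B > 0" "\<And>p. norm p \<ge> B \<Longrightarrow> \<phi> p = 0" using test_functions_bounded_support[OF \<phi>] by metis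
  have nrm: "\<bar>\<xi>\<bar> \<le> norm (t, x, \<xi>)" for t x \<xi> :: real
    using norm_snd_le[of "(t, x, \<xi>)"] norm_snd_le[of "(x, \<xi>)"] by (simp add: norm_Pair real_le_rsqrt)
  have bi: "L1 (\<lambda>\<xi>::real. K * ind {-B..B} \<xi>)"
    by (intro integrable_mult_right integrable_real_indicator) (auto simp: emeasure_lborel_Icc_eq)
  have le: "\<bar>ind {l<..} \<xi> * \<phi> (t, x, \<xi>)\<bar> \<le> K * ind {-B..B} \<xi>" for l t x \<xi>
  proof (cases "\<xi> \<in> {-B..B}")
    case False
    then have "\<bar>\<xi>\<bar> \<ge> B" by auto
    then have "\<phi> (t, x, \<xi>) = 0" using nrm[of \<xi> t x] by (intro B(2)) linarith
    then show ?thesis using K by simp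
  qed (use K in \<open>auto simp: indicator_def\<close>)
  have sec: "(\<lambda>\<xi>. \<phi> (t, x, \<xi>)) \<in> BM" for t x
    by (rule measurable_compose[OF _ test_functions_measurable[OF \<phi>]])
      (intro borel_measurable_continuous_onI continuous_intros)
  have i: "L1 (\<lambda>\<xi>. ind {l<..} \<xi> * \<phi> (t, x, \<xi>))" for l t x
    by (rule L1_bound[OF bi]) (use sec[of t x] le K in auto)
  show ?thesis
  proof (rule that[OF _ i])
    fix t x l
    have "\<bar>LBINT \<xi>. ind {l<..} \<xi> * \<phi> (t, x, \<xi>)\<bar> \<le> (LBINT \<xi>. \<bar>ind {l<..} \<xi> * \<phi> (t, x, \<xi>)\<bar>)"
      by (rule integral_abs_bound)
    also have "\<dots> \<le> (LINT \<xi>::real|lborel. K * ind {-B..B} \<xi>)"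
      using i bi le by (intro integral_mono) auto
    also have "\<dots> = 2 * B * K" using B by simp
    finally show "\<bar>LBINT \<xi>. ind {l<..} \<xi> * \<phi> (t, x, \<xi>)\<bar> \<le> 2 * B * K" .
    show "0 \<le> 2 * B * K" using B K by simp
  qed
qed

context kv_strip
begin

text \<open>\<open>kinetic_characteristic\<close> integrated over \<open>x\<close>. The transport
  term still has the form of \<open>w\<close> times \<phi> on the graph of \<open>u\<close>; it is
  unfolded into a \<xi>-integral only with the limit stress, in
  \<open>kinetic_limit\<close>.\<close>

lemma kinetic_level:
  assumes \<phi>: "\<phi> \<in> test_functions ({..<T} \<times> {0<..<1} \<times> UNIV)"
  shows "L1 (\<lambda>p. ind Q p * (LBINT \<xi>. ind {u p<..} \<xi> * dir_deriv (1, 0, 0) \<phi> (fst p, snd p, \<xi>)))"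
    and "L1 (\<lambda>p. w p * \<phi> (fst p, snd p, u p))"
    and "(LBINT p. ind Q p * (LBINT \<xi>. ind {u p<..} \<xi> * dir_deriv (1, 0, 0) \<phi> (fst p, snd p, \<xi>)))
       - (LBINT p. w p * \<phi> (fst p, snd p, u p))
       + (LBINT x. LBINT \<xi>. ind {u0 x<..} \<xi> * \<phi> (0, x, \<xi>)) = 0"
proof -
  let ?\<phi>t = "dir_deriv (1, 0, 0) \<phi>" and ?\<phi>x = "dir_deriv (0, 0, 1) \<phi>"
  note \<phi>t = test_functions_dir_deriv[OF \<phi>, of "(1, 0, 0)"] and \<phi>x = test_functions_dir_deriv[OF \<phi>, of "(0, 0, 1)"]
  obtain C where C: "\<And>t x l. \<bar>LBINT \<xi>. ind {l<..} \<xi> * ?\<phi>t (t, x, \<xi>)\<bar> \<le> C"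
    using test_tail_bounded[OF \<phi>t] by metis
  have am: "(\<lambda>p. LBINT \<xi>. ind {u p<..} \<xi> * ?\<phi>t (fst p, snd p, \<xi>)) \<in> BM"
    by (intro test_tail_measurable[OF \<phi>t]) auto
  show i1: "L1 (\<lambda>p. ind Q p * (LBINT \<xi>. ind {u p<..} \<xi> * ?\<phi>t (fst p, snd p, \<xi>)))"
    by (rule integrable_mult_bounded[OF Q_int am, of C]) (use C in auto)
  have um: "(\<lambda>p. \<phi> (fst p, snd p, u p)) \<in> BM"
    by (rule measurable_compose[OF _ test_functions_measurable[OF \<phi>]]) (intro borel_measurable_Pair; simp)
  obtain K where K: "\<And>p. \<bar>\<phi> p\<bar> \<le> K" using test_functions_bounded[OF \<phi>] by metis
  show i2: "L1 (\<lambda>p. w p * \<phi> (fst p, snd p, u p))"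
    by (rule integrable_mult_bounded[OF ints(2) um, of K]) (use K in auto)
  obtain B where B: "B > 0" "\<And>p. norm p \<ge> B \<Longrightarrow> \<phi> p = 0" using test_functions_bounded_support[OF \<phi>] by metis
  obtain B' where B': "B' > 0" "\<And>p. norm p \<ge> B' \<Longrightarrow> ?\<phi>t p = 0" using test_functions_bounded_support[OF \<phi>t] by metis
  have nrm: "\<bar>\<xi>\<bar> \<le> norm (t, x, \<xi>)" for t x \<xi> :: real
    using norm_snd_le[of "(t, x, \<xi>)"] norm_snd_le[of "(x, \<xi>)"] by (simp add: norm_Pair real_le_rsqrt)
  have i12: "L1 (\<lambda>p. ind Q p * (LBINT \<xi>. ind {u p<..} \<xi> * ?\<phi>t (fst p, snd p, \<xi>)) - w p * \<phi> (fst p, snd p, u p))"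
    using i1 i2 by auto
  have "(LBINT p. ind Q p * (LBINT \<xi>. ind {u p<..} \<xi> * ?\<phi>t (fst p, snd p, \<xi>)) - w p * \<phi> (fst p, snd p, u p))
    = (LBINT x. LBINT t. ind Q (t, x) * (LBINT \<xi>. ind {u (t, x)<..} \<xi> * ?\<phi>t (t, x, \<xi>)) - w (t, x) * \<phi> (t, x, u (t, x)))"
    using Fubini_snd(1)[OF i12] by simp
  also have "\<dots> = (LBINT x. - (LBINT \<xi>. ind {u0 x<..} \<xi> * \<phi> (0, x, \<xi>)))"
  proof (rule integral_cong_AE)
    show "(\<lambda>x. LBINT t. ind Q (t, x) * (LBINT \<xi>. ind {u (t, x)<..} \<xi> * ?\<phi>t (t, x, \<xi>)) - w (t, x) * \<phi> (t, x, u (t, x))) \<in> borel_measurable lborel"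
      using Fubini_snd(3)[OF i12] by simp
    have "(\<lambda>x. LBINT \<xi>. ind {u0 x<..} \<xi> * \<phi> (0, x, \<xi>)) \<in> borel_measurable lborel"
      by (intro test_tail_measurable[OF \<phi>]) auto
    then show "(\<lambda>x. - (LBINT \<xi>. ind {u0 x<..} \<xi> * \<phi> (0, x, \<xi>))) \<in> borel_measurable lborel" by simp
    show "AE x in lborel. (LBINT t. ind Q (t, x) * (LBINT \<xi>. ind {u (t, x)<..} \<xi> * ?\<phi>t (t, x, \<xi>)) - w (t, x) * \<phi> (t, x, u (t, x)))
        = - (LBINT \<xi>. ind {u0 x<..} \<xi> * \<phi> (0, x, \<xi>))"
      using good_x u_eq u_path_bound
    proof eventually_elim
      case (elim x)
      show ?case
      proof (cases "x \<in> {0<..<1}")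
        case False
        have "\<phi> (0, x, \<xi>) = 0" for \<xi> by (rule test_functions_outside[OF \<phi>]) (use False in auto)
        moreover have "(t, x) \<notin> Q" for t using False by (auto simp: Q_iff)
        ultimately show ?thesis using zero by simp
      next
        case True
        have wi: "L1 (\<lambda>r. w (r, x))" using elim by simp
        define U where "U t = u0 x + prim (\<lambda>r. w (r, x)) t" for t
        have cU: "continuous_on UNIV U" unfolding U_def[abs_def] by (intro continuous_intros continuous_on_prim wi)
        then have Um: "U \<in> BM" by (rule borel_measurable_continuous_onI)
        have "(LBINT t. ind Q (t, x) * (LBINT \<xi>. ind {u (t, x)<..} \<xi> * ?\<phi>t (t, x, \<xi>)) - w (t, x) * \<phi> (t, x, u (t, x)))
          = (LBINT t. ind {0..T} t * ((LBINT \<xi>. ind {U t<..} \<xi> * ?\<phi>t (t, x, \<xi>)) - \<phi> (t, x, U t) * w (t, x)))"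
        proof (rule integral_cong_AE)
          show "AE t in lborel. ind Q (t, x) * (LBINT \<xi>. ind {u (t, x)<..} \<xi> * ?\<phi>t (t, x, \<xi>)) - w (t, x) * \<phi> (t, x, u (t, x))
            = ind {0..T} t * ((LBINT \<xi>. ind {U t<..} \<xi> * ?\<phi>t (t, x, \<xi>)) - \<phi> (t, x, U t) * w (t, x))"
            using AE_lborel_singleton[of 0]
          proof eventually_elim
            fix t :: real assume t: "t \<noteq> 0"
            show "ind Q (t, x) * (LBINT \<xi>. ind {u (t, x)<..} \<xi> * ?\<phi>t (t, x, \<xi>)) - w (t, x) * \<phi> (t, x, u (t, x))
            = ind {0..T} t * ((LBINT \<xi>. ind {U t<..} \<xi> * ?\<phi>t (t, x, \<xi>)) - \<phi> (t, x, U t) * w (t, x))"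
            proof (cases "t \<in> {0..T}")
              case True': True
              then have "u (t, x) = U t" "(t, x) \<in> Q" using elim True t by (auto simp: U_def Q_iff)
              then show ?thesis using True' by simp
            next
              case False
              then have "(t, x) \<notin> Q" by (auto simp: Q_iff)
              then show ?thesis using False zero[of "(t, x)"] by simp
            qed
          qed
          have "(\<lambda>p. ind Q p * (LBINT \<xi>. ind {u p<..} \<xi> * ?\<phi>t (fst p, snd p, \<xi>)) - w p * \<phi> (fst p, snd p, u p)) \<in> BM"
            using i12 by simp
          from measurable_section(2)[OF this, of x]
          show "(\<lambda>t. ind Q (t, x) * (LBINT \<xi>. ind {u (t, x)<..} \<xi> * ?\<phi>t (t, x, \<xi>)) - w (t, x) * \<phi> (t, x, u (t, x))) \<in> borel_measurable lborel"
            by simp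
          have "(\<lambda>t. LBINT \<xi>. ind {U t<..} \<xi> * ?\<phi>t (t, x, \<xi>)) \<in> borel_measurable lborel"
            using Um by (intro test_tail_measurable[OF \<phi>t]) auto
          moreover have "(\<lambda>t. \<phi> (t, x, U t)) \<in> BM"
            by (rule measurable_compose[OF _ test_functions_measurable[OF \<phi>]]) (use Um in \<open>intro borel_measurable_Pair; simp\<close>)
          moreover have "(\<lambda>t. w (t, x)) \<in> BM" using wi by simp
          ultimately show "(\<lambda>t. ind {0..T} t * ((LBINT \<xi>. ind {U t<..} \<xi> * ?\<phi>t (t, x, \<xi>)) - \<phi> (t, x, U t) * w (t, x))) \<in> borel_measurable lborel"
            by simp
        qed
        also have "\<dots> = - (LBINT \<xi>. ind {u0 x<..} \<xi> * \<phi> (0, x, \<xi>))"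
        proof (rule kinetic_characteristic[where \<psi>="\<lambda>t y. \<phi> (t, x, y)" and \<psi>t="\<lambda>t y. ?\<phi>t (t, x, y)" and \<psi>x="\<lambda>t y. ?\<phi>x (t, x, y)" and B="max B B'" and R=R])
          show "((\<lambda>t. \<phi> (t, x, y)) has_real_derivative ?\<phi>t (t, x, y)) (at t)" for t y
            by (rule test_functions_partial3(1)[OF \<phi>])
          show "((\<lambda>y. \<phi> (t, x, y)) has_real_derivative ?\<phi>x (t, x, y)) (at y)" for t y
            by (rule test_functions_partial3(2)[OF \<phi>])
          show "U t = u0 x + prim (\<lambda>r. w (r, x)) t" for t by (simp add: U_def)
          show "\<bar>U t\<bar> \<le> R" if "t \<in> {0..T}" for t using elim True that by (simp add: U_def)
          show "\<phi> (t, x, y) = 0" if "max B B' \<le> \<bar>y\<bar>" for t y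
            using nrm[of y t x] that by (intro B(2)) linarith
          show "?\<phi>t (t, x, y) = 0" if "max B B' \<le> \<bar>y\<bar>" for t y
            using nrm[of y t x] that by (intro B'(2)) linarith
          show "\<phi> (T, x, y) = 0" for y by (rule test_functions_outside[OF \<phi>]) auto
        qed (use T wi continuous_test_section3[OF \<phi>] continuous_test_section3[OF \<phi>t] continuous_test_section3[OF \<phi>x] in auto)
        finally show ?thesis .
      qed
    qed
  qed
  finally show "(LBINT p. ind Q p * (LBINT \<xi>. ind {u p<..} \<xi> * dir_deriv (1, 0, 0) \<phi> (fst p, snd p, \<xi>)))
       - (LBINT p. w p * \<phi> (fst p, snd p, u p))
       + (LBINT x. LBINT \<xi>. ind {u0 x<..} \<xi> * \<phi> (0, x, \<xi>)) = 0"
    using i1 i2 by simp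
qed

lemma test_section_integrable:
  fixes \<phi> :: "real \<times> real \<Rightarrow> real"
  assumes \<phi>: "\<phi> \<in> test_functions U"
  shows "L1 (\<lambda>t. \<phi> (t, x))" "L1 (\<lambda>y. \<phi> (t, y))"
proof -
  obtain K where K: "\<And>p. \<bar>\<phi> p\<bar> \<le> K" using test_functions_bounded[OF \<phi>] by metis
  obtain B where B: "B > 0" "\<And>p. norm p \<ge> B \<Longrightarrow> \<phi> p = 0" using test_functions_bounded_support[OF \<phi>] by metis
  note m = measurable_section[OF test_functions_measurable[OF \<phi>]]
  have "L1 (\<lambda>t. ind {-B..B} t * \<phi> (t, x))"
    by (rule integrable_ind_bounded[where B=K]) (use m K in \<open>auto simp: emeasure_lborel_Icc_eq\<close>)
  moreover have "ind {-B..B} t * \<phi> (t, x) = \<phi> (t, x)" for t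
  proof (cases "t \<in> {-B..B}")
    case False
    have "norm (t, x) \<ge> B" using False norm_fst_le[of t x] by auto
    then show ?thesis using B(2) by simp
  qed simp
  ultimately show "L1 (\<lambda>t. \<phi> (t, x))" by simp
  have "L1 (\<lambda>y. ind {-B..B} y * \<phi> (t, y))"
    by (rule integrable_ind_bounded[where B=K]) (use m K in \<open>auto simp: emeasure_lborel_Icc_eq\<close>)
  moreover have "ind {-B..B} y * \<phi> (t, y) = \<phi> (t, y)" for y
  proof (cases "y \<in> {-B..B}")
    case False
    have "norm (t, y) \<ge> B" using False norm_snd_le[of y t] by auto
    then show ?thesis using B(2) by simp
  qed simp
  ultimately show "L1 (\<lambda>y. \<phi> (t, y))" by simp
qed

lemma test_prim:
  fixes \<phi> :: "real \<times> real \<Rightarrow> real"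
  assumes \<phi>: "\<phi> \<in> test_functions U"
  shows "t \<ge> 0 \<Longrightarrow> \<phi> (t, x) = \<phi> (0, x) + prim (\<lambda>r. dt \<phi> (r, x)) t"
    and "x \<ge> 0 \<Longrightarrow> \<phi> (t, x) = \<phi> (t, 0) + prim (\<lambda>y. dx \<phi> (t, y)) x"
proof -
  have c: "continuous_on UNIV (\<lambda>t. \<psi> (t, x))" "continuous_on UNIV (\<lambda>y. \<psi> (t, y))" if "\<psi> \<in> test_functions U" for \<psi> t x
    by (rule continuous_on_compose2[OF test_functions_continuous[OF that, of UNIV]]; auto intro!: continuous_intros)+
  show "t \<ge> 0 \<Longrightarrow> \<phi> (t, x) = \<phi> (0, x) + prim (\<lambda>r. dt \<phi> (r, x)) t"
    using prim_FTC[OF test_functions_partial2(1)[OF \<phi>] c(1)[OF test_functions_dir_deriv[OF \<phi>]], of t x] by simp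
  show "x \<ge> 0 \<Longrightarrow> \<phi> (t, x) = \<phi> (t, 0) + prim (\<lambda>y. dx \<phi> (t, y)) x"
    using prim_FTC[OF test_functions_partial2(2)[OF \<phi>] c(2)[OF test_functions_dir_deriv[OF \<phi>]], of x t] by simp
qed

lemma weak_v_test:
  assumes \<phi>: "\<phi> \<in> test_functions ({..<T} \<times> {0<..<1})"
  shows "(LBINT p. v p * dt \<phi> p - s p * dx \<phi> p) + (LBINT x. v0 x * \<phi> (0, x)) = 0"
proof -
  note \<phi>t = test_functions_dir_deriv[OF \<phi>, of "(1, 0)"] and \<phi>x = test_functions_dir_deriv[OF \<phi>, of "(0, 1)"]
  obtain B0 where B0: "\<And>p. \<bar>\<phi> p\<bar> \<le> B0" using test_functions_bounded[OF \<phi>] by metis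
  obtain B1 where B1: "\<And>p. \<bar>dt \<phi> p\<bar> \<le> B1" using test_functions_bounded[OF \<phi>t] by metis
  obtain B2 where B2: "\<And>p. \<bar>dx \<phi> p\<bar> \<le> B2" using test_functions_bounded[OF \<phi>x] by metis
  show ?thesis
  proof (rule weak_v[where B="max B0 (max B1 B2)"])
    show "\<phi> (T, x) = 0" for x by (rule test_functions_outside[OF \<phi>]) auto
    show "\<bar>\<phi> p\<bar> \<le> max B0 (max B1 B2)" "\<bar>dt \<phi> p\<bar> \<le> max B0 (max B1 B2)"
      "\<bar>dx \<phi> p\<bar> \<le> max B0 (max B1 B2)" for p
      using B0[of p] B1[of p] B2[of p] by linarith+
    show "\<phi> (t, x) = \<phi> (0, x) + prim (\<lambda>r. dt \<phi> (r, x)) t" if "t \<in> {0..T}" for t x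
      by (rule test_prim(1)[OF \<phi>]) (use that in simp)
    show "\<phi> (t, x) = \<phi> (t, 0) + prim (\<lambda>y. dx \<phi> (t, y)) x" if "x \<in> {0..1}" for t x
      by (rule test_prim(2)[OF \<phi>]) (use that in simp)
  qed (rule test_functions_measurable[OF \<phi>] test_functions_measurable[OF \<phi>t] test_functions_measurable[OF \<phi>x]
        test_section_integrable(1)[OF \<phi>t] test_section_integrable(2)[OF \<phi>x])+
qed

text \<open>Neither summand of the stress is differentiated in time as it stands. \<open>A\<close>
  is the chain rule for \<sigma>(u) times \<phi>, \<open>Bx\<close> trades \<open>w\<close> against
  \<open>dt \<phi>\<close> for \<open>v\<close> against \<open>dx (dt \<phi>)\<close>, and
  \<open>Cv\<close> is the equation for \<open>v\<close> tested with \<open>dx \<phi>\<close>;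
  adding them eliminates \<open>v\<close>.\<close>

lemma heat_level:
  assumes \<phi>: "\<phi> \<in> test_functions ({..<T} \<times> {0<..<1})"
  shows "L1 (\<lambda>p. s p * (dt \<phi> p + dx (dx \<phi>) p))"
    and "L1 (\<lambda>p. w p * \<sigma>' (u p) * \<phi> p)"
    and "(LBINT p. s p * (dt \<phi> p + dx (dx \<phi>) p))
       + (LBINT p. w p * \<sigma>' (u p) * \<phi> p)
       + (LBINT x. \<sigma> (u0 x) * \<phi> (0, x)) - (LBINT x. v0 x * dx \<phi> (0, x)) = 0"
proof -
  let ?t = "dt \<phi>" and ?x = "dx \<phi>"
  let ?xx = "dx ?x" and ?xt = "dx ?t"
  note \<phi>t = test_functions_dir_deriv[OF \<phi>, of "(1, 0)"] and \<phi>x = test_functions_dir_deriv[OF \<phi>, of "(0, 1)"]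
  note \<phi>xx = test_functions_dir_deriv[OF \<phi>x, of "(0, 1)"] and \<phi>xt = test_functions_dir_deriv[OF \<phi>t, of "(0, 1)"]
  note \<phi>m[measurable] = test_functions_measurable[OF \<phi>] test_functions_measurable[OF \<phi>t] test_functions_measurable[OF \<phi>x]
    test_functions_measurable[OF \<phi>xx] test_functions_measurable[OF \<phi>xt]
  have bd: "L1 (\<lambda>p. f p * \<psi> p)" if f: "L1 f" and \<psi>: "\<psi> \<in> test_functions U" for f \<psi> and U :: "(real \<times> real) set"
  proof -
    obtain K where K: "\<And>p. \<bar>\<psi> p\<bar> \<le> K" using test_functions_bounded[OF \<psi>] by metis
    show ?thesis by (rule integrable_mult_bounded[OF f test_functions_measurable[OF \<psi>], of K]) (use K in auto)
  qed
  have st: "L1 (\<lambda>p. s p * ?t p)" and sxx: "L1 (\<lambda>p. s p * ?xx p)"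
    using bd[OF s_int \<phi>t] bd[OF s_int \<phi>xx] by auto
  show "L1 (\<lambda>p. s p * (?t p + ?xx p))" using st sxx by (simp add: distrib_left)
  show iw: "L1 (\<lambda>p. w p * \<sigma>' (u p) * \<phi> p)"
    by (intro bd[OF _ \<phi>] integrable_comp_u \<sigma>' ints)
  have i\<sigma>: "L1 (\<lambda>p. ind Q p * \<sigma> (u p) * ?t p)"
    by (intro bd[OF _ \<phi>t] integrable_comp_u \<sigma>_cont Q_int)
  have wt: "L1 (\<lambda>p. w p * ?t p)" and vxt: "L1 (\<lambda>p. v p * ?xt p)"
    using bd[OF ints(2) \<phi>t] bd[OF ints(1) \<phi>xt] by auto
  have A: "(LBINT p. ind Q p * \<sigma> (u p) * ?t p + w p * \<sigma>' (u p) * \<phi> p) = - (LBINT x. \<sigma> (u0 x) * \<phi> (0, x))"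
  proof -
    have i: "L1 (\<lambda>p. ind Q p * \<sigma> (u p) * ?t p + w p * \<sigma>' (u p) * \<phi> p)" using i\<sigma> iw by auto
    have "(LBINT p. ind Q p * \<sigma> (u p) * ?t p + w p * \<sigma>' (u p) * \<phi> p) =
      (LBINT x. LBINT t. ind Q (t, x) * \<sigma> (u (t, x)) * ?t (t, x) + w (t, x) * \<sigma>' (u (t, x)) * \<phi> (t, x))"
      using Fubini_snd(1)[OF i] by simp
    also have "\<dots> = (LBINT x. - (\<sigma> (u0 x) * \<phi> (0, x)))"
    proof (rule integral_cong_AE)
      show "(\<lambda>x. LBINT t. ind Q (t, x) * \<sigma> (u (t, x)) * ?t (t, x) + w (t, x) * \<sigma>' (u (t, x)) * \<phi> (t, x)) \<in> borel_measurable lborel"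
        using Fubini_snd(3)[OF i] by simp
      have "(\<lambda>x. \<sigma> (u0 x)) \<in> BM" by (rule measurable_compose[OF meas(6) \<sigma>_cont(2)])
      then show "(\<lambda>x. - (\<sigma> (u0 x) * \<phi> (0, x))) \<in> borel_measurable lborel"
        using measurable_section(1)[OF \<phi>m(1)] by simp
      show "AE x in lborel. (LBINT t. ind Q (t, x) * \<sigma> (u (t, x)) * ?t (t, x) + w (t, x) * \<sigma>' (u (t, x)) * \<phi> (t, x)) = - (\<sigma> (u0 x) * \<phi> (0, x))"
        using good_x u_eq
      proof eventually_elim
        case (elim x)
        show ?case
        proof (cases "x \<in> {0<..<1}")
          case False
          have "\<phi> (0, x) = 0" by (rule test_functions_outside[OF \<phi>]) (use False in auto)
          moreover have "(t, x) \<notin> Q" for t using False by (auto simp: Q_iff)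
          ultimately show ?thesis using zero by simp
        next
          case True
          have wi: "L1 (\<lambda>r. w (r, x))" using elim by simp
          define U where "U t = u0 x + prim (\<lambda>r. w (r, x)) t" for t
          have cU: "continuous_on UNIV U" unfolding U_def[abs_def] by (intro continuous_intros continuous_on_prim wi)
          have c\<sigma>U: "continuous_on UNIV (\<lambda>t. \<sigma> (U t))" "continuous_on UNIV (\<lambda>t. \<sigma>' (U t))"
            by (rule continuous_on_compose2[OF \<sigma>_cont(1) cU], simp) (rule continuous_on_compose2[OF \<sigma>' cU], simp)
          have "(LBINT t. ind Q (t, x) * \<sigma> (u (t, x)) * ?t (t, x) + w (t, x) * \<sigma>' (u (t, x)) * \<phi> (t, x)) =
            (LBINT t. ind {0..T} t * (\<sigma> (U t) * ?t (t, x) + (\<sigma>' (U t) * \<phi> (t, x)) * w (t, x)))"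
          proof (rule integral_cong_AE)
            show "AE t in lborel. ind Q (t, x) * \<sigma> (u (t, x)) * ?t (t, x) + w (t, x) * \<sigma>' (u (t, x)) * \<phi> (t, x) =
               ind {0..T} t * (\<sigma> (U t) * ?t (t, x) + (\<sigma>' (U t) * \<phi> (t, x)) * w (t, x))"
              using AE_lborel_singleton[of 0]
            proof eventually_elim
              fix t :: real assume t: "t \<noteq> 0"
              show "ind Q (t, x) * \<sigma> (u (t, x)) * ?t (t, x) + w (t, x) * \<sigma>' (u (t, x)) * \<phi> (t, x) =
               ind {0..T} t * (\<sigma> (U t) * ?t (t, x) + (\<sigma>' (U t) * \<phi> (t, x)) * w (t, x))"
              proof (cases "t \<in> {0..T}")
                case True': True
                then have "u (t, x) = U t" "(t, x) \<in> Q" using elim True t by (auto simp: U_def Q_iff)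
                then show ?thesis using True' by (simp add: mult_ac)
              next
                case False
                then have "(t, x) \<notin> Q" by (auto simp: Q_iff)
                then show ?thesis using False zero[of "(t, x)"] by simp
              qed
            qed
            have "(\<lambda>p. ind Q p * \<sigma> (u p) * ?t p + w p * \<sigma>' (u p) * \<phi> p) \<in> BM" using i by simp
            from measurable_section(2)[OF this, of x]
            show "(\<lambda>t. ind Q (t, x) * \<sigma> (u (t, x)) * ?t (t, x) + w (t, x) * \<sigma>' (u (t, x)) * \<phi> (t, x)) \<in> borel_measurable lborel" by simp
            show "(\<lambda>t. ind {0..T} t * (\<sigma> (U t) * ?t (t, x) + (\<sigma>' (U t) * \<phi> (t, x)) * w (t, x))) \<in> borel_measurable lborel"
              using measurable_section(2)[OF \<phi>m(1)] measurable_section(2)[OF \<phi>m(2)] wi c\<sigma>U[THEN borel_measurable_continuous_onI] by simp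
          qed
          also have "\<dots> = \<sigma> (U T) * \<phi> (T, x) - \<sigma> (u0 x) * \<phi> (0, x)"
          proof (rule ac_chain_rule(2)[where G="\<lambda>t l. \<sigma> l * \<phi> (t, x)" and Gt="\<lambda>t l. \<sigma> l * ?t (t, x)" and Gl="\<lambda>t l. \<sigma>' l * \<phi> (t, x)", OF _ wi, symmetric])
            show "((\<lambda>t. \<sigma> l * \<phi> (t, x)) has_real_derivative \<sigma> l * ?t (t, x)) (at t)" for t l
              by (intro DERIV_cmult test_functions_partial2(1)[OF \<phi>])
            show "((\<lambda>l. \<sigma> l * \<phi> (t, x)) has_real_derivative \<sigma>' l * \<phi> (t, x)) (at l)" for t l
              by (intro DERIV_cmult_right \<sigma>)
            have c1: "continuous_on UNIV (\<lambda>q. f (snd q) * \<psi> (fst q, x))" if "continuous_on UNIV f" "\<psi> \<in> test_functions U'" for f \<psi> U'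
            proof (intro continuous_on_mult)
              show "continuous_on UNIV (\<lambda>q. f (snd q))" by (rule continuous_on_compose2[OF that(1)]) (auto intro!: continuous_intros)
              show "continuous_on UNIV (\<lambda>q. \<psi> (fst q, x))"
                by (rule continuous_on_compose2[OF test_functions_continuous[OF that(2), of UNIV]]) (auto intro!: continuous_intros)
            qed
            show "continuous_on UNIV (\<lambda>(t, l). \<sigma> l * ?t (t, x))" "continuous_on UNIV (\<lambda>(t, l). \<sigma>' l * \<phi> (t, x))"
              unfolding case_prod_beta' using c1[OF \<sigma>_cont(1) \<phi>t] c1[OF \<sigma>' \<phi>] by auto
            show "U t = u0 x + prim (\<lambda>r. w (r, x)) t" for t by (simp add: U_def)
          qed (use T in simp)
          also have "\<phi> (T, x) = 0" by (rule test_functions_outside[OF \<phi>]) auto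
          finally show ?thesis by simp
        qed
      qed
    qed
    finally show ?thesis by simp
  qed
  have Bx: "(LBINT p. w p * ?t p + v p * ?xt p) = 0"
  proof -
    have i: "L1 (\<lambda>p. w p * ?t p + v p * ?xt p)" using wt vxt by auto
    have "(LBINT p. w p * ?t p + v p * ?xt p) = (LBINT t. LBINT x. w (t, x) * ?t (t, x) + v (t, x) * ?xt (t, x))"
      using Fubini_fst(1)[OF i] by simp
    also have "\<dots> = 0"
    proof (rule integral_eq_zero_AE)
      show "AE t in lborel. (LBINT x. w (t, x) * ?t (t, x) + v (t, x) * ?xt (t, x)) = 0"
        using v_x good_t
      proof eventually_elim
        case (elim t)
        show ?case
        proof (cases "t \<in> {0<..T}")
          case False
          then have "(t, x) \<notin> Q" for x by (auto simp: Q_iff)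
          then show ?thesis using zero by simp
        next
          case True
          then obtain c where c: "AE x in lborel. x \<in> {0<..<1} \<longrightarrow> v (t, x) = c + prim (\<lambda>y. w (t, y)) x" using elim by auto
          have wi: "L1 (\<lambda>y. w (t, y))" using elim by simp
          have xi: "L1 (\<lambda>y. ?xt (t, y))" by (rule test_section_integrable(2)[OF \<phi>xt])
          have z: "?t (t, 0) = 0" "?t (t, 1) = 0" by (rule test_functions_outside[OF \<phi>t]; simp)+
          have "(LBINT x. w (t, x) * ?t (t, x) + v (t, x) * ?xt (t, x)) =
             (LBINT x. ind {0..1} x * ((0 + prim (\<lambda>y. ?xt (t, y)) x) * w (t, x) + ?xt (t, x) * (c + prim (\<lambda>y. w (t, y)) x)))"
          proof (rule integral_cong_AE)
            show "AE x in lborel. w (t, x) * ?t (t, x) + v (t, x) * ?xt (t, x) =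
              ind {0..1} x * ((0 + prim (\<lambda>y. ?xt (t, y)) x) * w (t, x) + ?xt (t, x) * (c + prim (\<lambda>y. w (t, y)) x))"
              using c AE_lborel_singleton[of 0] AE_lborel_singleton[of 1]
            proof eventually_elim
              case (elim x)
              show ?case
              proof (cases "x \<in> {0<..<1}")
                case True
                then show ?thesis using elim test_prim(2)[OF \<phi>t, of x t] z by (simp add: mult.commute)
              next
                case False
                then have "x \<notin> {0..1}" "(t, x) \<notin> Q" using elim by (auto simp: Q_iff)
                then show ?thesis using zero[of "(t, x)"] by simp
              qed
            qed
            show "(\<lambda>x. w (t, x) * ?t (t, x) + v (t, x) * ?xt (t, x)) \<in> borel_measurable lborel"
              using measurable_section(1)[OF \<phi>m(2)] xi wi measurable_section(1)[OF meas(2)] by simp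
            have "prim (\<lambda>y. ?xt (t, y)) \<in> BM" "prim (\<lambda>y. w (t, y)) \<in> BM"
              using xi wi by (auto intro!: borel_measurable_continuous_onI continuous_on_prim)
            then show "(\<lambda>x. ind {0..1} x * ((0 + prim (\<lambda>y. ?xt (t, y)) x) * w (t, x) + ?xt (t, x) * (c + prim (\<lambda>y. w (t, y)) x))) \<in> borel_measurable lborel"
              using xi wi by simp
          qed
          also have "\<dots> = (0 + prim (\<lambda>y. ?xt (t, y)) 1) * (c + prim (\<lambda>y. w (t, y)) 1) - 0 * c"
            by (rule ac_ibp[OF xi wi])
          also have "0 + prim (\<lambda>y. ?xt (t, y)) 1 = 0" using test_prim(2)[OF \<phi>t, of 1 t] z by simp
          finally show ?thesis by simp
        qed
      qed
    qed
    finally show ?thesis .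
  qed
  have Cv: "(LBINT p. v p * ?xt p - s p * ?xx p) + (LBINT x. v0 x * ?x (0, x)) = 0"
  proof -
    obtain B0 where B0: "\<And>p. \<bar>?x p\<bar> \<le> B0" using test_functions_bounded[OF \<phi>x] by metis
    obtain B1 where B1: "\<And>p. \<bar>?xt p\<bar> \<le> B1" using test_functions_bounded[OF \<phi>xt] by metis
    obtain B2 where B2: "\<And>p. \<bar>?xx p\<bar> \<le> B2" using test_functions_bounded[OF \<phi>xx] by metis
    show ?thesis
    proof (rule weak_v[where B="max B0 (max B1 B2)"])
      show "?x (T, x) = 0" for x by (rule test_functions_outside[OF \<phi>x]) auto
      show "?x (t, x) = ?x (0, x) + prim (\<lambda>r. ?xt (r, x)) t" if "t \<in> {0..T}" for t x
        using mixed_partial_prim[OF \<phi>, of t x] that by simp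
      show "?x (t, x) = ?x (t, 0) + prim (\<lambda>y. ?xx (t, y)) x" if "x \<in> {0..1}" for t x
        by (rule test_prim(2)[OF \<phi>x]) (use that in simp)
      show "\<bar>?x p\<bar> \<le> max B0 (max B1 B2)" "\<bar>?xt p\<bar> \<le> max B0 (max B1 B2)" "\<bar>?xx p\<bar> \<le> max B0 (max B1 B2)" for p
        using B0[of p] B1[of p] B2[of p] by linarith+
    qed (rule \<phi>m test_section_integrable(1)[OF \<phi>xt] test_section_integrable(2)[OF \<phi>xx])+
  qed
  have "(LBINT p. s p * ?t p) = (LBINT p. ind Q p * \<sigma> (u p) * ?t p + w p * ?t p)"
    by (intro LINT_cong) (simp add: s_split[of _] distrib_right)
  then show "(LBINT p. s p * (?t p + ?xx p)) + (LBINT p. w p * \<sigma>' (u p) * \<phi> p)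
       + (LBINT x. \<sigma> (u0 x) * \<phi> (0, x)) - (LBINT x. v0 x * ?x (0, x)) = 0"
    using A Bx Cv st sxx iw i\<sigma> wt vxt by (simp add: distrib_left)
qed

end

subsection \<open>Strong convergence of the stress\<close>

text \<open>Fatou bounds the limit in \<open>L^2\<close>. Convergence in \<open>L^1\<close> follows
  by truncation: a difference \<open>d\<close> satisfies
  \<open>\<bar>d\<bar> \<le> min \<bar>d\<bar> N + d\<^sup>2 / N\<close>, where the first part
  converges by domination on the set \<open>A\<close> of finite measure and the second is uniformly
  small for large \<open>N\<close>.\<close>

lemma L2_bounded_AE_limit:
  fixes f :: "nat \<Rightarrow> 'a::euclidean_space \<Rightarrow> real"
  assumes A: "A \<in> sets borel" "emeasure lborel A < \<infinity>"
    and fm: "\<And>n. f n \<in> BM" and lm: "l \<in> BM"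
    and z: "\<And>n p. p \<notin> A \<Longrightarrow> f n p = 0" "\<And>p. p \<notin> A \<Longrightarrow> l p = 0"
    and f2: "\<And>n. L1 (\<lambda>p. (f n p)\<^sup>2)" and C: "\<And>n. (LBINT p. (f n p)\<^sup>2) \<le> C"
    and lim: "AE p in lborel. (\<lambda>n. f n p) \<longlonglongrightarrow> l p"
  shows "L1 (\<lambda>p. (l p)\<^sup>2)" and "(\<lambda>n. LBINT p. \<bar>f n p - l p\<bar>) \<longlonglongrightarrow> 0"
proof -
  have "0 \<le> (LBINT p. (f 0 p)\<^sup>2)" by (rule LINT_nonneg) simp
  then have C0: "0 \<le> C" using C[of 0] by linarith
  have "(\<integral>\<^sup>+p. ennreal ((l p)\<^sup>2) \<partial>lborel) = (\<integral>\<^sup>+p. liminf (\<lambda>n. ennreal ((f n p)\<^sup>2)) \<partial>lborel)"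
  proof (rule nn_integral_cong_AE)
    show "AE p in lborel. ennreal ((l p)\<^sup>2) = liminf (\<lambda>n. ennreal ((f n p)\<^sup>2))"
      using lim by eventually_elim (auto intro!: lim_imp_Liminf[symmetric] tendsto_ennrealI tendsto_intros)
  qed
  also have "\<dots> \<le> liminf (\<lambda>n. \<integral>\<^sup>+p. ennreal ((f n p)\<^sup>2) \<partial>lborel)"
    using fm by (intro nn_integral_liminf) auto
  also have "\<dots> \<le> ennreal C"
  proof -
    have "(\<integral>\<^sup>+p. ennreal ((f n p)\<^sup>2) \<partial>lborel) \<le> ennreal C" for n
      using C[of n] by (subst nn_integral_eq_integral[OF f2]) (auto intro: ennreal_leI)
    then show ?thesis
      using Liminf_mono[of "\<lambda>n. \<integral>\<^sup>+p. ennreal ((f n p)\<^sup>2) \<partial>lborel" "\<lambda>_. ennreal C" sequentially]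
      by (simp add: Liminf_const)
  qed
  finally have le: "(\<integral>\<^sup>+p. ennreal ((l p)\<^sup>2) \<partial>lborel) \<le> ennreal C" .
  show l2: "L1 (\<lambda>p. (l p)\<^sup>2)"
    unfolding integrable_iff_bounded using le lm by (auto intro: le_less_trans)
  have lC: "(LBINT p. (l p)\<^sup>2) \<le> C" using le C0 nn_integral_eq_integral[OF l2] by simp
  have Ai: "L1 (ind A :: 'a \<Rightarrow> real)" using A by (intro integrable_real_indicator) auto
  have fi: "L1 (f n)" for n by (rule integrable_of_square[OF Ai fm z(1) f2])
  have li: "L1 l" by (rule integrable_of_square[OF Ai lm z(2) l2])
  have d2: "L1 (\<lambda>p. (f n p - l p)\<^sup>2)" "(LBINT p. (f n p - l p)\<^sup>2) \<le> 4 * C" for n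
  proof -
    have le: "(f n p - l p)\<^sup>2 \<le> 2 * (f n p)\<^sup>2 + 2 * (l p)\<^sup>2" for p
      using sum_squares_bound[of "f n p" "- l p"] by (simp add: power2_diff)
    show i: "L1 (\<lambda>p. (f n p - l p)\<^sup>2)"
      by (rule integrable_square_add(2)[OF fm lm f2 l2])
    have "(LBINT p. (f n p - l p)\<^sup>2) \<le> (LBINT p. 2 * (f n p)\<^sup>2 + 2 * (l p)\<^sup>2)"
      using i f2 l2 le by (intro integral_mono) auto
    also have "\<dots> \<le> 4 * C" using f2[of n] l2 C[of n] lC by simp
    finally show "(LBINT p. (f n p - l p)\<^sup>2) \<le> 4 * C" .
  qed
  show "(\<lambda>n. LBINT p. \<bar>f n p - l p\<bar>) \<longlonglongrightarrow> 0"
  proof (rule tendsto_zero_by_approximation)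
    fix e :: real assume e: "e > 0"
    \<comment> \<open>The integral of the squared difference is at most \<open>4 * C\<close>, so
      this level makes the tail at most \<open>e\<close>; the summand 1 keeps it positive when
      \<open>C = 0\<close>.\<close>
    define N where "N = (4 * C + 1) / e"
    have N: "N > 0" using e C0 by (simp add: N_def)
    have "(\<lambda>n. LBINT p. min \<bar>f n p - l p\<bar> N) \<longlonglongrightarrow> (LINT p::'a|lborel. (0::real))"
    proof (rule integral_dominated_convergence[where w="\<lambda>p. N * ind A p"])
      show "AE p in lborel. (\<lambda>n. min \<bar>f n p - l p\<bar> N) \<longlonglongrightarrow> 0"
        using lim
      proof eventually_elim
        case (elim p)
        have "(\<lambda>n. min \<bar>f n p - l p\<bar> N) \<longlonglongrightarrow> min \<bar>l p - l p\<bar> N" by (intro tendsto_intros elim)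
        then show ?case using N by simp
      qed
      show "AE p in lborel. norm (min \<bar>f n p - l p\<bar> N) \<le> N * ind A p" for n
        using N z by (intro AE_I2) (auto simp: indicator_def)
    qed (use Ai fm lm in auto)
    then have "(\<lambda>n. LBINT p. min \<bar>f n p - l p\<bar> N) \<longlonglongrightarrow> 0" by simp
    moreover have "(LBINT p. \<bar>f n p - l p\<bar>) \<le> (LBINT p. min \<bar>f n p - l p\<bar> N) + e" for n
    proof -
      have mi: "L1 (\<lambda>p. min \<bar>f n p - l p\<bar> N)"
        by (rule L1_bound[where f="\<lambda>p. f n p - l p"]) (use fi li fm lm N in auto)
      have pt: "\<bar>f n p - l p\<bar> \<le> min \<bar>f n p - l p\<bar> N + (f n p - l p)\<^sup>2 / N" for p
      proof (cases "\<bar>f n p - l p\<bar> \<le> N")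
        case False
        then have "\<bar>f n p - l p\<bar> * N \<le> \<bar>f n p - l p\<bar> * \<bar>f n p - l p\<bar>" by (intro mult_left_mono) auto
        then have "\<bar>f n p - l p\<bar> \<le> (f n p - l p)\<^sup>2 / N" using N by (simp add: field_simps power2_eq_square abs_mult_self)
        then show ?thesis using N by (simp add: min_def)
      qed (use N in simp)
      have "(LBINT p. \<bar>f n p - l p\<bar>) \<le> (LBINT p. min \<bar>f n p - l p\<bar> N + (f n p - l p)\<^sup>2 / N)"
        using fi[of n] li mi d2(1)[of n] pt by (intro integral_mono) auto
      also have "\<dots> \<le> (LBINT p. min \<bar>f n p - l p\<bar> N) + 4 * C / N"
        using mi d2[of n] N by (simp add: divide_right_mono)
      also have "4 * C / N \<le> e" using e C0 by (simp add: N_def field_simps)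
      finally show ?thesis by simp
    qed
    ultimately show "\<exists>Y. Y \<longlonglongrightarrow> 0 \<and> (\<forall>n. (LBINT p. \<bar>f n p - l p\<bar>) \<le> Y n + e)" by blast
  qed simp
qed

text \<open>As \<open>a\<close> has mean zero in \<open>x\<close>, its primitive \<open>P\<close>
  vanishes at both ends, and the integration constant of \<open>V\<close>, which may depend on
  \<open>t\<close> in an unknown way, does not enter. This makes the identity stable under weak
  limits.\<close>

lemma ibp_x:
  fixes V W a :: "real \<times> real \<Rightarrow> real"
  assumes V: "L1 V" and W: "L1 W"
    and m [measurable]: "V \<in> BM" "W \<in> BM" "a \<in> BM"
    and z: "\<And>p. p \<notin> QT T \<Longrightarrow> V p = 0 \<and> W p = 0"
    and d: "AE t in lborel. t \<in> {0<..T} \<longrightarrow> (\<exists>c. AE x in lborel. x \<in> {0<..<1} \<longrightarrow> V (t, x) = c + prim (\<lambda>y. W (t, y)) x)"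
    and aK: "\<And>p. \<bar>a p\<bar> \<le> K" and ai: "\<And>t. L1 (\<lambda>y. a (t, y))" and a1: "\<And>t. prim (\<lambda>y. a (t, y)) 1 = 0"
    and P: "\<And>t x. x \<in> {0..1} \<Longrightarrow> P (t, x) = prim (\<lambda>y. a (t, y)) x" and PK: "\<And>p. \<bar>P p\<bar> \<le> K" and Pm: "P \<in> BM"
  shows "(LBINT p. W p * P p) + (LBINT p. V p * a p) = 0"
proof -
  have i1: "L1 (\<lambda>p. W p * P p)" by (rule integrable_mult_bounded[OF W Pm, of K]) (use PK in auto)
  have i2: "L1 (\<lambda>p. V p * a p)" by (rule integrable_mult_bounded[OF V m(3), of K]) (use aK in auto)
  have i: "L1 (\<lambda>p. W p * P p + V p * a p)" using i1 i2 by auto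
  have "(LBINT p. W p * P p + V p * a p) = (LBINT t. LBINT x. W (t, x) * P (t, x) + V (t, x) * a (t, x))"
    using Fubini_fst(1)[OF i] by simp
  also have "\<dots> = 0"
  proof (rule integral_eq_zero_AE)
    show "AE t in lborel. (LBINT x. W (t, x) * P (t, x) + V (t, x) * a (t, x)) = 0"
      using d Fubini_fst(2)[OF W]
    proof eventually_elim
      case (elim t)
      show ?case
      proof (cases "t \<in> {0<..T}")
        case False
        then have "(t, x) \<notin> QT T" for x by (auto simp: QT_iff)
        then show ?thesis using z by simp
      next
        case True
        then obtain c where c: "AE x in lborel. x \<in> {0<..<1} \<longrightarrow> V (t, x) = c + prim (\<lambda>y. W (t, y)) x" using elim by auto
        have wi: "L1 (\<lambda>y. W (t, y))" using elim by simp
        have "(LBINT x. W (t, x) * P (t, x) + V (t, x) * a (t, x)) =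
           (LBINT x. ind {0..1} x * ((0 + prim (\<lambda>y. a (t, y)) x) * W (t, x) + a (t, x) * (c + prim (\<lambda>y. W (t, y)) x)))"
        proof (rule integral_cong_AE)
          show "AE x in lborel. W (t, x) * P (t, x) + V (t, x) * a (t, x) =
            ind {0..1} x * ((0 + prim (\<lambda>y. a (t, y)) x) * W (t, x) + a (t, x) * (c + prim (\<lambda>y. W (t, y)) x))"
            using c AE_lborel_singleton[of 0] AE_lborel_singleton[of 1]
          proof eventually_elim
            case (elim x)
            show ?case
            proof (cases "x \<in> {0<..<1}")
              case True
              then show ?thesis using elim P[of x t] by (simp add: mult.commute)
            next
              case False
              then have "x \<notin> {0..1}" "(t, x) \<notin> QT T" using elim by (auto simp: QT_iff)
              then show ?thesis using z[of "(t, x)"] by simp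
            qed
          qed
          show "(\<lambda>x. W (t, x) * P (t, x) + V (t, x) * a (t, x)) \<in> borel_measurable lborel"
            using measurable_section(1)[OF m(1)] measurable_section(1)[OF m(2)] measurable_section(1)[OF m(3)] measurable_section(1)[OF Pm] by simp
          have "prim (\<lambda>y. a (t, y)) \<in> BM" "prim (\<lambda>y. W (t, y)) \<in> BM"
            using ai wi by (auto intro!: borel_measurable_continuous_onI continuous_on_prim)
          then show "(\<lambda>x. ind {0..1} x * ((0 + prim (\<lambda>y. a (t, y)) x) * W (t, x) + a (t, x) * (c + prim (\<lambda>y. W (t, y)) x))) \<in> borel_measurable lborel"
            using measurable_section(1)[OF m(3)] measurable_section(1)[OF m(2)] by simp
        qed
        also have "\<dots> = (0 + prim (\<lambda>y. a (t, y)) 1) * (c + prim (\<lambda>y. W (t, y)) 1) - 0 * c"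
          by (rule ac_ibp[OF ai wi])
        finally show ?thesis using a1 by simp
      qed
    qed
  qed
  finally show ?thesis using i1 i2 by simp
qed

text \<open>Duality: \<open>W\<close> is the weak \<open>x\<close>-derivative of \<open>V\<close> as soon as integration by parts holds against
  the primitives \<open>P\<close> of all bounded mean-free \<open>a\<close>; the relevant \<open>a\<close> is the mean-free part of a sign.\<close>

lemma x_deriv_by_duality:
  fixes V W :: "real \<times> real \<Rightarrow> real"
  assumes V: "L1 V" and W: "L1 W"
    and m [measurable]: "V \<in> BM" "W \<in> BM"
    and z: "\<And>p. p \<notin> QT T \<Longrightarrow> V p = 0 \<and> W p = 0"
    and dual: "\<And>a K. a \<in> BM \<Longrightarrow> (\<And>p. \<bar>a p\<bar> \<le> K) \<Longrightarrow> (\<And>p. p \<notin> QT T \<Longrightarrow> a p = 0) \<Longrightarrow>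
       (\<And>t. prim (\<lambda>y. a (t, y)) 1 = 0) \<Longrightarrow>
       (LBINT p. W p * prim (\<lambda>y. a (fst p, y)) (snd p)) + (LBINT p. V p * a p) = 0"
  shows "AE t in lborel. t \<in> {0<..T} \<longrightarrow> (\<exists>c. AE x in lborel. x \<in> {0<..<1} \<longrightarrow> V (t, x) = c + prim (\<lambda>y. W (t, y)) x)"
proof -
  let ?Q = "QT T" and ?i = "ind (QT T) :: real \<times> real \<Rightarrow> real"
  have [measurable]: "?Q \<in> sets borel" by (rule QT_sets)
  have Qi: "L1 ?i" using QT_finite[of T] QT_sets[of T] by (intro integrable_real_indicator) auto
  \<comment> \<open>\<open>Z\<close> has \<open>x\<close>-derivative \<open>W\<close> by
    construction and therefore satisfies the same duality relation, so \<open>V - Z\<close> is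
    orthogonal to all bounded mean-free \<open>a\<close>.\<close>
  define Z where "Z p = ?i p * prim (\<lambda>y. W (fst p, y)) (snd p)" for p
  have pm: "(\<lambda>p. prim (\<lambda>y. f (fst p, y)) (snd p)) \<in> BM" if "f \<in> BM" for f :: "real \<times> real \<Rightarrow> real"
    by (rule measurable_prim_fst(2)[OF that])
  have Zm [measurable]: "Z \<in> BM" unfolding Z_def[abs_def] using pm[OF m(2)] by simp
  have Wa: "L1 (\<lambda>p. \<bar>W p\<bar>)" using W by simp
  have Zi: "L1 Z"
  proof (rule integrable_pairI_fst[OF Zm])
    have sec: "\<bar>Z (t, x)\<bar> \<le> ind {0..1} x * (LBINT y. \<bar>W (t, y)\<bar>)" if "L1 (\<lambda>y. W (t, y))" for t x
      using prim_abs_bound[OF that, of x] by (auto simp: Z_def indicator_def QT_def)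
    have c01: "L1 (\<lambda>x::real. ind {0..1} x * c)" for c :: real
      by (intro integrable_mult_left integrable_real_indicator) (auto simp: emeasure_lborel_Icc_eq)
    have si: "L1 (\<lambda>x. Z (t, x))" if "L1 (\<lambda>y. W (t, y))" for t
      by (rule L1_bound[OF c01[of "LBINT y. \<bar>W (t, y)\<bar>"]])
        (use sec[OF that] measurable_section(1)[OF Zm, of t] in \<open>auto intro!: AE_I2 order_trans[OF sec[OF that]]\<close>)
    show "AE t in lborel. L1 (\<lambda>x. Z (t, x))"
      using Fubini_fst(2)[OF W] by eventually_elim (rule si)
    show "L1 (\<lambda>t. LBINT x. \<bar>Z (t, x)\<bar>)"
    proof (rule L1_bound[OF Fubini_fst(3)[OF Wa]])
      have "(\<lambda>p. \<bar>Z p\<bar>) \<in> BM" by measurable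
      from measurable_integral_param[OF this] show "(\<lambda>t. LBINT x. \<bar>Z (t, x)\<bar>) \<in> borel_measurable lborel" by simp
      show "AE t in lborel. norm (LBINT x. \<bar>Z (t, x)\<bar>) \<le> norm (LBINT y. \<bar>W (t, y)\<bar>)"
        using Fubini_fst(2)[OF W]
      proof eventually_elim
        case (elim t)
        have "(LBINT x. \<bar>Z (t, x)\<bar>) \<le> (LINT x::real|lborel. ind {0..1} x * (LBINT y. \<bar>W (t, y)\<bar>))"
          using si[OF elim] c01 sec[OF elim] by (intro integral_mono) auto
        then show ?case by simp
      qed
    qed
  qed
  define D where "D p = V p - Z p" for p
  have Di: "L1 D" unfolding D_def[abs_def] using V Zi by auto
  have Dm [measurable]: "D \<in> BM" unfolding D_def[abs_def] by measurable
  define mn where "mn t = (LBINT x. D (t, x))" for t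
  have mnm [measurable]: "mn \<in> BM" unfolding mn_def[abs_def] by (rule measurable_integral_param[OF Dm])
  \<comment> \<open>\<open>mn\<close> is the mean of \<open>D\<close> in \<open>x\<close>.
    Subtracting its own mean from the sign of \<open>D - mn\<close> gives the admissible function
    \<open>a\<close> below.\<close>
  define b where "b p = ?i p * sgn (D p - mn (fst p))" for p
  have bm [measurable]: "b \<in> BM"
  proof -
    have "(\<lambda>p. D p - mn (fst p)) \<in> BM" by measurable
    then show ?thesis unfolding b_def[abs_def] by measurable
  qed
  define bn where "bn t = (LBINT x. b (t, x))" for t
  have bnm [measurable]: "bn \<in> BM" unfolding bn_def[abs_def] by (rule measurable_integral_param[OF bm])
  have bs: "L1 (\<lambda>x. b (t, x))" for t
    by (rule integrable_bounded_01(1)[of _ 1]) (use measurable_section(1)[OF bm] in \<open>auto simp: b_def indicator_def QT_def sgn_if\<close>)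
  have bn1: "\<bar>bn t\<bar> \<le> 1" for t
  proof -
    have "(LBINT x. \<bar>b (t, x)\<bar>) \<le> 1"
      by (rule integrable_bounded_01(2)) (use measurable_section(1)[OF bm] in \<open>auto simp: b_def indicator_def QT_def sgn_if\<close>)
    then show ?thesis using integral_abs_bound[of lborel "\<lambda>x. b (t, x)"] unfolding bn_def by linarith
  qed
  define a where "a p = b p - ?i p * bn (fst p)" for p
  have am [measurable]: "a \<in> BM" unfolding a_def[abs_def] by measurable
  have aK: "\<bar>a p\<bar> \<le> 2" for p using bn1[of "fst p"] by (auto simp: a_def b_def indicator_def sgn_if)
  have az: "a p = 0" if "p \<notin> ?Q" for p using that by (simp add: a_def b_def)
  have ai: "L1 (\<lambda>y. a (t, y))" for t
    by (rule integrable_bounded_01(1)[of _ 2]) (use measurable_section(1)[OF am] aK az in \<open>auto simp: QT_def\<close>)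
  have pf: "prim (\<lambda>y. f (t, y)) 1 = (LBINT y. f (t, y))" if fz: "\<And>p. p \<notin> ?Q \<Longrightarrow> f p = 0" for f :: "real \<times> real \<Rightarrow> real" and t
    unfolding prim_def
  proof (intro LINT_cong)
    fix y
    show "ind {0..1} y * f (t, y) = f (t, y)"
    proof (cases "y \<in> {0..1}")
      case False
      then have "(t, y) \<notin> ?Q" by (auto simp: QT_def)
      then show ?thesis using fz by simp
    qed simp
  qed
  have i01: "?i (t, x) = ind {0<..T} t * ind {0<..<1} x" for t x by (auto simp: indicator_def QT_def)
  have a1: "prim (\<lambda>y. a (t, y)) 1 = 0" for t
  proof (cases "t \<in> {0<..T}")
    case True
    have ii: "L1 (\<lambda>x. ?i (t, x) * bn t)"
      unfolding i01 using True by (intro integrable_mult_left integrable_mult_right integrable_real_indicator) auto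
    have "prim (\<lambda>y. a (t, y)) 1 = (LBINT y. b (t, y) - ?i (t, y) * bn t)" using pf[of a, OF az] by (simp add: a_def)
    also have "\<dots> = bn t - (LBINT y. ?i (t, y) * bn t)" using bs ii by (simp add: bn_def)
    also have "(LBINT y. ?i (t, y) * bn t) = bn t" unfolding i01 using True by simp
    finally show ?thesis by simp
  next
    case False
    then have "a (t, y) = 0" for y by (intro az) (auto simp: QT_def)
    then show ?thesis by (simp add: prim_def)
  qed
  have PK: "\<bar>prim (\<lambda>y. a (t, y)) x\<bar> \<le> 2" for t x
  proof -
    have "\<bar>prim (\<lambda>y. a (t, y)) x\<bar> \<le> (LBINT y. \<bar>a (t, y)\<bar>)" by (rule prim_abs_bound[OF ai])
    also have "\<dots> \<le> (LBINT y. 2 * ind {0..1::real} y)"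
      using ai[of t] aK az by (intro integral_mono integrable_mult_right integrable_real_indicator)
        (auto simp: emeasure_lborel_Icc_eq indicator_def QT_def)
    finally show ?thesis by simp
  qed
  have e1: "(LBINT p. W p * prim (\<lambda>y. a (fst p, y)) (snd p)) + (LBINT p. V p * a p) = 0"
    by (rule dual[OF am aK az a1])
  have e2: "(LBINT p. W p * prim (\<lambda>y. a (fst p, y)) (snd p)) + (LBINT p. Z p * a p) = 0"
  proof (rule ibp_x[OF Zi W Zm m(2) am _ _ aK ai a1 _ _ pm[OF am]])
    show "Z p = 0 \<and> W p = 0" if "p \<notin> ?Q" for p using that z by (simp add: Z_def)
    show "AE t in lborel. t \<in> {0<..T} \<longrightarrow> (\<exists>c. AE x in lborel. x \<in> {0<..<1} \<longrightarrow> Z (t, x) = c + prim (\<lambda>y. W (t, y)) x)"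
      by (intro AE_I2 impI exI[of _ 0]) (auto simp: Z_def QT_def)
  qed (use PK in auto)
  have Va: "L1 (\<lambda>p. V p * a p)" and Za: "L1 (\<lambda>p. Z p * a p)" and Db: "L1 (\<lambda>p. D p * a p)"
    using V Zi Di aK by (auto intro!: integrable_mult_bounded[where B=2])
  have D0: "(LBINT p. D p * a p) = 0"
    using e1 e2 Va Za by (simp add: D_def left_diff_distrib)
  have Dz: "D p = 0" if "p \<notin> ?Q" for p using z[OF that] that by (simp add: D_def Z_def)
  \<comment> \<open>Because \<open>a\<close> is mean-free, \<open>D\<close> may be replaced by
    \<open>D - mn\<close>; because \<open>D - mn\<close> is mean-free, the constant subtracted from
    \<open>b\<close> drops out. What remains is the absolute value.\<close>
  have key: "(LBINT x. D (t, x) * a (t, x)) = (LBINT x. ?i (t, x) * \<bar>D (t, x) - mn t\<bar>)"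
    if Ds: "L1 (\<lambda>x. D (t, x))" for t
  proof (cases "t \<in> {0<..T}")
    case True
    have j1: "L1 (\<lambda>x. ?i (t, x) * c)" for c
      unfolding i01 using True by (intro integrable_mult_left integrable_mult_right integrable_real_indicator) auto
    have asec: "(\<lambda>x. a (t, x)) \<in> BM" using measurable_section(1)[OF am] by simp
    have i3: "L1 (\<lambda>x. D (t, x) * a (t, x))"
      by (rule integrable_mult_bounded[OF Ds asec]) (use aK in auto)
    have ia: "(LBINT x. a (t, x)) = 0" using a1[of t] pf[of a, OF az] by simp
    have "(LBINT x. D (t, x) * a (t, x)) = (LBINT x. D (t, x) * a (t, x)) - mn t * (LBINT x. a (t, x))" by (simp add: ia)
    also have "\<dots> = (LBINT x. D (t, x) * a (t, x) - mn t * a (t, x))" using i3 ai by simp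
    also have "\<dots> = (LBINT x. ?i (t, x) * \<bar>D (t, x) - mn t\<bar> - bn t * (D (t, x) - ?i (t, x) * mn t))"
    proof (intro LINT_cong)
      fix x
      show "D (t, x) * a (t, x) - mn t * a (t, x) = ?i (t, x) * \<bar>D (t, x) - mn t\<bar> - bn t * (D (t, x) - ?i (t, x) * mn t)"
      proof (cases "(t, x) \<in> ?Q")
        case True
        have "sgn (D (t, x) - mn t) * (D (t, x) - mn t) = \<bar>D (t, x) - mn t\<bar>" by (simp add: sgn_if abs_if)
        then show ?thesis using True by (simp add: a_def b_def algebra_simps)
      next
        case False
        then show ?thesis using az Dz by simp
      qed
    qed
    also have "\<dots> = (LBINT x. ?i (t, x) * \<bar>D (t, x) - mn t\<bar>) - bn t * (LBINT x. D (t, x) - ?i (t, x) * mn t)"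
    proof -
      have i4: "L1 (\<lambda>x. D (t, x) - ?i (t, x) * mn t)" using Ds j1 by auto
      have "?i (t, x) * \<bar>D (t, x) - mn t\<bar> = \<bar>D (t, x) - ?i (t, x) * mn t\<bar>" for x
        using Dz[of "(t, x)"] by (cases "(t, x) \<in> ?Q") auto
      then have "L1 (\<lambda>x. ?i (t, x) * \<bar>D (t, x) - mn t\<bar>)" using i4 by simp
      then show ?thesis using i4 by simp
    qed
    also have "(LBINT x. D (t, x) - ?i (t, x) * mn t) = 0"
    proof -
      have "(LBINT x. ?i (t, x) * mn t) = mn t" unfolding i01 using True by simp
      then show ?thesis using Ds j1 by (simp add: mn_def)
    qed
    finally show ?thesis by simp
  next
    case False
    then have "(t, x) \<notin> ?Q" for x by (auto simp: QT_def)
    then show ?thesis using az by simp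
  qed
  have zero_int: "(LBINT t. LBINT x. D (t, x) * a (t, x)) = 0" using Fubini_fst(1)[OF Db] D0 by simp
  have "AE t in lborel. (LBINT x. D (t, x) * a (t, x)) = 0"
  proof -
    have ge: "AE t in lborel. 0 \<le> (LBINT x. D (t, x) * a (t, x))"
      using Fubini_fst(2)[OF Di] by eventually_elim (simp add: key)
    show ?thesis
      using integral_nonneg_eq_0_iff_AE[OF Fubini_fst(3)[OF Db] ge] zero_int by simp
  qed
  then show ?thesis
    using Fubini_fst(2)[OF Di]
  proof eventually_elim
    case (elim t)
    have e: "?i (t, x) * \<bar>D (t, x) - mn t\<bar> = \<bar>?i (t, x) * D (t, x) - ?i (t, x) * mn t\<bar>" for x
      by (cases "(t, x) \<in> ?Q") auto
    have iD: "L1 (\<lambda>x. ?i (t, x) * \<bar>D (t, x) - mn t\<bar>)"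
    proof -
      have "?i (t, x) * D (t, x) = D (t, x)" for x using Dz[of "(t, x)"] by (cases "(t, x) \<in> ?Q") auto
      then have j1: "L1 (\<lambda>x. ?i (t, x) * D (t, x))" by (simp only: elim(2))
      have j2: "L1 (\<lambda>x. ?i (t, x) * mn t)"
        unfolding i01 by (intro integrable_mult_left integrable_mult_right integrable_real_indicator) auto
      show ?thesis unfolding e by (intro integrable_abs L1_diff j1 j2)
    qed
    have "(LBINT x. ?i (t, x) * \<bar>D (t, x) - mn t\<bar>) = 0" using elim key by simp
    then have "AE x in lborel. ?i (t, x) * \<bar>D (t, x) - mn t\<bar> = 0"
      by (subst (asm) integral_nonneg_eq_0_iff_AE[OF iD]) auto
    then have ae: "AE x in lborel. (t, x) \<in> ?Q \<longrightarrow> V (t, x) = mn t + prim (\<lambda>y. W (t, y)) x"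
      by eventually_elim (auto simp: D_def Z_def)
    show ?case
    proof (intro impI exI[of _ "mn t"])
      assume tt: "t \<in> {0<..T}"
      from ae show "AE x in lborel. x \<in> {0<..<1} \<longrightarrow> V (t, x) = mn t + prim (\<lambda>y. W (t, y)) x"
        by eventually_elim (use tt in \<open>auto simp: QT_def\<close>)
    qed
  qed
qed

text \<open>The multipliers may vary with \<open>n\<close> and need not converge. This handles the
  products of the stress with functions of the oscillating strain.\<close>

lemma tendsto_L1_mult_bounded:
  fixes f \<psi> :: "nat \<Rightarrow> 'a::euclidean_space \<Rightarrow> real"
  assumes f: "\<And>n. L1 (f n)" and l: "L1 l"
    and lim: "(\<lambda>n. LBINT p. \<bar>f n p - l p\<bar>) \<longlonglongrightarrow> 0"
    and m: "\<And>n. \<psi> n \<in> BM" and K: "\<And>n. AE p in lborel. \<bar>\<psi> n p\<bar> \<le> K"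
  shows "(\<lambda>n. (LBINT p. f n p * \<psi> n p) - (LBINT p. l p * \<psi> n p)) \<longlonglongrightarrow> 0"
proof -
  have i: "L1 (\<lambda>p. f n p * \<psi> n p)" "L1 (\<lambda>p. l p * \<psi> n p)" for n
    using integrable_mult_bounded[OF f m K] integrable_mult_bounded[OF l m K] by auto
  have d: "L1 (\<lambda>p. f n p - l p)" for n using f l by auto
  have b: "\<bar>(LBINT p. f n p * \<psi> n p) - (LBINT p. l p * \<psi> n p)\<bar> \<le> K * (LBINT p. \<bar>f n p - l p\<bar>)" for n
  proof -
    have "(LBINT p. f n p * \<psi> n p) - (LBINT p. l p * \<psi> n p) = (LBINT p. (f n p - l p) * \<psi> n p)"
      using i by (simp add: left_diff_distrib)
    then show ?thesis using integral_mult_bounded[OF d m K] by simp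
  qed
  have KL: "(\<lambda>n. K * (LBINT p. \<bar>f n p - l p\<bar>)) \<longlonglongrightarrow> 0" using tendsto_mult_left[OF lim, of K] by simp
  show ?thesis
    by (rule tendsto_rabs_zero_cancel, rule tendsto_sandwich[OF _ _ tendsto_const KL]) (use b in auto)
qed

lemma tendsto_L1_mult:
  fixes f :: "nat \<Rightarrow> 'a::euclidean_space \<Rightarrow> real"
  assumes "\<And>n. L1 (f n)" "L1 l"
    and "(\<lambda>n. LBINT p. \<bar>f n p - l p\<bar>) \<longlonglongrightarrow> 0"
    and "\<psi> \<in> BM" "\<And>p. \<bar>\<psi> p\<bar> \<le> K"
  shows "(\<lambda>n. LBINT p. f n p * \<psi> p) \<longlonglongrightarrow> (LBINT p. l p * \<psi> p)"
  using tendsto_L1_mult_bounded[OF assms(1,2,3), of "\<lambda>_. \<psi>" K] assms(4,5) by (simp add: LIM_zero_iff)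

lemma prim_indicator:
  assumes "0 \<le> a" "a \<le> b"
  shows "prim (ind {a<..<b}) y = max 0 (min y b - a)"
proof -
  have "prim (ind {a<..<b}) y = (LBINT r. ind {a..min y b} r)"
    unfolding prim_def
  proof (rule integral_cong_AE)
    show "AE r in lborel. ind {0..y} r * ind {a<..<b} r = (ind {a..min y b} r :: real)"
      using AE_lborel_singleton[of a] AE_lborel_singleton[of b]
      by eventually_elim (use assms in \<open>auto simp: indicator_def\<close>)
  qed auto
  also have "\<dots> = max 0 (min y b - a)" by (auto simp: max_def)
  finally show ?thesis .
qed

context kv_strip
begin

lemma s_sq_bound:
  assumes B: "\<And>y. \<bar>y\<bar> \<le> R \<Longrightarrow> \<bar>\<sigma> y\<bar> \<le> B"
  shows "(LBINT p. (s p)\<^sup>2) \<le> 2 * (B\<^sup>2 * measure lborel Q) + 2 * (LBINT p. (w p)\<^sup>2)"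
proof -
  have i: "L1 (\<lambda>p. 2 * (B\<^sup>2 * ind Q p) + 2 * (w p)\<^sup>2)" using Q_int sq by auto
  have "(LBINT p. (s p)\<^sup>2) \<le> (LBINT p. 2 * (B\<^sup>2 * ind Q p) + 2 * (w p)\<^sup>2)"
  proof (rule integral_mono_AE[OF s_sq i])
    show "AE p in lborel. (s p)\<^sup>2 \<le> 2 * (B\<^sup>2 * ind Q p) + 2 * (w p)\<^sup>2"
      using u_bound
    proof eventually_elim
      case (elim p)
      have "(s p)\<^sup>2 \<le> 2 * (ind Q p * \<sigma> (u p))\<^sup>2 + 2 * (w p)\<^sup>2"
        unfolding s_split[of p] using sum_squares_bound[of "ind Q p * \<sigma> (u p)" "w p"] by (simp add: power2_sum)
      moreover have "\<bar>\<sigma> (u p)\<bar>\<^sup>2 \<le> B\<^sup>2" using B[OF elim] by (intro power_mono) auto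
      ultimately show ?case by (cases "p \<in> Q") auto
    qed
  qed
  also have "\<dots> = 2 * (B\<^sup>2 * measure lborel Q) + 2 * (LBINT p. (w p)\<^sup>2)"
    using Q_int sq by simp
  finally show ?thesis .
qed

text \<open>Testing with \<open>T - t\<close> times the primitive of \<open>q\<close> isolates the
  initial velocity: it is expressed through space-time integrals of \<open>v\<close> and
  \<open>s\<close>, which converge along the sequence.\<close>

lemma v0_test:
  assumes qm [measurable]: "q \<in> BM" and qK: "\<And>y. \<bar>q y\<bar> \<le> K" and qz: "\<And>y. y \<notin> {0<..<1} \<Longrightarrow> q y = 0"
  shows "L1 q" and "\<bar>prim q y\<bar> \<le> K"
    and "(LBINT p. v p * (- ind {0..T} (fst p) * prim q (snd p)) - s p * (ind {0..T} (fst p) * (T - fst p) * q (snd p)))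
      + T * (LBINT x. v0 x * prim q x) = 0"
proof -
  have K0: "0 \<le> K" using qK[of 0] by simp
  note q01 = integrable_bounded_01[OF qm AE_I2[OF qK] qz]
  show qi: "L1 q" by (rule q01(1))
  show PK: "\<bar>prim q y\<bar> \<le> K" for y
    using prim_abs_bound[OF qi, of y] q01(2) by linarith
  have Pm: "prim q \<in> BM" by (intro borel_measurable_continuous_onI continuous_on_prim qi)
  define \<phi> where "\<phi> p = ind {0..T} (fst p) * (T - fst p) * prim q (snd p)" for p :: "real \<times> real"
  define \<phi>t where "\<phi>t p = - ind {0..T} (fst p) * prim q (snd p)" for p :: "real \<times> real"
  define \<phi>x where "\<phi>x p = ind {0..T} (fst p) * (T - fst p) * q (snd p)" for p :: "real \<times> real"
  have ti: "L1 (ind {0..T} :: real \<Rightarrow> real)"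
    by (intro integrable_real_indicator) (auto simp: emeasure_lborel_Icc_eq)
  have tb: "\<bar>ind {0..T} t * (T - t)\<bar> \<le> T + 1" for t using T by (auto simp: indicator_def)
  have "(LBINT p. v p * \<phi>t p - s p * \<phi>x p) + (LBINT x. v0 x * \<phi> (0, x)) = 0"
  proof (rule weak_v[where B="(T + 1) * K"])
    show "\<phi> \<in> BM" "\<phi>t \<in> BM" "\<phi>x \<in> BM"
      unfolding \<phi>_def[abs_def] \<phi>t_def[abs_def] \<phi>x_def[abs_def]
      using measurable_compose[OF measurable_proj(2) Pm] measurable_compose[OF measurable_proj(2) qm] by measurable
    show "\<bar>\<phi> p\<bar> \<le> (T + 1) * K" "\<bar>\<phi>x p\<bar> \<le> (T + 1) * K" for p
      unfolding \<phi>_def \<phi>x_def using tb[of "fst p"] PK[of "snd p"] qK[of "snd p"] T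
      by (auto simp: abs_mult[of "ind {0..T} (fst p) * (T - fst p)"] intro!: mult_mono)
    show "\<bar>\<phi>t p\<bar> \<le> (T + 1) * K" for p
    proof -
      have "\<bar>\<phi>t p\<bar> \<le> \<bar>prim q (snd p)\<bar>" by (auto simp: \<phi>t_def indicator_def)
      also have "\<dots> \<le> 1 * K" using PK by simp
      also have "\<dots> \<le> (T + 1) * K" using T K0 by (intro mult_right_mono) auto
      finally show ?thesis .
    qed
    show "L1 (\<lambda>r. \<phi>t (r, x))" for x unfolding \<phi>t_def using ti by simp
    show "L1 (\<lambda>y. \<phi>x (t, y))" for t unfolding \<phi>x_def using qi by simp
    show "\<phi> (t, x) = \<phi> (0, x) + prim (\<lambda>r. \<phi>t (r, x)) t" if "t \<in> {0..T}" for t x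
    proof -
      have "prim (\<lambda>r. \<phi>t (r, x)) t = (LBINT r. - prim q x * ind {0..t} r)"
        unfolding prim_def \<phi>t_def using that by (intro LINT_cong) (auto simp: indicator_def)
      also have "\<dots> = - prim q x * t" using that by simp
      finally show ?thesis using that T by (simp add: \<phi>_def algebra_simps)
    qed
    show "\<phi> (t, x) = \<phi> (t, 0) + prim (\<lambda>y. \<phi>x (t, y)) x" if "x \<in> {0..1}" for t x
      by (simp add: \<phi>_def \<phi>x_def prim_cmult)
    show "\<phi> (T, x) = 0" for x by (simp add: \<phi>_def)
  qed
  moreover have "(LBINT x. v0 x * \<phi> (0, x)) = T * (LBINT x. v0 x * prim q x)"
    unfolding integral_mult_right_zero[symmetric] using T by (intro LINT_cong) (simp add: \<phi>_def)
  ultimately show "(LBINT p. v p * (- ind {0..T} (fst p) * prim q (snd p)) - s p * (ind {0..T} (fst p) * (T - fst p) * q (snd p)))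
      + T * (LBINT x. v0 x * prim q x) = 0"
    by (simp add: \<phi>t_def \<phi>x_def)
qed

end

subsection \<open>Passage to the limit\<close>

text \<open>\<open>Y \<beta>\<close> is the weak-\<open>*\<close> limit of \<open>\<beta>(u\<^sub>n)\<close>, that is, the average of \<open>\<beta>\<close> under the Young measure.\<close>

locale kv_limit =
  fixes T R C2 K :: real and \<sigma> \<sigma>' :: "real \<Rightarrow> real" and u0 v0 v0x :: "nat \<Rightarrow> real \<Rightarrow> real"
    and u v w s g :: "nat \<Rightarrow> real \<times> real \<Rightarrow> real" and vl S :: "real \<times> real \<Rightarrow> real"
    and F :: "real \<times> real \<times> real \<Rightarrow> real" and Y :: "(real \<Rightarrow> real) \<Rightarrow> real \<times> real \<Rightarrow> real"
  assumes strip: "\<And>n. kv_strip T R \<sigma> \<sigma>' (u0 n) (v0 n) (u n) (v n) (w n) (s n) (g n)"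
    and w2: "\<And>n. (LBINT p. (w n p)\<^sup>2) \<le> C2"
    and vlm [measurable]: "vl \<in> BM" and vlz: "\<And>p. p \<notin> QT T \<Longrightarrow> vl p = 0"
    and vl2: "L1 (\<lambda>p. (vl p)\<^sup>2)" and vlim: "(\<lambda>n. LBINT p. (v n p - vl p)\<^sup>2) \<longlonglongrightarrow> 0"
    and Sm [measurable]: "S \<in> BM" and Sz: "\<And>p. p \<notin> QT T \<Longrightarrow> S p = 0"
    and Slim: "AE p in lborel. (\<lambda>n. s n p) \<longlonglongrightarrow> S p"
    and v0xm [measurable]: "\<And>n. v0x n \<in> BM" and v0xK: "\<And>n. AE x in lborel. \<bar>v0x n x\<bar> \<le> K"
    and v0xz: "\<And>n x. x \<notin> {0<..<1} \<Longrightarrow> v0x n x = 0" and v0K: "\<And>n. AE x in lborel. \<bar>v0 n x\<bar> \<le> K"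
    and v0ac: "\<And>n. \<exists>c. AE x in lborel. x \<in> {0<..<1} \<longrightarrow> v0 n x = c + prim (v0x n) x"
    and Fm [measurable]: "F \<in> BM" and Fb: "\<exists>KF. AE q in lborel. \<bar>F q\<bar> \<le> KF"
    and Flim: "\<And>h. L1 h \<Longrightarrow>
       (\<lambda>n. LBINT q. ind (QT T) (fst q, fst (snd q)) * ind {u n (fst q, fst (snd q))<..} (snd (snd q)) * h q)
         \<longlonglongrightarrow> (LBINT q. F q * h q)"
    and Ym: "\<And>\<beta>. continuous_on UNIV \<beta> \<Longrightarrow> Y \<beta> \<in> BM"
    and Yz: "\<And>\<beta> p. p \<notin> QT T \<Longrightarrow> Y \<beta> p = 0"
    and Yb: "\<And>\<beta>. continuous_on UNIV \<beta> \<Longrightarrow> \<exists>KY. AE p in lborel. \<bar>Y \<beta> p\<bar> \<le> KY"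
    and Ylim: "\<And>\<beta> h. continuous_on UNIV \<beta> \<Longrightarrow> L1 h \<Longrightarrow>
       (\<lambda>n. LBINT p. ind (QT T) p * \<beta> (u n p) * h p) \<longlonglongrightarrow> (LBINT p. Y \<beta> p * h p)"
begin

interpretation st: kv_strip T R \<sigma> \<sigma>' "u0 n" "v0 n" "u n" "v n" "w n" "s n" "g n" for n
  by (rule strip)

lemma T: "T > 0" using st.T .

lemma integrable_square_on_Q:
  fixes f :: "real \<times> real \<Rightarrow> real"
  assumes "f \<in> BM" "\<And>p. p \<notin> QT T \<Longrightarrow> f p = 0" "L1 (\<lambda>p. (f p)\<^sup>2)"
  shows "L1 f"
  by (rule integrable_of_square[OF st.Q_int assms])

lemma vl_int: "L1 vl"
  by (rule integrable_square_on_Q[OF vlm vlz vl2])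

lemma s_bound: obtains Cs where "\<And>n. (LBINT p. (s n p)\<^sup>2) \<le> Cs"
proof -
  obtain B where B: "\<And>y. \<bar>y\<bar> \<le> R \<Longrightarrow> \<bar>\<sigma> y\<bar> \<le> B" using st.bounded_on_R[OF st.\<sigma>_cont(1)] by metis
  show ?thesis
  proof (rule that)
    fix n
    show "(LBINT p. (s n p)\<^sup>2) \<le> 2 * (B\<^sup>2 * measure lborel (QT T)) + 2 * C2"
      using st.s_sq_bound[of B n] B w2[of n] by auto
  qed
qed

lemma S_sq: "L1 (\<lambda>p. (S p)\<^sup>2)" and s_L1: "(\<lambda>n. LBINT p. \<bar>s n p - S p\<bar>) \<longlonglongrightarrow> 0"
proof -
  obtain Cs where Cs: "\<And>n. (LBINT p. (s n p)\<^sup>2) \<le> Cs" using s_bound by metis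
  note L = L2_bounded_AE_limit[OF QT_sets QT_finite st.meas(4) Sm _ Sz st.s_sq Cs Slim]
  show "L1 (\<lambda>p. (S p)\<^sup>2)" "(\<lambda>n. LBINT p. \<bar>s n p - S p\<bar>) \<longlonglongrightarrow> 0"
    using L st.zero by auto
qed

lemma S_int: "L1 S"
  by (rule integrable_square_on_Q[OF Sm Sz S_sq])

text \<open>On \<open>QT T\<close>, \<open>\<bar>a\<bar> \<le> d + a\<^sup>2 / d\<close>: a small
  \<open>d\<close> is fixed first, then the \<open>L^2\<close> convergence is used.\<close>

lemma v_L1: "(\<lambda>n. LBINT p. \<bar>v n p - vl p\<bar>) \<longlonglongrightarrow> 0"
proof (rule tendsto_zero_by_approximation)
  fix e :: real assume e: "e > 0"
  define M where "M = measure lborel (QT T)"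
  have M0: "M \<ge> 0" by (simp add: M_def)
  define d where "d = e / (M + 1)"
  have d: "d > 0" using e M0 by (simp add: d_def)
  have "(\<lambda>n. (LBINT p. (v n p - vl p)\<^sup>2) / d) \<longlonglongrightarrow> 0"
    using tendsto_divide[OF vlim tendsto_const, of d] d by simp
  moreover have "(LBINT p. \<bar>v n p - vl p\<bar>) \<le> (LBINT p. (v n p - vl p)\<^sup>2) / d + e" for n
  proof -
    have i2: "L1 (\<lambda>p. (v n p - vl p)\<^sup>2)"
      by (rule integrable_square_add(2)[OF st.meas(2) vlm st.sq(1) vl2])
    have pt: "\<bar>v n p - vl p\<bar> \<le> d * ind (QT T) p + (v n p - vl p)\<^sup>2 / d" for p
    proof (cases "p \<in> QT T")
      case False
      then show ?thesis using st.zero[OF False] vlz[OF False] d by simp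
    next
      case True
      have "2 * (d * \<bar>v n p - vl p\<bar>) \<le> d * d + (v n p - vl p)\<^sup>2"
        using sum_squares_bound[of d "\<bar>v n p - vl p\<bar>"] by (simp add: power2_eq_square mult.assoc)
      moreover have "0 \<le> d * \<bar>v n p - vl p\<bar>" using d by simp
      ultimately have "d * \<bar>v n p - vl p\<bar> \<le> d * d + (v n p - vl p)\<^sup>2" by linarith
      then have "\<bar>v n p - vl p\<bar> \<le> (d * d + (v n p - vl p)\<^sup>2) / d" using d by (simp add: field_simps)
      then show ?thesis using True d by (simp add: add_divide_distrib)
    qed
    have "(LBINT p. \<bar>v n p - vl p\<bar>) \<le> (LBINT p. d * ind (QT T) p + (v n p - vl p)\<^sup>2 / d)"
      using st.ints(1) vl_int i2 st.Q_int pt by (intro integral_mono) auto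
    also have "\<dots> = d * M + (LBINT p. (v n p - vl p)\<^sup>2) / d"
      using i2 st.Q_int by (simp add: M_def)
    also have "d * M \<le> e" using M0 e by (simp add: d_def field_simps)
    finally show ?thesis by simp
  qed
  ultimately show "\<exists>Y. Y \<longlonglongrightarrow> 0 \<and> (\<forall>n. (LBINT p. \<bar>v n p - vl p\<bar>) \<le> Y n + e)" by blast
qed simp

lemma v_tendsto:
  assumes "\<psi> \<in> BM" "\<And>p. \<bar>\<psi> p\<bar> \<le> B"
  shows "(\<lambda>n. LBINT p. v n p * \<psi> p) \<longlonglongrightarrow> (LBINT p. vl p * \<psi> p)"
  by (rule tendsto_L1_mult[OF st.ints(1) vl_int v_L1 assms])

lemma s_tendsto:
  assumes "\<psi> \<in> BM" "\<And>p. \<bar>\<psi> p\<bar> \<le> B"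
  shows "(\<lambda>n. LBINT p. s n p * \<psi> p) \<longlonglongrightarrow> (LBINT p. S p * \<psi> p)"
  by (rule tendsto_L1_mult[OF st.s_int S_int s_L1 assms])

text \<open>The only candidate for the weak limit of \<open>w n\<close>, as each \<open>w n\<close>
  is the stress minus \<sigma>(u n). That it is the \<open>x\<close>-derivative of \<open>vl\<close>
  is a theorem, \<open>vl_x_deriv\<close>.\<close>

definition vx :: "real \<times> real \<Rightarrow> real" where "vx p = S p - Y \<sigma> p"

lemma vx_meas [measurable]: "vx \<in> BM"
  unfolding vx_def[abs_def] using Ym[OF st.\<sigma>_cont(1)] by simp

lemma vx_zero: "p \<notin> QT T \<Longrightarrow> vx p = 0"
  by (simp add: vx_def Sz Yz)

lemma Y_int: assumes \<beta>: "continuous_on UNIV \<beta>" and h: "L1 h"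
  shows "L1 (\<lambda>p. h p * Y \<beta> p)"
  using Yb[OF \<beta>] integrable_mult_bounded[OF h Ym[OF \<beta>]] by blast

lemma Y_int1: assumes \<beta>: "continuous_on UNIV \<beta>"
  shows "L1 (Y \<beta>)"
proof -
  have "(\<lambda>p. ind (QT T) p * Y \<beta> p) = Y \<beta>"
    by (rule ext) (use Yz in \<open>auto simp: indicator_def\<close>)
  then show ?thesis using Y_int[OF \<beta> st.Q_int] by simp
qed

lemma vx_sq: "L1 (\<lambda>p. (vx p)\<^sup>2)"
proof -
  have "L1 (\<lambda>p. (Y \<sigma> p)\<^sup>2)" using Y_int[OF st.\<sigma>_cont(1) Y_int1[OF st.\<sigma>_cont(1)]] by (simp add: power2_eq_square)
  then show ?thesis unfolding vx_def by (intro integrable_square_add(2) Sm Ym st.\<sigma>_cont(1) S_sq)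
qed

lemma vx_int: "L1 vx"
  by (rule integrable_square_on_Q[OF vx_meas vx_zero vx_sq])

lemma w_tendsto:
  assumes m: "\<psi> \<in> BM" and b: "\<And>p. \<bar>\<psi> p\<bar> \<le> B" and z: "\<And>p. p \<notin> QT T \<Longrightarrow> \<psi> p = 0"
  shows "(\<lambda>n. LBINT p. w n p * \<psi> p) \<longlonglongrightarrow> (LBINT p. vx p * \<psi> p)"
proof -
  have "L1 (\<lambda>p. ind (QT T) p * \<psi> p)"
    by (rule integrable_mult_bounded[OF st.Q_int m, of B]) (use b in auto)
  moreover have "(\<lambda>p. ind (QT T) p * \<psi> p) = \<psi>"
    by (rule ext) (use z in \<open>auto simp: indicator_def\<close>)
  ultimately have \<psi>i: "L1 \<psi>" by simp
  have e: "(LBINT p. w n p * \<psi> p) = (LBINT p. s n p * \<psi> p) - (LBINT p. ind (QT T) p * \<sigma> (u n p) * \<psi> p)" for n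
  proof -
    have "L1 (\<lambda>p. s n p * \<psi> p)"
      by (rule integrable_mult_bounded[OF st.s_int m, of B]) (use b in auto)
    moreover have "L1 (\<lambda>p. ind (QT T) p * \<sigma> (u n p) * \<psi> p)"
      by (rule integrable_mult_bounded[OF st.integrable_comp_u[OF st.\<sigma>_cont(1) st.Q_int] m, of B]) (use b in auto)
    ultimately have "(LBINT p. s n p * \<psi> p) - (LBINT p. ind (QT T) p * \<sigma> (u n p) * \<psi> p) =
      (LBINT p. s n p * \<psi> p - ind (QT T) p * \<sigma> (u n p) * \<psi> p)" by simp
    also have "\<dots> = (LBINT p. w n p * \<psi> p)"
      by (intro LINT_cong) (simp add: st.s_split[of n] algebra_simps)
    finally show ?thesis by simp
  qed
  have "L1 (\<lambda>p. S p * \<psi> p)" "L1 (\<lambda>p. Y \<sigma> p * \<psi> p)"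
    by (rule integrable_mult_bounded[OF S_int m, of B] integrable_mult_bounded[OF Y_int1[OF st.\<sigma>_cont(1)] m, of B]; use b in simp)+
  then have "(LBINT p. vx p * \<psi> p) = (LBINT p. S p * \<psi> p) - (LBINT p. Y \<sigma> p * \<psi> p)"
    by (simp add: vx_def left_diff_distrib)
  then show ?thesis
    unfolding e using tendsto_diff[OF s_tendsto[OF m b] Ylim[OF st.\<sigma>_cont(1) \<psi>i]] by simp
qed

text \<open>The duality relation \<open>ibp_x\<close> of each pair \<open>v n\<close>,
  \<open>w n\<close> is linear with fixed bounded test functions, so it passes to the limit;
  \<open>x_deriv_by_duality\<close> then recovers the derivative.\<close>

lemma vl_x_deriv:
  "AE t in lborel. t \<in> {0<..T} \<longrightarrow> (\<exists>c. AE x in lborel. x \<in> {0<..<1} \<longrightarrow> vl (t, x) = c + prim (\<lambda>y. vx (t, y)) x)"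
proof (rule x_deriv_by_duality[OF vl_int vx_int vlm vx_meas])
  show "vl p = 0 \<and> vx p = 0" if "p \<notin> QT T" for p using that vlz vx_zero by simp
  fix a :: "real \<times> real \<Rightarrow> real" and K
  assume am: "a \<in> BM" and aK: "\<And>p. \<bar>a p\<bar> \<le> K" and az: "\<And>p. p \<notin> QT T \<Longrightarrow> a p = 0"
    and a1: "\<And>t. prim (\<lambda>y. a (t, y)) 1 = 0"
  \<comment> \<open>Cut off outside \<open>QT T\<close>, as \<open>w_tendsto\<close> demands of its
    test functions; \<open>w n\<close> and \<open>vx\<close> vanish there, so no integral
    changes.\<close>
  define P where "P p = ind (QT T) p * prim (\<lambda>y. a (fst p, y)) (snd p)" for p
  have Pm: "P \<in> BM" unfolding P_def[abs_def]
    using measurable_prim_fst(2)[OF am] st.Q_sets by (intro borel_measurable_times borel_measurable_indicator) auto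
  have K0: "0 \<le> K" using aK[of "(0, 0)"] by linarith
  have ai: "L1 (\<lambda>y. a (t, y))" "(LBINT y. \<bar>a (t, y)\<bar>) \<le> K" for t
    by (rule integrable_bounded_01; use measurable_section(1)[OF am] aK az in \<open>auto simp: QT_def\<close>)+
  have pK: "\<bar>prim (\<lambda>y. a (t, y)) x\<bar> \<le> K" for t x
    using prim_abs_bound[OF ai(1), of t x] ai(2)[of t] by linarith
  have PK: "\<bar>P p\<bar> \<le> K" for p using pK K0 by (auto simp: P_def indicator_def)
  have WP: "(LBINT p. W p * prim (\<lambda>y. a (fst p, y)) (snd p)) = (LBINT p. W p * P p)" if "\<And>p. p \<notin> QT T \<Longrightarrow> W p = 0" for W :: "real \<times> real \<Rightarrow> real"
    by (intro LINT_cong) (use that in \<open>auto simp: P_def indicator_def\<close>)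
  have "(LBINT p. w n p * P p) + (LBINT p. v n p * a p) = 0" for n
  proof -
    have "(LBINT p. w n p * prim (\<lambda>y. a (fst p, y)) (snd p)) + (LBINT p. v n p * a p) = 0"
      by (rule ibp_x[OF st.ints(1) st.ints(2) st.meas(2) st.meas(3) am _ st.v_x aK ai(1) a1 _ _ measurable_prim_fst(2)[OF am]])
        (use st.zero pK in auto)
    then show ?thesis using WP[of "w n"] st.zero by simp
  qed
  moreover have "(\<lambda>n. (LBINT p. w n p * P p) + (LBINT p. v n p * a p)) \<longlonglongrightarrow> (LBINT p. vx p * P p) + (LBINT p. vl p * a p)"
    by (intro tendsto_add w_tendsto[OF Pm PK] v_tendsto[OF am aK]) (simp add: P_def)
  ultimately have "(LBINT p. vx p * P p) + (LBINT p. vl p * a p) = 0" by (simp add: LIMSEQ_const_iff)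
  then show "(LBINT p. vx p * prim (\<lambda>y. a (fst p, y)) (snd p)) + (LBINT p. vl p * a p) = 0"
    using WP[OF vx_zero] by simp
qed

end

section \<open>Convergence of the initial velocities and smallness of \<open>w\<close> over short
  times\<close>

lemma prim_lipschitz:
  assumes f: "L1 f" and K: "AE x in lborel. \<bar>f x\<bar> \<le> K" and "0 \<le> a" "a \<le> b"
  shows "\<bar>prim f b - prim f a\<bar> \<le> K * (b - a)"
proof -
  have "L1 (ind {a<..b} :: real \<Rightarrow> real)" using assms by (intro integrable_real_indicator) auto
  from integral_mult_bounded[OF this _ K] f show ?thesis
    unfolding prim_diff[OF f assms(3,4)] using assms(4) by simp
qed

context kv_limit
begin

interpretation st: kv_strip T R \<sigma> \<sigma>' "u0 n" "v0 n" "u n" "v n" "w n" "s n" "g n" for n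
  by (rule strip)

lemma K0: "0 \<le> K"
proof (rule ccontr)
  assume "\<not> 0 \<le> K"
  then have "AE x::real in lborel. False" using v0K[of 0] by (auto elim!: eventually_mono)
  then have "emeasure lborel (UNIV :: real set) = 0" by (simp add: AE_iff_null null_sets_def)
  then show False by simp
qed

lemma v0x_int: "L1 (v0x n)"
  by (rule integrable_bounded_01[OF v0xm v0xK v0xz])

text \<open>By \<open>v0_test\<close> these integrals are fixed linear combinations of integrals of
  \<open>v n\<close> and \<open>s n\<close> against bounded functions.\<close>

lemma v0_test_convergent:
  assumes q: "q \<in> BM" "\<And>y. \<bar>q y\<bar> \<le> B" "\<And>y. y \<notin> {0<..<1} \<Longrightarrow> q y = 0"
  shows "convergent (\<lambda>n. LBINT x. v0 n x * prim q x)"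
proof -
  have qi: "L1 q" and PK: "\<And>y. \<bar>prim q y\<bar> \<le> B" using st.v0_test[OF q] by auto
  have Pm: "prim q \<in> BM" by (intro borel_measurable_continuous_onI continuous_on_prim qi)
  define \<alpha> where "\<alpha> p = - ind {0..T} (fst p) * prim q (snd p)" for p :: "real \<times> real"
  define \<beta> where "\<beta> p = ind {0..T} (fst p) * (T - fst p) * q (snd p)" for p :: "real \<times> real"
  have m: "\<alpha> \<in> BM" "\<beta> \<in> BM"
    unfolding \<alpha>_def[abs_def] \<beta>_def[abs_def]
    using measurable_compose[OF measurable_proj(2) Pm] measurable_compose[OF measurable_proj(2) q(1)] by measurable
  have B0: "0 \<le> B" using q(2)[of 0] by linarith
  have b1: "\<bar>\<alpha> p\<bar> \<le> B" for p using PK[of "snd p"] B0 by (auto simp: \<alpha>_def indicator_def)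
  have b2: "\<bar>\<beta> p\<bar> \<le> T * B" for p
  proof (cases "fst p \<in> {0..T}")
    case True
    then have "\<bar>\<beta> p\<bar> = (T - fst p) * \<bar>q (snd p)\<bar>" by (simp add: \<beta>_def abs_mult)
    also have "\<dots> \<le> T * B" using True q(2) T by (intro mult_mono) auto
    finally show ?thesis .
  next
    case False then show ?thesis using T B0 by (simp add: \<beta>_def)
  qed
  have i1: "L1 (\<lambda>p. v n p * \<alpha> p)" "L1 (\<lambda>p. s n p * \<beta> p)" for n
    by (rule integrable_mult_bounded[OF st.ints(1) m(1), of B] integrable_mult_bounded[OF st.s_int m(2), of "T * B"]; use b1 b2 in simp)+
  have "(LBINT x. v0 n x * prim q x) = (1 / T) * ((LBINT p. s n p * \<beta> p) - (LBINT p. v n p * \<alpha> p))" for n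
  proof -
    have "(LBINT p. v n p * \<alpha> p - s n p * \<beta> p) + T * (LBINT x. v0 n x * prim q x) = 0"
      using st.v0_test(3)[OF q, of n] unfolding \<alpha>_def \<beta>_def .
    then show ?thesis using i1[of n] T by (simp add: field_simps)
  qed
  moreover have "(\<lambda>n. (1 / T) * ((LBINT p. s n p * \<beta> p) - (LBINT p. v n p * \<alpha> p)))
    \<longlonglongrightarrow> (1 / T) * ((LBINT p. S p * \<beta> p) - (LBINT p. vl p * \<alpha> p))"
    by (intro tendsto_mult tendsto_const tendsto_diff s_tendsto[OF m(2) b2] v_tendsto[OF m(1) b1])
  ultimately show ?thesis by (auto simp: convergent_def)
qed

text \<open>The Lipschitz representative of \<open>v0 n\<close>. It can be evaluated at single
  points, including 0 and 1, where it will give the integrals of \<open>v0x n\<close> over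
  intervals.\<close>

definition V0 :: "nat \<Rightarrow> real \<Rightarrow> real"
  where "V0 n x = (SOME c. AE x in lborel. x \<in> {0<..<1} \<longrightarrow> v0 n x = c + prim (v0x n) x) + prim (v0x n) x"

lemma V0_AE: "AE x in lborel. x \<in> {0<..<1} \<longrightarrow> v0 n x = V0 n x"
  unfolding V0_def by (rule someI_ex[OF v0ac])

lemma V0_lipschitz: "0 \<le> a \<Longrightarrow> a \<le> b \<Longrightarrow> \<bar>V0 n b - V0 n a\<bar> \<le> K * (b - a)"
  using prim_lipschitz[OF v0x_int v0xK] by (simp add: V0_def)

text \<open>Weighted means of \<open>v0 n\<close> near \<open>x\<close> converge by
  \<open>v0_test_convergent\<close>. By the Lipschitz constant \<open>K\<close>, common to all
  \<open>n\<close>, they approximate the value at \<open>x\<close> uniformly in \<open>n\<close>, so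
  pointwise convergence holds for the whole sequence.\<close>

lemma V0_convergent:
  assumes x: "x \<in> {0..1}"
  shows "convergent (\<lambda>n. V0 n x)"
proof -
  have main: "convergent (\<lambda>n. V0 n x)" if x: "0 \<le> x" "x < 1" for x
  proof (rule Cauchy_by_approximation)
    fix e :: real assume e: "e > 0"
    \<comment> \<open>The first bound keeps the weight inside the unit interval, the second makes
      the oscillation \<open>K * (2 * \<eta>)\<close> over its support at most
      \<open>e\<close>.\<close>
    define \<eta> where "\<eta> = min ((1 - x) / 3) (e / (2 * (K + 1)))"
    have \<eta>: "\<eta> > 0" "x + 2 * \<eta> < 1" using x e K0 by (auto simp: \<eta>_def min_def field_simps)
    have \<eta>e: "K * (2 * \<eta>) \<le> e"
    proof -
      have "K * (2 * \<eta>) \<le> (K + 1) * (2 * (e / (2 * (K + 1))))"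
        using \<eta> K0 by (intro mult_mono) (auto simp: \<eta>_def)
      also have "\<dots> = e" using K0 by (simp add: field_simps)
      finally show ?thesis .
    qed
    \<comment> \<open>Its primitive is the hat function on \<open>[x, x + 2 * \<eta>]\<close> with
      peak \<eta> at the midpoint. It lies to the right of \<open>x\<close>, so that
      \<open>x = 0\<close> is included.\<close>
    define q :: "real \<Rightarrow> real" where "q y = ind {x<..<x + \<eta>} y - ind {x + \<eta><..<x + 2 * \<eta>} y" for y
    have qm: "q \<in> BM" unfolding q_def[abs_def] by measurable
    have q1: "\<bar>q y\<bar> \<le> 1" for y by (auto simp: q_def indicator_def)
    have qz: "q y = 0" if "y \<notin> {0<..<1}" for y using that x \<eta> by (auto simp: q_def indicator_def)
    define P where "P y = prim q y" for y
    have Pf: "P y = max 0 (min y (x + \<eta>) - x) - max 0 (min y (x + 2 * \<eta>) - (x + \<eta>))" for y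
    proof -
      have "P y = prim (ind {x<..<x + \<eta>}) y - prim (ind {x + \<eta><..<x + 2 * \<eta>}) y"
        unfolding P_def q_def[abs_def] using \<eta> by (intro prim_minus integrable_real_indicator) auto
      then show ?thesis using x \<eta> by (simp add: prim_indicator)
    qed
    have P0: "0 \<le> P y" for y unfolding Pf using \<eta> by (auto simp: min_def max_def)
    have Pz: "P y = 0" if "y \<notin> {x<..<x + 2 * \<eta>}" for y using that \<eta> unfolding Pf by (auto simp: min_def max_def)
    have PB: "\<bar>P y\<bar> \<le> 1" and qi: "L1 q" for y using st.v0_test(1,2)[OF qm q1 qz] by (auto simp: P_def)
    have Pm: "P \<in> BM" unfolding P_def[abs_def] by (intro borel_measurable_continuous_onI continuous_on_prim qi)
    have Pi: "L1 P"
      by (rule integrable_bounded_01[OF Pm, of 1]) (use PB Pz x \<eta> in auto)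
    define c where "c = (LBINT y. P y)"
    have c: "c > 0"
    proof -
      have "(LBINT y. (\<eta> / 2) * ind {x + \<eta> / 2..x + \<eta>} y) \<le> c"
        unfolding c_def
      proof (rule integral_mono[OF _ Pi])
        show "L1 (\<lambda>y. \<eta> / 2 * ind {x + \<eta> / 2..x + \<eta>} y)"
          by (intro integrable_mult_right integrable_real_indicator) (auto simp: emeasure_lborel_Icc_eq)
        show "\<eta> / 2 * ind {x + \<eta> / 2..x + \<eta>} y \<le> P y" for y
          using P0[of y] \<eta> by (auto simp: Pf indicator_def min_def max_def)
      qed
      moreover have "(LBINT y. (\<eta> / 2) * ind {x + \<eta> / 2..x + \<eta>} y) = \<eta> / 2 * (\<eta> / 2)" using \<eta> by simp
      moreover have "0 < \<eta> / 2 * (\<eta> / 2)" using \<eta> by simp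
      ultimately show ?thesis by linarith
    qed
    have vP: "L1 (\<lambda>y. v0 n y * P y)" for n
      by (rule integrable_mult_bounded[OF st.v0i Pm, of 1]) (use PB in auto)
    have near: "\<bar>V0 n x - (LBINT y. v0 n y * P y) / c\<bar> \<le> e" for n
    proof -
      have i: "L1 (\<lambda>y. V0 n x * P y - v0 n y * P y)" using vP Pi by auto
      have "V0 n x * c - (LBINT y. v0 n y * P y) = (LBINT y. V0 n x * P y - v0 n y * P y)"
        using vP Pi by (simp add: c_def)
      also have "\<bar>\<dots>\<bar> \<le> (LBINT y. \<bar>V0 n x * P y - v0 n y * P y\<bar>)" by (rule integral_abs_bound)
      also have "\<dots> \<le> (LBINT y. e * P y)"
      proof (rule integral_mono_AE)
        show "AE y in lborel. \<bar>V0 n x * P y - v0 n y * P y\<bar> \<le> e * P y"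
          using V0_AE[of n]
        proof eventually_elim
          case (elim y)
          show ?case
          proof (cases "y \<in> {x<..<x + 2 * \<eta>}")
            case False then show ?thesis using Pz by simp
          next
            case True
            then have "v0 n y = V0 n y" using elim x \<eta> by auto
            moreover have "\<bar>V0 n y - V0 n x\<bar> \<le> e"
            proof -
              have "\<bar>V0 n y - V0 n x\<bar> \<le> K * (y - x)" using True x by (intro V0_lipschitz) auto
              also have "\<dots> \<le> K * (2 * \<eta>)" using True K0 by (intro mult_left_mono) auto
              finally show ?thesis using \<eta>e by linarith
            qed
            ultimately have "\<bar>V0 n x - v0 n y\<bar> * P y \<le> e * P y" using P0 by (intro mult_right_mono) (auto simp: abs_minus_commute)
            then show ?thesis using P0[of y] by (simp add: left_diff_distrib[symmetric] abs_mult)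
          qed
        qed
      qed (use i Pi in auto)
      also have "\<dots> = e * c" using Pi by (simp add: c_def)
      finally have "\<bar>V0 n x * c - (LBINT y. v0 n y * P y)\<bar> \<le> e * c" .
      moreover have "V0 n x - (LBINT y. v0 n y * P y) / c = (V0 n x * c - (LBINT y. v0 n y * P y)) / c"
        using c by (simp add: field_simps)
      ultimately show ?thesis using c by (simp add: abs_divide field_simps)
    qed
    have "convergent (\<lambda>n. (LBINT y. v0 n y * P y) / c)"
    proof -
      obtain L where "(\<lambda>n. LBINT y. v0 n y * P y) \<longlonglongrightarrow> L"
        using v0_test_convergent[OF qm q1 qz] by (auto simp: P_def convergent_def)
      then have "(\<lambda>n. (LBINT y. v0 n y * P y) / c) \<longlonglongrightarrow> L / c" using c by (intro tendsto_divide tendsto_const) auto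
      then show ?thesis by (rule convergentI)
    qed
    with near show "\<exists>Z. convergent Z \<and> (\<forall>n. \<bar>V0 n x - Z n\<bar> \<le> e)" by blast
  qed
  show ?thesis
  proof (cases "x < 1")
    case True then show ?thesis using main x by auto
  next
    case False
    \<comment> \<open>No hat fits to the right of 1; the value there is approximated from points
      \<open>y < 1\<close> by the Lipschitz bound.\<close>
    then have x1: "x = 1" using x by simp
    show ?thesis
    proof (rule Cauchy_by_approximation)
      fix e :: real assume e: "e > 0"
      define y where "y = max 0 (1 - e / (K + 1))"
      have y: "0 \<le> y" "y < 1" using e K0 by (auto simp: y_def)
      have "\<bar>V0 n x - V0 n y\<bar> \<le> e" for n
      proof -
        have "\<bar>V0 n x - V0 n y\<bar> \<le> K * (1 - y)" using V0_lipschitz[of y 1 n] y x1 by simp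
        also have "\<dots> \<le> (K + 1) * (e / (K + 1))" using K0 y by (intro mult_mono) (auto simp: y_def)
        also have "\<dots> = e" using K0 by simp
        finally show ?thesis .
      qed
      with main[OF y] show "\<exists>Z. convergent Z \<and> (\<forall>n. \<bar>V0 n x - Z n\<bar> \<le> e)" by blast
    qed
  qed
qed

definition vini :: "real \<Rightarrow> real" where "vini x = ind {0<..<1} x * lim (\<lambda>n. V0 n x)"

lemma V0_cont: "continuous_on A (V0 n)"
  unfolding V0_def[abs_def] by (intro continuous_intros continuous_on_prim v0x_int)

lemma vini_meas [measurable]: "vini \<in> BM"
proof -
  have "V0 n \<in> BM" for n by (intro borel_measurable_continuous_onI V0_cont)
  then show ?thesis unfolding vini_def[abs_def]
    by (intro borel_measurable_times borel_measurable_lim_metric) auto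
qed

lemma v0_AE_lim: "AE x in lborel. (\<lambda>n. v0 n x) \<longlonglongrightarrow> vini x"
proof -
  have "AE x in lborel. \<forall>n. x \<in> {0<..<1} \<longrightarrow> v0 n x = V0 n x" using V0_AE by (subst AE_all_countable) auto
  then show ?thesis
  proof eventually_elim
    case (elim x)
    show ?case
    proof (cases "x \<in> {0<..<1}")
      case True
      then have "(\<lambda>n. V0 n x) \<longlonglongrightarrow> lim (\<lambda>n. V0 n x)" using V0_convergent[of x] by (simp add: convergent_LIMSEQ_iff)
      then show ?thesis using elim True by (simp add: vini_def)
    next
      case False then show ?thesis using st.zero0 by (simp add: vini_def)
    qed
  qed
qed

lemma vini_bound: "AE x in lborel. \<bar>vini x\<bar> \<le> K"
proof -
  have "AE x in lborel. \<forall>n. \<bar>v0 n x\<bar> \<le> K" using v0K by (subst AE_all_countable) auto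
  with v0_AE_lim show ?thesis
    by eventually_elim (auto intro: LIMSEQ_le_const2[OF tendsto_rabs])
qed

lemma vini_zero: "x \<notin> {0<..<1} \<Longrightarrow> vini x = 0" by (simp add: vini_def)

lemma v0_tendsto:
  assumes h: "L1 h"
  shows "(\<lambda>n. LBINT x. v0 n x * h x) \<longlonglongrightarrow> (LBINT x. vini x * h x)"
proof (rule integral_dominated_convergence[where w="\<lambda>x. K * \<bar>h x\<bar>"])
  show "AE x in lborel. (\<lambda>n. v0 n x * h x) \<longlonglongrightarrow> vini x * h x"
    using v0_AE_lim by eventually_elim (intro tendsto_intros)
  show "AE x in lborel. norm (v0 n x * h x) \<le> K * \<bar>h x\<bar>" for n
    using v0K[of n] by eventually_elim (auto simp: abs_mult intro: mult_right_mono)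
qed (use h st.meas(7) in auto)

lemma v0_L2: "(\<lambda>n. LBINT x. (v0 n x - vini x)\<^sup>2) \<longlonglongrightarrow> 0"
proof -
  have "(\<lambda>n. LBINT x. (v0 n x - vini x)\<^sup>2) \<longlonglongrightarrow> (LINT x::real|lborel. (0::real))"
  proof (rule integral_dominated_convergence[where w="\<lambda>x. 4 * K\<^sup>2 * ind {0..1} x"])
    show "L1 (\<lambda>x::real. 4 * K\<^sup>2 * ind {0..1} x)" by (rule integrable_01)
    show "AE x in lborel. (\<lambda>n. (v0 n x - vini x)\<^sup>2) \<longlonglongrightarrow> 0"
      using v0_AE_lim
    proof eventually_elim
      case (elim x)
      have "(\<lambda>n. (v0 n x - vini x)\<^sup>2) \<longlonglongrightarrow> (vini x - vini x)\<^sup>2" by (intro tendsto_intros elim)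
      then show ?case by simp
    qed
    show "AE x in lborel. norm ((v0 n x - vini x)\<^sup>2) \<le> 4 * K\<^sup>2 * ind {0..1} x" for n
      using v0K[of n] vini_bound
    proof eventually_elim
      case (elim x)
      show ?case
      proof (cases "x \<in> {0<..<1}")
        case True
        have "\<bar>v0 n x - vini x\<bar>\<^sup>2 \<le> (2 * K)\<^sup>2" using elim by (intro power_mono) auto
        then show ?thesis using True by (simp add: power_mult_distrib)
      next
        case False then show ?thesis using st.zero0[of x n] vini_zero[of x] by simp
      qed
    qed
  qed (use st.meas(7) in auto)
  then show ?thesis by simp
qed

text \<open>Uniform integrability from the \<open>L^2\<close> bound: on \<open>QT \<delta>\<close>,
  \<open>\<bar>w\<bar> \<le> \<Lambda> + w\<^sup>2 / \<Lambda>\<close>. A large \<Lambda> makes the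
  quadratic part at most \<open>e / 2\<close> for all \<open>n\<close>, and then \<delta> is chosen
  so that \<Lambda> times \<delta> is at most \<open>e / 2\<close>.\<close>

lemma w_short_time:
  assumes e: "e > 0"
  obtains \<delta> where "\<delta> > 0" "\<delta> < T" "\<And>n. (LBINT p. ind {0..\<delta>} (fst p) * \<bar>w n p\<bar>) \<le> e"
proof -
  have C20: "0 \<le> C2"
  proof -
    have "0 \<le> (LBINT p. (w 0 p)\<^sup>2)" by (rule LINT_nonneg) simp
    then show ?thesis using w2[of 0] by linarith
  qed
  define \<Lambda> where "\<Lambda> = 2 * (C2 + 1) / e"
  have \<Lambda>: "\<Lambda> > 0" using e C20 by (simp add: \<Lambda>_def)
  define \<delta> where "\<delta> = min (T / 2) (e / (2 * \<Lambda>))"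
  have \<delta>: "\<delta> > 0" "\<delta> < T" "\<Lambda> * \<delta> \<le> e / 2"
  proof -
    show "\<delta> > 0" "\<delta> < T" using T e \<Lambda> by (auto simp: \<delta>_def)
    have "\<Lambda> * \<delta> \<le> \<Lambda> * (e / (2 * \<Lambda>))" using \<Lambda> by (intro mult_left_mono) (auto simp: \<delta>_def)
    then show "\<Lambda> * \<delta> \<le> e / 2" using \<Lambda> by simp
  qed
  have Dm: "QT \<delta> \<in> sets borel" "emeasure lborel (QT \<delta>) < \<infinity>" by (rule QT_sets QT_finite)+
  have Di: "L1 (ind (QT \<delta>) :: real \<times> real \<Rightarrow> real)" using Dm by (intro integrable_real_indicator) auto
  have DM: "(LBINT p. ind (QT \<delta>) p) = \<delta>"
  proof -
    have "(LBINT p. ind (QT \<delta>) p) = (LBINT t. LBINT x. (ind (QT \<delta>) (t, x) :: real))"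
      by (rule Fubini_fst(1)[OF Di])
    also have "\<dots> = (LBINT t. ind {0<..\<delta>} t * (LINT x::real|lborel. ind {0<..<1} x))"
      unfolding integral_mult_right_zero[symmetric]
      by (intro LINT_cong) (auto simp: QT_def indicator_def)
    also have "\<dots> = \<delta>" using \<delta> by simp
    finally show ?thesis .
  qed
  show ?thesis
  proof (rule that[OF \<delta>(1,2)])
    fix n
    have m: "(\<lambda>p. ind {0..\<delta>} (fst p) * \<bar>w n p\<bar>) \<in> BM"
      using st.meas(3)[of n] by (intro borel_measurable_times measurable_indicator_Icc) auto
    have wi: "L1 (\<lambda>p. ind {0..\<delta>} (fst p) * \<bar>w n p\<bar>)"
      by (rule L1_bound[OF st.ints(2)[of n]]) (use m in \<open>auto simp: indicator_def\<close>)
    have pt: "ind {0..\<delta>} (fst p) * \<bar>w n p\<bar> \<le> \<Lambda> * ind (QT \<delta>) p + (w n p)\<^sup>2 / \<Lambda>" for p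
    proof (cases "p \<in> QT \<delta>")
      case True
      have "2 * (\<Lambda> * \<bar>w n p\<bar>) \<le> \<Lambda> * \<Lambda> + (w n p)\<^sup>2" using sum_squares_bound[of \<Lambda> "\<bar>w n p\<bar>"] by (simp add: power2_eq_square mult.assoc)
      moreover have "0 \<le> \<Lambda> * \<bar>w n p\<bar>" using \<Lambda> by simp
      ultimately have "\<Lambda> * \<bar>w n p\<bar> \<le> \<Lambda> * \<Lambda> + (w n p)\<^sup>2" by linarith
      then have "\<bar>w n p\<bar> \<le> (\<Lambda> * \<Lambda> + (w n p)\<^sup>2) / \<Lambda>" using \<Lambda> by (simp add: field_simps)
      then have "\<bar>w n p\<bar> \<le> \<Lambda> + (w n p)\<^sup>2 / \<Lambda>" using \<Lambda> by (simp add: add_divide_distrib)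
      moreover have "ind {0..\<delta>} (fst p) * \<bar>w n p\<bar> \<le> \<bar>w n p\<bar>" by (simp add: indicator_def)
      ultimately show ?thesis using True by simp
    next
      case False
      have e0: "ind {0..\<delta>} (fst p) * \<bar>w n p\<bar> = 0"
      proof (cases "p \<in> QT T")
        case True
        then have "fst p \<notin> {0..\<delta>}" using False by (cases p) (auto simp: QT_def)
        then show ?thesis by simp
      qed (use st.zero in simp)
      show ?thesis unfolding e0 using \<Lambda> by simp
    qed
    have "(LBINT p. ind {0..\<delta>} (fst p) * \<bar>w n p\<bar>) \<le> (LBINT p. \<Lambda> * ind (QT \<delta>) p + (w n p)\<^sup>2 / \<Lambda>)"
      using wi Di st.sq(2)[of n] pt by (intro integral_mono) auto
    also have "\<dots> = \<Lambda> * \<delta> + (LBINT p. (w n p)\<^sup>2) / \<Lambda>"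
      using Di st.sq(2)[of n] DM by simp
    also have "\<dots> \<le> e / 2 + e / 2"
    proof (rule add_mono[OF \<delta>(3)])
      have "(LBINT p. (w n p)\<^sup>2) / \<Lambda> \<le> (C2 + 1) / \<Lambda>" using w2[of n] \<Lambda> by (intro divide_right_mono) auto
      also have "\<dots> = e / 2" using e C20 by (simp add: \<Lambda>_def field_simps)
      finally show "(LBINT p. (w n p)\<^sup>2) / \<Lambda> \<le> e / 2" .
    qed
    finally show "(LBINT p. ind {0..\<delta>} (fst p) * \<bar>w n p\<bar>) \<le> e" by simp
  qed
qed

end

section \<open>Limits of the initial indicators and of the initial stress\<close>

text \<open>The passage from strains to indicators is an isometry: closeness of \<open>u\<close> at
  two times in \<open>L^1\<close> becomes closeness of the indicators in \<open>L^1\<close> of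
  \<open>(x, \<xi>)\<close>.\<close>

lemma step_difference:
  fixes a b :: real
  shows "L1 (\<lambda>\<xi>. \<bar>ind {a<..} \<xi> - ind {b<..} \<xi>\<bar> :: real)"
    and "(LBINT \<xi>. \<bar>ind {a<..} \<xi> - ind {b<..} \<xi>\<bar>) = \<bar>a - b\<bar>"
proof -
  have e: "(\<lambda>\<xi>. \<bar>ind {a<..} \<xi> - ind {b<..} \<xi>\<bar>) = (ind {min a b<..max a b} :: real \<Rightarrow> real)"
    by (rule ext) (auto simp: indicator_def min_def max_def)
  show "L1 (\<lambda>\<xi>. \<bar>ind {a<..} \<xi> - ind {b<..} \<xi>\<bar> :: real)"
    unfolding e by (rule integrable_real_indicator) auto
  show "(LBINT \<xi>. \<bar>ind {a<..} \<xi> - ind {b<..} \<xi>\<bar>) = \<bar>a - b\<bar>"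
    unfolding e by (auto simp: min_def max_def)
qed

text \<open>The Cauchy-Schwarz inequality, in the form of Jensen's inequality for the average over
  \<open>(a, b]\<close>. It makes functions with a bounded gradient in \<open>L^2\<close>
  equi-Hoelder of exponent 1/2.\<close>

lemma prim_hoelder:
  assumes f: "L1 f" and f2: "L1 (\<lambda>x. (f x)\<^sup>2)" and a: "0 \<le> a" "a \<le> b"
  shows "(prim f b - prim f a)\<^sup>2 \<le> (b - a) * (LBINT x. (f x)\<^sup>2)"
proof (cases "a = b")
  case False
  then have h: "b - a > 0" using a by simp
  have i2: "L1 (\<lambda>r. ind {a<..b} r * (f r)\<^sup>2)" using f2 by (intro integrable_ind_mult) auto
  have "prim f b - prim f a = (b - a) * stek (b - a) f a"
    using stek_eq_prim[OF f a(1), of "b - a"] h by simp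
  then have "(prim f b - prim f a)\<^sup>2 = (b - a)\<^sup>2 * (stek (b - a) f a)\<^sup>2" by (simp add: power_mult_distrib)
  also have "\<dots> \<le> (b - a)\<^sup>2 * stek (b - a) (\<lambda>s. (f s)\<^sup>2) a"
    by (intro mult_left_mono stek_square_le[OF f f2 h]) auto
  also have "\<dots> = (b - a) * (LBINT r. ind {a<..b} r * (f r)\<^sup>2)"
    using h by (simp add: stek_def power2_eq_square)
  also have "\<dots> \<le> (b - a) * (LBINT x. (f x)\<^sup>2)"
    using h i2 f2 by (intro mult_left_mono integral_mono) (auto simp: indicator_def)
  finally show ?thesis .
qed simp

context kv_limit
begin

interpretation st: kv_strip T R \<sigma> \<sigma>' "u0 n" "v0 n" "u n" "v n" "w n" "s n" "g n" for n
  by (rule strip)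

definition F0 :: "nat \<Rightarrow> real \<times> real \<Rightarrow> real"
  where "F0 n q = ind {0<..<1} (fst q) * ind {u0 n (fst q)<..} (snd q)"

lemma F0_meas [measurable]: "F0 n \<in> BM"
proof -
  have "(\<lambda>q::real \<times> real. u0 n (fst q)) \<in> BM"
    by (rule measurable_compose[OF measurable_proj(1) st.meas(6)])
  then show ?thesis unfolding F0_def[abs_def]
    by (intro borel_measurable_times measurable_indicator_greaterThan measurable_compose[OF measurable_proj(1) borel_measurable_indicator]) auto
qed

lemma F0_bound: "\<bar>F0 n q\<bar> \<le> 1" by (simp add: F0_def indicator_def)

definition Ft :: "nat \<Rightarrow> real \<Rightarrow> real \<times> real \<Rightarrow> real"
  where "Ft n t q = ind (QT T) (t, fst q) * ind {u n (t, fst q)<..} (snd q)"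

lemma Ft_meas3: "(\<lambda>q. Ft n (fst q) (snd q)) \<in> borel_measurable (borel :: (real \<times> real \<times> real) measure)"
proof -
  have p: "(\<lambda>q :: real \<times> real \<times> real. (fst q, fst (snd q))) \<in> BM"
    by (intro borel_measurable_continuous_onI continuous_intros)
  have z: "(\<lambda>q :: real \<times> real \<times> real. snd (snd q)) \<in> BM"
    by (intro borel_measurable_continuous_onI continuous_intros)
  show ?thesis unfolding Ft_def
    by (intro borel_measurable_times measurable_indicator_greaterThan measurable_compose[OF p st.meas(1)] z
        measurable_compose[OF p borel_measurable_indicator[OF QT_sets]])
qed

lemma Ft_meas: "Ft n t \<in> BM"
  using measurable_section(1)[OF Ft_meas3[of n], of t] by simp

lemma F0_Ft_L1:
  assumes t: "t \<in> {0<..T}"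
  shows "L1 (\<lambda>q. F0 n q - Ft n t q)"
    and "(LBINT q. \<bar>F0 n q - Ft n t q\<bar>) \<le> (LBINT p. ind {0..t} (fst p) * \<bar>w n p\<bar>)"
proof -
  have m: "(\<lambda>q. F0 n q - Ft n t q) \<in> BM" using F0_meas Ft_meas by simp
  have e: "\<bar>F0 n (x, \<xi>) - Ft n t (x, \<xi>)\<bar> = ind {0<..<1} x * \<bar>ind {u0 n x<..} \<xi> - ind {u n (t, x)<..} \<xi>\<bar>" for x \<xi>
    using t by (auto simp: F0_def Ft_def indicator_def QT_def)
  have inner: "(LBINT \<xi>. \<bar>F0 n (x, \<xi>) - Ft n t (x, \<xi>)\<bar>) = \<bar>u n (t, x) - u0 n x\<bar>" for x
  proof (cases "x \<in> {0<..<1}")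
    case True
    then show ?thesis unfolding e by (simp add: step_difference abs_minus_commute)
  next
    case False
    then have "(t, x) \<notin> QT T" by (auto simp: QT_def)
    then show ?thesis unfolding e using False st.zero[of "(t, x)" n] st.zero0[OF False, of n] by simp
  qed
  show i: "L1 (\<lambda>q. F0 n q - Ft n t q)"
  proof (rule integrable_pairI_fst[OF m])
    show "AE x in lborel. L1 (\<lambda>\<xi>. F0 n (x, \<xi>) - Ft n t (x, \<xi>))"
    proof (rule AE_I2)
      fix x
      have "L1 (\<lambda>\<xi>. \<bar>F0 n (x, \<xi>) - Ft n t (x, \<xi>)\<bar>)"
        unfolding e by (intro integrable_mult_right step_difference)
      then show "L1 (\<lambda>\<xi>. F0 n (x, \<xi>) - Ft n t (x, \<xi>))"
        by (rule L1_bound) (use measurable_section(1)[OF m, of x] in auto)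
    qed
    show "L1 (\<lambda>x. LBINT \<xi>. \<bar>F0 n (x, \<xi>) - Ft n t (x, \<xi>)\<bar>)"
      unfolding inner using st.u_initial_L1(1)[OF t] by simp
  qed
  have ia: "L1 (\<lambda>q. \<bar>F0 n q - Ft n t q\<bar>)" using i by simp
  have "(LBINT q. \<bar>F0 n q - Ft n t q\<bar>) = (LBINT x. \<bar>u n (t, x) - u0 n x\<bar>)"
    unfolding Fubini_fst(1)[OF ia] by (simp add: inner)
  also have "\<dots> \<le> (LBINT p. ind {0..t} (fst p) * \<bar>w n p\<bar>)" by (rule st.u_initial_L1(2)[OF t])
  finally show "(LBINT q. \<bar>F0 n q - Ft n t q\<bar>) \<le> (LBINT p. ind {0..t} (fst p) * \<bar>w n p\<bar>)" .
qed

text \<open>The indicator at time 0 is compared with its average over the times in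
  \<open>(0, \<delta>)\<close>. These averages converge by \<open>Flim\<close>, and by
  \<open>w_short_time\<close> the error is at most \<open>e\<close> for all \<open>n\<close> at
  once.\<close>

lemma F0_convergent:
  assumes h: "L1 h" and h1: "\<And>q. \<bar>h q\<bar> \<le> 1"
  shows "convergent (\<lambda>n. LBINT q. F0 n q * h q)"
proof (rule Cauchy_by_approximation)
  fix e :: real assume e: "e > 0"
  obtain \<delta> where \<delta>: "\<delta> > 0" "\<delta> < T" "\<And>n. (LBINT p. ind {0..\<delta>} (fst p) * \<bar>w n p\<bar>) \<le> e"
    using w_short_time[OF e] by metis
  have hm: "h \<in> BM" using h by simp
  \<comment> \<open>Integration against \<open>H\<close> is the time average up to the factor
    \<delta>, written as one integrable test function on triples.\<close>
  define H where "H q = ind {0<..<\<delta>} (fst q) * h (snd q)" for q :: "real \<times> real \<times> real"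
  have di: "L1 (ind {0<..<\<delta>} :: real \<Rightarrow> real)" using \<delta> by (intro integrable_real_indicator) auto
  have Hi: "L1 H"
  proof (rule integrable_pairI_fst)
    show "H \<in> BM" unfolding H_def[abs_def]
      by (intro borel_measurable_times measurable_compose[OF measurable_proj(1) borel_measurable_indicator] measurable_compose[OF measurable_proj(2) hm]) auto
    show "AE t in lborel. L1 (\<lambda>q. H (t, q))" using h by (simp add: H_def)
    show "L1 (\<lambda>t. LBINT q. \<bar>H (t, q)\<bar>)" using di by (simp add: H_def abs_mult)
  qed
  define A where "A n = (LBINT q. ind (QT T) (fst q, fst (snd q)) * ind {u n (fst q, fst (snd q))<..} (snd (snd q)) * H q)" for n
  have Ac: "convergent A" unfolding A_def[abs_def] using Flim[OF Hi] by (rule convergentI)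
  have F0h: "L1 (\<lambda>q. F0 n q * h q)" "L1 (\<lambda>q. Ft n t q * h q)" for n t
    using integrable_mult_bounded[OF h F0_meas[of n], of 1] integrable_mult_bounded[OF h Ft_meas[of n t], of 1] F0_bound
    by (auto simp: mult.commute Ft_def indicator_def)
  have near: "\<bar>(LBINT q. F0 n q * h q) - A n / \<delta>\<bar> \<le> e" for n
  proof -
    have FH: "L1 (\<lambda>q. H q * Ft n (fst q) (snd q))"
      by (rule integrable_mult_bounded[OF Hi Ft_meas3[of n], of 1]) (auto simp: Ft_def indicator_def)
    have "A n = (LBINT q. H q * Ft n (fst q) (snd q))"
      unfolding A_def Ft_def by (intro LINT_cong) simp
    also have "\<dots> = (LBINT t. LBINT q. H (t, q) * Ft n t q)" using Fubini_fst(1)[OF FH] by simp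
    also have "\<dots> = (LBINT t. ind {0<..<\<delta>} t * (LBINT q. Ft n t q * h q))"
      unfolding integral_mult_right_zero[symmetric] by (intro LINT_cong) (simp add: H_def)
    finally have An: "A n = (LBINT t. ind {0<..<\<delta>} t * (LBINT q. Ft n t q * h q))" .
    have FtI: "L1 (\<lambda>t. ind {0<..<\<delta>} t * (LBINT q. Ft n t q * h q))"
    proof -
      have "(LBINT q. H (t, q) * Ft n t q) = ind {0<..<\<delta>} t * (LBINT q. Ft n t q * h q)" for t
        unfolding integral_mult_right_zero[symmetric] by (intro LINT_cong) (simp add: H_def)
      then show ?thesis using Fubini_fst(3)[OF FH] by simp
    qed
    let ?X = "LBINT q. F0 n q * h q"
    have dX: "\<delta> * ?X = (LBINT t. ind {0<..<\<delta>} t * ?X)" using \<delta> by simp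
    have XI: "L1 (\<lambda>t. ind {0<..<\<delta>} t * ?X)" using di by simp
    have "\<delta> * ?X - A n = (LBINT t. ind {0<..<\<delta>} t * ?X - ind {0<..<\<delta>} t * (LBINT q. Ft n t q * h q))"
      unfolding dX An using XI FtI by simp
    then have "\<bar>\<delta> * ?X - A n\<bar> \<le> (LBINT t. \<bar>ind {0<..<\<delta>} t * ?X - ind {0<..<\<delta>} t * (LBINT q. Ft n t q * h q)\<bar>)"
      by (simp only: integral_abs_bound)
    also have "\<dots> \<le> (LBINT t. e * ind {0<..<\<delta>} t)"
    proof (rule integral_mono)
      show "L1 (\<lambda>t. \<bar>ind {0<..<\<delta>} t * ?X - ind {0<..<\<delta>} t * (LBINT q. Ft n t q * h q)\<bar>)"
        by (rule integrable_abs[OF L1_diff[OF XI FtI]])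
      show "L1 (\<lambda>t. e * ind {0<..<\<delta>} t)" using di by simp
      fix t
      show "\<bar>ind {0<..<\<delta>} t * ?X - ind {0<..<\<delta>} t * (LBINT q. Ft n t q * h q)\<bar> \<le> e * ind {0<..<\<delta>} t"
      proof (cases "t \<in> {0<..<\<delta>}")
        case True
        then have t: "t \<in> {0<..T}" using \<delta> by simp
        have "?X - (LBINT q. Ft n t q * h q) = (LBINT q. (F0 n q - Ft n t q) * h q)"
          using F0h by (simp add: left_diff_distrib)
        then have "\<bar>?X - (LBINT q. Ft n t q * h q)\<bar> \<le> (LBINT q. \<bar>F0 n q - Ft n t q\<bar>)"
          using integral_mult_bounded[OF F0_Ft_L1(1)[OF t, of n] _ AE_I2[OF h1]] h by simp
        also have "\<dots> \<le> (LBINT p. ind {0..t} (fst p) * \<bar>w n p\<bar>)" by (rule F0_Ft_L1(2)[OF t])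
        also have "\<dots> \<le> (LBINT p. ind {0..\<delta>} (fst p) * \<bar>w n p\<bar>)"
        proof -
          have i: "L1 (\<lambda>p. ind {0..c} (fst p) * \<bar>w n p\<bar>)" for c
          proof (rule L1_bound[OF st.ints(2)[of n]])
            show "(\<lambda>p. ind {0..c} (fst p) * \<bar>w n p\<bar>) \<in> borel_measurable lborel"
              using st.meas(3)[of n] by (intro borel_measurable_times measurable_indicator_Icc) auto
          qed (auto simp: indicator_def)
          show ?thesis by (rule integral_mono[OF i i]) (use True in \<open>auto simp: indicator_def\<close>)
        qed
        also have "\<dots> \<le> e" by (rule \<delta>(3))
        finally show ?thesis using True by simp
      qed simp
    qed
    also have "\<dots> = e * \<delta>" using \<delta> by simp
    finally have "\<bar>\<delta> * ?X - A n\<bar> \<le> e * \<delta>" .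
    moreover have "?X - A n / \<delta> = (\<delta> * ?X - A n) / \<delta>" using \<delta> by (simp add: field_simps)
    ultimately show ?thesis using \<delta> by (simp add: abs_divide field_simps)
  qed
  have "convergent (\<lambda>n. A n / \<delta>)"
  proof -
    obtain L where "A \<longlonglongrightarrow> L" using Ac by (auto simp: convergent_def)
    then have "(\<lambda>n. A n / \<delta>) \<longlonglongrightarrow> L / \<delta>" using \<delta> by (intro tendsto_divide tendsto_const) auto
    then show ?thesis by (rule convergentI)
  qed
  with near show "\<exists>Z. convergent Z \<and> (\<forall>n. \<bar>(LBINT q. F0 n q * h q) - Z n\<bar> \<le> e)" by blast
qed

lemma F0_limit:
  obtains Fini where "Fini \<in> BM" "\<And>q. \<bar>Fini q\<bar> \<le> 1"
    "\<And>h. L1 h \<Longrightarrow> (\<lambda>n. LBINT q. F0 n q * h q) \<longlonglongrightarrow> (LBINT q. Fini q * h q)"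
proof (rule weakstar_bounded_limit[OF F0_meas])
  show "AE q in lborel. \<bar>F0 n q\<bar> \<le> 1" for n using F0_bound by simp
  show "convergent (\<lambda>n. LBINT q. F0 n q * ind (box a b) q)" for a b
  proof (rule F0_convergent)
    show "L1 (ind (box a b) :: real \<times> real \<Rightarrow> real)"
      by (rule integrable_real_indicator[OF _ emeasure_lborel_box_finite]) simp
  qed (simp add: indicator_def)
qed (use that in blast)

definition S0 :: "nat \<Rightarrow> real \<Rightarrow> real"
  where "S0 n x = ind {0<..<1} x * \<sigma> (u0 n x) + v0x n x"

lemma S0_meas [measurable]: "S0 n \<in> BM"
  unfolding S0_def[abs_def] using measurable_compose[OF st.meas(6) st.\<sigma>_cont(2)] by simp

text \<open>It suffices to test with intervals. The part with \<sigma>(u0) is linear in the initial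
  indicator by the fundamental theorem of calculus, so \<open>F0_convergent\<close> applies; the
  part with \<open>v0x\<close> is an increment of \<open>V0\<close>, which converges
  pointwise.\<close>

lemma S0_limit:
  obtains Sini B where "Sini \<in> BM" "\<And>x. \<bar>Sini x\<bar> \<le> B" "\<And>n. AE x in lborel. \<bar>S0 n x\<bar> \<le> B"
    "\<And>h. L1 h \<Longrightarrow> (\<lambda>n. LBINT x. S0 n x * h x) \<longlonglongrightarrow> (LBINT x. Sini x * h x)"
proof -
  obtain B where B: "B \<ge> 0" "\<And>y. \<bar>y\<bar> \<le> R \<Longrightarrow> \<bar>\<sigma> y\<bar> \<le> B" using st.bounded_on_R[OF st.\<sigma>_cont(1)] by metis
  obtain B' where B': "\<And>y. \<bar>y\<bar> \<le> R \<Longrightarrow> \<bar>\<sigma>' y\<bar> \<le> B'" using st.bounded_on_R[OF st.\<sigma>'] by metis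
  have Sb: "AE x in lborel. \<bar>S0 n x\<bar> \<le> B + K" for n
    using st.u0_bound[of n] v0xK[of n]
  proof eventually_elim
    case (elim x)
    have "\<bar>ind {0<..<1} x * \<sigma> (u0 n x)\<bar> \<le> B" using B(1) B(2)[OF elim(1)] by (simp add: indicator_def)
    then show ?case unfolding S0_def using elim(2) abs_triangle_ineq[of "ind {0<..<1} x * \<sigma> (u0 n x)" "v0x n x"] by linarith
  qed
  have conv: "convergent (\<lambda>n. LBINT x. S0 n x * ind (box a b) x)" for a b :: real
  proof -
    let ?j = "ind (box a b) :: real \<Rightarrow> real"
    have ji: "L1 ?j" by (rule integrable_real_indicator[OF _ emeasure_lborel_box_finite]) simp
    define j where "j x = ind {0<..<1} x * ?j x" for x
    have jj: "L1 j" unfolding j_def[abs_def] by (intro integrable_ind_mult ji) auto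
    \<comment> \<open>\<open>\<sigma> R - \<sigma> (u0 n x)\<close> is the integral of \<sigma>'
      from \<open>u0 n x\<close> to \<open>R\<close>, that is, of \<sigma>' on
      \<open>[-R, R]\<close> against the indicator of \<open>u0 n x < \<xi>\<close>.\<close>
    define h where "h q = j (fst q) * (ind {-R..R} (snd q) * \<sigma>' (snd q))" for q :: "real \<times> real"
    have R: "R \<ge> 0" using st.R .
    have \<sigma>i: "L1 (\<lambda>\<xi>. ind {-R..R} \<xi> * \<sigma>' \<xi>)"
      by (rule integrable_ind_bounded[where B=B']) (use st.\<sigma>_cont(3) B' in \<open>auto simp: emeasure_lborel_Icc_eq abs_le_iff\<close>)
    have hi: "L1 h"
      using integrable_pair_mult[OF jj \<sigma>i] by (simp add: h_def[abs_def] lborel_prod case_prod_beta')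
    \<comment> \<open>\<open>F0_convergent\<close> takes test functions bounded by 1; dividing by
      \<open>B' + 1\<close> is safe even if \<sigma>' vanishes on the whole range.\<close>
    have hb: "\<bar>h q / (B' + 1)\<bar> \<le> 1" for q
    proof -
      have B'0: "B' \<ge> 0" using B'[of 0] R by simp
      have "\<bar>h q\<bar> \<le> 1 * B'" unfolding h_def abs_mult
        using B'[of "snd q"] B'0 by (intro mult_mono) (auto simp: j_def indicator_def abs_mult)
      then show ?thesis using B'0 by (simp add: abs_divide field_simps)
    qed
    have B'0: "B' \<ge> 0" using B'[of 0] R by simp
    have "convergent (\<lambda>n. LBINT q. F0 n q * (h q / (B' + 1)))"
      by (rule F0_convergent[OF _ hb]) (use hi in simp)
    then have c1: "convergent (\<lambda>n. LBINT q. F0 n q * h q)"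
      using convergent_mult_const_iff[of "1 / (B' + 1)" "\<lambda>n. LBINT q. F0 n q * h q"] B'0 by simp
    have eq1: "(LBINT x. ind {0<..<1} x * \<sigma> (u0 n x) * ?j x) = \<sigma> R * (LBINT x. j x) - (LBINT q. F0 n q * h q)" for n
    proof -
      have Fi: "L1 (\<lambda>q. F0 n q * h q)"
        using integrable_mult_bounded[OF hi F0_meas[of n], of 1] F0_bound by (simp add: mult.commute)
      have "(LBINT q. F0 n q * h q) = (LBINT x. LBINT \<xi>. F0 n (x, \<xi>) * h (x, \<xi>))" using Fubini_fst(1)[OF Fi] .
      also have "\<dots> = (LBINT x. j x * (\<sigma> R - \<sigma> (u0 n x)))"
      proof (rule integral_cong_AE)
        show "(\<lambda>x. LBINT \<xi>. F0 n (x, \<xi>) * h (x, \<xi>)) \<in> borel_measurable lborel" using Fubini_fst(3)[OF Fi] by simp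
        show "(\<lambda>x. j x * (\<sigma> R - \<sigma> (u0 n x))) \<in> borel_measurable lborel"
          using jj measurable_compose[OF st.meas(6) st.\<sigma>_cont(2)] by simp
        show "AE x in lborel. (LBINT \<xi>. F0 n (x, \<xi>) * h (x, \<xi>)) = j x * (\<sigma> R - \<sigma> (u0 n x))"
          using st.u0_bound[of n]
        proof eventually_elim
          case (elim x)
          have "(LBINT \<xi>. F0 n (x, \<xi>) * h (x, \<xi>)) = j x * (LBINT \<xi>. ind {u0 n x..R} \<xi> * \<sigma>' \<xi>)"
            unfolding integral_mult_right_zero[symmetric]
          proof (rule integral_cong_AE)
            show "AE \<xi> in lborel. F0 n (x, \<xi>) * h (x, \<xi>) = j x * (ind {u0 n x..R} \<xi> * \<sigma>' \<xi>)"
              using AE_lborel_singleton[of "u0 n x"]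
              by eventually_elim (use elim in \<open>auto simp: F0_def h_def j_def indicator_def abs_le_iff\<close>)
            show "(\<lambda>\<xi>. F0 n (x, \<xi>) * h (x, \<xi>)) \<in> borel_measurable lborel"
              using measurable_section(1)[OF F0_meas[of n], of x] measurable_section(1)[of h x] hi by simp
            show "(\<lambda>\<xi>. j x * (ind {u0 n x..R} \<xi> * \<sigma>' \<xi>)) \<in> borel_measurable lborel"
              using st.\<sigma>_cont(3) by simp
          qed
          also have "(LBINT \<xi>. ind {u0 n x..R} \<xi> * \<sigma>' \<xi>) = \<sigma> R - \<sigma> (u0 n x)"
          proof -
            have "(LBINT \<xi>. \<sigma>' \<xi> * ind {u0 n x..R} \<xi>) = \<sigma> R - \<sigma> (u0 n x)"
              using elim st.\<sigma> st.\<sigma>' by (intro integral_FTC_Icc_real) (auto simp: continuous_on_eq_continuous_at abs_le_iff)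
            then show ?thesis by (simp add: mult.commute)
          qed
          finally show ?case .
        qed
      qed
      also have "\<dots> = (LBINT x. \<sigma> R * j x - ind {0<..<1} x * \<sigma> (u0 n x) * ?j x)"
        by (intro LINT_cong) (simp add: j_def algebra_simps)
      also have "\<dots> = \<sigma> R * (LBINT x. j x) - (LBINT x. ind {0<..<1} x * \<sigma> (u0 n x) * ?j x)"
      proof -
        have "L1 (\<lambda>x. j x * \<sigma> (u0 n x))"
          by (rule integrable_mult_bounded[OF jj measurable_compose[OF st.meas(6)[of n] st.\<sigma>_cont(2)], of B])
            (use st.u0_bound[of n] B in \<open>auto elim!: eventually_mono\<close>)
        then have "L1 (\<lambda>x. ind {0<..<1} x * \<sigma> (u0 n x) * ?j x)" by (simp add: j_def mult_ac)
        then show ?thesis using jj by simp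
      qed
      finally show ?thesis by simp
    qed
    \<comment> \<open>As \<open>v0x n\<close> vanishes off the unit interval, the endpoints of the
      box can be clamped to \<open>[0, 1]\<close>; clamped endpoints in reverse order mean that the
      box misses the interval.\<close>
    have eq2: "(LBINT x. v0x n x * ?j x) = (if a' \<le> b' then V0 n b' - V0 n a' else 0)"
      if ab: "a' = max 0 (min 1 a)" "b' = max 0 (min 1 b)" for n a' b'
    proof (cases "a' \<le> b'")
      case True
      have "V0 n b' - V0 n a' = (LBINT r. ind {a'<..b'} r * v0x n r)"
        unfolding V0_def using prim_diff[OF v0x_int, of a' b'] True ab by simp
      also have "\<dots> = (LBINT x. v0x n x * ?j x)"
      proof (rule integral_cong_AE)
        show "AE r in lborel. ind {a'<..b'} r * v0x n r = v0x n r * ?j r"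
          using AE_lborel_singleton[of b]
        proof eventually_elim
          case (elim r)
          show ?case
          proof (cases "r \<in> {0<..<1}")
            case True
            then have "r \<in> {a'<..b'} \<longleftrightarrow> r \<in> box a b" using elim ab by (auto simp: box_real min_def max_def split: if_splits)
            then show ?thesis by (simp add: indicator_def)
          next
            case False then show ?thesis using v0xz by simp
          qed
        qed
      qed auto
      finally show ?thesis using True by simp
    next
      case False
      have "(LBINT x. v0x n x * ?j x) = (LINT x::real|lborel. (0::real))"
      proof (intro LINT_cong)
        fix x
        have "x \<notin> box a b" if "x \<in> {0<..<1}" using False ab that by (auto simp: box_real min_def max_def split: if_splits)
        then show "v0x n x * ?j x = 0" using v0xz[of x n] by (cases "x \<in> {0<..<1}") auto
      qed
      then show ?thesis using False by simp
    qed
    have c2: "convergent (\<lambda>n. LBINT x. v0x n x * ?j x)"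
      unfolding eq2[OF refl refl]
    proof (cases "max 0 (min 1 a) \<le> max 0 (min 1 b)")
      case True
      have "convergent (\<lambda>n. V0 n (max 0 (min 1 b)) - V0 n (max 0 (min 1 a)))"
        by (intro convergent_diff V0_convergent) auto
      then show "convergent (\<lambda>n. if max 0 (min 1 a) \<le> max 0 (min 1 b) then V0 n (max 0 (min 1 b)) - V0 n (max 0 (min 1 a)) else 0)"
        by (simp only: True if_True)
    qed (simp only: if_False convergent_const)
    have "(LBINT x. S0 n x * ?j x) = (\<sigma> R * (LBINT x. j x) - (LBINT q. F0 n q * h q)) + (LBINT x. v0x n x * ?j x)" for n
    proof -
      have "L1 (\<lambda>x. j x * \<sigma> (u0 n x))"
        by (rule integrable_mult_bounded[OF jj measurable_compose[OF st.meas(6)[of n] st.\<sigma>_cont(2)], of B])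
          (use st.u0_bound[of n] B in \<open>auto elim!: eventually_mono\<close>)
      then have i1: "L1 (\<lambda>x. ind {0<..<1} x * \<sigma> (u0 n x) * ?j x)" by (simp add: j_def mult_ac)
      have i2: "L1 (\<lambda>x. v0x n x * ?j x)"
        by (rule integrable_mult_bounded[OF v0x_int, where B=1]) (auto simp: indicator_def)
      show ?thesis unfolding eq1[symmetric] using i1 i2 by (simp add: S0_def distrib_right)
    qed
    then show ?thesis using c1 c2 by (simp add: convergent_add convergent_diff convergent_const)
  qed
  show ?thesis
    by (rule weakstar_bounded_limit[OF S0_meas Sb conv]) (use that Sb in blast)
qed

end

section \<open>Boundary values of the limit stress\<close>

lemma AE_lift_fst:
  assumes "AE t in lborel. P (t :: 'a::euclidean_space)"
  shows "AE p in lborel. P (fst (p :: 'a \<times> 'b::euclidean_space))"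
proof -
  obtain N where N: "{t \<in> space lborel. \<not> P t} \<subseteq> N" "N \<in> null_sets lborel"
    using assms by (auto elim!: AE_E simp: null_sets_def)
  have "AE p in lborel. fst (p :: 'a \<times> 'b) \<notin> N"
  proof (rule AE_pairI_fst)
    have "fst -` (- N) \<in> sets (borel :: ('a \<times> 'b) measure)"
      using N(2) measurable_sets[OF measurable_proj(1), of "- N"] by auto
    then show "{p :: 'a \<times> 'b. fst p \<notin> N} \<in> sets borel" by (simp add: vimage_def Compl_eq)
    show "AE t in lborel. AE x::'b in lborel. fst (t, x) \<notin> N" using AE_not_in[OF N(2)] by eventually_elim simp
  qed
  then show ?thesis by eventually_elim (use N(1) in auto)
qed

text \<open>The stress is known only at a dense set of good points. The Hoelder estimate gives
  uniform continuity there, and a uniformly continuous function extends to the closure.\<close>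

lemma hoelder_extension:
  fixes f :: "real \<Rightarrow> real"
  assumes M: "0 \<le> M" and h: "\<And>x y. x \<in> X \<Longrightarrow> y \<in> X \<Longrightarrow> (f x - f y)\<^sup>2 \<le> M * \<bar>x - y\<bar>"
    and d: "{0..1} \<subseteq> closure X"
  obtains G where "continuous_on {0..1} G" "\<And>x. x \<in> X \<Longrightarrow> G x = f x"
proof -
  have "uniformly_continuous_on X f"
    unfolding uniformly_continuous_on_def dist_real_def
  proof (intro allI impI)
    fix e :: real assume e: "e > 0"
    define \<delta> where "\<delta> = e\<^sup>2 / (M + 1)"
    have \<delta>: "\<delta> > 0" using e M by (simp add: \<delta>_def)
    show "\<exists>\<delta>>0. \<forall>x\<in>X. \<forall>x'\<in>X. \<bar>x' - x\<bar> < \<delta> \<longrightarrow> \<bar>f x' - f x\<bar> < e"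
    proof (intro exI[of _ \<delta>] conjI \<delta> ballI impI)
      fix x x' assume x: "x \<in> X" "x' \<in> X" "\<bar>x' - x\<bar> < \<delta>"
      have "(f x' - f x)\<^sup>2 \<le> M * \<bar>x' - x\<bar>" by (rule h[OF x(2,1)])
      also have "\<dots> \<le> M * \<delta>" using x M by (intro mult_left_mono) auto
      also have "\<dots> < (M + 1) * \<delta>" using \<delta> by simp
      also have "\<dots> = e\<^sup>2" using M by (simp add: \<delta>_def)
      finally have "\<bar>f x' - f x\<bar>\<^sup>2 < e\<^sup>2" by simp
      then show "\<bar>f x' - f x\<bar> < e" using e by (intro power2_less_imp_less[of _ e]) auto
    qed
  qed
  then obtain G where G: "uniformly_continuous_on (closure X) G" "\<And>x. x \<in> X \<Longrightarrow> f x = G x"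
    using uniformly_continuous_on_extension_on_closure by metis
  show ?thesis
  proof (rule that[of G])
    show "continuous_on {0..1} G" using uniformly_continuous_imp_continuous[OF G(1)] continuous_on_subset[OF _ d] by blast
  qed (use G in auto)
qed

context kv_limit
begin

interpretation st: kv_strip T R \<sigma> \<sigma>' "u0 n" "v0 n" "u n" "v n" "w n" "s n" "g n" for n
  by (rule strip)

text \<open>Fatou's lemma for the time slices of the weighted dissipation: their lower limit is
  integrable in \<open>t\<close>, hence finite almost everywhere. The slices are therefore bounded
  along infinitely many \<open>n\<close>, with a set of indices that depends on
  \<open>t\<close>.\<close>

lemma gradient_liminf_finite:
  "AE t in lborel. t \<in> {0<..<T} \<longrightarrow> (\<exists>M\<ge>0. \<exists>\<^sub>F n in sequentially. (LBINT x. (g n (t, x))\<^sup>2) \<le> M)"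
proof -
  obtain L where L: "L \<ge> 0" "\<And>y. \<bar>y\<bar> \<le> R \<Longrightarrow> \<bar>\<sigma>' y\<bar> \<le> L" using st.bounded_on_R[OF st.\<sigma>'] by metis
  obtain Cs where Cs: "\<And>n. (LBINT p. (s n p)\<^sup>2) \<le> Cs" using s_bound by metis
  define D where "D = Cs / 2 + T * L / 2 * (Cs + C2)"
  have gi: "L1 (\<lambda>p. fst p * (g n p)\<^sup>2)" and gD: "(LBINT p. fst p * (g n p)\<^sup>2) \<le> D" for n
  proof -
    show "L1 (\<lambda>p. fst p * (g n p)\<^sup>2)" using st.weighted_dissipation(1)[of L n] L by auto
    have "(LBINT p. fst p * (g n p)\<^sup>2) \<le> st.dissip n L" using st.weighted_dissipation(2)[of L n] L by auto
    also have "\<dots> \<le> D" unfolding st.dissip_def D_def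
      using Cs[of n] w2[of n] T L by (intro add_mono mult_left_mono) auto
    finally show "(LBINT p. fst p * (g n p)\<^sup>2) \<le> D" .
  qed
  define E where "E n t = (LBINT x. fst (t, x) * (g n (t, x))\<^sup>2)" for n t
  have Ei: "L1 (E n)" for n unfolding E_def[abs_def] by (rule Fubini_fst(3)[OF gi])
  have Eval: "E n t = t * (LBINT x. (g n (t, x))\<^sup>2)" for n t by (simp add: E_def)
  have E0: "0 \<le> E n t" for n t
  proof (cases "t > 0")
    case True then show ?thesis unfolding Eval by (intro mult_nonneg_nonneg LINT_nonneg) auto
  next
    case False
    then have "(t, x) \<notin> QT T" for x by (auto simp: QT_def)
    then show ?thesis unfolding Eval using st.zero by simp
  qed
  have "(\<integral>\<^sup>+t. liminf (\<lambda>n. ennreal (E n t)) \<partial>lborel) \<le> liminf (\<lambda>n. \<integral>\<^sup>+t. ennreal (E n t) \<partial>lborel)"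
    using Ei by (intro nn_integral_liminf) auto
  also have "\<dots> \<le> ennreal D"
  proof -
    have "(\<integral>\<^sup>+t. ennreal (E n t) \<partial>lborel) \<le> ennreal D" for n
    proof -
      have "(LBINT t. E n t) = (LBINT p. fst p * (g n p)\<^sup>2)" unfolding E_def using Fubini_fst(1)[OF gi] by simp
      then show ?thesis using gD[of n] E0 by (subst nn_integral_eq_integral[OF Ei]) (auto intro: ennreal_leI)
    qed
    then show ?thesis
      using Liminf_mono[of "\<lambda>n. \<integral>\<^sup>+t. ennreal (E n t) \<partial>lborel" "\<lambda>_. ennreal D" sequentially] by (simp add: Liminf_const)
  qed
  finally have fin: "(\<integral>\<^sup>+t. liminf (\<lambda>n. ennreal (E n t)) \<partial>lborel) \<noteq> \<infinity>" by (auto simp: top_unique)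
  have "AE t in lborel. liminf (\<lambda>n. ennreal (E n t)) \<noteq> \<infinity>"
    by (rule nn_integral_PInf_AE[OF _ fin]) (use Ei in measurable)
  then show ?thesis
  proof eventually_elim
    case (elim t)
    show ?case
    proof
      assume t: "t \<in> {0<..<T}"
      obtain k :: nat where k: "liminf (\<lambda>n. ennreal (E n t)) < of_nat k"
        using elim ennreal_Ex_less_of_nat by (auto simp: less_top)
      have "\<exists>\<^sub>F n in sequentially. E n t \<le> real k"
      proof (rule ccontr)
        assume "\<not> (\<exists>\<^sub>F n in sequentially. E n t \<le> real k)"
        then have "eventually (\<lambda>n. of_nat k \<le> ennreal (E n t)) sequentially"
          unfolding frequently_def by (auto elim!: eventually_mono simp: ennreal_of_nat_eq_real_of_nat intro: ennreal_leI)
        then have "of_nat k \<le> liminf (\<lambda>n. ennreal (E n t))" by (rule Liminf_bounded)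
        then show False using k by simp
      qed
      then have "\<exists>\<^sub>F n in sequentially. (LBINT x. (g n (t, x))\<^sup>2) \<le> real k / t"
        by (rule frequently_elim1) (use t in \<open>simp add: Eval field_simps\<close>)
      then show "\<exists>M\<ge>0. \<exists>\<^sub>F n in sequentially. (LBINT x. (g n (t, x))\<^sup>2) \<le> M"
        using t by (intro exI[of _ "real k / t"]) auto
    qed
  qed
qed

text \<open>At almost every time the primitives of \<open>g n\<close> converge on a dense set, and
  infinitely many of them share a Hoelder bound; the limit inherits the bound because an inequality
  between two points is tested at one suitable \<open>n\<close>. The zero boundary values of the
  primitives survive in the continuous extension.\<close>

lemma S_vanishes: "vanishes_at_ends {0<..<T} S"
proof -
  \<comment> \<open>For almost every \<open>t\<close> these points have full measure in the unit
    interval and are therefore dense in it.\<close>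
  define X where "X t = {x \<in> {0<..<1}. (\<forall>n. s n (t, x) = prim (\<lambda>y. g n (t, y)) x) \<and> (\<lambda>n. s n (t, x)) \<longlonglongrightarrow> S (t, x)}" for t
  have AX: "AE p in lborel. p \<in> {0<..<T} \<times> {0<..<1} \<longrightarrow> snd p \<in> X (fst p)"
  proof -
    have "AE p in lborel. \<forall>n. p \<in> QT T \<longrightarrow> s n p = prim (\<lambda>y. g n (fst p, y)) (snd p)"
      using st.s_prim_AE by (subst AE_all_countable) auto
    then show ?thesis using Slim by eventually_elim (auto simp: X_def QT_def)
  qed
  define ok where "ok t G \<longleftrightarrow> continuous_on {0..1} G \<and> G 0 = 0 \<and> G 1 = 0 \<and> (\<forall>x\<in>X t. S (t, x) = G x)" for t and G :: "real \<Rightarrow> real"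
  have good: "AE t in lborel. t \<in> {0<..<T} \<longrightarrow> (\<exists>G. ok t G)"
  proof -
    have "AE t in lborel. \<forall>n. t \<in> {0<..T} \<longrightarrow> prim (\<lambda>y. g n (t, y)) 1 = 0"
      unfolding AE_all_countable
    proof
      fix n
      show "AE t in lborel. t \<in> {0<..T} \<longrightarrow> prim (\<lambda>y. g n (t, y)) 1 = 0"
        using st.s_x[of n] by eventually_elim auto
    qed
    moreover have "AE t in lborel. \<forall>n. L1 (\<lambda>y. g n (t, y)) \<and> L1 (\<lambda>y. (g n (t, y))\<^sup>2)"
      unfolding AE_all_countable
    proof
      fix n
      show "AE t in lborel. L1 (\<lambda>y. g n (t, y)) \<and> L1 (\<lambda>y. (g n (t, y))\<^sup>2)"
        using Fubini_fst(2)[OF st.ints(3)[of n]] Fubini_fst(2)[OF st.sq(3)[of n]] by eventually_elim auto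
    qed
    ultimately show ?thesis
      using gradient_liminf_finite AE_fst[OF AX]
    proof eventually_elim
      case (elim t)
      show ?case
      proof
        assume t: "t \<in> {0<..<T}"
        then obtain M where M: "M \<ge> 0" "\<exists>\<^sub>F n in sequentially. (LBINT x. (g n (t, x))\<^sup>2) \<le> M" using elim by blast
        have AXt: "AE x in lborel. x \<in> {0<..<1} \<longrightarrow> x \<in> X t" using elim(4) by eventually_elim (use t in auto)
        define f where "f x = (if x \<in> X t then S (t, x) else 0)" for x
        \<comment> \<open>The endpoints are adjoined with value 0: each primitive vanishes at 0 by
          definition and at 1 by the boundary condition. The extension is thereby forced to vanish
          at both.\<close>
        define X' where "X' = insert 0 (insert 1 (X t))"
        have X01: "X t \<subseteq> {0<..<1}" by (auto simp: X_def)
        have lim: "(\<lambda>n. prim (\<lambda>y. g n (t, y)) x) \<longlonglongrightarrow> f x" if "x \<in> X'" for x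
        proof -
          consider "x = 0" | "x = 1" | "x \<in> X t" using \<open>x \<in> X'\<close> by (auto simp: X'_def)
          then show ?thesis
          proof cases
            case 1
            then have "x \<notin> X t" using X01 by auto
            then show ?thesis using 1 by (simp add: f_def)
          next
            case 2
            then have "x \<notin> X t" using X01 by auto
            then show ?thesis using 2 elim(1) t by (simp add: f_def)
          next
            case 3
            have "(\<lambda>n. s n (t, x)) = (\<lambda>n. prim (\<lambda>y. g n (t, y)) x)" and sl: "(\<lambda>n. s n (t, x)) \<longlonglongrightarrow> S (t, x)"
              using 3 by (auto simp: X_def fun_eq_iff)
            then show ?thesis using 3 by (simp add: f_def)
          qed
        qed
        have hold: "(f x - f y)\<^sup>2 \<le> M * \<bar>x - y\<bar>" if x: "x \<in> X'" and y: "y \<in> X'" for x y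
        proof (rule ccontr)
          assume "\<not> (f x - f y)\<^sup>2 \<le> M * \<bar>x - y\<bar>"
          then have gt: "M * \<bar>x - y\<bar> < (f x - f y)\<^sup>2" by simp
          have "(\<lambda>n. (prim (\<lambda>y. g n (t, y)) x - prim (\<lambda>y. g n (t, y)) y)\<^sup>2) \<longlonglongrightarrow> (f x - f y)\<^sup>2"
            by (intro tendsto_intros lim x y)
          \<comment> \<open>A violated estimate would be violated for all large \<open>n\<close>,
            while the gradient bound holds for infinitely many \<open>n\<close>; one common
            \<open>n\<close> contradicts \<open>prim_hoelder\<close>.\<close>
          from order_tendstoD(1)[OF this gt]
          have "eventually (\<lambda>n. (LBINT x. (g n (t, x))\<^sup>2) \<le> M \<longrightarrow> (LBINT x. (g n (t, x))\<^sup>2) \<le> M \<and>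
              M * \<bar>x - y\<bar> < (prim (\<lambda>y. g n (t, y)) x - prim (\<lambda>y. g n (t, y)) y)\<^sup>2) sequentially"
            by eventually_elim blast
          from frequently_rev_mp[OF M(2) this]
          have "\<exists>\<^sub>F n in sequentially. (LBINT x. (g n (t, x))\<^sup>2) \<le> M \<and>
              M * \<bar>x - y\<bar> < (prim (\<lambda>y. g n (t, y)) x - prim (\<lambda>y. g n (t, y)) y)\<^sup>2" .
          then obtain n where n: "(LBINT x. (g n (t, x))\<^sup>2) \<le> M"
            "M * \<bar>x - y\<bar> < (prim (\<lambda>y. g n (t, y)) x - prim (\<lambda>y. g n (t, y)) y)\<^sup>2" by (auto dest: frequently_ex)
          have x01: "0 \<le> x" "0 \<le> y" using x y X01 by (auto simp: X'_def)
          have "(prim (\<lambda>y. g n (t, y)) x - prim (\<lambda>y. g n (t, y)) y)\<^sup>2 \<le> \<bar>x - y\<bar> * (LBINT x. (g n (t, x))\<^sup>2)"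
          proof (cases "y \<le> x")
            case True
            then show ?thesis using prim_hoelder[of "\<lambda>y. g n (t, y)" y x] elim x01 by simp
          next
            case False
            then show ?thesis using prim_hoelder[of "\<lambda>y. g n (t, y)" x y] elim x01 by (simp add: power2_commute)
          qed
          also have "\<dots> \<le> \<bar>x - y\<bar> * M" using n(1) by (intro mult_left_mono) auto
          finally show False using n(2) by (simp add: mult.commute)
        qed
        have dense: "{0..1} \<subseteq> closure X'"
        proof
          fix x :: real assume x: "x \<in> {0..1}"
          show "x \<in> closure X'"
          proof (rule AE_closed_interval[where a=0 and b=1 and P="\<lambda>x. x \<in> closure X'"])
            show "closed {x. x \<in> closure X'}" by simp
            show "AE x in lborel. x \<in> {0<..<1} \<longrightarrow> x \<in> closure X'"
              using AXt by eventually_elim (use closure_subset[of X'] in \<open>auto simp: X'_def\<close>)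
          qed (use x in auto)
        qed
        obtain G where G: "continuous_on {0..1} G" "\<And>x. x \<in> X' \<Longrightarrow> G x = f x"
          using hoelder_extension[OF M(1) hold dense] by blast
        have "ok t G" unfolding ok_def
          using G(1) G(2)[of 0] G(2)[of 1] G(2) X01 by (auto simp: X'_def f_def)
        then show "\<exists>G. ok t G" by (rule exI[of _ G])
      qed
    qed
  qed
  define pick where "pick t = (SOME G. ok t G)" for t
  have pick: "ok t (pick t)" if "\<exists>G. ok t G" for t unfolding pick_def by (rule someI_ex[OF that])
  \<comment> \<open>Continuity and boundary values are demanded at every \<open>t\<close>, so the
    exceptional times, which form a null set, receive the zero function.\<close>
  define GG where "GG p = (if \<exists>G. ok (fst p) G then pick (fst p) (snd p) else 0)" for p
  show ?thesis
    unfolding vanishes_at_ends_def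
  proof (intro exI[of _ GG] conjI ballI)
    show "AE p in lborel. p \<in> {0<..<T} \<times> {0<..<1} \<longrightarrow> S p = GG p"
      using AX AE_lift_fst[OF good]
    proof eventually_elim
      case (elim p)
      show ?case
      proof
        assume p: "p \<in> {0<..<T} \<times> {0<..<1}"
        then have ex: "\<exists>G. ok (fst p) G" and x: "snd p \<in> X (fst p)" using elim by auto
        have "S (fst p, snd p) = pick (fst p) (snd p)" using pick[OF ex] x unfolding ok_def by blast
        moreover have "GG p = pick (fst p) (snd p)" unfolding GG_def by (simp only: ex if_True)
        ultimately show "S p = GG p" by simp
      qed
    qed
    fix t
    have "continuous_on {0..1} (\<lambda>x. GG (t, x)) \<and> GG (t, 0) = 0 \<and> GG (t, 1) = 0"
    proof (cases "\<exists>G. ok t G")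
      case True
      have "GG (t, x) = pick t x" for x unfolding GG_def fst_conv snd_conv by (simp only: True if_True)
      then show ?thesis using pick[OF True] unfolding ok_def by simp
    next
      case False
      then have "GG (t, x) = 0" for x unfolding GG_def fst_conv by (simp only: if_False)
      then show ?thesis by simp
    qed
    then show "continuous_on {0..1} (\<lambda>x. GG (t, x))" "GG (t, 0) = 0" "GG (t, 1) = 0" by auto
  qed
qed

section \<open>The limit equations for \<open>v\<close> and for \<open>S\<close>\<close>

text \<open>The limit of the weak equation for \<open>v n\<close> contains \<open>S\<close> against
  \<open>dx \<phi>\<close>. Splitting \<open>S\<close> into \<open>Y \<sigma>\<close> and
  \<open>vx\<close>, and integrating the second part by parts through \<open>vl_x_deriv\<close>,
  produces the second-order term.\<close>

lemma heat_v_limit: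
  assumes \<phi>: "\<phi> \<in> test_functions ({..<T} \<times> {0<..<1})"
  shows "L1 (\<lambda>p. vl p * dt \<phi> p + vl p * dx (dx \<phi>) p - Y \<sigma> p * dx \<phi> p)"
    and "(LBINT p. vl p * dt \<phi> p + vl p * dx (dx \<phi>) p - Y \<sigma> p * dx \<phi> p)
      + (LBINT x. vini x * \<phi> (0, x)) = 0"
proof -
  let ?t = "dt \<phi>" and ?x = "dx \<phi>" let ?xx = "dx ?x"
  note \<phi>t = test_functions_dir_deriv[OF \<phi>, of "(1, 0)"] and \<phi>x = test_functions_dir_deriv[OF \<phi>, of "(0, 1)"]
  note \<phi>xx = test_functions_dir_deriv[OF \<phi>x, of "(0, 1)"]
  obtain B1 where B1: "\<And>p. \<bar>?t p\<bar> \<le> B1" using test_functions_bounded[OF \<phi>t] by metis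
  obtain B2 where B2: "\<And>p. \<bar>?x p\<bar> \<le> B2" using test_functions_bounded[OF \<phi>x] by metis
  obtain B3 where B3: "\<And>p. \<bar>?xx p\<bar> \<le> B3" using test_functions_bounded[OF \<phi>xx] by metis
  note m = test_functions_measurable[OF \<phi>t] test_functions_measurable[OF \<phi>x] test_functions_measurable[OF \<phi>xx]
  have i: "L1 (\<lambda>p. f p * ?t p)" "L1 (\<lambda>p. f p * ?x p)" "L1 (\<lambda>p. f p * ?xx p)"
    if "L1 f" for f
    using integrable_mult_bounded[OF that m(1), of B1] integrable_mult_bounded[OF that m(2), of B2] integrable_mult_bounded[OF that m(3), of B3]
      B1 B2 B3 by auto
  note Yi = Y_int1[OF st.\<sigma>_cont(1)]
  show "L1 (\<lambda>p. vl p * ?t p + vl p * ?xx p - Y \<sigma> p * ?x p)"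
    using i(1)[OF vl_int] i(3)[OF vl_int] i(2)[OF Yi] by auto
  have e: "(LBINT p. v n p * ?t p) - (LBINT p. s n p * ?x p) + (LBINT x. v0 n x * \<phi> (0, x)) = 0" for n
    using st.weak_v_test[OF \<phi>, of n] i(1)[OF st.ints(1)[of n]] i(2)[OF st.s_int[of n]] by simp
  have "(\<lambda>n. (LBINT p. v n p * ?t p) - (LBINT p. s n p * ?x p) + (LBINT x. v0 n x * \<phi> (0, x)))
    \<longlonglongrightarrow> (LBINT p. vl p * ?t p) - (LBINT p. S p * ?x p) + (LBINT x. vini x * \<phi> (0, x))"
    by (intro tendsto_add tendsto_diff v_tendsto[OF m(1) B1] s_tendsto[OF m(2) B2] v0_tendsto st.test_section_integrable(2)[OF \<phi>])
  then have 1: "(LBINT p. vl p * ?t p) - (LBINT p. S p * ?x p) + (LBINT x. vini x * \<phi> (0, x)) = 0"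
    unfolding e by (simp add: LIMSEQ_const_iff)
  have pr: "?x (t, x) = prim (\<lambda>y. ?xx (t, y)) x" if "x \<in> {0..1}" for t x
    using st.test_prim(2)[OF \<phi>x, of x t] test_functions_outside[OF \<phi>x, of "(t, 0)"] that by simp
  have 2: "(LBINT p. vx p * ?x p) + (LBINT p. vl p * ?xx p) = 0"
  proof (rule ibp_x[OF vl_int vx_int vlm vx_meas m(3) _ vl_x_deriv, where K="max B2 B3"])
    show "vl p = 0 \<and> vx p = 0" if "p \<notin> QT T" for p using that vlz vx_zero by simp
    show "\<bar>?xx p\<bar> \<le> max B2 B3" "\<bar>?x p\<bar> \<le> max B2 B3" for p using B2[of p] B3[of p] by auto
    show "prim (\<lambda>y. ?xx (t, y)) 1 = 0" for t
      using pr[of 1 t] test_functions_outside[OF \<phi>x, of "(t, 1)"] by simp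
  qed (use pr m st.test_section_integrable(2)[OF \<phi>xx] in auto)
  have 3: "(LBINT p. vx p * ?x p) = (LBINT p. S p * ?x p) - (LBINT p. Y \<sigma> p * ?x p)"
    using i(2)[OF S_int] i(2)[OF Yi] by (simp add: vx_def left_diff_distrib)
  show "(LBINT p. vl p * ?t p + vl p * ?xx p - Y \<sigma> p * ?x p) + (LBINT x. vini x * \<phi> (0, x)) = 0"
    using 1 2 3 i(1)[OF vl_int] i(3)[OF vl_int] i(2)[OF Yi] by simp
qed

text \<open>The source \<open>w * \<sigma>'(u)\<close> is rewritten as
  \<open>s * \<sigma>'(u)\<close> minus a function of \<open>u\<close> alone. In the first product
  \<open>s n\<close> is exchanged for \<open>S\<close> by strong convergence; then
  \<open>S * \<phi>\<close> is a fixed integrable test function for the weak-star limit of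
  \<sigma>'(u n).\<close>

lemma heat_S_limit:
  assumes \<phi>: "\<phi> \<in> test_functions ({..<T} \<times> {0<..<1})"
    and Sini: "\<And>h. L1 h \<Longrightarrow> (\<lambda>n. LBINT x. S0 n x * h x) \<longlonglongrightarrow> (LBINT x. Sini x * h x)"
  shows "L1 (\<lambda>p. S p * (dt \<phi> p + dx (dx \<phi>) p)
       + (S p * Y \<sigma>' p - Y (\<lambda>y. \<sigma>' y * \<sigma> y) p) * \<phi> p)"
    and "(LBINT p. S p * (dt \<phi> p + dx (dx \<phi>) p)
       + (S p * Y \<sigma>' p - Y (\<lambda>y. \<sigma>' y * \<sigma> y) p) * \<phi> p) + (LBINT x. Sini x * \<phi> (0, x)) = 0"
proof -
  let ?t = "dt \<phi>" and ?x = "dx \<phi>" let ?xx = "dx ?x"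
  let ?ss = "\<lambda>y. \<sigma>' y * \<sigma> y"
  note \<phi>t = test_functions_dir_deriv[OF \<phi>, of "(1, 0)"] and \<phi>x = test_functions_dir_deriv[OF \<phi>, of "(0, 1)"]
  note \<phi>xx = test_functions_dir_deriv[OF \<phi>x, of "(0, 1)"]
  obtain B0 where B0: "\<And>p. \<bar>\<phi> p\<bar> \<le> B0" using test_functions_bounded[OF \<phi>] by metis
  obtain B1 where B1: "\<And>p. \<bar>?t p\<bar> \<le> B1" using test_functions_bounded[OF \<phi>t] by metis
  obtain B3 where B3: "\<And>p. \<bar>?xx p\<bar> \<le> B3" using test_functions_bounded[OF \<phi>xx] by metis
  note m = test_functions_measurable[OF \<phi>] test_functions_measurable[OF \<phi>t] test_functions_measurable[OF \<phi>xx]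
  have css: "continuous_on UNIV ?ss" by (intro continuous_intros st.\<sigma>_cont st.\<sigma>')
  define \<psi> where "\<psi> p = ?t p + ?xx p" for p
  have \<psi>m: "\<psi> \<in> BM" unfolding \<psi>_def[abs_def] using m by simp
  have \<psi>b: "\<bar>\<psi> p\<bar> \<le> B1 + B3" for p using B1[of p] B3[of p] unfolding \<psi>_def by linarith
  have S\<phi>: "L1 (\<lambda>p. S p * \<phi> p)" by (rule integrable_mult_bounded[OF S_int m(1), of B0]) (use B0 in auto)
  have Q\<phi>: "L1 (\<lambda>p. ind (QT T) p * \<phi> p)" by (rule integrable_mult_bounded[OF st.Q_int m(1), of B0]) (use B0 in auto)
  have S\<psi>: "L1 (\<lambda>p. S p * \<psi> p)" by (rule integrable_mult_bounded[OF S_int \<psi>m, of "B1 + B3"]) (use \<psi>b in auto)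
  have i1: "L1 (\<lambda>p. S p * \<phi> p * Y \<sigma>' p)" by (rule Y_int[OF st.\<sigma>' S\<phi>])
  have i2: "L1 (\<lambda>p. Y ?ss p * \<phi> p)"
    by (rule integrable_mult_bounded[OF Y_int1[OF css] m(1), of B0]) (use B0 in auto)
  have e0: "(S p * Y \<sigma>' p - Y ?ss p) * \<phi> p = S p * \<phi> p * Y \<sigma>' p - Y ?ss p * \<phi> p" for p by (simp add: algebra_simps)
  show "L1 (\<lambda>p. S p * (?t p + ?xx p) + (S p * Y \<sigma>' p - Y ?ss p) * \<phi> p)"
    unfolding e0 using S\<psi> i1 i2 by (auto simp: \<psi>_def)
  have s0: "\<phi> (0, x) = 0" if "x \<notin> {0<..<1}" for x by (rule test_functions_outside[OF \<phi>]) (use that in auto)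
  \<comment> \<open>Integrating \<open>v0\<close> by parts in \<open>x\<close> at time 0 combines
    the two initial terms of \<open>heat_level\<close> into the initial stress \<open>S0\<close>;
    \<phi> vanishes at the lateral ends.\<close>
  have ini: "(LBINT x. \<sigma> (u0 n x) * \<phi> (0, x)) - (LBINT x. v0 n x * ?x (0, x)) = (LBINT x. S0 n x * \<phi> (0, x))" for n
  proof -
    have xi: "L1 (\<lambda>y. ?x (0, y))" by (rule st.test_section_integrable(2)[OF \<phi>x])
    have pr: "\<phi> (0, x) = prim (\<lambda>y. ?x (0, y)) x" if "x \<in> {0..1}" for x
      using st.test_prim(2)[OF \<phi>, of x 0] s0[of 0] that by simp
    obtain c where c: "AE x in lborel. x \<in> {0<..<1} \<longrightarrow> v0 n x = c + prim (v0x n) x" using v0ac by blast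
    have \<phi>i: "L1 (\<lambda>x. \<phi> (0, x))" by (rule st.test_section_integrable(2)[OF \<phi>])
    have ms: "(\<lambda>x. \<phi> (0, x)) \<in> BM" "(\<lambda>x. ?x (0, x)) \<in> BM"
      using \<phi>i xi by auto
    have "(LBINT x. v0x n x * \<phi> (0, x) + v0 n x * ?x (0, x)) =
       (LBINT x. ind {0..1} x * ((0 + prim (\<lambda>y. ?x (0, y)) x) * v0x n x + ?x (0, x) * (c + prim (v0x n) x)))"
    proof (rule integral_cong_AE)
      show "AE x in lborel. v0x n x * \<phi> (0, x) + v0 n x * ?x (0, x) =
         ind {0..1} x * ((0 + prim (\<lambda>y. ?x (0, y)) x) * v0x n x + ?x (0, x) * (c + prim (v0x n) x))"
        using c AE_lborel_singleton[of 0] AE_lborel_singleton[of 1]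
      proof eventually_elim
        case (elim x)
        show ?case
        proof (cases "x \<in> {0<..<1}")
          case True
          then show ?thesis using elim pr[of x] by (simp add: mult.commute)
        next
          case False
          then have "x \<notin> {0..1}" using elim by auto
          then show ?thesis using v0xz[OF False] st.zero0[OF False, of n] by simp
        qed
      qed
      have "prim (\<lambda>y. ?x (0, y)) \<in> BM" "prim (v0x n) \<in> BM"
        using xi v0x_int by (auto intro!: borel_measurable_continuous_onI continuous_on_prim)
      then show "(\<lambda>x. ind {0..1} x * ((0 + prim (\<lambda>y. ?x (0, y)) x) * v0x n x + ?x (0, x) * (c + prim (v0x n) x))) \<in> borel_measurable lborel"
        using ms by simp
      show "(\<lambda>x. v0x n x * \<phi> (0, x) + v0 n x * ?x (0, x)) \<in> borel_measurable lborel" using ms st.meas(7)[of n] by simp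
    qed
    also have "\<dots> = (0 + prim (\<lambda>y. ?x (0, y)) 1) * (c + prim (v0x n) 1) - 0 * c" by (rule ac_ibp[OF xi v0x_int])
    also have "0 + prim (\<lambda>y. ?x (0, y)) 1 = 0" using pr[of 1] s0[of 1] by simp
    finally have p: "(LBINT x. v0x n x * \<phi> (0, x) + v0 n x * ?x (0, x)) = 0" by simp
    obtain B2 where B2: "\<And>p. \<bar>?x p\<bar> \<le> B2" using test_functions_bounded[OF \<phi>x] by metis
    have j1: "L1 (\<lambda>x. v0x n x * \<phi> (0, x))" by (rule integrable_mult_bounded[OF v0x_int ms(1), of B0]) (use B0 in auto)
    have j2: "L1 (\<lambda>x. v0 n x * ?x (0, x))" by (rule integrable_mult_bounded[OF st.v0i ms(2), of B2]) (use B2 in auto)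
    obtain B where B: "\<And>y. \<bar>y\<bar> \<le> R \<Longrightarrow> \<bar>\<sigma> y\<bar> \<le> B" using st.bounded_on_R[OF st.\<sigma>_cont(1)] by metis
    have j3: "L1 (\<lambda>x. \<phi> (0, x) * \<sigma> (u0 n x))"
      by (rule integrable_mult_bounded[OF \<phi>i measurable_compose[OF st.meas(6)[of n] st.\<sigma>_cont(2)], of B])
        (use st.u0_bound[of n] B in \<open>auto elim!: eventually_mono\<close>)
    have "S0 n x * \<phi> (0, x) = \<phi> (0, x) * \<sigma> (u0 n x) + v0x n x * \<phi> (0, x)" for x
      using s0[of x] by (cases "x \<in> {0<..<1}") (auto simp: S0_def algebra_simps)
    then have "(LBINT x. S0 n x * \<phi> (0, x)) = (LBINT x. \<phi> (0, x) * \<sigma> (u0 n x)) + (LBINT x. v0x n x * \<phi> (0, x))"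
      using j1 j3 by simp
    then show ?thesis using p j1 j2 by (simp add: mult.commute)
  qed
  have s\<psi>: "(\<lambda>n. LBINT p. s n p * \<psi> p) \<longlonglongrightarrow> (LBINT p. S p * \<psi> p)" by (rule s_tendsto[OF \<psi>m \<psi>b])
  obtain B where B: "B \<ge> 0" "\<And>y. \<bar>y\<bar> \<le> R \<Longrightarrow> \<bar>\<sigma>' y\<bar> \<le> B" using st.bounded_on_R[OF st.\<sigma>'] by metis
  have \<theta>m: "(\<lambda>p. \<sigma>' (u n p) * \<phi> p) \<in> BM" for n
    using measurable_compose[OF st.meas(1) st.\<sigma>_cont(3)] m(1) by simp
  have \<theta>b: "AE p in lborel. \<bar>\<sigma>' (u n p) * \<phi> p\<bar> \<le> B * B0" for n
    using st.u_bound[of n] by eventually_elim (use B B0 in \<open>auto simp: abs_mult intro!: mult_mono\<close>)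
  have d: "(\<lambda>n. (LBINT p. s n p * (\<sigma>' (u n p) * \<phi> p)) - (LBINT p. S p * (\<sigma>' (u n p) * \<phi> p))) \<longlonglongrightarrow> 0"
    by (rule tendsto_L1_mult_bounded[OF st.s_int S_int s_L1 \<theta>m \<theta>b])
  \<comment> \<open>The first bracket is the error of replacing \<open>s n\<close> by
    \<open>S\<close>; the other two integrals are weak-star convergent with test functions
    independent of \<open>n\<close>.\<close>
  have we: "(LBINT p. w n p * \<sigma>' (u n p) * \<phi> p) = ((LBINT p. s n p * (\<sigma>' (u n p) * \<phi> p)) - (LBINT p. S p * (\<sigma>' (u n p) * \<phi> p)))
     + (LBINT p. ind (QT T) p * \<sigma>' (u n p) * (S p * \<phi> p)) - (LBINT p. ind (QT T) p * ?ss (u n p) * (ind (QT T) p * \<phi> p))" for n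
  proof -
    have k1: "L1 (\<lambda>p. s n p * (\<sigma>' (u n p) * \<phi> p))" by (rule integrable_mult_bounded[OF st.s_int \<theta>m \<theta>b])
    have k2: "L1 (\<lambda>p. ind (QT T) p * \<phi> p * ?ss (u n p))" by (rule st.integrable_comp_u[OF css Q\<phi>])
    have a: "(LBINT p. ind (QT T) p * \<sigma>' (u n p) * (S p * \<phi> p)) = (LBINT p. S p * (\<sigma>' (u n p) * \<phi> p))"
      by (intro LINT_cong) (use Sz in \<open>auto simp: indicator_def\<close>)
    have b: "(LBINT p. ind (QT T) p * ?ss (u n p) * (ind (QT T) p * \<phi> p)) = (LBINT p. ind (QT T) p * \<phi> p * ?ss (u n p))"
      by (intro LINT_cong) (auto simp: indicator_def)
    have "(LBINT p. w n p * \<sigma>' (u n p) * \<phi> p) = (LBINT p. s n p * (\<sigma>' (u n p) * \<phi> p) - ind (QT T) p * \<phi> p * ?ss (u n p))"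
      by (intro LINT_cong) (simp add: st.s_split[of n] algebra_simps)
    then show ?thesis unfolding a b using k1 k2 by simp
  qed
  have wl: "(\<lambda>n. LBINT p. w n p * \<sigma>' (u n p) * \<phi> p) \<longlonglongrightarrow>
     0 + (LBINT p. Y \<sigma>' p * (S p * \<phi> p)) - (LBINT p. Y ?ss p * (ind (QT T) p * \<phi> p))"
    unfolding we by (intro tendsto_add tendsto_diff d Ylim st.\<sigma>' S\<phi> css Q\<phi>)
  have lv: "(LBINT p. s n p * \<psi> p) + (LBINT p. w n p * \<sigma>' (u n p) * \<phi> p) + (LBINT x. S0 n x * \<phi> (0, x)) = 0" for n
    using st.heat_level(3)[OF \<phi>, of n] ini[of n] by (simp add: \<psi>_def)
  have "(\<lambda>n. (LBINT p. s n p * \<psi> p) + (LBINT p. w n p * \<sigma>' (u n p) * \<phi> p) + (LBINT x. S0 n x * \<phi> (0, x))) \<longlonglongrightarrow>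
     (LBINT p. S p * \<psi> p) + (0 + (LBINT p. Y \<sigma>' p * (S p * \<phi> p)) - (LBINT p. Y ?ss p * (ind (QT T) p * \<phi> p))) + (LBINT x. Sini x * \<phi> (0, x))"
    by (intro tendsto_add[OF tendsto_add[OF s\<psi> wl]] Sini st.test_section_integrable(2)[OF \<phi>])
  then have z: "(LBINT p. S p * \<psi> p) + ((LBINT p. Y \<sigma>' p * (S p * \<phi> p)) - (LBINT p. Y ?ss p * (ind (QT T) p * \<phi> p))) + (LBINT x. Sini x * \<phi> (0, x)) = 0"
    unfolding lv by (simp add: LIMSEQ_const_iff)
  have a: "(LBINT p. Y \<sigma>' p * (S p * \<phi> p)) = (LBINT p. S p * \<phi> p * Y \<sigma>' p)"
    by (intro LINT_cong) simp
  have b: "(LBINT p. Y ?ss p * (ind (QT T) p * \<phi> p)) = (LBINT p. Y ?ss p * \<phi> p)"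
    by (intro LINT_cong) (use Yz[of _ ?ss] in \<open>auto simp: indicator_def\<close>)
  show "(LBINT p. S p * (?t p + ?xx p) + (S p * Y \<sigma>' p - Y ?ss p) * \<phi> p) + (LBINT x. Sini x * \<phi> (0, x)) = 0"
    unfolding e0 using z S\<psi> i1 i2 unfolding a b by (simp add: \<psi>_def)
qed

end

section \<open>The kinetic equation in the limit and the Young measure\<close>

lemma integrable_continuous_bounded_support:
  fixes f :: "'a::euclidean_space \<Rightarrow> real"
  assumes f: "continuous_on UNIV f" and z: "\<And>p. norm p \<ge> B \<Longrightarrow> f p = 0"
  shows "L1 f"
proof -
  have "compact (f ` cball 0 B)" by (intro compact_continuous_image continuous_on_subset[OF f]) auto
  then obtain K where K: "\<And>p. p \<in> cball 0 B \<Longrightarrow> \<bar>f p\<bar> \<le> K" using compact_imp_bounded by (fastforce simp: bounded_iff)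
  have "L1 (\<lambda>p. ind (cball 0 B) p * f p)"
  proof (rule integrable_ind_bounded[where B=K])
    show "emeasure lborel (cball (0::'a) B) < \<infinity>" by (rule emeasure_bounded_finite) simp
  qed (use K f borel_measurable_continuous_onI in auto)
  moreover have "(\<lambda>p. ind (cball 0 B) p * f p) = f"
    by (rule ext) (use z in \<open>auto simp: indicator_def dist_norm not_le\<close>)
  ultimately show ?thesis by simp
qed

text \<open>Equality on boxes extends to all integrable test functions by \<open>L1_induct\<close>.
  The sign of \<open>F - G\<close> is then made integrable over the whole space by a positive
  weight, and testing with it gives a vanishing integral of a weighted absolute difference.\<close>

lemma AE_eq_by_duality:
  fixes F G :: "'a::euclidean_space \<Rightarrow> real"
  assumes m [measurable]: "F \<in> BM" "G \<in> BM"
    and b: "AE q in lborel. \<bar>F q\<bar> \<le> K" "AE q in lborel. \<bar>G q\<bar> \<le> K"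
    and box: "\<And>a b. (LBINT q. F q * ind (box a b) q) = (LBINT q. G q * ind (box a b) q)"
  shows "AE q in lborel. F q = G q"
proof -
  have i: "L1 (\<lambda>q. F q * h q)" "L1 (\<lambda>q. G q * h q)" if "L1 h" for h
    using integrable_mult_bounded[OF that m(1) b(1)] integrable_mult_bounded[OF that m(2) b(2)] by (auto simp: mult.commute)
  have D: "(LBINT q. (F q - G q) * h q) = 0" if "L1 h" for h
    using that
  proof (induction rule: L1_induct)
    case (box a c)
    have "L1 (ind (box a c) :: 'a \<Rightarrow> real)"
      by (rule integrable_real_indicator[OF _ emeasure_lborel_box_finite]) simp
    then show ?case using i assms(5)[of a c] by (simp add: left_diff_distrib)
  next
    case (scale h c)
    have "(LBINT q. (F q - G q) * (c * h q)) = c * (LBINT q. (F q - G q) * h q)"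
      unfolding integral_mult_right_zero[symmetric] by (simp add: mult_ac)
    then show ?case using scale by simp
  next
    case (add f g)
    have "L1 (\<lambda>q. (F q - G q) * f q)" "L1 (\<lambda>q. (F q - G q) * g q)"
      using i[OF add.hyps(1)] i[OF add.hyps(2)] by (auto simp: left_diff_distrib)
    then show ?case using add.IH by (simp add: distrib_left)
  next
    case (lim f s)
    have "(\<lambda>n. (LBINT q. s n q * (F q - G q)) - (LBINT q. f q * (F q - G q))) \<longlonglongrightarrow> 0"
    proof (rule tendsto_L1_mult_bounded[OF lim.hyps(1,2,3)])
      show "AE q in lborel. \<bar>F q - G q\<bar> \<le> 2 * K" using b by eventually_elim auto
    qed simp
    then show ?case using lim.IH by (simp add: mult.commute LIMSEQ_const_iff)
  qed
  obtain \<rho> :: "'a \<Rightarrow> real" where \<rho>: "\<rho> \<in> borel_measurable lborel" "\<And>x. \<rho> x > 0" "L1 \<rho>"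
    using sigma_finite_measure.obtain_positive_integrable_function[OF sigma_finite_lborel] by metis
  have si: "L1 (\<lambda>q. \<rho> q * sgn (F q - G q))"
    by (rule integrable_mult_bounded[OF \<rho>(3), where B=1]) (auto simp: sgn_if)
  have e: "(F q - G q) * (\<rho> q * sgn (F q - G q)) = \<rho> q * \<bar>F q - G q\<bar>" for q by (simp add: sgn_if abs_if)
  have ii: "L1 (\<lambda>q. \<rho> q * \<bar>F q - G q\<bar>)"
    using i[OF si] unfolding e[symmetric] by (simp add: left_diff_distrib)
  have "(LBINT q. \<rho> q * \<bar>F q - G q\<bar>) = 0" using D[OF si] unfolding e .
  moreover have "AE q in lborel. 0 \<le> \<rho> q * \<bar>F q - G q\<bar>" using \<rho>(2) by (simp add: less_imp_le)
  ultimately have "AE q in lborel. \<rho> q * \<bar>F q - G q\<bar> = 0"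
    using integral_nonneg_eq_0_iff_AE[OF ii] by simp
  then show ?thesis
  proof eventually_elim
    case (elim q)
    then show ?case using \<rho>(2)[of q] by simp
  qed
qed

text \<open>Joint measurability of kernel integrals is proved with kernels on the whole space; the
  Dirac measure at 0 fills the points outside \<open>QT T\<close>.\<close>

lemma kernel_extension:
  assumes \<nu>: "\<nu> \<in> measurable (restrict_space borel (QT T)) (prob_algebra (borel :: real measure))"
  obtains \<nu>' where "\<nu>' \<in> measurable borel (prob_algebra borel)" "\<And>p. p \<in> QT T \<Longrightarrow> \<nu>' p = \<nu> p"
proof
  let ?\<nu>' = "\<lambda>p. if p \<in> QT T then \<nu> p else return borel 0"
  show "?\<nu>' \<in> measurable borel (prob_algebra borel)"
  proof (rule measurable_If_restrict_space_iff[THEN iffD2])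
    show "{x \<in> space borel. x \<in> QT T} \<in> sets (borel :: (real \<times> real) measure)" using QT_sets by simp
    show "\<nu> \<in> restrict_space borel {x. x \<in> QT T} \<rightarrow>\<^sub>M prob_algebra borel \<and>
      (\<lambda>x. return borel 0) \<in> restrict_space borel {x. \<not> x \<in> QT T} \<rightarrow>\<^sub>M prob_algebra borel"
      using \<nu> by (auto intro!: measurable_const simp: space_prob_algebra prob_space_return)
  qed
qed simp

lemma tail_of_interval:
  assumes "a \<le> b"
  shows "(LBINT \<xi>. ind {l<..} \<xi> * ind {a<..<b} \<xi>) = max 0 (b - max a (l::real))"
proof -
  have "(\<lambda>\<xi>. ind {l<..} \<xi> * ind {a<..<b} \<xi>) = (ind {max a l<..<b} :: real \<Rightarrow> real)"
    by (rule ext) (auto simp: indicator_def)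
  then show ?thesis by (cases "max a l \<le> b") (simp_all add: max_def)
qed

text \<open>Fubini for \<open>N\<close> and Lebesgue measure: the left integrand is the length of
  the part of \<open>(a, b)\<close> above \<open>l\<close>, and integrating the condition
  \<open>l < \<xi>\<close> in \<open>l\<close> first gives the distribution function.\<close>

lemma integral_tail_of_interval:
  assumes "prob_space N" and N: "sets N = sets (borel :: real measure)" and ab: "a \<le> b"
  shows "(\<integral>l. max 0 (b - max a l) \<partial>N) = (LBINT \<xi>. measure N {..\<xi>} * ind {a<..<b} \<xi>)"
proof -
  interpret N: prob_space N by fact
  interpret pair_sigma_finite N lborel ..
  have sp: "space N = UNIV" using sets_eq_imp_space_eq[OF N] by simp
  define H :: "real \<Rightarrow> real \<Rightarrow> real" where "H l \<xi> = ind {l<..} \<xi> * ind {a<..<b} \<xi>" for l \<xi>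
  have Hm: "case_prod H \<in> borel_measurable (N \<Otimes>\<^sub>M lborel)"
  proof -
    have "(\<lambda>p. H (fst p) (snd p)) \<in> borel_measurable (borel \<Otimes>\<^sub>M borel)"
      unfolding H_def by (intro borel_measurable_times measurable_indicator_greaterThan measurable_compose[OF measurable_snd borel_measurable_indicator]) auto
    moreover have "sets (N \<Otimes>\<^sub>M lborel) = sets (borel \<Otimes>\<^sub>M (borel :: real measure))" by (intro sets_pair_measure_cong N) simp
    ultimately show ?thesis by (simp add: case_prod_beta' cong: measurable_cong_sets)
  qed
  have ii: "L1 (H l)" for l
  proof -
    have "(H l) = ind {max a l<..<b}" by (rule ext) (auto simp: H_def indicator_def)
    then show ?thesis by (cases "max a l \<le> b") (auto intro!: integrable_real_indicator)
  qed
  have Ha: "\<bar>H l \<xi>\<bar> = H l \<xi>" for l \<xi> by (simp add: H_def)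
  have Hv: "(LBINT \<xi>. H l \<xi>) = max 0 (b - max a l)" for l unfolding H_def by (rule tail_of_interval[OF ab])
  have bi: "integrable N (\<lambda>l. max 0 (b - max a l))"
  proof (rule N.integrable_const_bound[where B="b - a"])
    show "(\<lambda>l. max 0 (b - max a l)) \<in> borel_measurable N" by (simp add: measurable_cong_sets[OF N refl])
  qed (use ab in auto)
  have Hi: "integrable (N \<Otimes>\<^sub>M lborel) (case_prod H)"
  proof (rule Fubini_integrable[OF Hm])
    show "integrable N (\<lambda>x. LBINT y. norm (case (x, y) of (x, xa) \<Rightarrow> H x xa))" using bi by (simp add: Ha Hv)
    show "AE x in N. L1 (\<lambda>y. case (x, y) of (x, xa) \<Rightarrow> H x xa)" using ii by simp
  qed
  have "(\<integral>l. max 0 (b - max a l) \<partial>N) = (\<integral>l. (LBINT \<xi>. H l \<xi>) \<partial>N)" by (simp add: Hv)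
  also have "\<dots> = (LBINT \<xi>. (\<integral>l. H l \<xi> \<partial>N))" using Fubini_integral[OF Hi] by simp
  also have "\<dots> = (LBINT \<xi>. measure N {..<\<xi>} * ind {a<..<b} \<xi>)"
  proof (intro LINT_cong)
    fix \<xi> :: real
    have "(\<integral>l. H l \<xi> \<partial>N) = (\<integral>l. ind {..<\<xi>} l * ind {a<..<b} \<xi> \<partial>N)"
      by (intro LINT_cong) (auto simp: H_def indicator_def)
    also have "\<dots> = measure N {..<\<xi>} * ind {a<..<b} \<xi>" using N sp by simp
    finally show "(\<integral>l. H l \<xi> \<partial>N) = measure N {..<\<xi>} * ind {a<..<b} \<xi>" .
  qed
  also have "\<dots> = (LBINT \<xi>. measure N {..\<xi>} * ind {a<..<b} \<xi>)"
  proof (rule integral_cong_AE)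
    have mono: "(\<lambda>\<xi>. measure N {..<\<xi>}) \<in> BM" "(\<lambda>\<xi>. measure N {..\<xi>}) \<in> BM"
      by (rule borel_measurable_mono; intro monoI N.finite_measure_mono; auto simp: N)+
    then show "(\<lambda>\<xi>. measure N {..<\<xi>} * ind {a<..<b} \<xi>) \<in> borel_measurable lborel"
      "(\<lambda>\<xi>. measure N {..\<xi>} * ind {a<..<b} \<xi>) \<in> borel_measurable lborel" by auto
    \<comment> \<open>The strict inequality in the indicator yields the open half-line. It differs
      from the closed one only at atoms, of which there are countably many, so the right-continuous
      distribution function may be used.\<close>
    have "countable {\<xi>. measure N {\<xi>} \<noteq> 0}" by (rule N.countable_support)
    then have "{\<xi>. measure N {\<xi>} \<noteq> 0} \<in> null_sets lborel" by (rule countable_imp_null_set_lborel)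
    from AE_not_in[OF this]
    show "AE \<xi> in lborel. measure N {..<\<xi>} * ind {a<..<b} \<xi> = measure N {..\<xi>} * ind {a<..<b} \<xi>"
    proof eventually_elim
      case (elim \<xi>)
      have "measure N ({..<\<xi>} \<union> {\<xi>}) = measure N {..<\<xi>} + measure N {\<xi>}"
        by (rule N.finite_measure_Union) (auto simp: N)
      moreover have "{..<\<xi>} \<union> {\<xi>} = {..\<xi>}" by auto
      ultimately show ?case using elim by simp
    qed
  qed
  finally show ?thesis .
qed

context kv_limit
begin

interpretation st: kv_strip T R \<sigma> \<sigma>' "u0 n" "v0 n" "u n" "v n" "w n" "s n" "g n" for n
  by (rule strip)

lemma Flim_Ft:
  assumes "L1 h"
  shows "(\<lambda>n. LBINT q. Ft n (fst q) (snd q) * h q) \<longlonglongrightarrow> (LBINT q. F q * h q)"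
  using Flim[OF assms] by (simp add: Ft_def)

text \<open>The last two terms of \<open>H\<close> are the \<xi>-derivative of \<phi> times
  \<open>S - \<sigma>\<close>; integrated over \<xi> above \<open>u n\<close> they give minus its
  value at \<open>u n\<close>. \<open>kinetic_level\<close> has \<open>s n\<close> in place of
  \<open>S\<close> there, so the defect at level \<open>n\<close> is the integral of
  \<open>s n - S\<close> against \<phi> on the graph of \<open>u n\<close>, and it tends to 0 by
  strong convergence.\<close>

lemma kinetic_limit:
  assumes \<phi>: "\<phi> \<in> test_functions ({..<T} \<times> {0<..<1} \<times> UNIV)"
    and Fini: "\<And>h. L1 h \<Longrightarrow> (\<lambda>n. LBINT q. F0 n q * h q) \<longlonglongrightarrow> (LBINT q. Fini q * h q)"
  defines "H \<equiv> \<lambda>q. dir_deriv (1, 0, 0) \<phi> q + (S (fst q, fst (snd q)) - \<sigma> (snd (snd q))) * dir_deriv (0, 0, 1) \<phi> q - \<sigma>' (snd (snd q)) * \<phi> q"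
  shows "L1 (\<lambda>q. F q * H q)"
    and "(LBINT q. F q * H q) + (LBINT q. Fini q * \<phi> (0, fst q, snd q)) = 0"
proof -
  let ?t = "dir_deriv (1, 0, 0) \<phi>" and ?x = "dir_deriv (0, 0, 1) \<phi>"
  note \<phi>t = test_functions_dir_deriv[OF \<phi>, of "(1, 0, 0)"] and \<phi>x = test_functions_dir_deriv[OF \<phi>, of "(0, 0, 1)"]
  obtain K where K: "\<And>p. \<bar>\<phi> p\<bar> \<le> K" using test_functions_bounded[OF \<phi>] by metis
  obtain Kx where Kx: "\<And>p. \<bar>?x p\<bar> \<le> Kx" using test_functions_bounded[OF \<phi>x] by metis
  obtain B0 where B0: "B0 > 0" "\<And>p. norm p \<ge> B0 \<Longrightarrow> \<phi> p = 0" using test_functions_bounded_support[OF \<phi>] by metis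
  obtain B1 where B1: "B1 > 0" "\<And>p. norm p \<ge> B1 \<Longrightarrow> ?t p = 0" using test_functions_bounded_support[OF \<phi>t] by metis
  obtain B2 where B2: "B2 > 0" "\<And>p. norm p \<ge> B2 \<Longrightarrow> ?x p = 0" using test_functions_bounded_support[OF \<phi>x] by metis
  have nrm: "\<bar>\<xi>\<bar> \<le> norm (t, x, \<xi>)" for t x \<xi> :: real
    using norm_snd_le[of "(t, x, \<xi>)"] norm_snd_le[of "(x, \<xi>)"] by (simp add: norm_Pair real_le_rsqrt)
  have c3: "continuous_on UNIV (\<lambda>q :: real \<times> real \<times> real. f (snd (snd q)))" if "continuous_on UNIV f" for f :: "real \<Rightarrow> real"
    by (rule continuous_on_compose2[OF that]) (auto intro!: continuous_intros)
  have i1: "L1 ?t"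
    by (rule integrable_continuous_bounded_support[OF test_functions_continuous[OF \<phi>t] B1(2)])
  have i2: "L1 (\<lambda>q. \<sigma> (snd (snd q)) * ?x q)"
    by (rule integrable_continuous_bounded_support[where B=B2])
      (use B2 in \<open>auto intro!: continuous_on_mult c3 st.\<sigma>_cont test_functions_continuous[OF \<phi>x]\<close>)
  have i3: "L1 (\<lambda>q. \<sigma>' (snd (snd q)) * \<phi> q)"
    by (rule integrable_continuous_bounded_support[where B=B0])
      (use B0 in \<open>auto intro!: continuous_on_mult c3 st.\<sigma>' test_functions_continuous[OF \<phi>]\<close>)
  have pm: "(\<lambda>q :: real \<times> real \<times> real. (fst q, fst (snd q))) \<in> BM"
    "(\<lambda>q :: real \<times> real \<times> real. snd (snd q)) \<in> BM"
    by (intro borel_measurable_continuous_onI continuous_intros)+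
  have i4: "L1 (\<lambda>q. S (fst q, fst (snd q)) * ?x q)"
  proof -
    have ji: "L1 (ind {-B2..B2} :: real \<Rightarrow> real)" by (intro integrable_real_indicator) (auto simp: emeasure_lborel_Icc_eq)
    have "L1 (\<lambda>q. S (fst q, fst (snd q)) * ind {-B2..B2} (snd (snd q)))"
    proof (rule integrable3I)
      show "(\<lambda>q. S (fst q, fst (snd q)) * ind {-B2..B2} (snd (snd q))) \<in> BM"
        by (intro borel_measurable_times measurable_compose[OF pm(1) Sm] measurable_compose[OF pm(2) borel_measurable_indicator]) auto
      show "AE p in lborel. L1 (\<lambda>\<xi>. S (fst (fst p, snd p, \<xi>), fst (snd (fst p, snd p, \<xi>))) * ind {-B2..B2} (snd (snd (fst p, snd p, \<xi>))))"
        using ji by simp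
      show "L1 (\<lambda>p. LBINT \<xi>. \<bar>S (fst (fst p, snd p, \<xi>), fst (snd (fst p, snd p, \<xi>))) * ind {-B2..B2} (snd (snd (fst p, snd p, \<xi>)))\<bar>)"
        using S_int by (simp add: abs_mult)
    qed
    then have "L1 (\<lambda>q. S (fst q, fst (snd q)) * ind {-B2..B2} (snd (snd q)) * ?x q)"
      by (rule integrable_mult_bounded[OF _ test_functions_measurable[OF \<phi>x], of _ Kx]) (use Kx in auto)
    moreover have "S (fst q, fst (snd q)) * ind {-B2..B2} (snd (snd q)) * ?x q = S (fst q, fst (snd q)) * ?x q" for q
    proof (cases "snd (snd q) \<in> {-B2..B2}")
      case False
      then have "B2 \<le> \<bar>snd (snd q)\<bar>" by auto
      also have "\<dots> \<le> norm q" using nrm[of "snd (snd q)" "fst q" "fst (snd q)"] by simp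
      finally show ?thesis using B2(2) by simp
    qed simp
    ultimately show ?thesis by simp
  qed
  have He: "H = (\<lambda>q. ?t q + (S (fst q, fst (snd q)) * ?x q - \<sigma> (snd (snd q)) * ?x q) - \<sigma>' (snd (snd q)) * \<phi> q)"
    unfolding H_def by (rule ext) (simp add: algebra_simps)
  have Hi: "L1 H" unfolding He
    by (intro L1_diff L1_add i1 i2 i3 i4)
  obtain KF where KF: "AE q in lborel. \<bar>F q\<bar> \<le> KF" using Fb by blast
  show "L1 (\<lambda>q. F q * H q)"
    using integrable_mult_bounded[OF Hi Fm KF] by (simp add: mult.commute)
  have lev: "(LBINT q. Ft n (fst q) (snd q) * H q) + (LBINT q. F0 n q * \<phi> (0, fst q, snd q)) =
     (LBINT p. s n p * \<phi> (fst p, snd p, u n p)) - (LBINT p. S p * \<phi> (fst p, snd p, u n p))" for n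
  proof -
    have FH: "L1 (\<lambda>q. Ft n (fst q) (snd q) * H q)"
      using integrable_mult_bounded[OF Hi Ft_meas3[of n], of 1] by (simp add: mult.commute Ft_def indicator_def)
    have um: "(\<lambda>p. \<phi> (fst p, snd p, u n p)) \<in> BM"
      by (rule measurable_compose[OF _ test_functions_measurable[OF \<phi>]]) (use st.meas(1)[of n] in \<open>intro borel_measurable_Pair; simp\<close>)
    have si: "L1 (\<lambda>p. s n p * \<phi> (fst p, snd p, u n p))" by (rule integrable_mult_bounded[OF st.s_int um, of K]) (use K in auto)
    have Si: "L1 (\<lambda>p. S p * \<phi> (fst p, snd p, u n p))" by (rule integrable_mult_bounded[OF S_int um, of K]) (use K in auto)
    note kl = st.kinetic_level[OF \<phi>, of n]
    have inner: "(LBINT \<xi>. Ft n (fst p) (snd p, \<xi>) * H (fst p, snd p, \<xi>)) =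
       (ind (QT T) p * (LBINT \<xi>. ind {u n p<..} \<xi> * ?t (fst p, snd p, \<xi>)) - w n p * \<phi> (fst p, snd p, u n p))
        + (s n p * \<phi> (fst p, snd p, u n p) - S p * \<phi> (fst p, snd p, u n p))" for p
    proof (cases "p \<in> QT T")
      case False
      then show ?thesis using st.zero[OF False, of n] Sz[OF False] by (simp add: Ft_def)
    next
      case True
      obtain t x where p: "p = (t, x)" by (cases p)
      define l where "l = u n p"
      define c where "c = S p"
      define f where "f \<xi> = (c - \<sigma> \<xi>) * ?x (t, x, \<xi>) - \<sigma>' \<xi> * \<phi> (t, x, \<xi>)" for \<xi>
      \<comment> \<open>Beyond the support of \<phi> in \<xi> and not below \<open>l\<close>, so
        that integrating up to \<open>M\<close> captures the whole tail and leaves no term at the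
        upper end.\<close>
      define M where "M = max (max B0 B2) l"
      have sc: "continuous_on UNIV (\<lambda>\<xi>. \<psi> (t, x, \<xi>))" if "\<psi> \<in> test_functions U" for \<psi> and U :: "(real \<times> real \<times> real) set"
        by (rule continuous_on_compose2[OF test_functions_continuous[OF that, of UNIV]]) (auto intro!: continuous_intros)
      have fc: "continuous_on UNIV f" unfolding f_def[abs_def] by (intro continuous_intros st.\<sigma>_cont st.\<sigma>' sc[OF \<phi>] sc[OF \<phi>x])
      have fm: "f \<in> BM" by (rule borel_measurable_continuous_onI[OF fc])
      have fz: "f \<xi> = 0" if "max B0 B2 \<le> \<bar>\<xi>\<bar>" for \<xi>
      proof -
        have "B0 \<le> norm (t, x, \<xi>)" "B2 \<le> norm (t, x, \<xi>)" using that nrm[of \<xi> t x] by linarith+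
        then show ?thesis using B0(2) B2(2) by (simp add: f_def)
      qed
      have fi: "L1 f"
        by (rule integrable_continuous_bounded_support[OF fc, of "max B0 B2"]) (use fz in auto)
      have tail: "(LBINT \<xi>. ind {l<..} \<xi> * f \<xi>) = - ((c - \<sigma> l) * \<phi> (t, x, l))"
      proof -
        have "(LBINT \<xi>. ind {l<..} \<xi> * f \<xi>) = (LBINT \<xi>. f \<xi> * ind {l..M} \<xi>)"
        proof (rule integral_cong_AE)
          show "AE \<xi> in lborel. ind {l<..} \<xi> * f \<xi> = f \<xi> * ind {l..M} \<xi>"
            using AE_lborel_singleton[of l]
          proof eventually_elim
            case (elim \<xi>)
            show ?case
            proof (cases "\<xi> \<le> M")
              case True then show ?thesis using elim by (auto simp: indicator_def)
            next
              case False
              then have "f \<xi> = 0" by (intro fz) (auto simp: M_def)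
              then show ?thesis by simp
            qed
          qed
        qed (use fm in auto)
        also have "\<dots> = (c - \<sigma> M) * \<phi> (t, x, M) - (c - \<sigma> l) * \<phi> (t, x, l)"
        proof (rule integral_FTC_Icc_real)
          show "((\<lambda>\<xi>. (c - \<sigma> \<xi>) * \<phi> (t, x, \<xi>)) has_real_derivative f \<xi>) (at \<xi>)" for \<xi>
            unfolding f_def using DERIV_mult[OF DERIV_diff[OF DERIV_const st.\<sigma>] test_functions_partial3(2)[OF \<phi>]]
            by (simp add: algebra_simps)
          show "isCont f \<xi>" for \<xi> using fc by (simp add: continuous_on_eq_continuous_at)
        qed (simp add: M_def)
        also have "\<phi> (t, x, M) = 0"
        proof (rule B0(2))
          have "B0 \<le> \<bar>M\<bar>" by (auto simp: M_def)
          then show "B0 \<le> norm (t, x, M)" using nrm[of M t x] by linarith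
        qed
        finally show ?thesis by simp
      qed
      have Ti: "L1 (\<lambda>\<xi>. ind {l<..} \<xi> * ?t (t, x, \<xi>))"
        using test_tail_bounded[OF \<phi>t] by metis
      have "(LBINT \<xi>. Ft n (fst p) (snd p, \<xi>) * H (fst p, snd p, \<xi>)) = (LBINT \<xi>. ind {l<..} \<xi> * ?t (t, x, \<xi>) + ind {l<..} \<xi> * f \<xi>)"
        using True by (intro LINT_cong) (simp add: Ft_def H_def f_def p l_def c_def algebra_simps)
      also have "\<dots> = (LBINT \<xi>. ind {l<..} \<xi> * ?t (t, x, \<xi>)) + (LBINT \<xi>. ind {l<..} \<xi> * f \<xi>)"
        by (intro LINT_add Ti integrable_ind_mult fi) simp
      finally show ?thesis unfolding tail using True st.s_eq[OF True, of n]
        by (simp add: p l_def c_def algebra_simps)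
    qed
    have "(LBINT q. Ft n (fst q) (snd q) * H q) = (LBINT p. (ind (QT T) p * (LBINT \<xi>. ind {u n p<..} \<xi> * ?t (fst p, snd p, \<xi>)) - w n p * \<phi> (fst p, snd p, u n p))
        + (s n p * \<phi> (fst p, snd p, u n p) - S p * \<phi> (fst p, snd p, u n p)))"
      using Fubini3(1)[OF FH] by (simp add: inner)
    also have "\<dots> = ((LBINT p. ind (QT T) p * (LBINT \<xi>. ind {u n p<..} \<xi> * ?t (fst p, snd p, \<xi>))) - (LBINT p. w n p * \<phi> (fst p, snd p, u n p)))
      + ((LBINT p. s n p * \<phi> (fst p, snd p, u n p)) - (LBINT p. S p * \<phi> (fst p, snd p, u n p)))"
      using kl(1,2) si Si by simp
    also have "(LBINT p. ind (QT T) p * (LBINT \<xi>. ind {u n p<..} \<xi> * ?t (fst p, snd p, \<xi>))) - (LBINT p. w n p * \<phi> (fst p, snd p, u n p))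
      = - (LBINT x. LBINT \<xi>. ind {u0 n x<..} \<xi> * \<phi> (0, x, \<xi>))"
      using kl(3) by simp
    also have "(LBINT x. LBINT \<xi>. ind {u0 n x<..} \<xi> * \<phi> (0, x, \<xi>)) = (LBINT q. F0 n q * \<phi> (0, fst q, snd q))"
    proof -
      have ci: "L1 (\<lambda>q. \<phi> (0, fst q, snd q))"
      proof (rule integrable_continuous_bounded_support[of _ B0])
        show "continuous_on UNIV (\<lambda>q. \<phi> (0, fst q, snd q))"
          by (rule continuous_on_compose2[OF test_functions_continuous[OF \<phi>, of UNIV]]) (auto intro!: continuous_intros)
        show "\<phi> (0, fst q, snd q) = 0" if "B0 \<le> norm q" for q
          using that norm_snd_le[of q 0] by (intro B0(2)) (cases q, auto)
      qed
      have "L1 (\<lambda>q. F0 n q * \<phi> (0, fst q, snd q))"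
        using integrable_mult_bounded[OF ci F0_meas[of n], of 1] F0_bound by (simp add: mult.commute)
      from Fubini_fst(1)[OF this]
      have "(LBINT q. F0 n q * \<phi> (0, fst q, snd q)) = (LBINT x. LBINT \<xi>. F0 n (x, \<xi>) * \<phi> (0, x, \<xi>))" by simp
      also have "\<dots> = (LBINT x. LBINT \<xi>. ind {u0 n x<..} \<xi> * \<phi> (0, x, \<xi>))"
      proof (intro LINT_cong)
        fix x \<xi>
        have "\<phi> (0, x, \<xi>) = 0" if "x \<notin> {0<..<1}" by (rule test_functions_outside[OF \<phi>]) (use that in auto)
        then show "F0 n (x, \<xi>) * \<phi> (0, x, \<xi>) = ind {u0 n x<..} \<xi> * \<phi> (0, x, \<xi>)" by (auto simp: F0_def indicator_def)
      qed
      finally show ?thesis by simp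
    qed
    finally show ?thesis by simp
  qed
  have ci: "L1 (\<lambda>q. \<phi> (0, fst q, snd q))"
  proof (rule integrable_continuous_bounded_support[of _ B0])
    show "continuous_on UNIV (\<lambda>q. \<phi> (0, fst q, snd q))"
      by (rule continuous_on_compose2[OF test_functions_continuous[OF \<phi>, of UNIV]]) (auto intro!: continuous_intros)
    show "\<phi> (0, fst q, snd q) = 0" if "B0 \<le> norm q" for q
      using that norm_snd_le[of q 0] by (intro B0(2)) (cases q, auto)
  qed
  have um: "(\<lambda>p. \<phi> (fst p, snd p, u n p)) \<in> BM" for n
    by (rule measurable_compose[OF _ test_functions_measurable[OF \<phi>]]) (use st.meas(1)[of n] in \<open>intro borel_measurable_Pair; simp\<close>)
  have r: "(\<lambda>n. (LBINT p. s n p * \<phi> (fst p, snd p, u n p)) - (LBINT p. S p * \<phi> (fst p, snd p, u n p))) \<longlonglongrightarrow> 0"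
    by (rule tendsto_L1_mult_bounded[where K=K, OF st.s_int S_int s_L1 um]) (use K in auto)
  have "(\<lambda>n. (LBINT q. Ft n (fst q) (snd q) * H q) + (LBINT q. F0 n q * \<phi> (0, fst q, snd q))) \<longlonglongrightarrow>
     (LBINT q. F q * H q) + (LBINT q. Fini q * \<phi> (0, fst q, snd q))"
    by (intro tendsto_add Flim_Ft[OF Hi] Fini[OF ci])
  with r show "(LBINT q. F q * H q) + (LBINT q. Fini q * \<phi> (0, fst q, snd q)) = 0"
    unfolding lev by (rule LIMSEQ_unique[rotated])
qed

text \<open>Tested with a box, the \<xi>-integral turns the discontinuous indicator of
  \<open>u n < \<xi>\<close> into a continuous function of \<open>u n\<close>. Its weak-star limit
  is an average under the Young measure, which \<open>integral_tail_of_interval\<close> turns back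
  into an integral of the distribution function.\<close>

lemma F_cdf:
  assumes \<nu>: "\<nu> \<in> measurable (restrict_space borel (QT T)) (prob_algebra (borel :: real measure))"
    and Y\<nu>: "\<And>\<beta> p. continuous_on UNIV \<beta> \<Longrightarrow> p \<in> QT T \<Longrightarrow> Y \<beta> p = (\<integral>y. \<beta> y \<partial>\<nu> p)"
  shows "AE q in lborel. (fst q, fst (snd q)) \<in> QT T \<longrightarrow> F q = measure (\<nu> (fst q, fst (snd q))) {..snd (snd q)}"
proof -
  have pm: "(\<lambda>q :: real \<times> real \<times> real. (fst q, fst (snd q))) \<in> BM"
    "(\<lambda>q :: real \<times> real \<times> real. snd (snd q)) \<in> BM"
    by (intro borel_measurable_continuous_onI continuous_intros)+
  obtain \<nu>' where \<nu>'m: "\<nu>' \<in> measurable borel (prob_algebra borel)" and \<nu>'_eq: "\<And>p. p \<in> QT T \<Longrightarrow> \<nu>' p = \<nu> p"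
    using kernel_extension[OF \<nu>] by metis
  have ps: "prob_space (\<nu>' p)" "sets (\<nu>' p) = sets borel" for p
    using measurable_space[OF \<nu>'m, of p] by (auto simp: space_prob_algebra)
  define G where "G q = ind (QT T) (fst q, fst (snd q)) * measure (\<nu>' (fst q, fst (snd q))) {..snd (snd q)}" for q :: "real \<times> real \<times> real"
  have Gm: "G \<in> BM"
  proof -
    have "(\<lambda>q :: real \<times> real \<times> real. measure (\<nu>' (fst q, fst (snd q))) {..snd (snd q)}) \<in> BM"
    proof (rule measure_measurable_subprob_algebra2)
      show "(\<lambda>q :: real \<times> real \<times> real. \<nu>' (fst q, fst (snd q))) \<in> measurable borel (subprob_algebra borel)"
        using measurable_compose[OF pm(1) measurable_prob_algebraD[OF \<nu>'m]] by simp
      have "{z \<in> space ((borel :: (real \<times> real \<times> real) measure) \<Otimes>\<^sub>M (borel :: real measure)). snd z \<le> snd (snd (fst z))} \<in> sets (borel \<Otimes>\<^sub>M borel)"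
        by (rule borel_measurable_le) (use measurable_compose[OF measurable_fst pm(2)] in auto)
      moreover have "{z \<in> space ((borel :: (real \<times> real \<times> real) measure) \<Otimes>\<^sub>M (borel :: real measure)). snd z \<le> snd (snd (fst z))} = (SIGMA q:space borel. {..snd (snd q)})"
        by (auto simp: space_pair_measure)
      ultimately show "(SIGMA q:space (borel :: (real \<times> real \<times> real) measure). {..snd (snd q)}) \<in> sets (borel \<Otimes>\<^sub>M borel)" by simp
    qed
    then show ?thesis unfolding G_def[abs_def]
      by (intro borel_measurable_times measurable_compose[OF pm(1) borel_measurable_indicator[OF QT_sets]])
  qed
  have G1: "\<bar>G q\<bar> \<le> 1" for q
    using prob_space.prob_le_1[OF ps(1)] by (auto simp: G_def indicator_def)
  obtain KF where KF: "AE q in lborel. \<bar>F q\<bar> \<le> KF" using Fb by blast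
  have "AE q in lborel. F q = G q"
  proof (rule AE_eq_by_duality[OF Fm Gm, of "max 1 KF"])
    show "AE q in lborel. \<bar>F q\<bar> \<le> max 1 KF" using KF by eventually_elim auto
    show "AE q in lborel. \<bar>G q\<bar> \<le> max 1 KF" by (intro AE_I2) (rule order_trans[OF G1], simp)
    fix a b :: "real \<times> real \<times> real"
    obtain a1 a2 a3 b1 b2 b3 where ab: "a = (a1, a2, a3)" "b = (b1, b2, b3)" by (metis prod.exhaust)
    let ?h = "ind (box a b) :: real \<times> real \<times> real \<Rightarrow> real"
    have hi: "L1 ?h" by (rule integrable_real_indicator[OF _ emeasure_lborel_box_finite]) simp
    let ?k = "ind (box (a1, a2) (b1, b2)) :: real \<times> real \<Rightarrow> real"
    have ki: "L1 ?k" by (rule integrable_real_indicator[OF _ emeasure_lborel_box_finite]) simp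
    have hk: "?h (t, x, \<xi>) = ?k (t, x) * ind {a3<..<b3} \<xi>" for t x \<xi>
      by (auto simp: ab box_prod box_real indicator_def)
    show "(LBINT q. F q * ?h q) = (LBINT q. G q * ?h q)"
    proof (cases "a3 \<le> b3")
      case False
      then have "?h q = 0" for q using hk[of "fst q" "fst (snd q)" "snd (snd q)"] by simp
      then show ?thesis by simp
    next
      case True
      \<comment> \<open>The length of the part of \<open>(a3, b3)\<close> above \<open>l\<close>,
        continuous in \<open>l\<close>.\<close>
      define \<beta> where "\<beta> l = max 0 (b3 - max a3 l)" for l
      have \<beta>: "continuous_on UNIV \<beta>" unfolding \<beta>_def[abs_def] by (intro continuous_intros)
      have "(LBINT q. Ft n (fst q) (snd q) * ?h q) = (LBINT p. ind (QT T) p * \<beta> (u n p) * ?k p)" for n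
      proof -
        have "L1 (\<lambda>q. Ft n (fst q) (snd q) * ?h q)"
          using integrable_mult_bounded[OF hi Ft_meas3[of n], of 1] by (simp add: mult.commute Ft_def indicator_def)
        from Fubini3(1)[OF this]
        have "(LBINT q. Ft n (fst q) (snd q) * ?h q) = (LBINT p. LBINT \<xi>. Ft n (fst p) (snd p, \<xi>) * ?h (fst p, snd p, \<xi>))" by simp
        also have "\<dots> = (LBINT p. ind (QT T) p * \<beta> (u n p) * ?k p)"
        proof (intro LINT_cong)
          fix p :: "real \<times> real"
          have "(LBINT \<xi>. Ft n (fst p) (snd p, \<xi>) * ?h (fst p, snd p, \<xi>)) =
             (LBINT \<xi>. (ind (QT T) p * ?k p) * (ind {u n p<..} \<xi> * ind {a3<..<b3} \<xi>))"
            by (intro LINT_cong) (simp add: hk Ft_def)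
          also have "\<dots> = ind (QT T) p * ?k p * \<beta> (u n p)"
            by (simp add: tail_of_interval[OF True] \<beta>_def del: mult_indicator_subset)
          finally show "(LBINT \<xi>. Ft n (fst p) (snd p, \<xi>) * ?h (fst p, snd p, \<xi>)) = ind (QT T) p * \<beta> (u n p) * ?k p" by simp
        qed
        finally show ?thesis .
      qed
      with Flim_Ft[OF hi] have "(\<lambda>n. LBINT p. ind (QT T) p * \<beta> (u n p) * ?k p) \<longlonglongrightarrow> (LBINT q. F q * ?h q)" by simp
      then have "(LBINT q. F q * ?h q) = (LBINT p. Y \<beta> p * ?k p)"
        using Ylim[OF \<beta> ki] by (rule LIMSEQ_unique)
      also have "\<dots> = (LBINT p. LBINT \<xi>. G (fst p, snd p, \<xi>) * ?h (fst p, snd p, \<xi>))"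
      proof (intro LINT_cong)
        fix p :: "real \<times> real"
        show "Y \<beta> p * ?k p = (LBINT \<xi>. G (fst p, snd p, \<xi>) * ?h (fst p, snd p, \<xi>))"
        proof (cases "p \<in> QT T")
          case False
          then show ?thesis using Yz[OF False] by (simp add: G_def)
        next
          case True': True
          then have e: "\<nu>' p = \<nu> p" by (rule \<nu>'_eq)
          have "Y \<beta> p = (\<integral>l. max 0 (b3 - max a3 l) \<partial>\<nu>' p)" unfolding Y\<nu>[OF \<beta> True'] e \<beta>_def ..
          also have "\<dots> = (LBINT \<xi>. measure (\<nu>' p) {..\<xi>} * ind {a3<..<b3} \<xi>)"
            by (rule integral_tail_of_interval[OF ps True])
          finally have "Y \<beta> p * ?k p = (LBINT \<xi>. ?k p * (measure (\<nu>' p) {..\<xi>} * ind {a3<..<b3} \<xi>))" by simp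
          also have "\<dots> = (LBINT \<xi>. G (fst p, snd p, \<xi>) * ?h (fst p, snd p, \<xi>))"
            using True' by (intro LINT_cong) (simp add: G_def hk)
          finally show ?thesis .
        qed
      qed
      also have "\<dots> = (LBINT q. G q * ?h q)"
      proof -
        have "L1 (\<lambda>q. G q * ?h q)"
          using integrable_mult_bounded[OF hi Gm, of 1] G1 by (simp add: mult.commute)
        from Fubini3(1)[OF this] show ?thesis by simp
      qed
      finally show ?thesis .
    qed
  qed
  then show ?thesis by eventually_elim (auto simp: G_def \<nu>'_eq)
qed

end

subsection \<open>Extension by zero\<close>

text \<open>Integrals, square integrability and essential bounds over a set become the same notions
  on the whole space, for functions whose values off the set are unspecified.\<close>

definition zext :: "'a set \<Rightarrow> ('a \<Rightarrow> real) \<Rightarrow> 'a \<Rightarrow> real"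
  where "zext A f p = ind A p * f p"

lemma zext_simps [simp]: "p \<in> A \<Longrightarrow> zext A f p = f p" "p \<notin> A \<Longrightarrow> zext A f p = 0"
  by (simp_all add: zext_def)

lemma set_borel_measurable_zext: "set_borel_measurable lborel A f \<longleftrightarrow> zext A f \<in> BM"
  by (simp add: set_borel_measurable_def zext_def[abs_def])

lemma set_integrable_zext: "set_integrable lborel A f \<longleftrightarrow> L1 (zext A f)"
  by (simp add: set_integrable_def zext_def[abs_def])

lemma set_integral_zext: "(LINT p:A|lborel. f p) = (LBINT p. zext A f p)"
  by (simp add: set_lebesgue_integral_def zext_def)

lemma zext_mult: "zext A (\<lambda>p. f p * g p) p = zext A f p * zext A g p"
  "zext A (\<lambda>p. f p * g p) p = zext A f p * g p"
  by (cases "p \<in> A"; simp)+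

lemma zext_mono_set:
  assumes "A \<subseteq> B" "A \<in> sets borel" "zext B f \<in> BM"
  shows "zext A f \<in> BM"
proof -
  have "zext A f = (\<lambda>p. ind A p * zext B f p)" using assms(1) by (auto simp: fun_eq_iff zext_def indicator_def)
  then show ?thesis using assms(2,3) by simp
qed

lemma Linf_iff_zext:
  "f \<in> Linf A \<longleftrightarrow> zext A f \<in> BM \<and> (\<exists>K. AE p in lborel. \<bar>zext A f p\<bar> \<le> K)"
proof
  assume "f \<in> Linf A"
  then obtain K where K: "zext A f \<in> BM" "AE p in lborel. p \<in> A \<longrightarrow> \<bar>f p\<bar> \<le> K"
    by (auto simp: Linf_def Linf_le_def set_borel_measurable_zext)
  from K(2) have "AE p in lborel. \<bar>zext A f p\<bar> \<le> max K 0" by eventually_elim (auto simp: zext_def indicator_def)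
  with K(1) show "zext A f \<in> BM \<and> (\<exists>K. AE p in lborel. \<bar>zext A f p\<bar> \<le> K)" by blast
next
  assume "zext A f \<in> BM \<and> (\<exists>K. AE p in lborel. \<bar>zext A f p\<bar> \<le> K)"
  then obtain K where K: "zext A f \<in> BM" "AE p in lborel. \<bar>zext A f p\<bar> \<le> K" by blast
  from K(2) have "AE p in lborel. p \<in> A \<longrightarrow> \<bar>f p\<bar> \<le> K" by eventually_elim (auto simp: zext_def indicator_def)
  with K(1) show "f \<in> Linf A" by (auto simp: Linf_def Linf_le_def set_borel_measurable_zext)
qed

lemma L2_iff_zext:
  "f \<in> L2 A \<longleftrightarrow> zext A f \<in> BM \<and> L1 (\<lambda>p. (zext A f p)\<^sup>2)"
proof -
  have "zext A (\<lambda>p. (f p)\<^sup>2) = (\<lambda>p. (zext A f p)\<^sup>2)" by (auto simp: zext_def indicator_def)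
  then show ?thesis by (simp add: L2_def set_borel_measurable_zext set_integrable_zext)
qed

lemma zext_id: "(\<And>p. p \<notin> A \<Longrightarrow> f p = 0) \<Longrightarrow> zext A f = f"
  by (auto simp: zext_def fun_eq_iff indicator_def)

lemma Linf_weakstar_limD:
  assumes "Linf_weakstar_lim A f g" and h: "L1 h" and A: "A \<in> sets borel"
  shows "(\<lambda>n. LBINT p. zext A (f n) p * h p) \<longlonglongrightarrow> (LBINT p. zext A g p * h p)"
proof -
  have "set_integrable lborel A h"
    unfolding set_integrable_def using integrable_ind_mult[OF h A] by simp
  then have "(\<lambda>n. LINT p:A|lborel. f n p * h p) \<longlonglongrightarrow> (LINT p:A|lborel. g p * h p)"
    using assms(1) by (auto simp: Linf_weakstar_lim_def)
  then show ?thesis by (simp add: set_integral_zext zext_mult(2))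
qed

lemma Linf_weakstar_limI:
  assumes f: "\<And>n. f n \<in> Linf A" and g: "g \<in> Linf A"
    and eq: "\<And>n p. p \<in> A \<Longrightarrow> f' n p = f n p" "\<And>p. p \<in> A \<Longrightarrow> g' p = g p"
    and lim: "\<And>h. L1 h \<Longrightarrow> (\<lambda>n. LBINT p. f' n p * h p) \<longlonglongrightarrow> (LBINT p. g' p * h p)"
  shows "Linf_weakstar_lim A f g"
  unfolding Linf_weakstar_lim_def
proof (intro conjI allI impI f g)
  fix h :: "'a \<Rightarrow> real" assume "set_integrable lborel A h"
  then have "L1 (zext A h)" by (simp add: set_integrable_zext)
  from lim[OF this] have "(\<lambda>n. LBINT p. f' n p * zext A h p) \<longlonglongrightarrow> (LBINT p. g' p * zext A h p)" .
  moreover have "f' n p * zext A h p = zext A (\<lambda>p. f n p * h p) p" "g' p * zext A h p = zext A (\<lambda>p. g p * h p) p" for n p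
    by (cases "p \<in> A"; simp add: eq)+
  ultimately show "(\<lambda>n. LINT p:A|lborel. f n p * h p) \<longlonglongrightarrow> (LINT p:A|lborel. g p * h p)"
    by (simp add: set_integral_zext)
qed

lemma interval_integral_eq_prim:
  assumes t: "0 \<le> t" and h: "h \<in> BM" and eq: "\<And>s. s \<in> {0<..<t} \<Longrightarrow> f s = h s"
  shows "(LBINT s=0..t. f s) = prim h t"
proof -
  have "(LBINT s=0..t. f s) = (LBINT s=ereal 0..ereal t. f s)" by (simp add: zero_ereal_def)
  also have "\<dots> = (LBINT s:{0<..<t}. f s)"
    using t by (simp add: interval_lebesgue_integral_def einterval_def greaterThanLessThan_def greaterThan_def lessThan_def Collect_conj_eq)
  also have "\<dots> = (LBINT s. ind {0<..<t} s * h s)"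
    unfolding set_lebesgue_integral_def
    by (intro LINT_cong) (auto simp: indicator_def eq)
  also have "\<dots> = prim h t" unfolding prim_def
  proof (rule integral_cong_AE)
    show "AE s in lborel. ind {0<..<t} s * h s = ind {0..t} s * h s"
      using AE_lborel_singleton[of 0] AE_lborel_singleton[of t] by eventually_elim (auto simp: indicator_def)
  qed (use h in auto)
  finally show ?thesis .
qed

text \<open>Without a bound, \<open>\<bar>u\<^sub>n\<bar> > k\<close> on a set of measure \<open>a\<^sub>k > 0\<close> for some \<open>n\<close>, for each \<open>k\<close>; the integrals
  of a continuous \<open>\<beta>\<close> with \<open>\<beta>(y) \<ge> k / a\<^sub>k\<close> for \<open>\<bar>y\<bar> \<ge> k\<close> are then unbounded.\<close>

lemma uniform_bound_of_continuous_integrals: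
  fixes u :: "nat \<Rightarrow> 'a::euclidean_space \<Rightarrow> real"
  assumes Q: "Q \<in> sets borel" "emeasure lborel Q < \<infinity>" and um [measurable]: "\<And>n. u n \<in> BM"
    and int: "\<And>(\<beta> :: real \<Rightarrow> real) n. continuous_on UNIV \<beta> \<Longrightarrow> L1 (\<lambda>p. ind Q p * \<beta> (u n p))"
    and bd: "\<And>\<beta> :: real \<Rightarrow> real. continuous_on UNIV \<beta> \<Longrightarrow> \<exists>B. \<forall>n. (LBINT p. ind Q p * \<beta> (u n p)) \<le> B"
  obtains R where "R \<ge> 0" "\<And>n. AE p in lborel. p \<in> Q \<longrightarrow> \<bar>u n p\<bar> \<le> R"
proof (rule ccontr)
  assume notR: "\<not> thesis"
  have "\<exists>n. \<not> (AE p in lborel. p \<in> Q \<longrightarrow> \<bar>u n p\<bar> \<le> real k)" for k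
    using notR that[of "real k"] by auto
  then obtain m where m: "\<And>k. \<not> (AE p in lborel. p \<in> Q \<longrightarrow> \<bar>u (m k) p\<bar> \<le> real k)" by metis
  define A where "A k = {p \<in> Q. real k < \<bar>u (m k) p\<bar>}" for k
  have As [measurable]: "A k \<in> sets borel" for k
  proof -
    have "{p \<in> space borel. real k < \<bar>u (m k) p\<bar>} \<in> sets borel" by measurable
    moreover have "A k = Q \<inter> {p \<in> space borel. real k < \<bar>u (m k) p\<bar>}" by (auto simp: A_def)
    ultimately show ?thesis using Q(1) by auto
  qed
  have Af: "emeasure lborel (A k) < \<infinity>" for k
    using emeasure_mono[of "A k" Q lborel] Q by (auto simp: A_def intro: le_less_trans)
  define a where "a k = measure lborel (A k)" for k
  have a: "a k > 0" for k
  proof (rule ccontr)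
    assume "\<not> a k > 0"
    then have "a k = 0" using measure_nonneg[of lborel "A k"] by (simp add: a_def)
    then have "emeasure lborel (A k) = 0" using Af[of k] by (simp add: a_def emeasure_eq_ennreal_measure)
    then have "A k \<in> null_sets lborel" by (auto simp: null_sets_def)
    then have "AE p in lborel. p \<notin> A k" by (rule AE_not_in)
    then have "AE p in lborel. p \<in> Q \<longrightarrow> \<bar>u (m k) p\<bar> \<le> real k" by eventually_elim (auto simp: A_def)
    with m show False by blast
  qed
  define d where "d k = real k / a k" for k
  have d0: "d k \<ge> 0" for k using a[of k] by (simp add: d_def)
  \<comment> \<open>The summand with index \<open>j\<close> vanishes for
    \<open>\<bar>y\<bar> \<le> j - 1\<close> and is at least \<open>d j\<close> for
    \<open>\<bar>y\<bar> \<ge> j\<close>. The sum is thus locally finite with continuous terms, and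
    dominates each \<open>d k\<close> where required.\<close>
  define \<beta> where "\<beta> y = (\<Sum>j<nat \<lceil>\<bar>y\<bar>\<rceil> + 2. d j * max 0 (\<bar>y\<bar> + 1 - real j))" for y
  have \<beta>_eq: "\<beta> y = (\<Sum>j<N + 2. d j * max 0 (\<bar>y\<bar> + 1 - real j))" if "\<bar>y\<bar> \<le> real N" for y N
    unfolding \<beta>_def
  proof (rule sum.mono_neutral_left)
    have "nat \<lceil>\<bar>y\<bar>\<rceil> \<le> N" using that by (simp add: nat_le_iff ceiling_le_iff)
    then show "{..<nat \<lceil>\<bar>y\<bar>\<rceil> + 2} \<subseteq> {..<N + 2}" by auto
    show "\<forall>j\<in>{..<N + 2} - {..<nat \<lceil>\<bar>y\<bar>\<rceil> + 2}. d j * max 0 (\<bar>y\<bar> + 1 - real j) = 0"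
    proof
      fix j assume "j \<in> {..<N + 2} - {..<nat \<lceil>\<bar>y\<bar>\<rceil> + 2}"
      then have "nat \<lceil>\<bar>y\<bar>\<rceil> + 2 \<le> j" by simp
      then have "real (nat \<lceil>\<bar>y\<bar>\<rceil>) + 2 \<le> real j" by linarith
      moreover have "\<bar>y\<bar> \<le> real (nat \<lceil>\<bar>y\<bar>\<rceil>)" by (rule real_nat_ceiling_ge)
      ultimately have "max 0 (\<bar>y\<bar> + 1 - real j) = 0" by linarith
      then show "d j * max 0 (\<bar>y\<bar> + 1 - real j) = 0" by simp
    qed
  qed simp
  have \<beta>c: "continuous_on UNIV \<beta>"
  proof (rule continuous_at_imp_continuous_on, rule ballI)
    fix y0 :: real
    obtain N :: nat where N: "\<bar>y0\<bar> < real N" using reals_Archimedean2 by blast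
    let ?b = "\<lambda>y. \<Sum>j<N + 2. d j * max 0 (\<bar>y\<bar> + 1 - real j)"
    have "open {y::real. \<bar>y\<bar> < real N}" by (intro open_Collect_less continuous_intros)
    then have "eventually (\<lambda>y. y \<in> {y. \<bar>y\<bar> < real N}) (nhds y0)" using N by (intro eventually_nhds_in_open) auto
    then have "eventually (\<lambda>y. \<beta> y = ?b y) (nhds y0)" by eventually_elim (use \<beta>_eq in auto)
    moreover have "isCont ?b y0" by (intro continuous_intros)
    ultimately show "isCont \<beta> y0" using isCont_cong[of \<beta> ?b y0] by simp
  qed
  have \<beta>0: "0 \<le> \<beta> y" for y unfolding \<beta>_def by (intro sum_nonneg mult_nonneg_nonneg d0) simp
  have \<beta>k: "d k \<le> \<beta> y" if "real k \<le> \<bar>y\<bar>" for k y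
  proof -
    have "real k \<le> real (nat \<lceil>\<bar>y\<bar>\<rceil>)" using that real_nat_ceiling_ge[of "\<bar>y\<bar>"] by linarith
    then have "k \<in> {..<nat \<lceil>\<bar>y\<bar>\<rceil> + 2}" by simp
    then have "d k * max 0 (\<bar>y\<bar> + 1 - real k) \<le> \<beta> y"
      unfolding \<beta>_def by (intro member_le_sum) (use d0 in auto)
    moreover have "d k * 1 \<le> d k * max 0 (\<bar>y\<bar> + 1 - real k)" using that by (intro mult_left_mono d0) auto
    ultimately show ?thesis by simp
  qed
  obtain B where B: "\<And>n. (LBINT p. ind Q p * \<beta> (u n p)) \<le> B" using bd[OF \<beta>c] by blast
  have "real k \<le> B" for k
  proof -
    have "real k = (LBINT p. d k * ind (A k) p)"
      using a[of k] by (simp add: d_def a_def)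
    also have "\<dots> \<le> (LBINT p. ind Q p * \<beta> (u (m k) p))"
    proof (rule integral_mono[OF _ int[OF \<beta>c]])
      show "L1 (\<lambda>p. d k * ind (A k) p)"
        using Af[of k] by (intro integrable_mult_right integrable_real_indicator) auto
      show "d k * ind (A k) p \<le> ind Q p * \<beta> (u (m k) p)" for p
        using \<beta>k[of k "u (m k) p"] \<beta>0 by (auto simp: indicator_def A_def)
    qed
    also have "\<dots> \<le> B" by (rule B)
    finally show ?thesis .
  qed
  then show False using reals_Archimedean2[of B] by (meson not_less)
qed

section \<open>From the hypotheses on the solutions to the strip and its bounds\<close>

lemma kv_solution_strip:
  assumes T: "T > 0" and R: "R \<ge> 0" and \<sigma>: "\<And>\<xi>. (\<sigma> has_real_derivative \<sigma>' \<xi>) (at \<xi>)" and \<sigma>': "continuous_on UNIV \<sigma>'"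
    and sol: "kv_solution \<sigma> u0 v0 u v vx"
    and u0: "Linf_le {0<..<1} K u0" and v0: "Linf_le {0<..<1} K v0"
    and vL2: "v \<in> L2 (QT T)" and ub: "AE p in lborel. p \<in> QT T \<longrightarrow> \<bar>u p\<bar> \<le> R"
  shows "\<exists>g. kv_strip T R \<sigma> \<sigma>' (zext {0<..<1} u0) (zext {0<..<1} v0) (zext (QT T) u) (zext (QT T) v) (zext (QT T) vx)
    (zext (QT T) (stress \<sigma> u vx)) g"
proof -
  let ?Q = "QT T"
  have Qs: "?Q \<in> sets borel" by (rule QT_sets)
  from sol obtain Sx where um: "set_borel_measurable lborel ({0<..} \<times> {0<..<1}) u"
    and vx_d: "has_x_deriv {0<..} v vx" and vxL: "vx \<in> L2 ?Q" and SxL: "Sx \<in> L2 ?Q"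
    and ue: "AE x in lborel. x \<in> {0<..<1} \<longrightarrow> (\<forall>t\<ge>0. u (t, x) = u0 x + (LBINT s=0..t. vx (s, x)))"
    and Sx_d: "has_x_deriv {0<..} (stress \<sigma> u vx) Sx"
    and ve: "AE x in lborel. x \<in> {0<..<1} \<longrightarrow> (\<forall>t\<ge>0. v (t, x) = v0 x + (LBINT s=0..t. Sx (s, x)))"
    and van: "vanishes_at_ends {0<..} (stress \<sigma> u vx)"
    using T by (auto simp: kv_solution_def)
  have sub: "?Q \<subseteq> {0<..} \<times> {0<..<1}" by (auto simp: QT_def)
  have m: "zext ?Q u \<in> BM" "zext ?Q v \<in> BM" "zext ?Q vx \<in> BM"
    "zext ?Q Sx \<in> BM"
    "zext {0<..<1} u0 \<in> BM" "zext {0<..<1} v0 \<in> BM"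
    using zext_mono_set[OF sub Qs] um vL2 vxL SxL u0 v0
    by (auto simp: set_borel_measurable_zext L2_iff_zext Linf_le_def)
  have "zext ?Q (stress \<sigma> u vx) = (\<lambda>p. ind ?Q p * \<sigma> (zext ?Q u p) + zext ?Q vx p)"
    by (auto simp: fun_eq_iff zext_def indicator_def stress_def)
  moreover have \<sigma>c: "continuous_on UNIV \<sigma>" using \<sigma> by (auto intro!: continuous_at_imp_continuous_on DERIV_isCont)
  ultimately have ms: "zext ?Q (stress \<sigma> u vx) \<in> BM"
    using measurable_compose[OF m(1) borel_measurable_continuous_onI[OF \<sigma>c]] m(3) Qs by simp
  have xint: "(LBINT y=0..x. f (t, y)) = prim (\<lambda>y. zext ?Q f (t, y)) x"
    if "zext ?Q f \<in> BM" "t \<in> {0<..T}" "x \<in> {0<..<1}" for f t x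
    using that by (intro interval_integral_eq_prim measurable_section(1)[OF that(1)]) (auto simp: zext_def QT_def)
  have tint: "(LBINT r=0..t. f (r, x)) = prim (\<lambda>r. zext ?Q f (r, x)) t"
    if "zext ?Q f \<in> BM" "t \<in> {0<..T}" "x \<in> {0<..<1}" for f t x
    using that by (intro interval_integral_eq_prim measurable_section(2)[OF that(1)]) (auto simp: zext_def QT_def)
  have v0i: "L1 (zext {0<..<1} v0)"
  proof (rule integrable_bounded_01[OF m(6)])
    have "AE x in lborel. x \<in> {0<..<1} \<longrightarrow> \<bar>v0 x\<bar> \<le> K" using v0 by (auto simp: Linf_le_def)
    then show "AE x in lborel. \<bar>zext {0<..<1} v0 x\<bar> \<le> max K 0" by eventually_elim (auto simp: zext_def indicator_def)
  qed simp
  have s_x: "AE t in lborel. t \<in> {0<..T} \<longrightarrow>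
        (AE x in lborel. x \<in> {0<..<1} \<longrightarrow> zext ?Q (stress \<sigma> u vx) (t, x) = prim (\<lambda>y. zext ?Q Sx (t, y)) x)
          \<and> prim (\<lambda>y. zext ?Q Sx (t, y)) 1 = 0"
  proof -
    obtain G where G: "AE p in lborel. p \<in> {0<..} \<times> {0<..<1} \<longrightarrow> stress \<sigma> u vx p = G p"
      and Gc: "\<And>t. t > 0 \<Longrightarrow> continuous_on {0..1} (\<lambda>x. G (t, x)) \<and> G (t, 0) = 0 \<and> G (t, 1) = 0"
      using van by (auto simp: vanishes_at_ends_def)
    have "AE t in lborel. t \<in> {0<..} \<longrightarrow> has_ac_deriv (\<lambda>x. stress \<sigma> u vx (t, x)) (\<lambda>x. Sx (t, x))"
      using Sx_d by (simp add: has_x_deriv_def)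
    with AE_fst[OF G] show ?thesis
    proof eventually_elim
      case (elim t)
      show ?case
      proof
        assume t: "t \<in> {0<..T}"
        let ?p = "prim (\<lambda>y. zext ?Q Sx (t, y))"
        from elim(2) t obtain c where si: "set_integrable lborel {0<..<1} (\<lambda>x. Sx (t, x))"
          and c: "AE x in lborel. x \<in> {0<..<1} \<longrightarrow> stress \<sigma> u vx (t, x) = c + (LBINT y=0..x. Sx (t, y))"
          by (auto simp: has_ac_deriv_def)
        have "(\<lambda>y. zext ?Q Sx (t, y)) = zext {0<..<1} (\<lambda>x. Sx (t, x))"
          using t by (auto simp: fun_eq_iff zext_def indicator_def QT_def)
        then have i: "L1 (\<lambda>y. zext ?Q Sx (t, y))" using si by (simp add: set_integrable_zext)
        have cp: "AE x in lborel. x \<in> {0<..<1} \<longrightarrow> stress \<sigma> u vx (t, x) = c + ?p x"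
          using c by eventually_elim (use xint[OF m(4) t] in auto)
        \<comment> \<open>The trace \<open>G\<close> and the representative \<open>c + ?p\<close>
          are both continuous on \<open>[0, 1]\<close> and agree almost everywhere, hence
          everywhere; \<open>x = 0\<close> then gives \<open>c = 0\<close> and \<open>x = 1\<close>
          gives the mean-zero condition on \<open>Sx\<close>. Membership in \<open>[0, 1]\<close> is
          part of the condition so that it defines a closed set.\<close>
        have "AE x in lborel. x \<in> {0<..<1} \<longrightarrow> x \<in> {0..1} \<and> c + ?p x - G (t, x) = 0"
          using elim(1) cp by eventually_elim (use t in auto)
        moreover have "closed {x \<in> {0..1}. c + ?p x - G (t, x) = 0}"
          using Gc[of t] t by (intro continuous_closed_preimage_constant continuous_intros continuous_on_prim i) auto
        ultimately have e: "x \<in> {0..1} \<and> c + ?p x - G (t, x) = 0" if "x \<in> {0..1}" for x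
          using that by (intro AE_closed_interval[where P="\<lambda>x. x \<in> {0..1} \<and> c + ?p x - G (t, x) = 0" and a=0 and b=1]) auto
        have c0: "c = 0" and p1: "?p 1 = 0" using e[of 0] e[of 1] Gc[of t] t by auto
        have "AE x in lborel. x \<in> {0<..<1} \<longrightarrow> zext ?Q (stress \<sigma> u vx) (t, x) = ?p x"
          using cp by eventually_elim (use t c0 in \<open>auto simp: QT_iff\<close>)
        with p1 show "(AE x in lborel. x \<in> {0<..<1} \<longrightarrow> zext ?Q (stress \<sigma> u vx) (t, x) = ?p x) \<and> ?p 1 = 0" by blast
      qed
    qed
  qed
  show ?thesis
  proof (intro exI[of _ "zext ?Q Sx"], unfold_locales)
    show "AE x in lborel. x \<in> {0<..<1} \<longrightarrow> (\<forall>t\<in>{0<..T}. zext ?Q u (t, x) = zext {0<..<1} u0 x + prim (\<lambda>r. zext ?Q vx (r, x)) t)"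
      using ue by eventually_elim (use tint[OF m(3)] in \<open>auto simp: QT_iff\<close>)
    show "AE x in lborel. x \<in> {0<..<1} \<longrightarrow> (\<forall>t\<in>{0<..T}. zext ?Q v (t, x) = zext {0<..<1} v0 x + prim (\<lambda>r. zext ?Q Sx (r, x)) t)"
      using ve by eventually_elim (use tint[OF m(4)] in \<open>auto simp: QT_iff\<close>)
    have "AE t in lborel. t \<in> {0<..} \<longrightarrow> has_ac_deriv (\<lambda>x. v (t, x)) (\<lambda>x. vx (t, x))"
      using vx_d by (simp add: has_x_deriv_def)
    then show "AE t in lborel. t \<in> {0<..T} \<longrightarrow>
      (\<exists>c. AE x in lborel. x \<in> {0<..<1} \<longrightarrow> zext ?Q v (t, x) = c + prim (\<lambda>y. zext ?Q vx (t, y)) x)"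
    proof eventually_elim
      case (elim t)
      show ?case
      proof
        assume t: "t \<in> {0<..T}"
        from elim t obtain c where "AE x in lborel. x \<in> {0<..<1} \<longrightarrow> v (t, x) = c + (LBINT y=0..x. vx (t, y))"
          by (auto simp: has_ac_deriv_def)
        then have "AE x in lborel. x \<in> {0<..<1} \<longrightarrow> zext ?Q v (t, x) = c + prim (\<lambda>y. zext ?Q vx (t, y)) x"
          by eventually_elim (use t xint[OF m(3) t] in \<open>auto simp: QT_iff\<close>)
        then show "\<exists>c. AE x in lborel. x \<in> {0<..<1} \<longrightarrow> zext ?Q v (t, x) = c + prim (\<lambda>y. zext ?Q vx (t, y)) x" by blast
      qed
    qed
    show "AE p in lborel. \<bar>zext ?Q u p\<bar> \<le> R"
      using ub by eventually_elim (use R in \<open>auto simp: zext_def indicator_def\<close>)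
  qed (use T R \<sigma> \<sigma>' m ms v0i s_x vL2 vxL SxL in \<open>auto simp: L2_iff_zext stress_def\<close>)
qed

text \<open>The energy at time \<open>T\<close> is at least \<open>- C\<close>, and the initial
  energy is at most \<open>K\<^sup>2 + D\<close> by the essential bounds on the data; the
  dissipation is bounded by the difference.\<close>

lemma energy_dissipation_bound:
  assumes W: "\<And>\<xi>. - C \<le> Wpot \<sigma> \<xi>" "\<And>\<xi>. \<bar>\<xi>\<bar> \<le> K \<Longrightarrow> Wpot \<sigma> \<xi> \<le> D" and D: "0 \<le> D" and T: "T > 0"
    and en: "energy_bound \<sigma> u0 v0 u v vx"
    and u0: "Linf_le {0<..<1} K u0" and v0: "Linf_le {0<..<1} K v0"
  shows "(LBINT p. (zext (QT T) vx p)\<^sup>2) \<le> K\<^sup>2 + D + C"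
proof -
  let ?e = "\<lambda>x. (v (T, x))\<^sup>2 / 2 + Wpot \<sigma> (u (T, x))" and ?i = "\<lambda>x. (v0 x)\<^sup>2 / 2 + Wpot \<sigma> (u0 x)"
  have ind: "L1 (\<lambda>x. c * ind {0<..<1::real} x :: real)" "(LBINT x. c * ind {0<..<1::real} x) = c" for c :: real
    by (auto intro!: integrable_mult_right integrable_real_indicator)
  have ei: "L1 (zext {0<..<1} ?e)"
    and le: "(LBINT x. zext {0<..<1} ?e x) + (LINT p:QT T|lborel. (vx p)\<^sup>2) \<le> (LBINT x. zext {0<..<1} ?i x)"
    using en T by (auto simp: energy_bound_def set_integrable_zext energy_def set_integral_zext)
  have "- C = (LBINT x. (- C) * ind {0<..<1::real} x)" using ind(2)[of "- C"] by simp
  also have "\<dots> \<le> (LBINT x. zext {0<..<1} ?e x)"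
  proof (rule integral_mono[OF ind(1) ei])
    show "(- C) * ind {0<..<1} x \<le> zext {0<..<1} ?e x" for x
      using add_mono[OF _ W(1)[of "u (T, x)"], of 0 "(v (T, x))\<^sup>2 / 2"] by (auto simp: zext_def indicator_def)
  qed
  finally have lo: "- C \<le> (LBINT x. zext {0<..<1} ?e x)" .
  have hi: "(LBINT x. zext {0<..<1} ?i x) \<le> K\<^sup>2 + D"
  proof (cases "L1 (zext {0<..<1} ?i)")
    case True
    have "AE x in lborel. x \<in> {0<..<1} \<longrightarrow> \<bar>u0 x\<bar> \<le> K" "AE x in lborel. x \<in> {0<..<1} \<longrightarrow> \<bar>v0 x\<bar> \<le> K"
      using u0 v0 by (auto simp: Linf_le_def)
    then have "AE x in lborel. zext {0<..<1} ?i x \<le> (K\<^sup>2 + D) * ind {0<..<1} x"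
    proof eventually_elim
      case (elim x)
      show ?case
      proof (cases "x \<in> {0<..<1}")
        case True
        then have "(v0 x)\<^sup>2 \<le> K\<^sup>2" "Wpot \<sigma> (u0 x) \<le> D"
          using elim W(2) by (auto intro: abs_le_square_iff[THEN iffD1, OF order_trans[OF _ abs_ge_self]])
        moreover have "0 \<le> (v0 x)\<^sup>2" by simp
        ultimately have "(v0 x)\<^sup>2 / 2 + Wpot \<sigma> (u0 x) \<le> K\<^sup>2 + D" by linarith
        then show ?thesis using True by simp
      qed simp
    qed
    then have "(LBINT x. zext {0<..<1} ?i x) \<le> (LBINT x. (K\<^sup>2 + D) * ind {0<..<1::real} x)"
      by (intro integral_mono_AE True ind(1))
    then show ?thesis using ind(2)[of "K\<^sup>2 + D"] by linarith
  next
    case False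
    \<comment> \<open>An initial energy density that is not integrable has integral 0 by convention,
      which also obeys the bound since \<open>D\<close> is nonnegative.\<close>
    then show ?thesis using D by (simp add: not_integrable_integral_eq)
  qed
  have "(LINT p:QT T|lborel. (vx p)\<^sup>2) = (LBINT p. (zext (QT T) vx p)\<^sup>2)"
    unfolding set_integral_zext by (intro LINT_cong) (simp add: zext_def indicator_def)
  then show ?thesis using lo hi le by linarith
qed

text \<open>The Bochner integral is written through nonnegative integrals of the positive and
  negative parts, with the default value 0 where the absolute value has infinite integral; each of
  these is measurable in \<open>x\<close>.\<close>

lemma measurable_integral_kernel:
  fixes f :: "'a \<Rightarrow> 'b \<Rightarrow> real"
  assumes f: "(\<lambda>(x, y). f x y) \<in> borel_measurable (M \<Otimes>\<^sub>M N)" and L: "L \<in> measurable M (subprob_algebra N)"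
  shows "(\<lambda>x. \<integral>y. f x y \<partial>L x) \<in> borel_measurable M"
proof -
  note nn = nn_integral_measurable_subprob_algebra2[OF _ L]
  have m: "(\<lambda>x. \<integral>\<^sup>+y. ennreal (f x y) \<partial>L x) \<in> borel_measurable M" "(\<lambda>x. \<integral>\<^sup>+y. ennreal (- f x y) \<partial>L x) \<in> borel_measurable M"
    "(\<lambda>x. \<integral>\<^sup>+y. ennreal \<bar>f x y\<bar> \<partial>L x) \<in> borel_measurable M"
    by (rule nn; use f in \<open>simp add: split_beta'\<close>)+
  have "(\<integral>y. f x y \<partial>L x) = (if (\<integral>\<^sup>+y. ennreal \<bar>f x y\<bar> \<partial>L x) < \<infinity>
      then enn2real (\<integral>\<^sup>+y. ennreal (f x y) \<partial>L x) - enn2real (\<integral>\<^sup>+y. ennreal (- f x y) \<partial>L x) else 0)" if x: "x \<in> space M" for x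
  proof -
    have "f x \<in> borel_measurable N" using measurable_compose[OF measurable_Pair1'[OF x] f] by simp
    then have "f x \<in> borel_measurable (L x)"
      using sets_kernel[OF L x] measurable_cong_sets by blast
    then show ?thesis
      by (auto simp: integrable_iff_bounded real_lebesgue_integral_def not_integrable_integral_eq)
  qed
  then show ?thesis using m by (subst measurable_cong) auto
qed

text \<open>The source of the heat equation agrees with a combination of weak-star limits only
  almost everywhere. That alone does not make it Borel, so its measurability is proved from the
  kernel itself.\<close>

lemma measurable_young_average:
  assumes \<nu>: "\<nu> \<in> measurable (restrict_space borel (QT T)) (prob_algebra (borel :: real measure))"
    and f: "continuous_on UNIV f" "continuous_on UNIV g" and S: "zext (QT T) S \<in> BM"
  shows "zext (QT T) (\<lambda>q. \<integral>\<xi>. f \<xi> * (S q - g \<xi>) \<partial>\<nu> q) \<in> BM"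
proof -
  obtain \<nu>' where \<nu>': "\<nu>' \<in> measurable borel (prob_algebra borel)" "\<And>p. p \<in> QT T \<Longrightarrow> \<nu>' p = \<nu> p"
    using kernel_extension[OF \<nu>] by metis
  have [measurable]: "f \<in> BM" "g \<in> BM"
    using f by (auto intro: borel_measurable_continuous_onI)
  have m: "(\<lambda>(q, \<xi>). f \<xi> * (zext (QT T) S q - g \<xi>)) \<in> borel_measurable ((borel :: (real \<times> real) measure) \<Otimes>\<^sub>M (borel :: real measure))"
    using S by measurable
  have "(\<lambda>q. \<integral>\<xi>. f \<xi> * (zext (QT T) S q - g \<xi>) \<partial>\<nu>' q) \<in> BM"
    by (rule measurable_integral_kernel[OF m measurable_prob_algebraD[OF \<nu>'(1)]])
  then have "(\<lambda>q. ind (QT T) q * (\<integral>\<xi>. f \<xi> * (zext (QT T) S q - g \<xi>) \<partial>\<nu>' q)) \<in> BM"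
    using QT_sets by simp
  moreover have "zext (QT T) (\<lambda>q. \<integral>\<xi>. f \<xi> * (S q - g \<xi>) \<partial>\<nu> q) = (\<lambda>q. ind (QT T) q * (\<integral>\<xi>. f \<xi> * (zext (QT T) S q - g \<xi>) \<partial>\<nu>' q))"
    by (auto simp: fun_eq_iff zext_def[of _ "\<lambda>q. LINT \<xi>|_. _ \<xi> q"] zext_def indicator_def \<nu>'(2))
  ultimately show ?thesis by simp
qed

theorem theorem7p3:
  fixes T p c C K :: real
    and \<sigma> \<sigma>' :: "real \<Rightarrow> real"
    and u0 v0 v0x :: "real \<Rightarrow> real \<Rightarrow> real"
    and u\<epsilon> v\<epsilon> vx\<epsilon> :: "real \<Rightarrow> real \<times> real \<Rightarrow> real"
    and eps :: "nat \<Rightarrow> real"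
    and u v S :: "real \<times> real \<Rightarrow> real"
    and F :: "real \<times> real \<times> real \<Rightarrow> real"
    and \<nu> :: "real \<times> real \<Rightarrow> real measure"
  assumes T_pos: "T > 0"
    and sigma_deriv: "\<And>\<xi>. (\<sigma> has_real_derivative \<sigma>' \<xi>) (at \<xi>)"
    and sigma'_cont: "continuous_on UNIV \<sigma>'"
    and sigma_nonmono: "\<not> mono \<sigma>" "\<not> antimono \<sigma>"
    and sigma_lim: "filterlim \<sigma> at_top at_top" "filterlim \<sigma> at_bot at_bot"
    and const_ranges: "p > 1" "c > 0" "C > 0"
    and W_growth: "\<And>\<xi>. c * \<bar>\<xi>\<bar> powr p - C \<le> Wpot \<sigma> \<xi>"
                  "\<And>\<xi>. Wpot \<sigma> \<xi> \<le> C * (\<bar>\<xi>\<bar> powr p + 1)"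
    and sigma_growth: "\<And>\<xi>. \<bar>\<sigma> \<xi>\<bar> \<le> C * (1 + \<bar>\<xi>\<bar> powr (p - 1))"
    and solution: "\<And>\<epsilon>. \<epsilon> > 0 \<Longrightarrow> kv_solution \<sigma> (u0 \<epsilon>) (v0 \<epsilon>) (u\<epsilon> \<epsilon>) (v\<epsilon> \<epsilon>) (vx\<epsilon> \<epsilon>)"
    and energy_est: "\<And>\<epsilon>. \<epsilon> > 0 \<Longrightarrow> energy_bound \<sigma> (u0 \<epsilon>) (v0 \<epsilon>) (u\<epsilon> \<epsilon>) (v\<epsilon> \<epsilon>) (vx\<epsilon> \<epsilon>)"
    and u0_bound: "\<And>\<epsilon>. \<epsilon> > 0 \<Longrightarrow> Linf_le {0<..<1} K (u0 \<epsilon>)"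
    and v0_bound: "\<And>\<epsilon>. \<epsilon> > 0 \<Longrightarrow> Linf_le {0<..<1} K (v0 \<epsilon>) \<and> Linf_le {0<..<1} K (v0x \<epsilon>)
                     \<and> has_ac_deriv (v0 \<epsilon>) (v0x \<epsilon>)"
    and B_top: "\<And>\<epsilon>. \<epsilon> > 0 \<Longrightarrow>
      filterlim (\<lambda>\<xi>. \<sigma> \<xi> - Bmax \<sigma>' \<xi> (sqrt (energy \<sigma> (u0 \<epsilon>) (v0 \<epsilon>)))) at_top at_top"
    and B_bot: "\<And>\<epsilon>. \<epsilon> > 0 \<Longrightarrow>
      filterlim (\<lambda>\<xi>. \<sigma> \<xi> + Bmax \<sigma>' \<xi> (sqrt (energy \<sigma> (u0 \<epsilon>) (v0 \<epsilon>)))) at_bot at_bot"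
    and eps: "\<And>n. eps n > 0" "eps \<longlonglongrightarrow> 0"
    and u_lim: "Linf_weakstar_lim (QT T) (\<lambda>n. u\<epsilon> (eps n)) u"
    and v_lim: "L2_lim (QT T) (\<lambda>n. v\<epsilon> (eps n)) v"
    and S_meas: "set_borel_measurable lborel (QT T) S"
    and S_lim: "AE q in lborel. q \<in> QT T \<longrightarrow>
                  (\<lambda>n. stress \<sigma> (u\<epsilon> (eps n)) (vx\<epsilon> (eps n)) q) \<longlonglongrightarrow> S q"
    and F_lim: "Linf_weakstar_lim ({0<..T} \<times> {0<..<1} \<times> UNIV)
                  (\<lambda>n (t, x, \<xi>). if u\<epsilon> (eps n) (t, x) < \<xi> then 1 else 0) F"
    and young: "young_measure (QT T) (\<lambda>n. u\<epsilon> (eps n)) \<nu>"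
  shows
    "(AE (t, x, \<xi>) in lborel. (t, x) \<in> QT T \<longrightarrow> F (t, x, \<xi>) = measure (\<nu> (t, x)) {..\<xi>})
     \<and>
     (\<exists>\<sigma>bar vx vini Fini.
        Linf_weakstar_lim (QT T) (\<lambda>n q. \<sigma> (u\<epsilon> (eps n) q)) \<sigma>bar \<and>
        vx \<in> L2 (QT T) \<and> has_x_deriv {0<..T} v vx \<and>
        L2_lim {0<..<1} (\<lambda>n. v0 (eps n)) vini \<and>
        Linf_weakstar_lim ({0<..<1} \<times> UNIV)
          (\<lambda>n (x, \<xi>). if u0 (eps n) x < \<xi> then 1 else 0) Fini \<and>
        kinetic_eq T \<sigma> \<sigma>' (\<lambda>q. vx q + \<sigma>bar q) F Fini \<and>
        heat_eq T v \<sigma>bar (\<lambda>q. 0) vini \<and>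
        (AE q in lborel. q \<in> QT T \<longrightarrow>
           S q = \<sigma>bar q + vx q \<and> S q = (\<integral>\<xi>. \<sigma> \<xi> \<partial>\<nu> q) + vx q) \<and>
        vanishes_at_ends {0<..<T} S)
     \<and>
     (\<exists>Sini Fini.
        L2_weak_lim {0<..<1} (\<lambda>n x. \<sigma> (u0 (eps n) x) + v0x (eps n) x) Sini \<and>
        Linf_weakstar_lim ({0<..<1} \<times> UNIV)
          (\<lambda>n (x, \<xi>). if u0 (eps n) x < \<xi> then 1 else 0) Fini \<and>
        kinetic_eq T \<sigma> \<sigma>' S F Fini \<and>
        heat_eq T S (\<lambda>q. 0) (\<lambda>q. \<integral>\<xi>. \<sigma>' \<xi> * (S q - \<sigma> \<xi>) \<partial>\<nu> q) Sini \<and>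
        vanishes_at_ends {0<..<T} S)"
proof -
  let ?Q = "QT T" and ?J = "{0<..<1::real}"
  have Qs: "?Q \<in> sets borel" by (rule QT_sets)
  have Qi: "L1 (ind ?Q :: real \<times> real \<Rightarrow> real)"
    using QT_finite Qs by (intro integrable_real_indicator) auto
  have \<sigma>c: "continuous_on UNIV \<sigma>"
    using sigma_deriv by (auto intro!: continuous_at_imp_continuous_on DERIV_isCont)
  have \<nu>m: "\<nu> \<in> measurable (restrict_space borel ?Q) (prob_algebra borel)"
    and y: "\<forall>\<beta>. continuous_on UNIV \<beta> \<longrightarrow> (AE p in lborel. p \<in> ?Q \<longrightarrow> integrable (\<nu> p) \<beta>) \<and>
      Linf_weakstar_lim ?Q (\<lambda>n p. \<beta> (u\<epsilon> (eps n) p)) (\<lambda>p. \<integral>y. \<beta> y \<partial>\<nu> p)"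
    using young unfolding young_measure_def by (rule conjunct1, rule conjunct2)
  have \<nu>i: "AE p in lborel. p \<in> ?Q \<longrightarrow> integrable (\<nu> p) \<beta>"
    and \<nu>w: "Linf_weakstar_lim ?Q (\<lambda>n p. \<beta> (u\<epsilon> (eps n) p)) (\<lambda>p. \<integral>y. \<beta> y \<partial>\<nu> p)"
    if "continuous_on UNIV \<beta>" for \<beta>
    using y[rule_format, OF that] by (rule conjunct1, rule conjunct2)
  define U where "U n = zext ?Q (u\<epsilon> (eps n))" for n
  have Um: "U n \<in> BM" for n
    using u_lim by (auto simp: U_def Linf_weakstar_lim_def Linf_iff_zext)
  have \<beta>U: "zext ?Q (\<lambda>p. \<beta> (u\<epsilon> (eps n) p)) = (\<lambda>p. ind ?Q p * \<beta> (U n p))" for \<beta> n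
    by (auto simp: fun_eq_iff zext_def U_def indicator_def)
  obtain R where R: "R \<ge> 0" "\<And>n. AE p in lborel. p \<in> ?Q \<longrightarrow> \<bar>U n p\<bar> \<le> R"
  proof (rule uniform_bound_of_continuous_integrals[OF Qs QT_finite Um])
    fix \<beta> :: "real \<Rightarrow> real" assume \<beta>: "continuous_on UNIV \<beta>"
    show "L1 (\<lambda>p. ind ?Q p * \<beta> (U n p))" for n
    proof -
      have "(\<lambda>p. \<beta> (u\<epsilon> (eps n) p)) \<in> Linf ?Q" using \<nu>w[OF \<beta>] by (auto simp: Linf_weakstar_lim_def)
      then obtain B where "zext ?Q (\<lambda>p. \<beta> (u\<epsilon> (eps n) p)) \<in> BM" "AE p in lborel. \<bar>zext ?Q (\<lambda>p. \<beta> (u\<epsilon> (eps n) p)) p\<bar> \<le> B"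
        by (auto simp: Linf_iff_zext)
      from integrable_mult_bounded[OF Qi this]
      have "L1 (\<lambda>p. ind ?Q p * (ind ?Q p * \<beta> (U n p)))" by (simp only: \<beta>U)
      moreover have "(\<lambda>p. ind ?Q p * (ind ?Q p * \<beta> (U n p))) = (\<lambda>p. ind ?Q p * \<beta> (U n p))"
        by (auto simp: fun_eq_iff indicator_def)
      ultimately show ?thesis by simp
    qed
    \<comment> \<open>\<open>QT T\<close> has finite measure, so its own indicator is an admissible
      test function; the resulting convergent sequence of integrals is bounded.\<close>
    have "convergent (\<lambda>n. LBINT p. ind ?Q p * \<beta> (U n p) * ind ?Q p)"
      using Linf_weakstar_limD[OF \<nu>w[OF \<beta>] Qi Qs] unfolding \<beta>U convergent_def by blast
    then have "Bseq (\<lambda>n. LBINT p. ind ?Q p * \<beta> (U n p) * ind ?Q p)" by (rule convergent_imp_Bseq)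
    moreover have "ind ?Q p * \<beta> (U n p) * ind ?Q p = ind ?Q p * \<beta> (U n p)" for n p
      by (simp add: indicator_def)
    ultimately have "Bseq (\<lambda>n. LBINT p. ind ?Q p * \<beta> (U n p))" by simp
    then obtain B where "\<And>n. norm (LBINT p. ind ?Q p * \<beta> (U n p)) \<le> B" by (auto simp: Bseq_def)
    then show "\<exists>B. \<forall>n. (LBINT p. ind ?Q p * \<beta> (U n p)) \<le> B"
      by (intro exI[of _ B] allI) (metis abs_ge_self order_trans real_norm_def)
  qed (use that in blast)
  \<comment> \<open>Bounds the potential on \<open>[-K, K]\<close>, the range of the initial
    strains, by the upper growth condition.\<close>
  define D where "D = C * (\<bar>K\<bar> powr p + 1)"
  have D0: "0 \<le> D" using const_ranges by (simp add: D_def)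
  have W1: "- C \<le> Wpot \<sigma> \<xi>" for \<xi>
  proof -
    have "0 \<le> c * \<bar>\<xi>\<bar> powr p" using const_ranges by simp
    with W_growth(1)[of \<xi>] show ?thesis by linarith
  qed
  have W2: "Wpot \<sigma> \<xi> \<le> D" if "\<bar>\<xi>\<bar> \<le> K" for \<xi>
  proof -
    have "\<bar>\<xi>\<bar> powr p \<le> \<bar>K\<bar> powr p" using that const_ranges by (intro powr_mono2) auto
    then have "C * (\<bar>\<xi>\<bar> powr p + 1) \<le> D" unfolding D_def using const_ranges by (intro mult_left_mono) auto
    with W_growth(2)[of \<xi>] show ?thesis by linarith
  qed
  note dissip = energy_dissipation_bound[OF W1 W2 D0 T_pos energy_est[OF eps(1)] u0_bound[OF eps(1)] v0_bound[OF eps(1), THEN conjunct1]]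
  have "\<exists>g. kv_strip T R \<sigma> \<sigma>' (zext ?J (u0 (eps n))) (zext ?J (v0 (eps n))) (U n) (zext ?Q (v\<epsilon> (eps n))) (zext ?Q (vx\<epsilon> (eps n)))
    (zext ?Q (stress \<sigma> (u\<epsilon> (eps n)) (vx\<epsilon> (eps n)))) g" for n
    unfolding U_def
  proof (rule kv_solution_strip[OF T_pos R(1) sigma_deriv sigma'_cont solution[OF eps(1)] u0_bound[OF eps(1)] v0_bound[OF eps(1), THEN conjunct1]])
    show "v\<epsilon> (eps n) \<in> L2 ?Q" using v_lim by (auto simp: L2_lim_def)
    show "AE p in lborel. p \<in> ?Q \<longrightarrow> \<bar>u\<epsilon> (eps n) p\<bar> \<le> R" using R(2)[of n] by eventually_elim (simp add: U_def)
  qed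
  then obtain g where g: "\<And>n. kv_strip T R \<sigma> \<sigma>' (zext ?J (u0 (eps n))) (zext ?J (v0 (eps n))) (U n) (zext ?Q (v\<epsilon> (eps n))) (zext ?Q (vx\<epsilon> (eps n)))
    (zext ?Q (stress \<sigma> (u\<epsilon> (eps n)) (vx\<epsilon> (eps n)))) (g n)" by metis
  let ?Q3 = "{0<..T} \<times> {0<..<1::real} \<times> (UNIV :: real set)"
  have Q3: "?Q3 \<in> sets borel"
  proof -
    have "?Q3 \<in> sets (borel \<Otimes>\<^sub>M (borel \<Otimes>\<^sub>M borel))" by (intro pair_measureI) auto
    then show ?thesis by (simp only: borel_prod)
  qed
  have Q3_iff: "(t, x, \<xi>) \<in> ?Q3 \<longleftrightarrow> (t, x) \<in> ?Q" for t x \<xi> by (simp add: QT_def)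
  define Y where "Y \<beta> = zext ?Q (\<lambda>p. \<integral>y. \<beta> y \<partial>\<nu> p)" for \<beta> :: "real \<Rightarrow> real"
  interpret kl: kv_limit T R "K\<^sup>2 + D + C" K \<sigma> \<sigma>' "\<lambda>n. zext ?J (u0 (eps n))" "\<lambda>n. zext ?J (v0 (eps n))" "\<lambda>n. zext ?J (v0x (eps n))"
    U "\<lambda>n. zext ?Q (v\<epsilon> (eps n))" "\<lambda>n. zext ?Q (vx\<epsilon> (eps n))" "\<lambda>n. zext ?Q (stress \<sigma> (u\<epsilon> (eps n)) (vx\<epsilon> (eps n)))" g
    "zext ?Q v" "zext ?Q S" "zext ?Q3 F" Y
  proof (rule kv_limit.intro)
    show "kv_strip T R \<sigma> \<sigma>' (zext ?J (u0 (eps n))) (zext ?J (v0 (eps n))) (U n) (zext ?Q (v\<epsilon> (eps n))) (zext ?Q (vx\<epsilon> (eps n)))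
      (zext ?Q (stress \<sigma> (u\<epsilon> (eps n)) (vx\<epsilon> (eps n)))) (g n)" for n by (rule g)
    show "(LBINT p. (zext ?Q (vx\<epsilon> (eps n)) p)\<^sup>2) \<le> K\<^sup>2 + D + C" for n by (rule dissip)
    show "zext ?Q v \<in> BM" "L1 (\<lambda>p. (zext ?Q v p)\<^sup>2)"
      using v_lim by (auto simp: L2_lim_def L2_iff_zext)
    have "zext ?Q (\<lambda>p. (v\<epsilon> (eps n) p - v p)\<^sup>2) = (\<lambda>p. (zext ?Q (v\<epsilon> (eps n)) p - zext ?Q v p)\<^sup>2)" for n
      by (auto simp: zext_def fun_eq_iff indicator_def)
    then show "(\<lambda>n. LBINT p. (zext ?Q (v\<epsilon> (eps n)) p - zext ?Q v p)\<^sup>2) \<longlonglongrightarrow> 0"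
      using v_lim by (simp add: L2_lim_def set_integral_zext)
    show "zext ?Q S \<in> BM" using S_meas by (simp add: set_borel_measurable_zext)
    show "AE p in lborel. (\<lambda>n. zext ?Q (stress \<sigma> (u\<epsilon> (eps n)) (vx\<epsilon> (eps n))) p) \<longlonglongrightarrow> zext ?Q S p"
      using S_lim by eventually_elim (auto simp: zext_def indicator_def)
    have K0: "0 \<le> K"
    proof (rule ccontr)
      assume "\<not> 0 \<le> K"
      then have "AE x in lborel. x \<in> ?J \<longrightarrow> False"
        using v0_bound[OF eps(1)[of 0]] by (auto simp: Linf_le_def elim!: eventually_mono)
      \<comment> \<open>A condition that holds nowhere on the interval is weakened to the closed
        condition \<open>x = 2\<close>, which \<open>AE_closed_interval\<close> then asserts at
        \<open>1/2\<close>.\<close>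
      then have "AE x in lborel. x \<in> {0<..<1::real} \<longrightarrow> x = (2::real)" by eventually_elim simp
      from AE_closed_interval[OF _ this, of "1/2"] show False by simp
    qed
    show "zext ?J (v0x (eps n)) \<in> BM" for n
      using v0_bound[OF eps(1)[of n]] by (simp add: Linf_le_def set_borel_measurable_zext)
    show "AE x in lborel. \<bar>zext ?J (v0x (eps n)) x\<bar> \<le> K" "AE x in lborel. \<bar>zext ?J (v0 (eps n)) x\<bar> \<le> K" for n
      using v0_bound[OF eps(1)[of n]] K0 by (auto simp: Linf_le_def zext_def indicator_def elim!: eventually_mono)
    show "\<exists>c. AE x in lborel. x \<in> {0<..<1} \<longrightarrow> zext ?J (v0 (eps n)) x = c + prim (zext ?J (v0x (eps n))) x" for n
    proof -
      have m: "zext ?J (v0x (eps n)) \<in> BM"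
        using v0_bound[OF eps(1)[of n]] by (simp add: Linf_le_def set_borel_measurable_zext)
      obtain c where "AE x in lborel. x \<in> {0<..<1} \<longrightarrow> v0 (eps n) x = c + (LBINT y=0..x. v0x (eps n) y)"
        using v0_bound[OF eps(1)[of n]] by (auto simp: has_ac_deriv_def)
      moreover have "(LBINT y=0..x. v0x (eps n) y) = prim (zext ?J (v0x (eps n))) x" if "x \<in> ?J" for x
        using that by (intro interval_integral_eq_prim m) auto
      ultimately have "AE x in lborel. x \<in> {0<..<1} \<longrightarrow> zext ?J (v0 (eps n)) x = c + prim (zext ?J (v0x (eps n))) x"
        by (auto elim!: eventually_mono)
      then show ?thesis by blast
    qed
    show "zext ?Q3 F \<in> BM" "\<exists>KF. AE q in lborel. \<bar>zext ?Q3 F q\<bar> \<le> KF"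
      using F_lim by (auto simp: Linf_weakstar_lim_def Linf_iff_zext)
    fix h :: "real \<times> real \<times> real \<Rightarrow> real" assume h: "L1 h"
    have "zext ?Q3 (\<lambda>(t, x, \<xi>). if u\<epsilon> (eps n) (t, x) < \<xi> then 1 else 0) q =
      ind ?Q (fst q, fst (snd q)) * ind {U n (fst q, fst (snd q))<..} (snd (snd q))" for n q
      by (cases q) (auto simp: zext_def U_def indicator_def QT_iff)
    then show "(\<lambda>n. LBINT q. ind ?Q (fst q, fst (snd q)) * ind {U n (fst q, fst (snd q))<..} (snd (snd q)) * h q)
         \<longlonglongrightarrow> (LBINT q. zext ?Q3 F q * h q)"
      using Linf_weakstar_limD[OF F_lim h Q3] by simp
  next
    fix \<beta> :: "real \<Rightarrow> real" assume \<beta>: "continuous_on UNIV \<beta>"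
    show "Y \<beta> \<in> BM" "\<exists>KY. AE p in lborel. \<bar>Y \<beta> p\<bar> \<le> KY"
      using \<nu>w[OF \<beta>] by (auto simp: Y_def Linf_weakstar_lim_def Linf_iff_zext)
    fix h :: "real \<times> real \<Rightarrow> real" assume h: "L1 h"
    show "(\<lambda>n. LBINT p. ind ?Q p * \<beta> (U n p) * h p) \<longlonglongrightarrow> (LBINT p. Y \<beta> p * h p)"
      using Linf_weakstar_limD[OF \<nu>w[OF \<beta>] h Qs] by (simp only: \<beta>U Y_def)
  qed (auto simp: Y_def)
  define \<sigma>bar where "\<sigma>bar q = (\<integral>\<xi>. \<sigma> \<xi> \<partial>\<nu> q)" for q
  \<comment> \<open>With this witness the stress relation holds by definition at every point; the
    content lies in \<open>v_x\<close> below, which identifies it as the weak derivative of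
    \<open>v\<close>.\<close>
  define vx where "vx q = S q - \<sigma>bar q" for q
  have Y\<sigma>: "Y \<sigma> = zext ?Q \<sigma>bar" by (simp add: Y_def \<sigma>bar_def[abs_def])
  have klvx: "kl.vx = zext ?Q vx"
    by (auto simp: fun_eq_iff kl.vx_def Y\<sigma> vx_def zext_def indicator_def)
  obtain Fini where Fini: "Fini \<in> BM" "\<And>q. \<bar>Fini q\<bar> \<le> 1"
    "\<And>h. L1 h \<Longrightarrow> (\<lambda>n. LBINT q. kl.F0 n q * h q) \<longlonglongrightarrow> (LBINT q. Fini q * h q)"
    by (rule kl.F0_limit) (rule that; assumption)
  obtain Sini B where Sini: "Sini \<in> BM" "\<And>x. \<bar>Sini x\<bar> \<le> B" "\<And>n. AE x in lborel. \<bar>kl.S0 n x\<bar> \<le> B"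
    "\<And>h. L1 h \<Longrightarrow> (\<lambda>n. LBINT x. kl.S0 n x * h x) \<longlonglongrightarrow> (LBINT x. Sini x * h x)"
    by (rule kl.S0_limit) (rule that; assumption)
  have cdf: "AE (t, x, \<xi>) in lborel. (t, x) \<in> ?Q \<longrightarrow> F (t, x, \<xi>) = measure (\<nu> (t, x)) {..\<xi>}"
  proof -
    have "AE q in lborel. (fst q, fst (snd q)) \<in> ?Q \<longrightarrow> zext ?Q3 F q = measure (\<nu> (fst q, fst (snd q))) {..snd (snd q)}"
      by (rule kl.F_cdf[OF \<nu>m]) (simp add: Y_def)
    then show ?thesis by eventually_elim (auto simp: QT_iff zext_def)
  qed
  have FiniL: "Linf_weakstar_lim ({0<..<1} \<times> UNIV) (\<lambda>n (x, \<xi>). if u0 (eps n) x < \<xi> then 1 else 0) Fini"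
  proof (rule Linf_weakstar_limI[OF _ _ _ _ Fini(3)])
    have J2: "{0<..<1::real} \<times> (UNIV :: real set) \<in> sets borel"
    proof -
      have "{0<..<1::real} \<times> (UNIV :: real set) \<in> sets (borel \<Otimes>\<^sub>M borel)" by (intro pair_measureI) auto
      then show ?thesis by (simp only: borel_prod)
    qed
    show "(\<lambda>(x, \<xi>). if u0 (eps n) x < \<xi> then 1 else 0) \<in> Linf ({0<..<1} \<times> UNIV)" for n
    proof -
      have "zext ({0<..<1} \<times> UNIV) (\<lambda>(x, \<xi>). if u0 (eps n) x < \<xi> then 1 else 0) = kl.F0 n"
        by (auto simp: fun_eq_iff zext_def kl.F0_def indicator_def)
      then show ?thesis unfolding Linf_iff_zext
        using kl.F0_meas[of n] kl.F0_bound[of n] by (simp only:) (intro conjI exI[of _ 1] AE_I2; blast)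
    qed
    show "Fini \<in> Linf ({0<..<1} \<times> UNIV)" unfolding Linf_iff_zext
    proof (intro conjI exI[of _ 1] AE_I2)
      show "zext ({0<..<1} \<times> UNIV) Fini \<in> BM" using Fini(1) J2 by (simp add: zext_def[abs_def])
      show "\<bar>zext ({0<..<1} \<times> UNIV) Fini q\<bar> \<le> 1" for q using Fini(2)[of q] by (simp add: zext_def indicator_def)
    qed
  qed (auto simp: kl.F0_def indicator_def zext_def)
  have kin: "kinetic_eq T \<sigma> \<sigma>' S F Fini"
    unfolding kinetic_eq_def Let_def
  proof
    fix \<phi> :: "real \<times> real \<times> real \<Rightarrow> real" assume \<phi>: "\<phi> \<in> test_functions ({..<T} \<times> {0<..<1} \<times> UNIV)"
    let ?I = "\<lambda>(t, x, \<xi>). F (t, x, \<xi>) * dir_deriv (1, 0, 0) \<phi> (t, x, \<xi>)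
                + (S (t, x) - \<sigma> \<xi>) * F (t, x, \<xi>) * dir_deriv (0, 0, 1) \<phi> (t, x, \<xi>)
                - \<sigma>' \<xi> * F (t, x, \<xi>) * \<phi> (t, x, \<xi>)"
    let ?H = "\<lambda>q. dir_deriv (1, 0, 0) \<phi> q + (zext ?Q S (fst q, fst (snd q)) - \<sigma> (snd (snd q))) * dir_deriv (0, 0, 1) \<phi> q - \<sigma>' (snd (snd q)) * \<phi> q"
    let ?P = "{0<..<T} \<times> {0<..<1} \<times> UNIV :: (real \<times> real \<times> real) set"
    \<comment> \<open>The kinetic equation integrates over \<open>t < T\<close> and the limit lemma
      over \<open>t \<le> T\<close>. The difference is the slice \<open>t = T\<close>, where test
      functions and their derivatives vanish.\<close>
    have eq: "zext ?P ?I = (\<lambda>q. zext ?Q3 F q * ?H q)"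
    proof
      fix q :: "real \<times> real \<times> real"
      obtain t x \<xi> where q: "q = (t, x, \<xi>)" by (metis prod.exhaust)
      show "zext ?P ?I q = zext ?Q3 F q * ?H q"
      proof (cases "q \<in> ?P")
        case True
        then have "(t, x) \<in> ?Q" "q \<in> ?Q3" by (auto simp: q QT_iff)
        then show ?thesis using True by (simp add: q algebra_simps)
      next
        case False
        have "\<phi> q = 0 \<and> dir_deriv (1, 0, 0) \<phi> q = 0 \<and> dir_deriv (0, 0, 1) \<phi> q = 0" if "q \<in> ?Q3"
        proof -
          have "q \<notin> {..<T} \<times> {0<..<1} \<times> UNIV" using that False by (auto simp: q)
          then show ?thesis using test_functions_outside \<phi> test_functions_dir_deriv[OF \<phi>] by blast
        qed
        then show ?thesis using False by (cases "q \<in> ?Q3") auto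
      qed
    qed
    have eq0: "zext ({0<..<1} \<times> UNIV) (\<lambda>q. Fini q * \<phi> (0, fst q, snd q)) = (\<lambda>q. Fini q * \<phi> (0, fst q, snd q))"
      by (rule zext_id) (auto intro!: test_functions_outside[OF \<phi>])
    show "set_integrable lborel ?P ?I \<and> (LINT p:?P|lborel. ?I p) + (LINT q:{0<..<1} \<times> UNIV|lborel. Fini q * \<phi> (0, fst q, snd q)) = 0"
      unfolding set_integrable_zext set_integral_zext eq eq0
      using kl.kinetic_limit[OF \<phi> Fini(3)] by blast
  qed
  \<comment> \<open>Transfers an identity on the whole plane to the domain of
    \<open>heat_eq\<close>. The integrand \<open>I \<phi>\<close> is matched only almost everywhere,
    and therefore measurability of the original integrand is asked for separately.\<close>
  have heat: "heat_eq T w a b w0"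
    if I: "\<And>\<phi>. \<phi> \<in> test_functions ({..<T} \<times> {0<..<1}) \<Longrightarrow> L1 (I \<phi>) \<and> (LBINT p. I \<phi> p) + (LBINT x. w0' x * \<phi> (0, x)) = 0"
      and e: "\<And>\<phi>. \<phi> \<in> test_functions ({..<T} \<times> {0<..<1}) \<Longrightarrow> zext ?Q (\<lambda>p. w p * dt \<phi> p
                + w p * dx (dx \<phi>) p - a p * dx \<phi> p + b p * \<phi> p) \<in> BM"
          "\<And>\<phi>. \<phi> \<in> test_functions ({..<T} \<times> {0<..<1}) \<Longrightarrow> AE p in lborel. zext ?Q (\<lambda>p. w p * dt \<phi> p
                + w p * dx (dx \<phi>) p - a p * dx \<phi> p + b p * \<phi> p) p = I \<phi> p"
      and w0: "\<And>x. x \<in> ?J \<Longrightarrow> w0 x = w0' x"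
    for w a b w0 w0' I
    unfolding heat_eq_def Let_def
  proof
    fix \<phi> :: "real \<times> real \<Rightarrow> real" assume \<phi>: "\<phi> \<in> test_functions ({..<T} \<times> {0<..<1})"
    let ?P = "{0<..<T} \<times> {0<..<1} :: (real \<times> real) set"
    let ?I = "\<lambda>p. w p * dt \<phi> p + w p * dx (dx \<phi>) p - a p * dx \<phi> p + b p * \<phi> p"
    have eq: "zext ?P ?I = zext ?Q ?I"
    proof
      fix q
      show "zext ?P ?I q = zext ?Q ?I q"
      proof (cases "q \<in> {..<T} \<times> {0<..<1}")
        case True
        then have "q \<in> ?P \<longleftrightarrow> q \<in> ?Q" by (auto simp: QT_def)
        then show ?thesis by (simp add: zext_def indicator_def)
      next
        case False
        then have "\<phi> q = 0 \<and> dt \<phi> q = 0 \<and> dx \<phi> q = 0 \<and> dx (dx \<phi>) q = 0"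
          using test_functions_outside \<phi> test_functions_dir_deriv[OF \<phi>] test_functions_dir_deriv[OF test_functions_dir_deriv[OF \<phi>]] by blast
        then show ?thesis by (simp add: zext_def)
      qed
    qed
    have Im: "I \<phi> \<in> borel_measurable lborel" using I[OF \<phi>] by blast
    have i: "L1 (zext ?Q ?I)"
      using integrable_cong_AE[of "zext ?Q ?I" lborel "I \<phi>"] e(1)[OF \<phi>] Im e(2)[OF \<phi>] I[OF \<phi>] by simp
    have "(LBINT p. zext ?Q ?I p) = (LBINT p. I \<phi> p)"
      using e(1)[OF \<phi>] Im e(2)[OF \<phi>] by (intro integral_cong_AE) auto
    moreover have "zext ?J (\<lambda>x. w0 x * \<phi> (0, x)) = (\<lambda>x. w0' x * \<phi> (0, x))"
    proof
      fix x
      have "\<phi> (0, x) = 0" if "x \<notin> ?J" by (rule test_functions_outside[OF \<phi>]) (use that in auto)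
      then show "zext ?J (\<lambda>x. w0 x * \<phi> (0, x)) x = w0' x * \<phi> (0, x)" by (cases "x \<in> ?J") (simp_all add: w0)
    qed
    ultimately show "set_integrable lborel ?P ?I \<and> (LINT p:?P|lborel. ?I p) + (LINT x:{0<..<1}|lborel. w0 x * \<phi> (0, x)) = 0"
      unfolding set_integrable_zext set_integral_zext eq using i I[OF \<phi>] by simp
  qed
  have tm: "\<phi> \<in> BM" "dt \<phi> \<in> BM" "dx \<phi> \<in> BM"
    "dx (dx \<phi>) \<in> BM" if "\<phi> \<in> test_functions ({..<T} \<times> {0<..<1})" for \<phi> :: "real \<times> real \<Rightarrow> real"
    using that by (auto intro: test_functions_measurable test_functions_dir_deriv)
  have heat_v: "heat_eq T v \<sigma>bar (\<lambda>q. 0) kl.vini"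
  proof (rule heat[OF conjI[OF kl.heat_v_limit]])
    fix \<phi> :: "real \<times> real \<Rightarrow> real" assume \<phi>: "\<phi> \<in> test_functions ({..<T} \<times> {0<..<1})"
    have e: "zext ?Q (\<lambda>p. v p * dt \<phi> p + v p * dx (dx \<phi>) p - \<sigma>bar p * dx \<phi> p + 0 * \<phi> p)
      = (\<lambda>p. zext ?Q v p * dt \<phi> p + zext ?Q v p * dx (dx \<phi>) p - Y \<sigma> p * dx \<phi> p)"
      by (auto simp: fun_eq_iff Y\<sigma> zext_def indicator_def)
    show "AE p in lborel. zext ?Q (\<lambda>p. v p * dt \<phi> p + v p * dx (dx \<phi>) p - \<sigma>bar p * dx \<phi> p + 0 * \<phi> p) p
      = zext ?Q v p * dt \<phi> p + zext ?Q v p * dx (dx \<phi>) p - Y \<sigma> p * dx \<phi> p" unfolding e by simp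
    show "zext ?Q (\<lambda>p. v p * dt \<phi> p + v p * dx (dx \<phi>) p - \<sigma>bar p * dx \<phi> p + 0 * \<phi> p) \<in> BM"
      unfolding e using tm[OF \<phi>] kl.vlm kl.Ym[OF \<sigma>c] by simp
  qed auto
  have heat_S: "heat_eq T S (\<lambda>q. 0) (\<lambda>q. \<integral>\<xi>. \<sigma>' \<xi> * (S q - \<sigma> \<xi>) \<partial>\<nu> q) Sini"
  proof (rule heat[OF conjI[OF kl.heat_S_limit[OF _ Sini(4)]]])
    fix \<phi> :: "real \<times> real \<Rightarrow> real" assume \<phi>: "\<phi> \<in> test_functions ({..<T} \<times> {0<..<1})"
    let ?b = "\<lambda>q. \<integral>\<xi>. \<sigma>' \<xi> * (S q - \<sigma> \<xi>) \<partial>\<nu> q"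
    let ?I = "\<lambda>p. S p * dt \<phi> p + S p * dx (dx \<phi>) p - 0 * dx \<phi> p + ?b p * \<phi> p"
    have "zext ?Q ?I = (\<lambda>p. zext ?Q S p * dt \<phi> p + zext ?Q S p * dx (dx \<phi>) p + zext ?Q ?b p * \<phi> p)"
      by (auto simp: fun_eq_iff zext_def indicator_def)
    then show "zext ?Q ?I \<in> BM"
      using tm[OF \<phi>] kl.Sm measurable_young_average[OF \<nu>m sigma'_cont \<sigma>c kl.Sm] by simp
    \<comment> \<open>Splitting the average of \<open>\<sigma>' * (S - \<sigma>)\<close> needs both
      parts to be integrable under the Young measure. This is available for almost every
      \<open>p\<close>, which is why the integrands are compared almost everywhere.\<close>
    have "continuous_on UNIV (\<lambda>\<xi>. \<sigma>' \<xi> * \<sigma> \<xi>)" by (intro continuous_intros sigma'_cont \<sigma>c)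
    from \<nu>i[OF sigma'_cont] \<nu>i[OF this]
    show "AE p in lborel. zext ?Q ?I p = zext ?Q S p * (dt \<phi> p + dx (dx \<phi>) p)
       + (zext ?Q S p * Y \<sigma>' p - Y (\<lambda>y. \<sigma>' y * \<sigma> y) p) * \<phi> p"
    proof eventually_elim
      case (elim p)
      show ?case
      proof (cases "p \<in> ?Q")
        case True
        then have "?b p = S p * (\<integral>\<xi>. \<sigma>' \<xi> \<partial>\<nu> p) - (\<integral>\<xi>. \<sigma>' \<xi> * \<sigma> \<xi> \<partial>\<nu> p)"
        proof -
          have "?b p = (\<integral>\<xi>. S p * \<sigma>' \<xi> - \<sigma>' \<xi> * \<sigma> \<xi> \<partial>\<nu> p)" by (simp add: algebra_simps)
          also have "\<dots> = S p * (\<integral>\<xi>. \<sigma>' \<xi> \<partial>\<nu> p) - (\<integral>\<xi>. \<sigma>' \<xi> * \<sigma> \<xi> \<partial>\<nu> p)"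
            using elim True by (subst LINT_diff) auto
          finally show ?thesis .
        qed
        then show ?thesis using True unfolding Y_def zext_simps(1)[OF True] by (simp only:) (simp add: algebra_simps)
      qed (simp add: Y_def)
    qed
  qed auto
  have vxL2: "vx \<in> L2 ?Q" using kl.vx_sq kl.vx_meas unfolding klvx by (simp add: L2_iff_zext)
  have v_x: "has_x_deriv {0<..T} v vx"
    unfolding has_x_deriv_def has_ac_deriv_def
    using kl.vl_x_deriv Fubini_fst(2)[OF kl.vx_int]
  proof eventually_elim
    case (elim t)
    show ?case
    proof
      assume t: "t \<in> {0<..T}"
      then have zt: "zext {0<..<1} (\<lambda>x. vx (t, x)) = (\<lambda>x. kl.vx (t, x))"
        by (auto simp: fun_eq_iff klvx zext_def indicator_def QT_iff)
      from elim t obtain c where c: "AE x in lborel. x \<in> {0<..<1} \<longrightarrow> zext ?Q v (t, x) = c + prim (\<lambda>y. kl.vx (t, y)) x" by blast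
      have "(LBINT y=0..x. vx (t, y)) = prim (\<lambda>y. kl.vx (t, y)) x" if "x \<in> {0<..<1}" for x
        using that t by (intro interval_integral_eq_prim measurable_section(1) kl.vx_meas) (auto simp: klvx QT_iff)
      with c have "AE x in lborel. x \<in> {0<..<1} \<longrightarrow> v (t, x) = c + (LBINT y=0..x. vx (t, y))"
        by (auto elim!: eventually_mono simp: QT_iff t[simplified] zext_def)
      then show "set_integrable lborel {0<..<1} (\<lambda>x. vx (t, x)) \<and>
        (\<exists>c. AE x in lborel. x \<in> {0<..<1} \<longrightarrow> v (t, x) = c + (LBINT y=0..x. vx (t, y)))"
        using elim(2) by (auto simp: set_integrable_zext zt)
    qed
  qed
  have L2J: "f \<in> L2 ?J" if "zext ?J f \<in> BM" "AE x in lborel. \<bar>zext ?J f x\<bar> \<le> b" for f b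
  proof -
    have "L1 (zext ?J f)" by (rule integrable_bounded_01[OF that]) simp
    from integrable_mult_bounded[OF this that] show ?thesis using that(1) by (simp add: L2_iff_zext power2_eq_square)
  qed
  have v0L: "L2_lim {0<..<1} (\<lambda>n. v0 (eps n)) kl.vini"
    unfolding L2_lim_def
  proof (intro conjI allI)
    show "v0 (eps n) \<in> L2 ?J" for n
      using v0_bound[OF eps(1)[of n]] kl.v0K[of n] by (intro L2J) (auto simp: Linf_le_def set_borel_measurable_zext)
    have z: "zext ?J kl.vini = kl.vini" by (rule zext_id) (rule kl.vini_zero)
    show "kl.vini \<in> L2 ?J" using kl.vini_meas kl.vini_bound by (intro L2J[of _ K]) (simp_all add: z)
    have "zext ?J (\<lambda>x. (v0 (eps n) x - kl.vini x)\<^sup>2) = (\<lambda>x. (zext ?J (v0 (eps n)) x - kl.vini x)\<^sup>2)" for n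
    proof
      fix x
      show "zext ?J (\<lambda>x. (v0 (eps n) x - kl.vini x)\<^sup>2) x = (zext ?J (v0 (eps n)) x - kl.vini x)\<^sup>2"
        using kl.vini_zero[of x] by (cases "x \<in> ?J") simp_all
    qed
    then show "(\<lambda>n. LINT x:?J|lborel. (v0 (eps n) x - kl.vini x)\<^sup>2) \<longlonglongrightarrow> 0"
      using kl.v0_L2 by (simp add: set_integral_zext)
  qed
  have S0L: "L2_weak_lim {0<..<1} (\<lambda>n x. \<sigma> (u0 (eps n) x) + v0x (eps n) x) Sini"
    unfolding L2_weak_lim_def
  proof (intro conjI allI ballI)
    have z: "zext ?J (\<lambda>x. \<sigma> (u0 (eps n) x) + v0x (eps n) x) = kl.S0 n" for n
      by (auto simp: fun_eq_iff zext_def kl.S0_def indicator_def)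
    show "(\<lambda>x. \<sigma> (u0 (eps n) x) + v0x (eps n) x) \<in> L2 ?J" for n
      using kl.S0_meas[of n] Sini(3)[of n] by (intro L2J[of _ B]) (simp_all add: z)
    have B: "0 \<le> B" using Sini(2)[of 0] by linarith
    show "Sini \<in> L2 ?J"
      using Sini(1,2) B by (intro L2J[of _ B]) (auto simp: zext_def[abs_def] abs_mult indicator_def)
    fix h assume "h \<in> L2 ?J"
    then have hm: "zext ?J h \<in> BM" and h2: "L1 (\<lambda>x. (zext ?J h x)\<^sup>2)"
      by (auto simp: L2_iff_zext)
    have hi: "L1 (zext ?J h)"
    proof (rule L1_bound[where f="\<lambda>x. ind ?J x + (zext ?J h x)\<^sup>2"])
      show "L1 (\<lambda>x. ind ?J x + (zext ?J h x)\<^sup>2)"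
        by (intro L1_add h2 integrable_real_indicator) auto
      have "\<bar>y\<bar> \<le> 1 + y\<^sup>2" for y :: real
        using sum_power2_ge_zero[of "\<bar>y\<bar> - 1" 0] zero_le_power2[of "\<bar>y\<bar> - 1"] abs_ge_zero[of y] by (simp add: power2_eq_square algebra_simps)
      then show "AE x in lborel. norm (zext ?J h x) \<le> norm (ind ?J x + (zext ?J h x)\<^sup>2)"
        by (intro AE_I2) (auto simp: zext_def indicator_def)
    qed (use hm in simp)
    have "(LINT x:?J|lborel. (\<sigma> (u0 (eps n) x) + v0x (eps n) x) * h x) = (LBINT x. kl.S0 n x * zext ?J h x)" for n
      unfolding set_integral_zext z[of n, symmetric] zext_mult(1) ..
    moreover have "(LINT x:?J|lborel. Sini x * h x) = (LBINT x. Sini x * zext ?J h x)"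
      unfolding set_integral_zext by (intro LINT_cong) (simp add: zext_def)
    ultimately show "(\<lambda>n. LINT x:?J|lborel. (\<sigma> (u0 (eps n) x) + v0x (eps n) x) * h x) \<longlonglongrightarrow> (LINT x:?J|lborel. Sini x * h x)"
      using Sini(4)[OF hi] by simp
  qed
  have S0: "vanishes_at_ends {0<..<T} S"
  proof -
    obtain G where G: "AE p in lborel. p \<in> {0<..<T} \<times> {0<..<1} \<longrightarrow> zext ?Q S p = G p"
      "\<forall>t\<in>{0<..<T}. continuous_on {0..1} (\<lambda>x. G (t, x)) \<and> G (t, 0) = 0 \<and> G (t, 1) = 0"
      using kl.S_vanishes unfolding vanishes_at_ends_def by blast
    from G(1) have "AE p in lborel. p \<in> {0<..<T} \<times> {0<..<1} \<longrightarrow> S p = G p"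
      by eventually_elim (auto simp: zext_def QT_iff)
    with G(2) show ?thesis unfolding vanishes_at_ends_def by blast
  qed
  have "Linf_weakstar_lim ?Q (\<lambda>n q. \<sigma> (u\<epsilon> (eps n) q)) \<sigma>bar" using \<nu>w[OF \<sigma>c] by (simp add: \<sigma>bar_def[abs_def])
  moreover have "kinetic_eq T \<sigma> \<sigma>' (\<lambda>q. vx q + \<sigma>bar q) F Fini" using kin by (simp add: vx_def)
  moreover have "AE q in lborel. q \<in> ?Q \<longrightarrow> S q = \<sigma>bar q + vx q \<and> S q = (\<integral>\<xi>. \<sigma> \<xi> \<partial>\<nu> q) + vx q"
    by (simp add: vx_def \<sigma>bar_def)
  ultimately show ?thesis using cdf vxL2 v_x v0L FiniL kin heat_v heat_S S0L S0 by blast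
qed

end
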